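(* Let $C_{\underline t_1}$ be a (real non degenerated) msqh-smoothing of a real plane branch $(C,0)$ and let $1\le j\le g$. The size of an oval $O$ of depth $j$ of $C_{\underline t_1}$ is equal to $(t_j^{e_1n_1},\,t_j^{e_1m_1})$.
   Context: **Size.** Write $a(t)\sim t^\gamma$ if $a(t)/t^\gamma$ tends to a nonzero constant as $t>0$ tends to $0$. An oval is of size $(t^\alpha,t^\beta)$ if it is contained in a minimal box with edges parallel to the coordinate axes each of whose vertices has coordinates of the form $(\sim t^\alpha,\sim t^\beta)$. Here this is applied in the coordinates $(x,y)=(x_1,y_1)$ with respect to the parameter $t_j$, with $t_{j+1},\dots,t_g$ fixed and $0<t_1\ll\cdots\ll t_{j-1}\ll t_j$. **Non degeneracy.** For $P=\sum c_{ij}x^iy^j$ and $\Lambda\subset\mathbb{R}^2$ put $P^\Lambda=\sum_{(i,j)\in\Lambda}c_{ij}x^iy^j$. A real polynomial $P$ with Newton polygon $\Theta$ is real non degenerated with respect to $\Theta$ if for every face $\Lambda$ of $\Theta$ (including $\Theta$), $P^\Lambda=0$ defines a nonsingular subset of $(\mathbb{R}^* )^2$. **Toric resolution.** A real plane branch $(C,0)$ is a germ $F=0$, $F\in\mathbb{R}[x,y]$, analytically irreducible in $(\mathbb{C}^2,0)$, with a real Newton–Puiseux parametrization $x=\tau^{e_0}$, $y=\sum_i\eta_i\tau^i$, $\eta_i\in\mathbb{R}$. Put $(x_1,y_1)=(x,y)$, $F^{(1)}=F$, $C^{(1)}=C$, $o_1=0$. Coordinates are chosen so that $F^{(1)}=(y_1^{n_1}-x_1^{m_1})^{e_1}+\cdots$,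 $\gcd(n_1,m_1)=1$, $e_0=e_1n_1$, omitted terms having exponents strictly above the compact edge of the local Newton polygon. Inductively, let $\Sigma_j$ be the minimal regular subdivision of $\mathbb{R}^2_{\ge0}$ containing the ray of $(n_j,m_j)$, let $\sigma_j\in\Sigma_j$ be the cone spanned by $(n_j,m_j)$ and the integral vector $(c_j,d_j)$ with $c_jm_j-d_jn_j=1$, let $\Pi_j:Z_{j+1}\to Z_j$ be the toric modification defined by $\Sigma_j$ (at $o_j$ in the coordinates $(x_j,y_j)$, $Z_1=\mathbb{C}^2$), and let $\pi_j$ be its restriction to the chart of $\sigma_j$: $x_j=u_{j+1}^{c_j}x_{j+1}^{n_j}$, $y_j=u_{j+1}^{d_j}x_{j+1}^{m_j}$. Let $E_{j+1}=\{x_{j+1}=0\}$. Write $F^{(j)}\circ\pi_j=(y_j^{e_{j-1}}\circ\pi_j)\,\bar F^{(j+1)}(x_{j+1},u_{j+1})$; $\bar F^{(j+1)}=0$ defines the strict transform $C^{(j+1)}$, which meets the exceptional divisor of $\Pi_j$ only at $o_{j+1}$: $x_{j+1}=0,u_{j+1}=1$. One takes real coordinates $(x_{j+1},y_{j+1})$ at $o_{j+1}$ with $\xi_{j+1}y_{j+1}=1-u_{j+1}+x_{j+1}R_{j+1}(x_{j+1},u_{j+1})$, $\xi_{j+1}\in\mathbb{R}^*$, $R_{j+1}$ a real polynomial, such that $C^{(j+1)}$ is defined by $F^{(j+1)}(x_{j+1},y_{j+1})=(y_{j+1}^{n_{j+1}}-x_{j+1}^{m_{j+1}})^{e_{j+1}}+\cdots$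 with $\gcd(n_{j+1},m_{j+1})=1$, $e_j=e_{j+1}n_{j+1}$, omitted terms strictly above the compact edge. The process stops at the first $g$ with $e_g=1$. Put $\Gamma_j=[(m_je_j,0),(0,n_je_j)]$, $\Delta_j$ the triangle with vertices $(0,0),(m_je_j,0),(0,n_je_j)$, $\Delta_j^-=\Delta_j\setminus\Gamma_j$, $\omega_j(r,s)=e_j(e_jn_jm_j-rn_j-sm_j)$. **Msqh-deformations.** A Milnor ball of a germ is a small ball centred at the singular point such that each branch is transversal to the boundary of this and all smaller balls. Put $M_1(r,s)=x^ry^s$. For $j\ge2$, $r\ge 0$, $0\le s<e_{j-1}$, fix $M_j(r,s)\in\mathbb{R}[x,y]$ (these exist; they are monomials in $x,y$ and certain Weierstrass polynomials defining curvettes) with $$M_j(r,s)\circ\pi_1\circ\cdots\circ\pi_{j-1}=\mathrm{Exc}_{j-1}\,u_2^{k_2}\cdots u_j^{k_j}x_j^ry_j^s,\quad \mathrm{Exc}_{j-1}=\prod_{i=1}^{j-1}y_i^{e_{i-1}}\circ\pi_i\circ\cdots\circ\pi_{j-1},$$ for some positive integers $k_i$ depending on $(r,s)$, where $u_i$ stands for $u_i\circ\pi_i\circ\cdots\circ\pi_{j-1}$ if $i<j$. With $\underline t_j=(t_j,\dots,t_g)$, put $$P_{\underline t_j}=F+\sum_{l=j}^g\ \sum_{(r,s)\in\Delta_l^-\cap\mathbb{Z}^2}A^{(l)}_{r,s}\,t_l^{\omega_l(r,s)}M_l(r,s),\qquad P_{\underline t_{g+1}}=F,$$ with real constants $A^{(l)}_{r,s}$,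 $A^{(l)}_{0,0}\neq0$. The msqh-deformation of $(C,0)$ is $C_{\underline t_1}=\{P_{\underline t_1}=0\}$ in a Milnor ball of $(C,0)$; it is a msqh-smoothing if it is smooth and transversal to the boundary of the Milnor ball for $0<t_1\ll\cdots\ll t_g\ll1$ (each $t_j$ sufficiently small depending on $t_{j+1},\dots,t_g$). Let $C_{\underline t_l}=\{P_{\underline t_l}=0\}$, let $C^{(j)}_{\underline t_l}$ be its strict transform by $\Pi_1\circ\cdots\circ\Pi_{j-1}$, defined by $P^{(j)}_{\underline t_l}(x_j,y_j)$ (the quotient of $P_{\underline t_l}\circ\pi_1\circ\cdots\circ\pi_{j-1}$ by $\mathrm{Exc}_{j-1}$), $j\le l$, with $P^{(1)}_{\underline t_l}=P_{\underline t_l}$. Put $$Q_j=\sum_{(r,s)\in\Delta_j^-\cap\mathbb{Z}^2}A^{(j)}_{r,s}x_j^ry_j^s+(P^{(j)}_{\underline t_{j+1}})^{\Gamma_j}.$$ The msqh-deformation is real non degenerated if $Q_j$ is real non degenerated with respect to $\Delta_j$ for $j=1,\dots,g$; then $C^{(j)}_{\underline t_j}$ is a msqh-smoothing of $(C^{(j)},o_j)$ for all $1\le j\le g$. **Depth.** $\mathbb{R}X$ denotes real part; an oval of a smoothing is a closed component of its real part in the Milnor ball. For an integral polygon $\Theta\subset\mathbb{R}^2_{\ge0}$ let $\phi_\Theta(x,y)=\big(\sum_{(a,b)\in\Theta\cap\mathbb{Z}^2}|x^ay^b|\big)^{-1}\sum_{(a,b)\in\Theta\cap\mathbb{Z}^2}|x^ay^b|(a,b)$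 on $\mathbb{R}^2_{>0}$, extended to $\tilde\phi_\Theta$ on $(\mathbb{R}^* )^2$ by equivariance under the symmetries $\rho_{a,b}(x,y)=((-1)^ax,(-1)^by)$; for $A\subset\mathbb{R}^2$ put $\tilde A=\bigcup_{a,b}\rho_{a,b}(A)$; the chart of $Q$ in $\tilde\Theta$ is the closure of $\tilde\phi_\Theta(\{Q=0\}\cap(\mathbb{R}^* )^2)$. By patchworking, in a Milnor ball $B'$ of $(C_{\underline t_2},0)$ the pair $(\mathbb{R}B',\mathbb{R}C_{\underline t_1}\cap\mathbb{R}B')$ is (stratified) homeomorphic to $\tilde\Delta_1$ with the chart of $Q_1$. The ovals of depth $1$ of $C_{\underline t_1}$ are those which appear in the chart of $Q_1$ and do not meet $\tilde\Gamma_1$; in the same way (replacing level 1 by level $j$) one defines the ovals of depth 1 of the smoothing $C^{(j)}_{\underline t_j}$ of $(C^{(j)},o_j)$. An oval $O$ of $C_{\underline t_1}$ is of depth $j$ if there is an oval $O_j$ of depth $1$ of the smoothing $C^{(j)}_{\underline t_j}$ of $(C^{(j)},o_j)$ with $E_j\cap O_j=\emptyset$ (a condition only for $j\ge2$) such that $O$ arises as a slight perturbation of the oval $\Pi_1\circ\cdots\circ\Pi_{j-1}(O_j)$ of $C_{\underline t_j}$. *)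

theory Defs
  imports "HOL-Analysis.Analysis" "HOL-Computational_Algebra.Polynomial"
begin

section \<open>Polynomials and power series in two variables\<close>

text \<open>
  A polynomial in \<open>x, y\<close> is a polynomial in \<open>y\<close> whose coefficients are polynomials in \<open>x\<close>.
  A power series in \<open>x, y\<close> is its array of coefficients, the coefficient of \<open>x^r y^s\<close> being
  \<open>a r s\<close>.
\<close>

type_synonym 'a ser2 = "nat \<Rightarrow> nat \<Rightarrow> 'a"

definition poly2 :: "real poly poly \<Rightarrow> real \<times> real \<Rightarrow> real" where
  "poly2 P p = poly (poly P [:snd p:]) (fst p)"

definition monom2 :: "real \<Rightarrow> nat \<Rightarrow> nat \<Rightarrow> real poly poly" where
  "monom2 a r s = monom (monom a r) s"

definition coeff2 :: "real poly poly \<Rightarrow> real ser2" where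
  "coeff2 P r s = coeff (coeff P s) r"

definition conv_on :: "'a::{real_normed_field,banach} ser2 \<Rightarrow> real \<Rightarrow> bool" where
  "conv_on a \<rho> \<longleftrightarrow> (\<forall>x y. norm x < \<rho> \<longrightarrow> norm y < \<rho> \<longrightarrow>
     (\<lambda>(r,s). a r s * x ^ r * y ^ s) summable_on UNIV)"

definition convergent_ser :: "'a::{real_normed_field,banach} ser2 \<Rightarrow> bool" where
  "convergent_ser a \<longleftrightarrow> (\<exists>\<rho>>0. conv_on a \<rho>)"

definition eval2 :: "'a::{real_normed_field,banach} ser2 \<Rightarrow> 'a \<times> 'a \<Rightarrow> 'a" where
  "eval2 a p = (\<Sum>\<^sub>\<infinity>(r,s)\<in>UNIV. a r s * fst p ^ r * snd p ^ s)"

definition ser_mult :: "'a::comm_ring_1 ser2 \<Rightarrow> 'a ser2 \<Rightarrow> 'a ser2" where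
  "ser_mult a b r s = (\<Sum>i\<le>r. \<Sum>k\<le>s. a i k * b (r - i) (s - k))"

definition ser_dx :: "'a::comm_ring_1 ser2 \<Rightarrow> 'a ser2" where
  "ser_dx a r s = of_nat (Suc r) * a (Suc r) s"

definition ser_dy :: "'a::comm_ring_1 ser2 \<Rightarrow> 'a ser2" where
  "ser_dy a r s = of_nat (Suc s) * a r (Suc s)"

definition complexify :: "real ser2 \<Rightarrow> complex ser2" where
  "complexify a r s = complex_of_real (a r s)"

text \<open>Irreducibility in the local ring of convergent series, whose units are the series with
  nonzero constant term.\<close>

definition analytically_irreducible :: "complex ser2 \<Rightarrow> bool" where
  "analytically_irreducible a \<longleftrightarrow>
     convergent_ser a \<and> a \<noteq> (\<lambda>r s. 0) \<and> a 0 0 = 0 \<and>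
     (\<forall>b c. convergent_ser b \<and> convergent_ser c \<and> a = ser_mult b c \<longrightarrow> b 0 0 \<noteq> 0 \<or> c 0 0 \<noteq> 0)"

definition coord_square :: "real \<Rightarrow> (real \<times> real) set" where
  "coord_square \<rho> = {p. \<bar>fst p\<bar> < \<rho> \<and> \<bar>snd p\<bar> < \<rho>}"

section \<open>Polygons, non degeneracy, charts\<close>

definition lattice_points :: "(real \<times> real) set \<Rightarrow> (nat \<times> nat) set" where
  "lattice_points \<Theta> = {(r,s). (real r, real s) \<in> \<Theta>}"

definition truncation :: "real poly poly \<Rightarrow> (real \<times> real) set \<Rightarrow> real poly poly" where
  "truncation P \<Lambda> =
     (\<Sum>(r,s)\<in>{(r,s)\<in>lattice_points \<Lambda>. coeff2 P r s \<noteq> 0}. monom2 (coeff2 P r s) r s)"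

definition newton_polygon :: "real poly poly \<Rightarrow> (real \<times> real) set" where
  "newton_polygon P = convex hull {(real r, real s) |r s. coeff2 P r s \<noteq> 0}"

definition nonsingular_in_torus :: "real poly poly \<Rightarrow> bool" where
  "nonsingular_in_torus P \<longleftrightarrow>
     (\<forall>p. fst p \<noteq> 0 \<and> snd p \<noteq> 0 \<and> poly2 P p = 0 \<longrightarrow>
        poly2 (map_poly pderiv P) p \<noteq> 0 \<or> poly2 (pderiv P) p \<noteq> 0)"

definition real_nondegenerated :: "real poly poly \<Rightarrow> (real \<times> real) set \<Rightarrow> bool" where
  "real_nondegenerated P \<Theta> \<longleftrightarrow> newton_polygon P = \<Theta> \<and>
     (\<forall>\<Lambda>. \<Lambda> face_of \<Theta> \<and> \<Lambda> \<noteq> {} \<longrightarrow> nonsingular_in_torus (truncation P \<Lambda>))"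

definition moment_map :: "(real \<times> real) set \<Rightarrow> real \<times> real \<Rightarrow> real \<times> real" where
  "moment_map \<Theta> p =
     inverse (\<Sum>(a,b)\<in>lattice_points \<Theta>. \<bar>fst p ^ a * snd p ^ b\<bar>) *\<^sub>R
     (\<Sum>(a,b)\<in>lattice_points \<Theta>. \<bar>fst p ^ a * snd p ^ b\<bar> *\<^sub>R (real a, real b))"

definition moment_map_ext :: "(real \<times> real) set \<Rightarrow> real \<times> real \<Rightarrow> real \<times> real" where
  "moment_map_ext \<Theta> p =
     (let q = moment_map \<Theta> (\<bar>fst p\<bar>, \<bar>snd p\<bar>) in (sgn (fst p) * fst q, sgn (snd p) * snd q))"

definition reflect :: "nat \<Rightarrow> nat \<Rightarrow> real \<times> real \<Rightarrow> real \<times> real" where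
  "reflect a b p = ((-1) ^ a * fst p, (-1) ^ b * snd p)"

definition symmetrize :: "(real \<times> real) set \<Rightarrow> (real \<times> real) set" where
  "symmetrize S = (\<Union>a b. reflect a b ` S)"

definition chart :: "real poly poly \<Rightarrow> (real \<times> real) set \<Rightarrow> (real \<times> real) set" where
  "chart Q \<Theta> = closure (moment_map_ext \<Theta> ` {p. fst p \<noteq> 0 \<and> snd p \<noteq> 0 \<and> poly2 Q p = 0})"

section \<open>Milnor balls\<close>

text \<open>Near \<open>p\<close> the subset \<open>S\<close> of the complex plane is a smooth analytic curve, and its tangent
  line at \<open>p\<close> is not contained in the tangent space at \<open>p\<close> of the sphere through \<open>p\<close> centred
  at the origin. Here \<open>a\<close> is a reduced local equation of \<open>S\<close>, expanded at \<open>p\<close>, and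
  \<open>\<bullet>\<close> is the real scalar product of the underlying real vector space of dimension four.\<close>

definition transversal_to_sphere_at :: "(complex \<times> complex) set \<Rightarrow> complex \<times> complex \<Rightarrow> bool" where
  "transversal_to_sphere_at S p \<longleftrightarrow> (\<exists>a \<delta>. \<delta> > 0 \<and> conv_on a \<delta> \<and>
     (\<forall>v. norm v < \<delta> \<longrightarrow> (p + v \<in> S \<longleftrightarrow> eval2 a v = 0)) \<and>
     (a 1 0 \<noteq> 0 \<or> a 0 1 \<noteq> 0) \<and>
     (\<exists>v. a 1 0 * fst v + a 0 1 * snd v = 0 \<and> p \<bullet> v \<noteq> 0))"

definition complex_zeros :: "real ser2 \<Rightarrow> (complex \<times> complex) set" where
  "complex_zeros a = {p. eval2 (complexify a) p = 0}"

definition milnor_ball :: "real ser2 \<Rightarrow> real \<Rightarrow> bool" where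
  "milnor_ball a \<rho> \<longleftrightarrow> \<rho> > 0 \<and>
     (\<forall>p\<in>cball 0 \<rho>. p \<noteq> 0 \<and> p \<in> complex_zeros a \<longrightarrow> transversal_to_sphere_at (complex_zeros a) p)"

section \<open>Toric resolution of a real plane branch\<close>

text \<open>A regular subdivision of the quadrant is given by the primitive generators of its rays,
  listed counterclockwise.\<close>

definition regular_subdivision :: "(nat \<times> nat) list \<Rightarrow> bool" where
  "regular_subdivision vs \<longleftrightarrow> vs \<noteq> [] \<and> hd vs = (1, 0) \<and> last vs = (0, 1) \<and>
     (\<forall>i. Suc i < length vs \<longrightarrow>
        int (fst (vs ! i)) * int (snd (vs ! Suc i)) - int (snd (vs ! i)) * int (fst (vs ! Suc i)) = 1)"

definition minimal_regular_subdivision :: "nat \<times> nat \<Rightarrow> (nat \<times> nat) list \<Rightarrow> bool" where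
  "minimal_regular_subdivision v vs \<longleftrightarrow> regular_subdivision vs \<and> v \<in> set vs \<and>
     (\<forall>ws. regular_subdivision ws \<and> v \<in> set ws \<longrightarrow> set vs \<subseteq> set ws)"

text \<open>The cone spanned by \<open>(c,d)\<close> and \<open>(n,m)\<close> belongs to the subdivision and \<open>c m - d n = 1\<close>.\<close>

definition resolution_cone :: "nat \<times> nat \<Rightarrow> nat \<times> nat \<Rightarrow> bool" where
  "resolution_cone nm cd \<longleftrightarrow> (\<exists>vs i. minimal_regular_subdivision nm vs \<and>
     Suc i < length vs \<and> vs ! i = cd \<and> vs ! Suc i = nm)"

text \<open>
  The data at level \<open>j\<close>. The local coordinates \<open>(x_j, y_j)\<close> at \<open>o_j\<close> are used on the square
  \<open>coord_square (rad j)\<close>; there \<open>uu j\<close> (for \<open>j \<ge> 2\<close>) is the function \<open>u_j\<close> expressed in the coordinates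
  \<open>(x_j, y_j)\<close>, and \<open>local_eq j\<close> is the series defining the strict transform of the branch.
  In \<open>RR j\<close> the variables are \<open>(x_j, u_j)\<close>.
\<close>

record branch_resolution =
  curve_poly :: "real poly poly"
  gg :: nat
  ee :: "nat \<Rightarrow> nat"
  nn :: "nat \<Rightarrow> nat"
  mm :: "nat \<Rightarrow> nat"
  cc :: "nat \<Rightarrow> nat"
  dd :: "nat \<Rightarrow> nat"
  xi :: "nat \<Rightarrow> real"
  RR :: "nat \<Rightarrow> real poly poly"
  uu :: "nat \<Rightarrow> real \<times> real \<Rightarrow> real"
  rad :: "nat \<Rightarrow> real"
  local_eq :: "nat \<Rightarrow> real ser2"

text \<open>The map \<open>\<pi>_j\<close>, in the coordinates \<open>(x_(j+1), y_(j+1))\<close> and \<open>(x_j, y_j)\<close>.\<close>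

definition pi_map :: "branch_resolution \<Rightarrow> nat \<Rightarrow> real \<times> real \<Rightarrow> real \<times> real" where
  "pi_map D j p = (uu D (Suc j) p ^ cc D j * fst p ^ nn D j, uu D (Suc j) p ^ dd D j * fst p ^ mm D j)"

text \<open>\<open>down D i k\<close> is the composite of \<open>\<pi>_i, \<dots>, \<pi>_(i+k-1)\<close>, from level \<open>i + k\<close> to level \<open>i\<close>.\<close>

primrec down :: "branch_resolution \<Rightarrow> nat \<Rightarrow> nat \<Rightarrow> real \<times> real \<Rightarrow> real \<times> real" where
  "down D i 0 p = p"
| "down D i (Suc k) p = down D i k (pi_map D (i + k) p)"

definition to_plane :: "branch_resolution \<Rightarrow> nat \<Rightarrow> real \<times> real \<Rightarrow> real \<times> real" where
  "to_plane D j = down D 1 (j - 1)"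

text \<open>The function \<open>Exc_(j-1)\<close> in the coordinates at level \<open>j\<close>.\<close>

definition exc :: "branch_resolution \<Rightarrow> nat \<Rightarrow> real \<times> real \<Rightarrow> real" where
  "exc D j p = (\<Prod>i\<in>{1..<j}. snd (down D i (j - i) p) ^ ee D (i - 1))"

text \<open>\<open>a\<close> equals \<open>(y^n - x^m)^e\<close> plus terms with exponents strictly above the segment
  joining \<open>(m e, 0)\<close> and \<open>(0, n e)\<close>.\<close>

definition has_initial_form :: "real ser2 \<Rightarrow> nat \<Rightarrow> nat \<Rightarrow> nat \<Rightarrow> bool" where
  "has_initial_form a n m e \<longleftrightarrow>
     (\<forall>x y. (\<Sum>(r,s)\<in>{(r,s). r * n + s * m \<le> e * n * m}. a r s * x ^ r * y ^ s) = (y ^ n - x ^ m) ^ e)"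

definition real_puiseux :: "real poly poly \<Rightarrow> nat \<Rightarrow> bool" where
  "real_puiseux F e0 \<longleftrightarrow> (\<exists>\<eta> :: nat \<Rightarrow> real. \<exists>\<rho>>0. \<eta> 0 = 0 \<and>
     (\<forall>\<tau>. \<bar>\<tau>\<bar> < \<rho> \<longrightarrow> summable (\<lambda>i. \<eta> i * \<tau> ^ i) \<and> poly2 F (\<tau> ^ e0, \<Sum>i. \<eta> i * \<tau> ^ i) = 0))"

text \<open>
  The coordinate \<open>y_j\<close> (for \<open>j \<ge> 2\<close>) is determined by \<open>\<xi>_j y_j = 1 - u_j + x_j R_j(x_j,u_j)\<close>;
  hence \<open>u_j\<close> is the analytic solution of this equation with value \<open>1\<close> at \<open>o_j\<close>.
\<close>

definition local_coordinates :: "branch_resolution \<Rightarrow> nat \<Rightarrow> bool" where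
  "local_coordinates D j \<longleftrightarrow> xi D j \<noteq> 0 \<and> uu D j (0, 0) = 1 \<and>
     (\<exists>b. conv_on b (rad D j) \<and> (\<forall>p\<in>coord_square (rad D j). uu D j p = eval2 b p)) \<and>
     (\<forall>p\<in>coord_square (rad D j).
        xi D j * snd p = 1 - uu D j p + fst p * poly2 (RR D j) (fst p, uu D j p))"

text \<open>The equation \<open>local_eq D (j+1)\<close> of the strict transform may differ by a unit \<open>v\<close> from the
  quotient of \<open>local_eq D j \<circ> \<pi>_j\<close> by \<open>y_j^(e_(j-1)) \<circ> \<pi>_j\<close>.\<close>

definition toric_resolution :: "branch_resolution \<Rightarrow> bool" where
  "toric_resolution D \<longleftrightarrow>
     analytically_irreducible (complexify (coeff2 (curve_poly D))) \<and>
     real_puiseux (curve_poly D) (ee D 0) \<and>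
     gg D \<ge> 1 \<and> ee D (gg D) = 1 \<and> (\<forall>j\<in>{1..<gg D}. ee D j > 1) \<and>
     (\<forall>j\<in>{1..gg D}. nn D j \<ge> 1 \<and> mm D j \<ge> 1 \<and> coprime (nn D j) (mm D j) \<and>
        ee D (j - 1) = ee D j * nn D j \<and> rad D j > 0 \<and> conv_on (local_eq D j) (rad D j) \<and>
        has_initial_form (local_eq D j) (nn D j) (mm D j) (ee D j)) \<and>
     local_eq D 1 = coeff2 (curve_poly D) \<and>
     (\<forall>j\<in>{1..<gg D}.
        resolution_cone (nn D j, mm D j) (cc D j, dd D j) \<and>
        local_coordinates D (Suc j) \<and>
        pi_map D j ` coord_square (rad D (Suc j)) \<subseteq> coord_square (rad D j) \<and>
        (\<exists>v. conv_on v (rad D (Suc j)) \<and> v 0 0 \<noteq> 0 \<and>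
           (\<forall>p\<in>coord_square (rad D (Suc j)).
              eval2 (local_eq D j) (pi_map D j p) =
              snd (pi_map D j p) ^ ee D (j - 1) * (eval2 v p * eval2 (local_eq D (Suc j)) p))))"

definition Delta :: "branch_resolution \<Rightarrow> nat \<Rightarrow> (real \<times> real) set" where
  "Delta D j = convex hull {(0, 0), (real (mm D j * ee D j), 0), (0, real (nn D j * ee D j))}"

definition Gamma :: "branch_resolution \<Rightarrow> nat \<Rightarrow> (real \<times> real) set" where
  "Gamma D j = closed_segment (real (mm D j * ee D j), 0) (0, real (nn D j * ee D j))"

definition Delta_minus :: "branch_resolution \<Rightarrow> nat \<Rightarrow> (real \<times> real) set" where
  "Delta_minus D j = Delta D j - Gamma D j"

text \<open>Only used for \<open>(r,s)\<close> in \<open>Delta_minus D j\<close>, where the subtractions do not truncate.\<close>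

definition omega :: "branch_resolution \<Rightarrow> nat \<Rightarrow> nat \<Rightarrow> nat \<Rightarrow> nat" where
  "omega D j r s = ee D j * (ee D j * nn D j * mm D j - r * nn D j - s * mm D j)"

section \<open>Multi-semi-quasi-homogeneous deformations\<close>

text \<open>
  \<open>very_small i k \<Phi> t\<close> means: \<open>\<Phi>\<close> holds for all \<open>0 < t_i \<lless> t_(i+1) \<lless> \<dots> \<lless> t_k \<lless> 1\<close>,
  each parameter being sufficiently small depending on the following ones; the other
  parameters are those of \<open>t\<close>. We use it for \<open>i \<ge> 1\<close>; if \<open>k < i\<close> nothing is quantified.
\<close>

primrec very_small ::
  "nat \<Rightarrow> nat \<Rightarrow> ((nat \<Rightarrow> real) \<Rightarrow> bool) \<Rightarrow> (nat \<Rightarrow> real) \<Rightarrow> bool" where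
  "very_small i 0 \<Phi> t = \<Phi> t"
| "very_small i (Suc k) \<Phi> t =
     (if Suc k < i then \<Phi> t
      else (\<forall>\<^sub>F s in at_right 0. very_small i k \<Phi> (t(Suc k := s))))"

text \<open>\<open>M j r s\<close> is \<open>M_j(r,s)\<close> and \<open>A j r s\<close> is \<open>A^(j)_(r,s)\<close>.\<close>

type_synonym monomials = "nat \<Rightarrow> nat \<Rightarrow> nat \<Rightarrow> real poly poly"
type_synonym coefficients = "nat \<Rightarrow> nat \<Rightarrow> nat \<Rightarrow> real"

definition adapted_monomials :: "branch_resolution \<Rightarrow> monomials \<Rightarrow> bool" where
  "adapted_monomials D M \<longleftrightarrow>
     (\<forall>r s. M 1 r s = monom2 1 r s) \<and>
     (\<forall>j\<in>{2..gg D}. \<forall>r. \<forall>s<ee D (j - 1). \<exists>k :: nat \<Rightarrow> nat. (\<forall>i\<in>{2..j}. k i > 0) \<and>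
        (\<forall>p\<in>coord_square (rad D j). poly2 (M j r s) (to_plane D j p) =
           exc D j p * (\<Prod>i\<in>{2..j}. uu D i (down D i (j - i) p) ^ k i) * fst p ^ r * snd p ^ s))"

text \<open>The polynomial \<open>P_(t_j,\<dots>,t_g)\<close>.\<close>

definition msqh_poly ::
  "branch_resolution \<Rightarrow> monomials \<Rightarrow> coefficients \<Rightarrow> nat \<Rightarrow> (nat \<Rightarrow> real) \<Rightarrow> real poly poly" where
  "msqh_poly D M A j t = curve_poly D +
     (\<Sum>l\<in>{j..gg D}. \<Sum>(r,s)\<in>lattice_points (Delta_minus D l).
        smult [:A l r s * t l ^ omega D l r s:] (M l r s))"

text \<open>\<open>a\<close> is the quotient of \<open>P \<circ> \<pi>_1 \<circ> \<dots> \<circ> \<pi>_(j-1)\<close> by \<open>Exc_(j-1)\<close>, as a series in \<open>(x_j, y_j)\<close>.\<close>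

definition is_strict_transform ::
  "branch_resolution \<Rightarrow> nat \<Rightarrow> real poly poly \<Rightarrow> real ser2 \<Rightarrow> bool" where
  "is_strict_transform D j P a \<longleftrightarrow> conv_on a (rad D j) \<and>
     (\<forall>p\<in>coord_square (rad D j). poly2 P (to_plane D j p) = exc D j p * eval2 a p)"

definition strict_transform :: "branch_resolution \<Rightarrow> nat \<Rightarrow> real poly poly \<Rightarrow> real ser2" where
  "strict_transform D j P = (THE a. is_strict_transform D j P a)"

text \<open>The last clause says that the quotients \<open>P^(j)_(t_l,\<dots>,t_g)\<close> are power series converging on the
  chosen coordinate squares.\<close>

definition msqh_deformation ::
  "branch_resolution \<Rightarrow> monomials \<Rightarrow> coefficients \<Rightarrow> bool" where
  "msqh_deformation D M A \<longleftrightarrow> adapted_monomials D M \<and> (\<forall>l\<in>{1..gg D}. A l 0 0 \<noteq> 0) \<and>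
     (\<forall>j\<in>{1..gg D}. \<forall>l\<in>{j..Suc (gg D)}. \<forall>t. \<exists>a. is_strict_transform D j (msqh_poly D M A l t) a)"

definition smooth_in_ball :: "real ser2 \<Rightarrow> real \<Rightarrow> bool" where
  "smooth_in_ball a \<rho> \<longleftrightarrow> (\<forall>p\<in>cball 0 \<rho>. p \<in> complex_zeros a \<longrightarrow>
     eval2 (ser_dx (complexify a)) p \<noteq> 0 \<or> eval2 (ser_dy (complexify a)) p \<noteq> 0)"

definition transversal_to_boundary :: "real ser2 \<Rightarrow> real \<Rightarrow> bool" where
  "transversal_to_boundary a \<rho> \<longleftrightarrow>
     (\<forall>p\<in>sphere 0 \<rho>. p \<in> complex_zeros a \<longrightarrow> transversal_to_sphere_at (complex_zeros a) p)"

text \<open>The deformation is considered in the Milnor ball of radius \<open>\<rho>\<close> of the branch. The starting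
  value of the parameters is irrelevant, since all of \<open>t_1, \<dots>, t_g\<close> are quantified.\<close>

definition msqh_smoothing ::
  "branch_resolution \<Rightarrow> monomials \<Rightarrow> coefficients \<Rightarrow> real \<Rightarrow> bool" where
  "msqh_smoothing D M A \<rho> \<longleftrightarrow> msqh_deformation D M A \<and> milnor_ball (coeff2 (curve_poly D)) \<rho> \<and>
     very_small 1 (gg D)
       (\<lambda>t. smooth_in_ball (coeff2 (msqh_poly D M A 1 t)) \<rho> \<and>
            transversal_to_boundary (coeff2 (msqh_poly D M A 1 t)) \<rho>) (\<lambda>_. 0)"

text \<open>The polynomial \<open>Q_j\<close>; it depends on \<open>t_(j+1), \<dots>, t_g\<close>.\<close>

definition Q_poly ::
  "branch_resolution \<Rightarrow> monomials \<Rightarrow> coefficients \<Rightarrow> nat \<Rightarrow> (nat \<Rightarrow> real) \<Rightarrow> real poly poly" where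
  "Q_poly D M A j t =
     (\<Sum>(r,s)\<in>lattice_points (Delta_minus D j). monom2 (A j r s) r s) +
     (\<Sum>(r,s)\<in>lattice_points (Gamma D j).
        monom2 (strict_transform D j (msqh_poly D M A (Suc j) t) r s) r s)"

definition real_nondegenerated_deformation ::
  "branch_resolution \<Rightarrow> monomials \<Rightarrow> coefficients \<Rightarrow> bool" where
  "real_nondegenerated_deformation D M A \<longleftrightarrow>
     (\<forall>j\<in>{1..gg D}. very_small (Suc j) (gg D)
        (\<lambda>t. real_nondegenerated (Q_poly D M A j t) (Delta D j)) (\<lambda>_. 0))"

section \<open>Ovals, depth and size\<close>

definition oval_of :: "(real \<times> real) set \<Rightarrow> (real \<times> real) set \<Rightarrow> bool" where
  "oval_of S K \<longleftrightarrow> K \<in> components S \<and> K homeomorphic sphere (0 :: real \<times> real) 1"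

definition real_part :: "real ser2 \<Rightarrow> real \<Rightarrow> (real \<times> real) set" where
  "real_part a \<rho> = {p\<in>cball 0 \<rho>. eval2 a p = 0}"

definition hausdorff_close :: "real \<Rightarrow> (real \<times> real) set \<Rightarrow> (real \<times> real) set \<Rightarrow> bool" where
  "hausdorff_close \<epsilon> S T \<longleftrightarrow> (\<forall>p\<in>S. \<exists>q\<in>T. dist p q < \<epsilon>) \<and> (\<forall>q\<in>T. \<exists>p\<in>S. dist p q < \<epsilon>)"

text \<open>Homeomorphism of pairs from a real ball with the curve \<open>C\<close> onto the symmetrized polygon
  with the chart of \<open>Q\<close>. Stratified: the open quadrants and the coordinate half axes correspond.\<close>

definition patchworking_homeo ::
  "(real \<times> real) set \<Rightarrow> (real \<times> real) set \<Rightarrow> real poly poly \<Rightarrow> (real \<times> real) set \<Rightarrow>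
   (real \<times> real \<Rightarrow> real \<times> real) \<Rightarrow> bool" where
  "patchworking_homeo B C Q \<Theta> h \<longleftrightarrow>
     (\<exists>k. homeomorphism B (symmetrize \<Theta>) h k) \<and> h ` C = chart Q \<Theta> \<and>
     (\<forall>p\<in>B. sgn (fst (h p)) = sgn (fst p) \<and> sgn (snd (h p)) = sgn (snd p))"

text \<open>
  An oval of depth 1 of the smoothing with equation \<open>P^(j)_(t_j,\<dots>,t_g)\<close>, where
  \<open>t_(j+1), \<dots>, t_g\<close> are fixed and given by \<open>t\<close>. Such an oval is a family \<open>K\<close> depending
  continuously on the small parameter \<open>t_j = s\<close>. The radius \<open>\<rho>'\<close> is that of the Milnor ball \<open>B'\<close>,
  and \<open>K\<^sub>0\<close> is the corresponding component of the chart of \<open>Q_j\<close>; neither depends on \<open>s\<close>.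
\<close>

definition depth_one_oval ::
  "branch_resolution \<Rightarrow> monomials \<Rightarrow> coefficients \<Rightarrow> nat \<Rightarrow> (nat \<Rightarrow> real) \<Rightarrow>
   (real \<Rightarrow> (real \<times> real) set) \<Rightarrow> bool" where
  "depth_one_oval D M A j t K \<longleftrightarrow> (\<exists>\<rho>' \<delta> K\<^sub>0.
     \<rho>' < rad D j \<and> \<delta> > 0 \<and>
     milnor_ball (strict_transform D j (msqh_poly D M A (Suc j) t)) \<rho>' \<and>
     K\<^sub>0 \<in> components (chart (Q_poly D M A j t) (Delta D j)) \<and>
     K\<^sub>0 \<inter> symmetrize (Gamma D j) = {} \<and>
     (\<forall>s\<in>{0<..<\<delta>}.
        let C = real_part (strict_transform D j (msqh_poly D M A j (t(j := s)))) \<rho>'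
        in oval_of C (K s) \<and>
           (\<exists>h. patchworking_homeo (cball 0 \<rho>') C (Q_poly D M A j t) (Delta D j) h \<and>
                h ` K s = K\<^sub>0)) \<and>
     (\<forall>s\<in>{0<..<\<delta>}. \<forall>\<epsilon>>0. \<forall>\<^sub>F s' in at s. hausdorff_close \<epsilon> (K s') (K s)))"

text \<open>
  An oval of depth \<open>j\<close> of the smoothing, as a family \<open>O'\<close> depending on \<open>t_1, \<dots>, t_j\<close>, the
  parameters \<open>t_(j+1), \<dots>, t_g\<close> being fixed and given by \<open>t\<close>. That it is a slight perturbation of
  the image of \<open>K s\<close> means that it tends to this image for \<open>0 < t_1 \<lless> \<dots> \<lless> t_(j-1)\<close> tending to
  \<open>0\<close> with \<open>t_j = s\<close> fixed; for \<open>j = 1\<close> it means that these two compact sets are equal.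
\<close>

definition oval_of_depth ::
  "branch_resolution \<Rightarrow> monomials \<Rightarrow> coefficients \<Rightarrow> real \<Rightarrow> nat \<Rightarrow> (nat \<Rightarrow> real) \<Rightarrow>
   ((nat \<Rightarrow> real) \<Rightarrow> (real \<times> real) set) \<Rightarrow> bool" where
  "oval_of_depth D M A \<rho> j t O' \<longleftrightarrow>
     very_small 1 j (\<lambda>t'. oval_of (real_part (coeff2 (msqh_poly D M A 1 t')) \<rho>) (O' t')) t \<and>
     (\<exists>K. depth_one_oval D M A j t K \<and>
        (j \<ge> 2 \<longrightarrow> (\<forall>\<^sub>F s in at_right 0. \<forall>p\<in>K s. fst p \<noteq> 0)) \<and>
        (\<forall>\<^sub>F s in at_right 0. \<forall>\<epsilon>>0.
           very_small 1 (j - 1) (\<lambda>t'. hausdorff_close \<epsilon> (O' t') (to_plane D j ` K s)) (t(j := s))))"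

definition minimal_box :: "(real \<times> real) set \<Rightarrow> real \<times> real \<Rightarrow> real \<times> real \<Rightarrow> bool" where
  "minimal_box S a b \<longleftrightarrow> S \<subseteq> cbox a b \<and> (\<forall>a' b'. S \<subseteq> cbox a' b' \<longrightarrow> cbox a b \<subseteq> cbox a' b')"

text \<open>\<open>f \<sim> t_j^\<gamma>\<close> as \<open>t_j\<close> tends to \<open>0\<close>, where \<open>0 < t_1 \<lless> \<dots> \<lless> t_(j-1) \<lless> t_j\<close> and the
  remaining parameters are those of \<open>t\<close>.\<close>

definition sim_power ::
  "nat \<Rightarrow> (nat \<Rightarrow> real) \<Rightarrow> ((nat \<Rightarrow> real) \<Rightarrow> real) \<Rightarrow> nat \<Rightarrow> bool" where
  "sim_power j t f \<gamma> \<longleftrightarrow>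
     (\<exists>L. L \<noteq> 0 \<and> (\<forall>\<epsilon>>0. very_small 1 j (\<lambda>t'. dist (f t' / t' j ^ \<gamma>) L < \<epsilon>) t))"

definition has_size ::
  "nat \<Rightarrow> (nat \<Rightarrow> real) \<Rightarrow> ((nat \<Rightarrow> real) \<Rightarrow> (real \<times> real) set) \<Rightarrow> nat \<Rightarrow> nat \<Rightarrow> bool" where
  "has_size j t O' \<alpha> \<beta> \<longleftrightarrow> (\<exists>a b.
     very_small 1 j (\<lambda>t'. minimal_box (O' t') (a t') (b t')) t \<and>
     sim_power j t (\<lambda>t'. fst (a t')) \<alpha> \<and> sim_power j t (\<lambda>t'. fst (b t')) \<alpha> \<and>
     sim_power j t (\<lambda>t'. snd (a t')) \<beta> \<and> sim_power j t (\<lambda>t'. snd (b t')) \<beta>)"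

end

theory Submission
  imports Defs "HOL-Complex_Analysis.Complex_Analysis"
begin

text \<open>
  Give \<open>x_j\<close>, \<open>y_j\<close>, \<open>t_j\<close> the weights \<open>\<alpha> = e_j n_j\<close>, \<open>\<beta> = e_j m_j\<close>, \<open>1\<close>. The exponents \<open>\<omega>_j\<close> are chosen
  such that every term that \<open>t_j\<close> contributes to the equation \<open>P^(j)\<close> of the strict transform starts
  in weight \<open>\<Omega> = e_j^2 n_j m_j\<close>, and \<open>P^(j)\<close> at \<open>t_j = 0\<close> has no terms of
  smaller weight either (\<open>weight_gser\<close>). So substituting \<open>x_j = s^\<alpha> X\<close>, \<open>y_j = s^\<beta> Y\<close>, \<open>t_j = s\<close> and
  dividing by \<open>s^\<Omega>\<close> turns \<open>P^(j)\<close> into a function that converges to \<open>Q_j(X, Y)\<close> together with its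
  derivatives (\<open>scaled_tendsto\<close>, \<open>leading_ser_1\<close>). Hence an oval of depth \<open>1\<close> at level \<open>j\<close> should be of size
  \<open>(s^\<alpha>, s^\<beta>)\<close>. Three points have to be established.

  First, the rescaled ovals stay bounded (\<open>K_weighted_bound\<close>). By invariance of domain the oval lies
  in the interior of the Milnor ball, because its image in the chart does not meet the hypotenuses. At
  a point of maximal distance from the origin the curve is tangent to a circle, which for the
  curve at \<open>t_j = 0\<close> happens only at the origin (\<open>radial_transversality\<close>); so the ovals shrink to the
  origin (\<open>K_shrinks\<close>). At a point that is extremal for the weighted distance \<open>x^(2 \<beta>) + y^(2 \<alpha>)\<close> and
  of larger order than \<open>s\<close>, the curve would look like the zero set of the part of \<open>Q_j\<close> on the
  hypotenuse. That part is weighted homogeneous and nondegenerate, so Euler's identity makes the products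
  \<open>x \<partial>_x\<close> and \<open>y \<partial>_y\<close> of it have opposite signs along its zero set, which is impossible at such an extremum
  (\<open>opposite_signs_near_origin\<close>).

  Second, the extremal coordinates of the rescaled ovals converge (\<open>support_value_asymptotics\<close>). Their
  cluster values are critical values of a coordinate on the smooth curve \<open>Q_j = 0\<close>, and such values
  fill no interval by an elementary version of Sard's theorem
  (\<open>critical_values_contain_no_interval\<close>). Since the oval depends continuously on \<open>s\<close>, the cluster values
  form an interval; therefore there is only one.

  Third, the limits are nonzero: \<open>Q_j = 0\<close> crosses the coordinate axes transversally by nondegeneracy
  on the legs of the triangle (\<open>Q_crosses_y_axis\<close>, \<open>Q_crosses_x_axis\<close>), so \<open>0\<close> is not a critical value of the
  corresponding coordinate.

  For \<open>j \<ge> 2\<close> the oval is disjoint from \<open>x_j = 0\<close>, and the coordinates in the plane are, up to factors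
  tending to \<open>1\<close>, the powers of \<open>x_j\<close> with exponents \<open>n_1 \<cdots> n_(j-1)\<close> and \<open>m_1 n_2 \<cdots> n_(j-1)\<close>. As
  \<open>e_1 = n_2 \<cdots> n_j e_j\<close>, these powers of \<open>s^(e_j n_j)\<close> are of order \<open>s^(e_1 n_1)\<close> and \<open>s^(e_1 m_1)\<close>
  (\<open>image_extremes_of_depth_one_oval\<close>). The slight perturbation that leads to \<open>O\<close> is chosen after
  \<open>t_j\<close> and may therefore be taken negligible against any power of \<open>t_j\<close> (\<open>sim_power_sup\<close>).
\<close>

section \<open>Convergent power series in two variables\<close>

text \<open>For termwise differentiation: the factor \<open>r + 1\<close> is absorbed by a smaller radius.\<close>

lemma linear_times_geometric_bounded:
  fixes q :: real
  assumes "0 \<le> q" "q < 1"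
  obtains K where "\<And>r. (real r + 1) * q ^ r \<le> K"
proof -
  have "(\<lambda>n. real n * q ^ n) \<longlonglongrightarrow> 0" "(\<lambda>n. q ^ n) \<longlonglongrightarrow> 0"
    using assms by (auto intro!: powser_times_n_limit_0 LIMSEQ_power_zero)
  from tendsto_add[OF this] have "(\<lambda>n. (real n + 1) * q ^ n) \<longlonglongrightarrow> 0"
    by (simp add: algebra_simps)
  then have "Bseq (\<lambda>n. (real n + 1) * q ^ n)"
    by (intro convergent_imp_Bseq) (auto simp: convergent_def)
  then obtain K where "\<And>n. norm ((real n + 1) * q ^ n) \<le> K"
    by (auto simp: Bseq_def)
  then show ?thesis
    by (intro that[of K]) (smt (verit, best) real_norm_def)
qed

lemma geometric2_summable_on:
  fixes p q :: real
  assumes "0 \<le> p" "p < 1" "0 \<le> q" "q < 1"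
  shows "(\<lambda>(r::nat,s::nat). p ^ r * q ^ s) summable_on UNIV"
proof -
  have g: "((\<lambda>n. x ^ n) has_sum (1 / (1 - x))) UNIV" if "0 \<le> x" "x < 1" for x :: real
    using that by (intro sums_nonneg_imp_has_sum) (auto intro!: geometric_sums)
  have "(\<lambda>(r::nat,s::nat). p ^ r * q ^ s) summable_on Sigma UNIV (\<lambda>_. UNIV)"
  proof (rule summable_on_SigmaI)
    show "((\<lambda>y. case (x, y) of (r, s) \<Rightarrow> p ^ r * q ^ s) has_sum p ^ x * (1 / (1 - q))) UNIV" for x
      using has_sum_cmult_right[OF g[OF assms(3,4)]] by simp
    show "(\<lambda>x. p ^ x * (1 / (1 - q))) summable_on UNIV"
      using has_sum_cmult_left[OF g[OF assms(1,2)], of "1 / (1 - q)"] unfolding summable_on_def by blast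
  qed (use assms in auto)
  then show ?thesis by simp
qed

lemma has_sum_imp_sums_prod_decode:
  "(f has_sum l) UNIV \<Longrightarrow> (\<lambda>n. f (prod_decode n)) sums l"
  using has_sum_reindex_bij_betw[OF bij_prod_decode, of f l] has_sum_imp_sums by blast

text \<open>The terms of a convergent series are bounded; conversely bounded terms at a radius are dominated
  by a geometric series at every smaller one. In this form convergence is inherited by other series
  through comparison of coefficients.\<close>

lemma conv_on_iff_bounded:
  fixes a :: "'a::{real_normed_field,banach} ser2"
  shows "conv_on a R \<longleftrightarrow> (\<forall>x. 0 < x \<longrightarrow> x < R \<longrightarrow> (\<exists>C. \<forall>r s. norm (a r s) * x ^ (r + s) \<le> C))"
proof (intro iffI allI impI)
  fix x :: real assume "conv_on a R" "0 < x" "x < R"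
  then have "(\<lambda>(r,s). a r s * of_real x ^ r * of_real x ^ s) summable_on UNIV"
    by (auto simp: conv_on_def)
  then obtain l where "((\<lambda>(r,s). a r s * of_real x ^ r * of_real x ^ s) has_sum l) UNIV"
    by (auto simp: summable_on_def)
  then have "summable (\<lambda>n. case prod_decode n of (r,s) \<Rightarrow> a r s * of_real x ^ r * of_real x ^ s)"
    by (rule sums_summable[OF has_sum_imp_sums_prod_decode])
  then have "Bseq (\<lambda>n. case prod_decode n of (r,s) \<Rightarrow> a r s * of_real x ^ r * of_real x ^ s)"
    by (rule summable_imp_Bseq)
  then obtain K where K: "\<And>n. norm (case prod_decode n of (r,s) \<Rightarrow> a r s * of_real x ^ r * of_real x ^ s) \<le> K"
    by (auto simp: Bseq_def)
  show "\<exists>C. \<forall>r s. norm (a r s) * x ^ (r + s) \<le> C"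
  proof (intro exI allI)
    fix r s show "norm (a r s) * x ^ (r + s) \<le> K"
      using K[of "prod_encode (r,s)"] \<open>0 < x\<close>
      by (simp add: norm_mult norm_power power_add mult.assoc)
  qed
next
  assume bd: "\<forall>x. 0 < x \<longrightarrow> x < R \<longrightarrow> (\<exists>C. \<forall>r s. norm (a r s) * x ^ (r + s) \<le> C)"
  show "conv_on a R"
    unfolding conv_on_def
  proof (intro allI impI)
    fix X Y :: 'a assume XY: "norm X < R" "norm Y < R"
    then obtain x where x: "max (norm X) (norm Y) < x" "x < R"
      using dense[of "max (norm X) (norm Y)" R] by auto
    then have "0 < x" by (smt (verit) norm_ge_zero)
    with x bd obtain C where C: "\<And>r s. norm (a r s) * x ^ (r + s) \<le> C" by blast
    define p q where "p = norm X / x" and "q = norm Y / x"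
    have pq: "0 \<le> p" "p < 1" "0 \<le> q" "q < 1" and XYe: "norm X = p * x" "norm Y = q * x"
      using x \<open>0 < x\<close> by (auto simp: p_def q_def)
    have "(\<lambda>z. norm ((\<lambda>(r,s). a r s * X ^ r * Y ^ s) z)) summable_on UNIV"
    proof (rule Infinite_Sum.abs_summable_on_comparison_test')
      show "(\<lambda>z. C * (\<lambda>(r::nat,s::nat). p ^ r * q ^ s) z) summable_on UNIV"
        by (intro summable_on_cmult_right geometric2_summable_on pq)
      show "norm ((\<lambda>(r,s). a r s * X ^ r * Y ^ s) z) \<le> C * (\<lambda>(r::nat,s::nat). p ^ r * q ^ s) z" for z
      proof -
        obtain r s where z: "z = (r, s)" by force
        have "norm (a r s * X ^ r * Y ^ s) = (norm (a r s) * x ^ (r + s)) * (p ^ r * q ^ s)"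
          by (simp add: norm_mult norm_power XYe power_mult_distrib power_add)
        also have "\<dots> \<le> C * (p ^ r * q ^ s)"
          by (intro mult_right_mono C) (use pq in auto)
        finally show ?thesis by (simp add: z)
      qed
    qed
    then show "(\<lambda>(r, s). a r s * X ^ r * Y ^ s) summable_on UNIV"
      by (rule abs_summable_summable)
  qed
qed

lemma conv_on_bounded_comparison:
  fixes a :: "'a::{real_normed_field,banach} ser2" and b :: "'b::{real_normed_field,banach} ser2"
  assumes "conv_on a R" "\<And>r s. norm (b r s) \<le> norm (a r s)"
  shows "conv_on b R"
  unfolding conv_on_iff_bounded
proof (intro allI impI)
  fix x :: real assume x: "0 < x" "x < R"
  then obtain C where "\<forall>r s. norm (a r s) * x ^ (r + s) \<le> C"
    using assms(1) by (auto simp: conv_on_iff_bounded)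
  then show "\<exists>C. \<forall>r s. norm (b r s) * x ^ (r + s) \<le> C"
    using assms(2) x by (meson mult_right_mono order_trans zero_le_power less_imp_le)
qed

lemma conv_on_norm: "conv_on a R \<Longrightarrow> conv_on (\<lambda>r s. norm (a r s)) R"
  by (rule conv_on_bounded_comparison) auto

lemma conv_on_complexify: "conv_on a R \<Longrightarrow> conv_on (complexify a) R"
  by (rule conv_on_bounded_comparison) (auto simp: complexify_def)

lemma conv_on_transpose: "conv_on (\<lambda>r s. a s r) R \<longleftrightarrow> conv_on a R"
  by (simp add: conv_on_iff_bounded add.commute) (metis add.commute)

text \<open>The bound for the coefficients of the derivative at a radius \<open>x\<close> comes from the bound for \<open>a\<close> at a
  slightly larger radius \<open>y\<close>, since \<open>(r + 1) (x/y)^r\<close> is bounded.\<close>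

lemma conv_on_ser_dx:
  fixes a :: "'a::{real_normed_field,banach} ser2"
  assumes "conv_on a R" shows "conv_on (ser_dx a) R"
  unfolding conv_on_iff_bounded
proof (intro allI impI)
  fix x :: real assume x: "0 < x" "x < R"
  then obtain y where y: "x < y" "y < R" using dense by blast
  then obtain C where C: "\<And>r s. norm (a r s) * y ^ (r + s) \<le> C"
    using assms x by (fastforce simp: conv_on_iff_bounded)
  obtain K where K: "\<And>r. (real r + 1) * (x / y) ^ r \<le> K"
    using linear_times_geometric_bounded[of "x / y"] x y by auto
  have "norm (ser_dx a r s) * x ^ (r + s) \<le> C / y * K" for r s
  proof -
    have "(x / y) ^ (r + s) \<le> (x / y) ^ r"
      using x y by (intro power_decreasing) auto
    then have "(real r + 1) * (x / y) ^ (r + s) \<le> (real r + 1) * (x / y) ^ r"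
      by (intro mult_left_mono) auto
    from order_trans[OF this K[of r]] have le: "real (Suc r) * (x / y) ^ (r + s) \<le> K"
      by (simp add: add.commute)
    have "norm (ser_dx a r s) * x ^ (r + s) =
          norm (a (Suc r) s) * y ^ (Suc r + s) / y * (real (Suc r) * (x / y) ^ (r + s))"
      using x y by (simp add: ser_dx_def norm_mult power_divide field_simps del: of_nat_Suc)
    also have "\<dots> \<le> C / y * K"
      using x y C[of "Suc r" s] le
      by (intro mult_mono divide_right_mono) (auto intro!: divide_nonneg_nonneg intro: order_trans[OF _ C])
    finally show ?thesis .
  qed
  then show "\<exists>C. \<forall>r s. norm (ser_dx a r s) * x ^ (r + s) \<le> C" by blast
qed

lemma conv_on_ser_dy:
  fixes a :: "'a::{real_normed_field,banach} ser2"
  assumes "conv_on a R" shows "conv_on (ser_dy a) R"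
proof -
  have "conv_on (ser_dx (\<lambda>r s. a s r)) R"
    by (rule conv_on_ser_dx[OF conv_on_transpose[THEN iffD2, OF assms]])
  moreover have "ser_dx (\<lambda>r s. a s r) = (\<lambda>r s. ser_dy a s r)"
    by (simp add: ser_dx_def ser_dy_def fun_eq_iff)
  ultimately have "conv_on (\<lambda>r s. ser_dy a s r) R" by (simp only:)
  then show ?thesis by (rule conv_on_transpose[THEN iffD1])
qed

lemma eval2_has_sum:
  assumes "conv_on a R" "norm (fst p) < R" "norm (snd p) < R"
  shows "((\<lambda>(r,s). a r s * fst p ^ r * snd p ^ s) has_sum eval2 a p) UNIV"
  using assms by (auto simp: conv_on_def eval2_def intro!: has_sum_infsum)

lemma eval2_eqI:
  "((\<lambda>(r,s). a r s * fst p ^ r * snd p ^ s) has_sum l) UNIV \<Longrightarrow> eval2 a p = l"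
  by (simp add: eval2_def infsumI)

text \<open>The summands are the derivatives of the monomials of \<open>a\<close>, in the order of the terms of \<open>a\<close>; the
  theorem on termwise differentiation needs this indexing.\<close>

lemma eval2_ser_dx_has_sum:
  fixes a :: "'a::{real_normed_field,banach} ser2"
  assumes "conv_on a R" "norm (fst p) < R" "norm (snd p) < R"
  shows "((\<lambda>(r,s). of_nat r * a r s * fst p ^ (r - 1) * snd p ^ s) has_sum eval2 (ser_dx a) p) UNIV"
proof -
  let ?f = "\<lambda>(r,s). of_nat r * a r s * fst p ^ (r - 1) * snd p ^ s"
  have "((?f \<circ> (\<lambda>(r,s). (Suc r, s))) has_sum eval2 (ser_dx a) p) UNIV"
    using eval2_has_sum[OF conv_on_ser_dx[OF assms(1)] assms(2,3)]
    by (simp add: ser_dx_def o_def case_prod_unfold)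
  then have "(?f has_sum eval2 (ser_dx a) p) (range (\<lambda>(r,s). (Suc r, s)))"
    by (subst has_sum_reindex) (auto simp: inj_on_def)
  moreover have "?f z = 0" if "z \<notin> range (\<lambda>(r,s). (Suc r, s))" for z
  proof -
    obtain r s where "z = (r, s)" by force
    with that show ?thesis by (cases r) auto
  qed
  ultimately show ?thesis
    by (subst has_sum_cong_neutral[where T = "range (\<lambda>(r,s). (Suc r, s))" and g = ?f]) auto
qed

lemma eval2_ser_dy_has_sum:
  fixes a :: "'a::{real_normed_field,banach} ser2"
  assumes "conv_on a R" "norm (fst p) < R" "norm (snd p) < R"
  shows "((\<lambda>(r,s). of_nat s * a r s * fst p ^ r * snd p ^ (s - 1)) has_sum eval2 (ser_dy a) p) UNIV"
proof -
  let ?f = "\<lambda>(r,s). of_nat s * a r s * fst p ^ r * snd p ^ (s - 1)"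
  have "((?f \<circ> (\<lambda>(r,s). (r, Suc s))) has_sum eval2 (ser_dy a) p) UNIV"
    using eval2_has_sum[OF conv_on_ser_dy[OF assms(1)] assms(2,3)]
    by (simp add: ser_dy_def o_def case_prod_unfold)
  then have "(?f has_sum eval2 (ser_dy a) p) (range (\<lambda>(r,s). (r, Suc s)))"
    by (subst has_sum_reindex) (auto simp: inj_on_def)
  moreover have "?f z = 0" if "z \<notin> range (\<lambda>(r,s). (r, Suc s))" for z
  proof -
    obtain r s where "z = (r, s)" by force
    with that show ?thesis by (cases s) auto
  qed
  ultimately show ?thesis
    by (subst has_sum_cong_neutral[where T = "range (\<lambda>(r,s). (r, Suc s))" and g = ?f]) auto
qed

text \<open>Termwise differentiation: on a smaller bidisc the differentials of the terms are
  dominated by a convergent numerical series.\<close>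

lemma eval2_has_derivative:
  fixes a :: "'a::{real_normed_field,banach} ser2"
  assumes a: "conv_on a R" and p: "norm (fst p) < R" "norm (snd p) < R"
  shows "(eval2 a has_derivative (\<lambda>h. eval2 (ser_dx a) p * fst h + eval2 (ser_dy a) p * snd h)) (at p)"
proof -
  obtain x where x: "max (norm (fst p)) (norm (snd p)) < x" "x < R"
    using p dense[of "max (norm (fst p)) (norm (snd p))" R] by auto
  then have x0: "0 < x" by (smt (verit) norm_ge_zero)
  define S where "S = {q :: 'a \<times> 'a. norm (fst q) < x \<and> norm (snd q) < x}"
  have S: "S = ball 0 x \<times> ball 0 x" by (auto simp: S_def)
  have opS: "open S" and convS: "convex S" by (auto simp: S intro: open_Times convex_Times)
  have pS: "p \<in> S" using x by (simp add: S_def)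
  define f where "f = (\<lambda>n q. (\<lambda>(r,s). a r s * fst q ^ r * snd q ^ s) (prod_decode n))"
  define f' where "f' = (\<lambda>n q h. (\<lambda>(r,s). of_nat r * a r s * fst q ^ (r - 1) * snd q ^ s) (prod_decode n) * fst h
     + (\<lambda>(r,s). of_nat s * a r s * fst q ^ r * snd q ^ (s - 1)) (prod_decode n) * snd h)"
  define g' where "g' = (\<lambda>q h. eval2 (ser_dx a) q * fst h + eval2 (ser_dy a) q * snd h)"
  let ?c = "\<lambda>r s. norm (a r s)"
  define M where "M = (\<lambda>n. (\<lambda>(r,s). of_nat r * ?c r s * x ^ (r - 1) * x ^ s) (prod_decode n)
     + (\<lambda>(r,s). of_nat s * ?c r s * x ^ r * x ^ (s - 1)) (prod_decode n))"
  have summ: "summable M"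
  proof -
    note * = eval2_ser_dx_has_sum[OF conv_on_norm[OF a], of "(x,x)"] eval2_ser_dy_has_sum[OF conv_on_norm[OF a], of "(x,x)"]
    have "M sums (eval2 (ser_dx ?c) (x,x) + eval2 (ser_dy ?c) (x,x))"
      unfolding M_def
      by (intro sums_add has_sum_imp_sums_prod_decode) (use * x x0 in simp_all)
    then show ?thesis by (simp add: sums_summable)
  qed
  have f'sums: "(\<lambda>n. f' n q h) sums g' q h" if "q \<in> S" for q h
    unfolding f'_def g'_def
    using that x
    by (intro sums_add sums_mult2 has_sum_imp_sums_prod_decode eval2_ser_dx_has_sum[OF a] eval2_ser_dy_has_sum[OF a])
       (auto simp: S_def)
  have bound: "norm (f' n q h) \<le> M n * norm h" if "q \<in> S" for n q h
  proof -
    obtain r s where rs: "prod_decode n = (r, s)" by force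
    have q: "norm (fst q) \<le> x" "norm (snd q) \<le> x" using that by (auto simp: S_def)
    have h: "norm (fst h) \<le> norm h" "norm (snd h) \<le> norm h" using norm_fst_le[of "fst h" "snd h"] norm_snd_le[of "snd h" "fst h"] by simp_all
    have "norm (f' n q h) \<le> of_nat r * ?c r s * norm (fst q) ^ (r - 1) * norm (snd q) ^ s * norm (fst h)
        + of_nat s * ?c r s * norm (fst q) ^ r * norm (snd q) ^ (s - 1) * norm (snd h)"
      unfolding f'_def rs by (rule order_trans[OF norm_triangle_ineq]) (simp add: norm_mult norm_power)
    also have "\<dots> \<le> of_nat r * ?c r s * x ^ (r - 1) * x ^ s * norm h + of_nat s * ?c r s * x ^ r * x ^ (s - 1) * norm h"
      using q h x0 by (intro add_mono mult_mono power_mono) auto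
    finally show ?thesis by (simp add: M_def rs algebra_simps)
  qed
  have "\<exists>g. \<forall>q\<in>S. (\<lambda>n. f n q) sums (g q) \<and> (g has_derivative g' q) (at q within S)"
  proof (rule has_derivative_series)
    show "convex S" by fact
    show "p \<in> S" by fact
    show "(f n has_derivative f' n q) (at q within S)" if "q \<in> S" for n q
    proof -
      obtain r s where rs: "prod_decode n = (r, s)" by force
      show ?thesis unfolding f_def f'_def rs
        by (auto intro!: derivative_eq_intros simp: fun_eq_iff algebra_simps)
    qed
    show "(\<lambda>n. f n p) sums eval2 a p"
      unfolding f_def by (intro has_sum_imp_sums_prod_decode eval2_has_sum[OF a p])
    show "\<forall>\<^sub>F n in sequentially. \<forall>q\<in>S. \<forall>h. norm (sum (\<lambda>i. f' i q h) {..<n} - g' q h) \<le> e * norm h"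
      if "e > 0" for e
    proof -
      have "(\<lambda>n. suminf M - (\<Sum>i<n. M i)) \<longlonglongrightarrow> suminf M - suminf M"
        by (intro tendsto_diff tendsto_const summable_LIMSEQ summ)
      then have "\<forall>\<^sub>F n in sequentially. suminf M - (\<Sum>i<n. M i) < e"
        using that by (intro order_tendstoD) auto
      then show ?thesis
      proof (rule eventually_mono, intro ballI allI)
        fix n q h assume n: "suminf M - (\<Sum>i<n. M i) < e" and q: "q \<in> S"
        have "g' q h - (\<Sum>i<n. f' i q h) = (\<Sum>i. f' (i + n) q h)"
          using f'sums[OF q, of h] suminf_minus_initial_segment[of "\<lambda>i. f' i q h" n]
          by (auto simp: sums_iff)
        also have "norm \<dots> \<le> (\<Sum>i. M (i + n) * norm h)"
          by (intro norm_suminf_le bound q summable_mult2) (use summ in \<open>simp add: summable_iff_shift\<close>)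
        also have "\<dots> = (\<Sum>i. M (i + n)) * norm h"
          by (intro suminf_mult2[symmetric]) (use summ in \<open>simp add: summable_iff_shift\<close>)
        also have "\<dots> = (suminf M - (\<Sum>i<n. M i)) * norm h"
          by (simp add: suminf_minus_initial_segment[OF summ])
        also have "\<dots> \<le> e * norm h" using n by (intro mult_right_mono) auto
        finally show "norm (sum (\<lambda>i. f' i q h) {..<n} - g' q h) \<le> e * norm h"
          by (simp add: norm_minus_commute)
      qed
    qed
  qed
  then obtain g where g: "\<And>q. q \<in> S \<Longrightarrow> (\<lambda>n. f n q) sums (g q)"
      "\<And>q. q \<in> S \<Longrightarrow> (g has_derivative g' q) (at q within S)" by blast
  have gev: "g q = eval2 a q" if "q \<in> S" for q
  proof -
    have "(\<lambda>n. f n q) sums eval2 a q"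
      unfolding f_def by (intro has_sum_imp_sums_prod_decode eval2_has_sum[OF a]) (use that x in \<open>auto simp: S_def\<close>)
    with g(1)[OF that] show ?thesis by (rule sums_unique2)
  qed
  have "(eval2 a has_derivative g' p) (at p within S)"
    by (rule has_derivative_transform[OF pS _ g(2)[OF pS]]) (simp add: gev)
  then show ?thesis
    unfolding at_within_open[OF pS opS] g'_def .
qed

lemma eval2_tendsto:
  fixes a :: "'a::{real_normed_field,banach} ser2"
  assumes "conv_on a R" "norm (fst p) < R" "norm (snd p) < R" "(f \<longlongrightarrow> p) F"
  shows "((\<lambda>z. eval2 a (f z)) \<longlongrightarrow> eval2 a p) F"
proof -
  have "isCont (eval2 a) p"
    by (rule has_derivative_continuous[OF eval2_has_derivative[OF assms(1-3)]])
  then show ?thesis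
    using assms(4) by (rule isCont_tendsto_compose)
qed

lemma eval2_zero:
  fixes a :: "'a::{real_normed_field,banach} ser2"
  shows "eval2 a (0, 0) = a 0 0"
proof (rule eval2_eqI)
  let ?f = "\<lambda>(r,s). a r s * fst (0::'a,0::'a) ^ r * snd (0::'a,0::'a) ^ s"
  have "(?f has_sum a 0 0) {(0,0)}"
    by (rule has_sum_finiteI) auto
  then show "(?f has_sum a 0 0) UNIV"
    by (subst has_sum_cong_neutral[where T = "{(0,0)}" and g = ?f]) (auto simp: power_0_left split: if_splits)
qed

lemma eval2_finite:
  fixes a :: "'a::{real_normed_field,banach} ser2"
  assumes "finite S" "\<And>r s. a r s \<noteq> 0 \<Longrightarrow> (r, s) \<in> S"
  shows "eval2 a p = (\<Sum>(r,s)\<in>S. a r s * fst p ^ r * snd p ^ s)"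
proof (rule eval2_eqI)
  have "((\<lambda>(r,s). a r s * fst p ^ r * snd p ^ s) has_sum
      (\<Sum>(r,s)\<in>S. a r s * fst p ^ r * snd p ^ s)) S"
    by (rule has_sum_finite) fact
  then show "((\<lambda>(r,s). a r s * fst p ^ r * snd p ^ s) has_sum
      (\<Sum>(r,s)\<in>S. a r s * fst p ^ r * snd p ^ s)) UNIV"
    by (rule has_sum_cong_neutral[THEN iffD1, rotated -1]) (use assms in auto)
qed

lemma conv_on_finite:
  fixes a :: "'a::{real_normed_field,banach} ser2"
  assumes "finite S" "\<And>r s. a r s \<noteq> 0 \<Longrightarrow> (r, s) \<in> S"
  shows "conv_on a R"
  unfolding conv_on_def
proof (intro allI impI)
  fix x y :: 'a
  have "(\<lambda>(r,s). a r s * x ^ r * y ^ s) summable_on S" using assms(1) by simp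
  then show "(\<lambda>(r,s). a r s * x ^ r * y ^ s) summable_on UNIV"
    by (rule summable_on_cong_neutral[THEN iffD1, rotated -1]) (use assms in auto)
qed

lemma conv_on_add:
  fixes a b :: "'a::{real_normed_field,banach} ser2"
  assumes "conv_on a R" "conv_on b R"
  shows "conv_on (\<lambda>r s. a r s + b r s) R"
  using assms unfolding conv_on_def case_prod_unfold
  by (auto simp: algebra_simps intro!: summable_on_add)

lemma conv_on_scale:
  fixes a :: "'a::{real_normed_field,banach} ser2"
  assumes "conv_on a R"
  shows "conv_on (\<lambda>r s. c * a r s) R"
  using assms unfolding conv_on_def case_prod_unfold
  by (auto simp: mult.assoc intro!: summable_on_cmult_right)

lemma eval2_add:
  fixes a b :: "'a::{real_normed_field,banach} ser2"
  assumes "conv_on a R" "conv_on b R" "norm (fst p) < R" "norm (snd p) < R"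
  shows "eval2 (\<lambda>r s. a r s + b r s) p = eval2 a p + eval2 b p"
  by (rule eval2_eqI)
     (use has_sum_add[OF eval2_has_sum[OF assms(1,3,4)] eval2_has_sum[OF assms(2,3,4)]] in
       \<open>simp add: case_prod_unfold algebra_simps\<close>)

lemma eval2_scale:
  fixes a :: "'a::{real_normed_field,banach} ser2"
  assumes "conv_on a R" "norm (fst p) < R" "norm (snd p) < R"
  shows "eval2 (\<lambda>r s. c * a r s) p = c * eval2 a p"
  by (rule eval2_eqI)
     (use has_sum_cmult_right[OF eval2_has_sum[OF assms(1,2,3)], of c] in
       \<open>simp add: case_prod_unfold algebra_simps\<close>)

lemma conv_on_sum:
  fixes g :: "'k \<Rightarrow> 'a::{real_normed_field,banach} ser2"
  assumes "\<And>k. k \<in> K \<Longrightarrow> conv_on (g k) R"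
  shows "conv_on (\<lambda>r s. \<Sum>k\<in>K. g k r s) R"
  using assms
proof (induction K rule: infinite_finite_induct)
  case (insert k K)
  then show ?case using conv_on_add[of "g k" R "\<lambda>r s. \<Sum>k\<in>K. g k r s"] by simp
qed (auto intro!: conv_on_finite[of "{}"])

lemma eval2_sum:
  fixes g :: "'k \<Rightarrow> 'a::{real_normed_field,banach} ser2"
  assumes "\<And>k. k \<in> K \<Longrightarrow> conv_on (g k) R" "norm (fst p) < R" "norm (snd p) < R"
  shows "eval2 (\<lambda>r s. \<Sum>k\<in>K. g k r s) p = (\<Sum>k\<in>K. eval2 (g k) p)"
  using assms(1)
proof (induction K rule: infinite_finite_induct)
  case (insert k K)
  then show ?case using eval2_add[of "g k" R "\<lambda>r s. \<Sum>k\<in>K. g k r s"] assms(2,3)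
    by (simp add: conv_on_sum)
qed (use eval2_finite[of "{}" "\<lambda>_ _. 0" p] in auto)

lemma eval2_complexify:
  assumes "conv_on a R" "\<bar>fst p\<bar> < R" "\<bar>snd p\<bar> < R"
  shows "eval2 (complexify a) (of_real (fst p), of_real (snd p)) = of_real (eval2 a p)"
  by (rule eval2_eqI)
     (use has_sum_bounded_linear[OF bounded_linear_of_real[where 'a=complex] eval2_has_sum[OF assms(1)], of p] assms in
       \<open>simp add: case_prod_unfold complexify_def o_def\<close>)

lemma eval2_complexify_cnj:
  assumes "conv_on a R" "norm (fst p) < R" "norm (snd p) < R"
  shows "eval2 (complexify a) (cnj (fst p), cnj (snd p)) = cnj (eval2 (complexify a) p)"
  by (rule eval2_eqI)
     (use has_sum_bounded_linear[OF bounded_linear_cnj eval2_has_sum[OF conv_on_complexify[OF assms(1)]], of p] assms in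
       \<open>simp add: case_prod_unfold complexify_def o_def\<close>)

section \<open>Weights and rescaling\<close>

lemma finite_weight_le:
  assumes "\<alpha> \<ge> 1" "\<beta> \<ge> 1"
  shows "finite {(r::nat, s::nat). \<alpha> * r + \<beta> * s + v \<le> W}"
proof (rule finite_subset)
  show "{(r, s). \<alpha> * r + \<beta> * s + v \<le> W} \<subseteq> {..W} \<times> {..W}"
  proof clarify
    fix r s assume "\<alpha> * r + \<beta> * s + v \<le> W"
    moreover have "r \<le> \<alpha> * r" "s \<le> \<beta> * s"
      using assms mult_le_mono1[of 1 \<alpha> r] mult_le_mono1[of 1 \<beta> s] by simp_all
    ultimately have "r \<le> W" "s \<le> W" by linarith+
    then show "r \<in> {..W} \<and> s \<in> {..W}" by simp
  qed
qed simp

lemma finite_weight_eq: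
  assumes "\<alpha> \<ge> 1" "\<beta> \<ge> 1"
  shows "finite {(r::nat, s::nat). \<alpha> * r + \<beta> * s + v = W}"
  by (rule finite_subset[OF _ finite_weight_le[OF assms, of v W]]) auto

text \<open>The part of weight \<open>W\<close>, where \<open>x\<close> and \<open>y\<close> have weights \<open>\<alpha>\<close> and \<open>\<beta>\<close>; the number \<open>v\<close> is the weight of an
  additional factor, which is a power of the parameter or comes from a differentiation.\<close>

definition weighted_part :: "nat \<Rightarrow> nat \<Rightarrow> nat \<Rightarrow> nat \<Rightarrow> real ser2 \<Rightarrow> real \<times> real \<Rightarrow> real" where
  "weighted_part \<alpha> \<beta> v W a p = (\<Sum>(r,s)\<in>{(r,s). \<alpha> * r + \<beta> * s + v = W}. a r s * fst p ^ r * snd p ^ s)"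

text \<open>Terms of weight \<open>W\<close> are not affected by the rescaling, and the others are dominated by \<open>\<sigma>\<close> times a
  convergent series. All of \<open>\<sigma>, X, Y\<close> may vary, so that the lemma applies along sequences of points.\<close>

lemma eval2_scaling_tendsto:
  fixes a :: "real ser2"
  assumes a: "conv_on a R" and R: "R > 0" and \<alpha>: "\<alpha> \<ge> 1" and \<beta>: "\<beta> \<ge> 1"
    and wt: "\<And>r s. a r s \<noteq> 0 \<Longrightarrow> W \<le> \<alpha> * r + \<beta> * s + v"
    and lim: "(\<sigma> \<longlongrightarrow> 0) F" "\<forall>\<^sub>F z in F. \<sigma> z > 0" "(X \<longlongrightarrow> X0) F" "(Y \<longlongrightarrow> Y0) F"
  shows "((\<lambda>z. \<sigma> z ^ v * eval2 a (\<sigma> z ^ \<alpha> * X z, \<sigma> z ^ \<beta> * Y z) / \<sigma> z ^ W)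
           \<longlongrightarrow> weighted_part \<alpha> \<beta> v W a (X0, Y0)) F"
proof -
  define B where "B = max \<bar>X0\<bar> \<bar>Y0\<bar> + 1"
  have B: "B > 0" "\<bar>X0\<bar> < B" "\<bar>Y0\<bar> < B" by (auto simp: B_def)
  define \<sigma>0 where "\<sigma>0 = min (1/2) (R / (2 * B))"
  have "R / (2 * B) > 0" using R B by simp
  have \<sigma>0: "0 < \<sigma>0" "\<sigma>0 < 1" using \<open>R / (2 * B) > 0\<close> by (auto simp: \<sigma>0_def)
  have "\<sigma>0 \<le> R / (2 * B)" by (simp add: \<sigma>0_def)
  then have "\<sigma>0 * B \<le> R / 2" using B by (simp add: field_simps)
  then have \<sigma>0B: "\<sigma>0 * B < R" using R by simp
  have pow1: "\<sigma>0 ^ \<alpha> \<le> \<sigma>0" "\<sigma>0 ^ \<beta> \<le> \<sigma>0"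
    using power_decreasing[of 1 \<alpha> \<sigma>0] power_decreasing[of 1 \<beta> \<sigma>0] \<alpha> \<beta> \<sigma>0 by auto
  have dom: "\<sigma>0 ^ \<alpha> * B < R" "\<sigma>0 ^ \<beta> * B < R"
    using pow1 B \<sigma>0B by (meson mult_right_mono less_imp_le order_le_less_trans)+
  \<comment> \<open>the part of weight exactly \<open>W\<close>, and the tail\<close>
  define a1 where "a1 = (\<lambda>r s. if \<alpha> * r + \<beta> * s + v = W then a r s else 0)"
  define a2 where "a2 = (\<lambda>r s. if \<alpha> * r + \<beta> * s + v = W then 0 else a r s)"
  have ca: "conv_on a1 R" "conv_on a2 R"
    by (rule conv_on_bounded_comparison[OF a]; simp add: a1_def a2_def)+
  have aeq: "a = (\<lambda>r s. a1 r s + a2 r s)" by (intro ext) (simp add: a1_def a2_def)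
  have wt2: "Suc W \<le> \<alpha> * r + \<beta> * s + v" if "a2 r s \<noteq> 0" for r s
    using that wt[of r s] by (auto simp: a2_def split: if_splits)
  define C where "C = \<sigma>0 ^ v * eval2 (\<lambda>r s. norm (a2 r s)) (\<sigma>0 ^ \<alpha> * B, \<sigma>0 ^ \<beta> * B)"
  have ev: "\<forall>\<^sub>F z in F. 0 < \<sigma> z \<and> \<sigma> z < \<sigma>0 \<and> \<bar>X z\<bar> < B \<and> \<bar>Y z\<bar> < B"
    using lim(2) order_tendstoD(2)[OF lim(1) \<sigma>0(1)]
      order_tendstoD(2)[OF tendsto_rabs[OF lim(3)] B(2)] order_tendstoD(2)[OF tendsto_rabs[OF lim(4)] B(3)]
    by eventually_elim auto
  have tail: "\<bar>\<sigma> ^ v * eval2 a2 (\<sigma> ^ \<alpha> * X, \<sigma> ^ \<beta> * Y) / \<sigma> ^ W\<bar> \<le> \<sigma> * (C / \<sigma>0 ^ Suc W)"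
    if \<sigma>: "0 < \<sigma>" "\<sigma> < \<sigma>0" and X: "\<bar>X\<bar> < B" and Y: "\<bar>Y\<bar> < B" for \<sigma> X Y :: real
  proof -
    have d: "\<bar>\<sigma> ^ \<alpha> * X\<bar> < R" "\<bar>\<sigma> ^ \<beta> * Y\<bar> < R"
    proof -
      have "\<sigma> ^ \<alpha> * \<bar>X\<bar> \<le> \<sigma>0 ^ \<alpha> * B" "\<sigma> ^ \<beta> * \<bar>Y\<bar> \<le> \<sigma>0 ^ \<beta> * B"
        using \<sigma> X Y by (auto intro!: mult_mono power_mono)
      then show "\<bar>\<sigma> ^ \<alpha> * X\<bar> < R" "\<bar>\<sigma> ^ \<beta> * Y\<bar> < R" using dom \<sigma> by (auto simp: abs_mult)
    qed
    note h1 = has_sum_cmult_right[OF eval2_has_sum[OF ca(2), of "(\<sigma> ^ \<alpha> * X, \<sigma> ^ \<beta> * Y)"], of "\<sigma> ^ v"]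
    note h2 = has_sum_cmult_right[OF eval2_has_sum[OF conv_on_norm[OF ca(2)], of "(\<sigma>0 ^ \<alpha> * B, \<sigma>0 ^ \<beta> * B)"],
        of "(\<sigma> / \<sigma>0) ^ Suc W * \<sigma>0 ^ v"]
    have "norm (\<sigma> ^ v * eval2 a2 (\<sigma> ^ \<alpha> * X, \<sigma> ^ \<beta> * Y)) \<le> (\<sigma> / \<sigma>0) ^ Suc W * \<sigma>0 ^ v *
       eval2 (\<lambda>r s. norm (a2 r s)) (\<sigma>0 ^ \<alpha> * B, \<sigma>0 ^ \<beta> * B)"
    proof (rule norm_infsum_le[OF h1 h2])
      fix z :: "nat \<times> nat"
      obtain r s where z: "z = (r, s)" by force
      show "norm (\<sigma> ^ v * (case z of (r, s) \<Rightarrow> a2 r s * fst (\<sigma> ^ \<alpha> * X, \<sigma> ^ \<beta> * Y) ^ r * snd (\<sigma> ^ \<alpha> * X, \<sigma> ^ \<beta> * Y) ^ s))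
         \<le> (\<sigma> / \<sigma>0) ^ Suc W * \<sigma>0 ^ v * (case z of (r, s) \<Rightarrow>
             norm (a2 r s) * fst (\<sigma>0 ^ \<alpha> * B, \<sigma>0 ^ \<beta> * B) ^ r * snd (\<sigma>0 ^ \<alpha> * B, \<sigma>0 ^ \<beta> * B) ^ s)"
      proof (cases "a2 r s = 0")
        case False
        let ?w = "\<alpha> * r + \<beta> * s + v"
        have "(\<sigma> / \<sigma>0) ^ ?w \<le> (\<sigma> / \<sigma>0) ^ Suc W"
          using wt2[OF False] \<sigma> \<sigma>0 by (intro power_decreasing) auto
        then have w: "\<sigma> ^ ?w \<le> (\<sigma> / \<sigma>0) ^ Suc W * \<sigma>0 ^ ?w"
          using \<sigma>0 by (simp add: power_divide field_simps)
        have "norm (\<sigma> ^ v * (a2 r s * (\<sigma> ^ \<alpha> * X) ^ r * (\<sigma> ^ \<beta> * Y) ^ s))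
            = norm (a2 r s) * \<sigma> ^ ?w * (\<bar>X\<bar> ^ r * \<bar>Y\<bar> ^ s)"
          using \<sigma> by (simp add: abs_mult power_abs power_mult_distrib power_add power_mult)
        also have "\<dots> \<le> norm (a2 r s) * ((\<sigma> / \<sigma>0) ^ Suc W * \<sigma>0 ^ ?w) * (B ^ r * B ^ s)"
          using w X Y B \<sigma> by (intro mult_mono power_mono) auto
        also have "\<dots> = (\<sigma> / \<sigma>0) ^ Suc W * \<sigma>0 ^ v * (norm (a2 r s) * (\<sigma>0 ^ \<alpha> * B) ^ r * (\<sigma>0 ^ \<beta> * B) ^ s)"
          by (simp add: power_mult_distrib power_add power_mult mult_ac)
        finally show ?thesis by (simp add: z)
      qed (simp add: z)
    qed (use d dom \<sigma>0 B in auto)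
    then have "\<bar>\<sigma> ^ v * eval2 a2 (\<sigma> ^ \<alpha> * X, \<sigma> ^ \<beta> * Y)\<bar> \<le> (\<sigma> / \<sigma>0) ^ Suc W * C"
      by (simp add: C_def mult.assoc)
    then have "\<bar>\<sigma> ^ v * eval2 a2 (\<sigma> ^ \<alpha> * X, \<sigma> ^ \<beta> * Y)\<bar> / \<sigma> ^ W \<le> (\<sigma> / \<sigma>0) ^ Suc W * C / \<sigma> ^ W"
      using \<sigma> by (intro divide_right_mono) auto
    also have "\<dots> = \<sigma> * (C / \<sigma>0 ^ Suc W)" using \<sigma> by (simp add: power_divide field_simps)
    finally show ?thesis using \<sigma> by (simp add: abs_divide)
  qed
  have dR: "\<bar>\<sigma> ^ \<alpha> * X\<bar> < R \<and> \<bar>\<sigma> ^ \<beta> * Y\<bar> < R"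
    if \<sigma>: "0 < \<sigma>" "\<sigma> < \<sigma>0" and X: "\<bar>X\<bar> < B" and Y: "\<bar>Y\<bar> < B" for \<sigma> X Y :: real
  proof -
    have "\<sigma> ^ \<alpha> * \<bar>X\<bar> \<le> \<sigma>0 ^ \<alpha> * B" "\<sigma> ^ \<beta> * \<bar>Y\<bar> \<le> \<sigma>0 ^ \<beta> * B"
      using \<sigma> X Y by (auto intro!: mult_mono power_mono)
    then show ?thesis using dom \<sigma> by (auto simp: abs_mult)
  qed
  have "((\<lambda>z. \<sigma> z ^ v * eval2 a2 (\<sigma> z ^ \<alpha> * X z, \<sigma> z ^ \<beta> * Y z) / \<sigma> z ^ W) \<longlongrightarrow> 0) F"
  proof (rule Lim_null_comparison)
    show "\<forall>\<^sub>F z in F. norm (\<sigma> z ^ v * eval2 a2 (\<sigma> z ^ \<alpha> * X z, \<sigma> z ^ \<beta> * Y z) / \<sigma> z ^ W)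
        \<le> \<sigma> z * (C / \<sigma>0 ^ Suc W)"
      using ev by eventually_elim (simp only: real_norm_def, rule tail, auto)
    show "((\<lambda>z. \<sigma> z * (C / \<sigma>0 ^ Suc W)) \<longlongrightarrow> 0) F"
      by (rule tendsto_mult_left_zero[OF lim(1)])
  qed
  moreover have "((\<lambda>z. weighted_part \<alpha> \<beta> v W a (X z, Y z)) \<longlongrightarrow> weighted_part \<alpha> \<beta> v W a (X0, Y0)) F"
    unfolding weighted_part_def fst_conv snd_conv case_prod_unfold
    by (intro tendsto_sum tendsto_mult tendsto_power tendsto_const lim)
  ultimately have "((\<lambda>z. weighted_part \<alpha> \<beta> v W a (X z, Y z) +
      \<sigma> z ^ v * eval2 a2 (\<sigma> z ^ \<alpha> * X z, \<sigma> z ^ \<beta> * Y z) / \<sigma> z ^ W)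
      \<longlongrightarrow> weighted_part \<alpha> \<beta> v W a (X0, Y0) + 0) F"
    by (intro tendsto_add)
  moreover have "\<forall>\<^sub>F z in F. weighted_part \<alpha> \<beta> v W a (X z, Y z) +
      \<sigma> z ^ v * eval2 a2 (\<sigma> z ^ \<alpha> * X z, \<sigma> z ^ \<beta> * Y z) / \<sigma> z ^ W =
      \<sigma> z ^ v * eval2 a (\<sigma> z ^ \<alpha> * X z, \<sigma> z ^ \<beta> * Y z) / \<sigma> z ^ W"
    using ev
  proof eventually_elim
    case (elim z)
    let ?p = "(\<sigma> z ^ \<alpha> * X z, \<sigma> z ^ \<beta> * Y z)"
    have p: "norm (fst ?p) < R" "norm (snd ?p) < R" using dR[of "\<sigma> z" "X z" "Y z"] elim by auto
    have "\<sigma> z ^ v * eval2 a1 ?p = (\<Sum>(r,s)\<in>{(r,s). \<alpha> * r + \<beta> * s + v = W}. \<sigma> z ^ v * (a1 r s * fst ?p ^ r * snd ?p ^ s))"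
      by (subst eval2_finite[OF finite_weight_eq[OF \<alpha> \<beta>, of v W]])
         (auto simp: a1_def sum_distrib_left case_prod_unfold split: if_splits)
    also have "\<dots> = (\<Sum>(r,s)\<in>{(r,s). \<alpha> * r + \<beta> * s + v = W}. \<sigma> z ^ W * (a r s * X z ^ r * Y z ^ s))"
    proof (intro sum.cong refl, clarify)
      fix r s assume "W = \<alpha> * r + \<beta> * s + v"
      then show "\<sigma> z ^ v * (a1 r s * fst ?p ^ r * snd ?p ^ s)
        = \<sigma> z ^ (\<alpha> * r + \<beta> * s + v) * (a r s * X z ^ r * Y z ^ s)"
        by (simp add: a1_def power_mult_distrib power_add power_mult mult_ac)
    qed
    also have "\<dots> = \<sigma> z ^ W * weighted_part \<alpha> \<beta> v W a (X z, Y z)"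
      by (simp add: weighted_part_def sum_distrib_left case_prod_unfold)
    finally have e1: "\<sigma> z ^ v * eval2 a1 ?p = \<sigma> z ^ W * weighted_part \<alpha> \<beta> v W a (X z, Y z)" .
    have "eval2 a ?p = eval2 a1 ?p + eval2 a2 ?p"
      unfolding aeq by (rule eval2_add[OF ca p])
    then have "\<sigma> z ^ v * eval2 a ?p / \<sigma> z ^ W = (\<sigma> z ^ v * eval2 a1 ?p) / \<sigma> z ^ W + \<sigma> z ^ v * eval2 a2 ?p / \<sigma> z ^ W"
      by (simp add: distrib_left add_divide_distrib)
    then show ?case using elim by (simp add: e1)
  qed
  ultimately show ?thesis by (simp add: tendsto_cong)
qed

lemma poly2_add: "poly2 (P + Q) p = poly2 P p + poly2 Q p"
  by (simp add: poly2_def)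

lemma poly2_0 [simp]: "poly2 0 p = 0"
  by (simp add: poly2_def)

lemma poly2_sum: "poly2 (sum f S) p = (\<Sum>z\<in>S. poly2 (f z) p)"
  by (induction S rule: infinite_finite_induct) (auto simp: poly2_add)

lemma poly2_smult: "poly2 (smult [:c:] P) p = c * poly2 P p"
  by (simp add: poly2_def)

lemma poly2_monom2: "poly2 (monom2 c r s) p = c * fst p ^ r * snd p ^ s"
  by (simp add: poly2_def monom2_def poly_monom)

lemma coeff2_sum: "coeff2 (sum f S) r s = (\<Sum>z\<in>S. coeff2 (f z) r s)"
  by (simp add: coeff2_def coeff_sum)

lemma coeff2_monom2: "coeff2 (monom2 c r s) r' s' = (if r = r' \<and> s = s' then c else 0)"
  by (auto simp: coeff2_def monom2_def)

lemma coeff2_sum_monom2: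
  assumes "finite S"
  shows "coeff2 (\<Sum>(r,s)\<in>S. monom2 (c r s) r s) r s = (if (r, s) \<in> S then c r s else 0)"
proof -
  have "coeff2 (\<Sum>(r,s)\<in>S. monom2 (c r s) r s) r s = (\<Sum>z\<in>S. if z = (r, s) then c r s else 0)"
    by (simp add: coeff2_sum case_prod_unfold coeff2_monom2) (auto intro!: sum.cong)
  then show ?thesis using assms by simp
qed

text \<open>A polynomial ring over a domain has no nonzero element with infinitely many roots; this is
  applied first to the variable \<open>x\<close> and then to \<open>y\<close>.\<close>

lemma poly2_zero_on_quadrant_imp_zero:
  assumes "\<And>x y. x > 0 \<Longrightarrow> y > 0 \<Longrightarrow> poly2 P (x, y) = 0"
  shows "P = 0"
proof -
  have inf: "infinite {0<..<1::real}" by (rule infinite_Ioo) simp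
  have "poly P [:y:] = 0" if "y > 0" for y
  proof (rule ccontr)
    assume "poly P [:y:] \<noteq> 0"
    then have "finite {x. poly (poly P [:y:]) x = 0}" by (rule poly_roots_finite)
    moreover have "{0<..<1} \<subseteq> {x. poly (poly P [:y:]) x = 0}"
      using assms[OF _ that] by (auto simp: poly2_def)
    ultimately show False using inf finite_subset by blast
  qed
  then have sub: "(\<lambda>y. [:y:]) ` {0<..<1} \<subseteq> {q. poly P q = 0}" by auto
  have "infinite ((\<lambda>y::real. [:y:]) ` {0<..<1})"
    using inf by (subst finite_image_iff) (auto simp: inj_on_def)
  then show ?thesis using poly_roots_finite[of P] sub finite_subset by blast
qed

lemma sum_monomials_zero_imp_coeff_zero:
  fixes c :: "real ser2"
  assumes "finite S" "\<And>x y. x > 0 \<Longrightarrow> y > 0 \<Longrightarrow> (\<Sum>(r,s)\<in>S. c r s * x ^ r * y ^ s) = 0"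
    and "(r, s) \<in> S"
  shows "c r s = 0"
proof -
  have "(\<Sum>(r,s)\<in>S. monom2 (c r s) r s) = 0"
    by (rule poly2_zero_on_quadrant_imp_zero)
       (use assms(2) in \<open>simp add: poly2_sum case_prod_unfold poly2_monom2\<close>)
  then show ?thesis
    using coeff2_sum_monom2[OF assms(1), of c r s] assms(3) by (simp add: coeff2_def)
qed

text \<open>Take the smallest weight \<open>W'\<close> that occurs. The rescalings with exponent \<open>W'\<close> tend to the part of this
  weight, which is nonzero; so \<open>W'\<close> cannot be smaller than \<open>W\<close>.\<close>

lemma weight_ge_if_scaling_null:
  fixes a :: "real ser2"
  assumes a: "conv_on a R" and R: "R > 0" and \<alpha>: "\<alpha> \<ge> 1" and \<beta>: "\<beta> \<ge> 1"
    and null: "\<And>X Y W'. X > 0 \<Longrightarrow> Y > 0 \<Longrightarrow> W' < W \<Longrightarrow>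
      ((\<lambda>\<sigma>. \<sigma> ^ v * eval2 a (\<sigma> ^ \<alpha> * X, \<sigma> ^ \<beta> * Y) / \<sigma> ^ W') \<longlongrightarrow> 0) (at_right 0)"
    and nz: "a r s \<noteq> 0"
  shows "W \<le> \<alpha> * r + \<beta> * s + v"
proof (rule ccontr)
  assume less: "\<not> W \<le> \<alpha> * r + \<beta> * s + v"
  define W' where "W' = (LEAST w. \<exists>r s. a r s \<noteq> 0 \<and> w = \<alpha> * r + \<beta> * s + v)"
  have ex: "\<exists>w. \<exists>r s. a r s \<noteq> 0 \<and> w = \<alpha> * r + \<beta> * s + v" using nz by auto
  obtain r' s' where rs': "a r' s' \<noteq> 0" "W' = \<alpha> * r' + \<beta> * s' + v"
    using LeastI_ex[OF ex] unfolding W'_def by blast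
  have min: "W' \<le> \<alpha> * i + \<beta> * k + v" if "a i k \<noteq> 0" for i k
    unfolding W'_def by (rule Least_le) (use that in blast)
  have "W' < W" using min[OF nz] less by simp
  have part0: "weighted_part \<alpha> \<beta> v W' a (X, Y) = 0" if "X > 0" "Y > 0" for X Y
  proof (rule tendsto_unique[OF _ _ null[OF that \<open>W' < W\<close>]])
    show "((\<lambda>\<sigma>. \<sigma> ^ v * eval2 a (\<sigma> ^ \<alpha> * X, \<sigma> ^ \<beta> * Y) / \<sigma> ^ W') \<longlongrightarrow> weighted_part \<alpha> \<beta> v W' a (X, Y)) (at_right 0)"
      by (rule eval2_scaling_tendsto[OF a R \<alpha> \<beta> min])
         (auto simp: eventually_at_right_less)
  qed simp
  have "a r' s' = 0"
    by (rule sum_monomials_zero_imp_coeff_zero[OF finite_weight_eq[OF \<alpha> \<beta>, of v W'], where c = a])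
       (use rs' part0 in \<open>auto simp: weighted_part_def\<close>)
  with rs' show False by simp
qed

text \<open>A finite limit with exponent \<open>W\<close> forces the limit \<open>0\<close> with every smaller exponent.\<close>

lemma weight_ge_if_scaling_tendsto:
  fixes a :: "real ser2"
  assumes a: "conv_on a R" and R: "R > 0" and \<alpha>: "\<alpha> \<ge> 1" and \<beta>: "\<beta> \<ge> 1"
    and lim: "\<And>X Y. X > 0 \<Longrightarrow> Y > 0 \<Longrightarrow>
      ((\<lambda>\<sigma>. \<sigma> ^ v * eval2 a (\<sigma> ^ \<alpha> * X, \<sigma> ^ \<beta> * Y) / \<sigma> ^ W) \<longlongrightarrow> \<phi> X Y) (at_right 0)"
  shows "a r s \<noteq> 0 \<Longrightarrow> W \<le> \<alpha> * r + \<beta> * s + v"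
    and "X > 0 \<Longrightarrow> Y > 0 \<Longrightarrow> weighted_part \<alpha> \<beta> v W a (X, Y) = \<phi> X Y"
proof -
  show ge: "W \<le> \<alpha> * r + \<beta> * s + v" if "a r s \<noteq> 0" for r s
  proof (rule weight_ge_if_scaling_null[OF a R \<alpha> \<beta> _ that])
    fix X Y :: real and W' assume XY: "X > 0" "Y > 0" and W': "W' < W"
    have "((\<lambda>\<sigma>::real. \<sigma> ^ (W - W')) \<longlongrightarrow> 0 ^ (W - W')) (at_right 0)"
      by (intro tendsto_intros)
    then have "((\<lambda>\<sigma>. \<sigma> ^ (W - W') * (\<sigma> ^ v * eval2 a (\<sigma> ^ \<alpha> * X, \<sigma> ^ \<beta> * Y) / \<sigma> ^ W)) \<longlongrightarrow> 0 ^ (W - W') * \<phi> X Y) (at_right 0)"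
      by (intro tendsto_mult lim XY)
    moreover have "\<forall>\<^sub>F \<sigma> in at_right (0::real). \<sigma> ^ (W - W') * (\<sigma> ^ v * eval2 a (\<sigma> ^ \<alpha> * X, \<sigma> ^ \<beta> * Y) / \<sigma> ^ W)
        = \<sigma> ^ v * eval2 a (\<sigma> ^ \<alpha> * X, \<sigma> ^ \<beta> * Y) / \<sigma> ^ W'"
      using eventually_at_right_less[of 0]
    proof eventually_elim
      case (elim \<sigma>)
      have "\<sigma> ^ W = \<sigma> ^ (W - W') * \<sigma> ^ W'" using W' by (simp flip: power_add)
      then show ?case using elim by simp
    qed
    ultimately show "((\<lambda>\<sigma>. \<sigma> ^ v * eval2 a (\<sigma> ^ \<alpha> * X, \<sigma> ^ \<beta> * Y) / \<sigma> ^ W') \<longlongrightarrow> 0) (at_right 0)"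
      using W' by (simp add: tendsto_cong zero_power)
  qed
  show "weighted_part \<alpha> \<beta> v W a (X, Y) = \<phi> X Y" if XY: "X > 0" "Y > 0"
  proof (rule tendsto_unique[OF _ _ lim[OF XY]])
    show "((\<lambda>\<sigma>. \<sigma> ^ v * eval2 a (\<sigma> ^ \<alpha> * X, \<sigma> ^ \<beta> * Y) / \<sigma> ^ W) \<longlongrightarrow> weighted_part \<alpha> \<beta> v W a (X, Y)) (at_right 0)"
      by (rule eval2_scaling_tendsto[OF a R \<alpha> \<beta> ge])
         (auto simp: eventually_at_right_less)
  qed simp
qed

lemma eventually_at_right_scaled_point:
  fixes X Y :: real
  assumes "\<delta> > 0" "X > 0" "Y > 0" "\<alpha> \<ge> 1" "\<beta> \<ge> 1"
  shows "\<forall>\<^sub>F \<sigma> in at_right 0. 0 < \<sigma> ^ \<alpha> * X \<and> \<sigma> ^ \<alpha> * X < \<delta> \<and> 0 < \<sigma> ^ \<beta> * Y \<and> \<sigma> ^ \<beta> * Y < \<delta>"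
proof -
  have *: "\<forall>\<^sub>F \<sigma> in at_right 0. \<sigma> ^ k * Z < \<delta>" if "k \<ge> 1" for k and Z :: real
  proof -
    have "((\<lambda>\<sigma>::real. \<sigma> ^ k * Z) \<longlongrightarrow> 0 ^ k * Z) (at_right 0)" by (intro tendsto_intros)
    then have "((\<lambda>\<sigma>::real. \<sigma> ^ k * Z) \<longlongrightarrow> 0) (at_right 0)" using that by (simp add: zero_power)
    then show ?thesis using assms(1) by (rule order_tendstoD)
  qed
  show ?thesis
    using *[OF assms(4), of X] *[OF assms(5), of Y] eventually_at_right_less[of 0]
    by eventually_elim (use assms in auto)
qed

text \<open>The rescalings of the difference vanish, so any nonzero coefficient would have a weight larger than
  its own.\<close>

lemma eval2_eq_on_quadrant_imp_eq:
  fixes a b :: "real ser2"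
  assumes a: "conv_on a R" and b: "conv_on b R" and R: "R > 0" and \<delta>: "\<delta> > 0"
    and eq: "\<And>x y. 0 < x \<Longrightarrow> x < \<delta> \<Longrightarrow> 0 < y \<Longrightarrow> y < \<delta> \<Longrightarrow> eval2 a (x, y) = eval2 b (x, y)"
  shows "a = b"
proof (intro ext, rule ccontr)
  fix r s assume ne: "a r s \<noteq> b r s"
  define c where "c = (\<lambda>r s. a r s + (- 1) * b r s)"
  have cb: "conv_on (\<lambda>r s. (- 1) * b r s) R" using b by (rule conv_on_scale)
  have c: "conv_on c R" unfolding c_def using a cb by (rule conv_on_add)
  have "Suc (1 * r + 1 * s + 0) \<le> 1 * r + 1 * s + 0"
  proof (rule weight_ge_if_scaling_tendsto(1)[OF c R])
    fix X Y :: real assume XY: "X > 0" "Y > 0"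
    have "\<forall>\<^sub>F \<sigma> in at_right 0. \<sigma> ^ 0 * eval2 c (\<sigma> ^ 1 * X, \<sigma> ^ 1 * Y) / \<sigma> ^ Suc (1 * r + 1 * s + 0) = 0"
      using eventually_at_right_scaled_point[OF \<delta> XY order_refl order_refl] eventually_at_right_scaled_point[OF R XY order_refl order_refl]
    proof eventually_elim
      case (elim \<sigma>)
      then have "eval2 c (\<sigma> * X, \<sigma> * Y) = 0"
        unfolding c_def
        by (subst eval2_add[OF a cb]; (subst eval2_scale[OF b])?) (auto simp: eq)
      then show ?case by simp
    qed
    then show "((\<lambda>\<sigma>. \<sigma> ^ 0 * eval2 c (\<sigma> ^ 1 * X, \<sigma> ^ 1 * Y) / \<sigma> ^ Suc (1 * r + 1 * s + 0)) \<longlongrightarrow> 0) (at_right 0)"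
      by (rule tendsto_eventually)
  qed (use ne in \<open>auto simp: c_def\<close>)
  then show False by simp
qed

text \<open>Termwise, since \<open>\<alpha> x \<partial>_x + \<beta> y \<partial>_y\<close> multiplies a monomial by its weight.\<close>

lemma euler_identity:
  fixes b :: "real ser2" and \<alpha> \<beta> W :: nat and p :: "real \<times> real"
  assumes b: "conv_on b R" and p: "\<bar>fst p\<bar> < R" "\<bar>snd p\<bar> < R"
    and hom: "\<And>r s. b r s \<noteq> 0 \<Longrightarrow> \<alpha> * r + \<beta> * s = W"
  shows "\<alpha> * fst p * eval2 (ser_dx b) p + \<beta> * snd p * eval2 (ser_dy b) p = W * eval2 b p"
proof -
  have pp: "norm (fst p) < R" "norm (snd p) < R" using p by auto
  note 1 = has_sum_cmult_right[OF eval2_ser_dx_has_sum[OF b pp], of "\<alpha> * fst p"]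
  note 2 = has_sum_cmult_right[OF eval2_ser_dy_has_sum[OF b pp], of "\<beta> * snd p"]
  note 3 = has_sum_cmult_right[OF eval2_has_sum[OF b pp], of W]
  have pw: "x * x ^ (n - Suc 0) * n = x ^ n * n" for x :: real and n :: nat by (cases n) auto
  have "\<alpha> * fst p * (case z of (r, s) \<Rightarrow> of_nat r * b r s * fst p ^ (r - 1) * snd p ^ s) +
        \<beta> * snd p * (case z of (r, s) \<Rightarrow> of_nat s * b r s * fst p ^ r * snd p ^ (s - 1))
      = W * (case z of (r, s) \<Rightarrow> b r s * fst p ^ r * snd p ^ s)" for z
  proof -
    obtain r s where z: "z = (r, s)" by force
    show ?thesis
    proof (cases "b r s = 0")
      case False
      have "\<alpha> * fst p * (r * b r s * fst p ^ (r - 1) * snd p ^ s) + \<beta> * snd p * (s * b r s * fst p ^ r * snd p ^ (s - 1))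
         = \<alpha> * (fst p * fst p ^ (r - 1) * r) * b r s * snd p ^ s + \<beta> * (snd p * snd p ^ (s - 1) * s) * b r s * fst p ^ r"
        by (simp add: algebra_simps)
      also have "\<dots> = real (\<alpha> * r + \<beta> * s) * (b r s * fst p ^ r * snd p ^ s)"
        unfolding One_nat_def pw by (simp add: algebra_simps)
      finally show ?thesis using hom[OF False] z by simp
    qed (simp add: z)
  qed
  then show ?thesis
    by (intro has_sum_unique[OF has_sum_add[OF 1 2]]) (use 3 in simp)
qed

section \<open>Deformations of given weight\<close>

text \<open>A deformation \<open>\<Sum>k s^k g_k\<close> with parameter \<open>s\<close>; the degree in \<open>s\<close> is at most the weight \<open>\<Omega>\<close>, since
  the parameter will have weight \<open>1\<close>.\<close>

definition family_ser :: "nat \<Rightarrow> (nat \<Rightarrow> real ser2) \<Rightarrow> real \<Rightarrow> real ser2" where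
  "family_ser \<Omega> g s = (\<lambda>r q. \<Sum>k\<le>\<Omega>. s ^ k * g k r q)"

text \<open>The part of weight \<open>\<Omega>\<close> of the deformation, as a polynomial in \<open>x\<close> and \<open>y\<close>, with \<open>\<tau>\<close> for the ratio of
  the parameter to the scale: \<open>\<tau> = 1\<close> is the scale of the parameter itself, and \<open>\<tau> = 0\<close> describes scales
  that are large compared with the parameter.\<close>

definition leading_ser :: "nat \<Rightarrow> nat \<Rightarrow> nat \<Rightarrow> (nat \<Rightarrow> real ser2) \<Rightarrow> real \<Rightarrow> real ser2" where
  "leading_ser \<alpha> \<beta> \<Omega> g \<tau> = (\<lambda>r q. if \<alpha> * r + \<beta> * q \<le> \<Omega>
     then \<tau> ^ (\<Omega> - (\<alpha> * r + \<beta> * q)) * g (\<Omega> - (\<alpha> * r + \<beta> * q)) r q else 0)"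

text \<open>In a given weight the monomial determines the power of the parameter that goes with it. The shift
  \<open>v\<close> is \<open>0\<close> for the deformation itself and \<open>\<alpha>\<close> or \<open>\<beta>\<close> for its derivatives.\<close>

lemma sum_weighted_parts:
  fixes h :: "nat \<Rightarrow> real ser2"
  assumes \<alpha>: "\<alpha> \<ge> 1" and \<beta>: "\<beta> \<ge> 1"
  shows "(\<Sum>k\<le>\<Omega>. \<tau> ^ k * weighted_part \<alpha> \<beta> (k + v) \<Omega> (h k) p) =
    eval2 (\<lambda>r q. if \<alpha> * r + \<beta> * q + v \<le> \<Omega>
      then \<tau> ^ (\<Omega> - (\<alpha> * r + \<beta> * q + v)) * h (\<Omega> - (\<alpha> * r + \<beta> * q + v)) r q else 0) p"
proof -
  let ?S = "{(r::nat,q::nat). \<alpha> * r + \<beta> * q + v \<le> \<Omega>}"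
  let ?f = "\<lambda>(r,q). \<tau> ^ (\<Omega> - (\<alpha> * r + \<beta> * q + v)) * h (\<Omega> - (\<alpha> * r + \<beta> * q + v)) r q * fst p ^ r * snd p ^ q"
  have fin: "finite ?S" by (rule finite_weight_le[OF \<alpha> \<beta>])
  have "(\<Sum>k\<le>\<Omega>. \<tau> ^ k * weighted_part \<alpha> \<beta> (k + v) \<Omega> (h k) p)
      = (\<Sum>k\<le>\<Omega>. \<Sum>z\<in>{z \<in> ?S. (\<lambda>(r,q). \<Omega> - (\<alpha> * r + \<beta> * q + v)) z = k}. ?f z)"
  proof (intro sum.cong refl)
    fix k assume "k \<in> {..\<Omega>}"
    then have eq: "{(r,q). \<alpha> * r + \<beta> * q + (k + v) = \<Omega>} = {z \<in> ?S. (\<lambda>(r,q). \<Omega> - (\<alpha> * r + \<beta> * q + v)) z = k}"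
      by auto
    show "\<tau> ^ k * weighted_part \<alpha> \<beta> (k + v) \<Omega> (h k) p = (\<Sum>z\<in>{z \<in> ?S. (\<lambda>(r,q). \<Omega> - (\<alpha> * r + \<beta> * q + v)) z = k}. ?f z)"
      unfolding weighted_part_def eq sum_distrib_left
      by (intro sum.cong refl) (auto simp: mult_ac)
  qed
  also have "\<dots> = sum ?f ?S"
    by (rule sum.group) (use fin in auto)
  also have "\<dots> = eval2 (\<lambda>r q. if \<alpha> * r + \<beta> * q + v \<le> \<Omega>
      then \<tau> ^ (\<Omega> - (\<alpha> * r + \<beta> * q + v)) * h (\<Omega> - (\<alpha> * r + \<beta> * q + v)) r q else 0) p"
    by (subst eval2_finite[OF fin]) (auto intro!: sum.cong split: if_splits)
  finally show ?thesis .
qed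

lemma eval2_leading_ser:
  assumes "\<alpha> \<ge> 1" "\<beta> \<ge> 1"
  shows "eval2 (leading_ser \<alpha> \<beta> \<Omega> g \<tau>) p = (\<Sum>k\<le>\<Omega>. \<tau> ^ k * weighted_part \<alpha> \<beta> k \<Omega> (g k) p)"
  unfolding leading_ser_def by (rule sum_weighted_parts[OF assms, of \<tau> 0, unfolded add_0_right, symmetric])

lemma ser_dx_leading_ser:
  "ser_dx (leading_ser \<alpha> \<beta> \<Omega> g \<tau>) = (\<lambda>r q. if \<alpha> * r + \<beta> * q + \<alpha> \<le> \<Omega>
      then \<tau> ^ (\<Omega> - (\<alpha> * r + \<beta> * q + \<alpha>)) * ser_dx (g (\<Omega> - (\<alpha> * r + \<beta> * q + \<alpha>))) r q else 0)"
  by (intro ext) (simp add: ser_dx_def leading_ser_def algebra_simps)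

lemma ser_dy_leading_ser:
  "ser_dy (leading_ser \<alpha> \<beta> \<Omega> g \<tau>) = (\<lambda>r q. if \<alpha> * r + \<beta> * q + \<beta> \<le> \<Omega>
      then \<tau> ^ (\<Omega> - (\<alpha> * r + \<beta> * q + \<beta>)) * ser_dy (g (\<Omega> - (\<alpha> * r + \<beta> * q + \<beta>))) r q else 0)"
  by (intro ext) (simp add: ser_dy_def leading_ser_def algebra_simps)

lemma eval2_ser_dx_leading_ser:
  assumes "\<alpha> \<ge> 1" "\<beta> \<ge> 1"
  shows "eval2 (ser_dx (leading_ser \<alpha> \<beta> \<Omega> g \<tau>)) p
    = (\<Sum>k\<le>\<Omega>. \<tau> ^ k * weighted_part \<alpha> \<beta> (k + \<alpha>) \<Omega> (ser_dx (g k)) p)"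
  unfolding ser_dx_leading_ser sum_weighted_parts[OF assms, where h = "\<lambda>k. ser_dx (g k)"] ..

lemma eval2_ser_dy_leading_ser:
  assumes "\<alpha> \<ge> 1" "\<beta> \<ge> 1"
  shows "eval2 (ser_dy (leading_ser \<alpha> \<beta> \<Omega> g \<tau>)) p
    = (\<Sum>k\<le>\<Omega>. \<tau> ^ k * weighted_part \<alpha> \<beta> (k + \<beta>) \<Omega> (ser_dy (g k)) p)"
  unfolding ser_dy_leading_ser sum_weighted_parts[OF assms, where h = "\<lambda>k. ser_dy (g k)"] ..

lemma conv_on_leading_ser:
  assumes "\<alpha> \<ge> 1" "\<beta> \<ge> 1"
  shows "conv_on (leading_ser \<alpha> \<beta> \<Omega> g \<tau>) R"
  by (rule conv_on_finite[OF finite_weight_le[OF assms, of 0 \<Omega>]]) (auto simp: leading_ser_def split: if_splits)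

lemma ser_dx_family: "ser_dx (family_ser \<Omega> g s) = family_ser \<Omega> (\<lambda>k. ser_dx (g k)) s"
  by (intro ext) (simp add: ser_dx_def family_ser_def sum_distrib_left mult_ac)

lemma ser_dy_family: "ser_dy (family_ser \<Omega> g s) = family_ser \<Omega> (\<lambda>k. ser_dy (g k)) s"
  by (intro ext) (simp add: ser_dy_def family_ser_def sum_distrib_left mult_ac)

lemma conv_on_family:
  assumes "\<And>k. k \<le> \<Omega> \<Longrightarrow> conv_on (g k) R"
  shows "conv_on (family_ser \<Omega> g s) R"
  unfolding family_ser_def by (intro conv_on_sum conv_on_scale assms) auto

lemma eval2_family:
  assumes "\<And>k. k \<le> \<Omega> \<Longrightarrow> conv_on (g k) R" "\<bar>fst p\<bar> < R" "\<bar>snd p\<bar> < R"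
  shows "eval2 (family_ser \<Omega> g s) p = (\<Sum>k\<le>\<Omega>. s ^ k * eval2 (g k) p)"
proof -
  have "eval2 (family_ser \<Omega> g s) p = (\<Sum>k\<le>\<Omega>. eval2 (\<lambda>r q. s ^ k * g k r q) p)"
    unfolding family_ser_def by (rule eval2_sum) (use assms in \<open>auto intro: conv_on_scale\<close>)
  also have "\<dots> = (\<Sum>k\<le>\<Omega>. s ^ k * eval2 (g k) p)"
    by (intro sum.cong refl eval2_scale) (use assms in auto)
  finally show ?thesis .
qed

lemma tendsto_scaled_point_zero:
  fixes \<sigma> X :: "'z \<Rightarrow> real"
  assumes "(\<sigma> \<longlongrightarrow> 0) F" "(X \<longlongrightarrow> X0) F" "\<alpha> \<ge> 1"
  shows "((\<lambda>z. \<sigma> z ^ \<alpha> * X z) \<longlongrightarrow> 0) F"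
  using tendsto_mult[OF tendsto_power[OF assms(1)] assms(2), of \<alpha>] assms(3) by (simp add: zero_power)

text \<open>Near the origin the deformation is governed, at each scale \<open>\<sigma>\<close>, by a polynomial that depends
  only on the ratio of the parameter to the scale.\<close>

lemma family_scaling_tendsto_aux:
  assumes h: "\<And>k. k \<le> \<Omega> \<Longrightarrow> conv_on (h k) R" and R: "R > 0" and \<alpha>: "\<alpha> \<ge> 1" and \<beta>: "\<beta> \<ge> 1"
    and wt: "\<And>k r q. k \<le> \<Omega> \<Longrightarrow> h k r q \<noteq> 0 \<Longrightarrow> \<Omega> \<le> \<alpha> * r + \<beta> * q + (k + v)"
    and lim: "(\<sigma> \<longlongrightarrow> 0) F" "\<forall>\<^sub>F z in F. \<sigma> z > 0" "(X \<longlongrightarrow> X0) F" "(Y \<longlongrightarrow> Y0) F" "(\<tau> \<longlongrightarrow> \<tau>0) F"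
  shows "((\<lambda>z. \<sigma> z ^ v * eval2 (family_ser \<Omega> h (\<tau> z * \<sigma> z)) (\<sigma> z ^ \<alpha> * X z, \<sigma> z ^ \<beta> * Y z) / \<sigma> z ^ \<Omega>)
    \<longlongrightarrow> (\<Sum>k\<le>\<Omega>. \<tau>0 ^ k * weighted_part \<alpha> \<beta> (k + v) \<Omega> (h k) (X0, Y0))) F"
proof -
  have "((\<lambda>z. \<Sum>k\<le>\<Omega>. \<tau> z ^ k * (\<sigma> z ^ (k + v) * eval2 (h k) (\<sigma> z ^ \<alpha> * X z, \<sigma> z ^ \<beta> * Y z) / \<sigma> z ^ \<Omega>))
    \<longlongrightarrow> (\<Sum>k\<le>\<Omega>. \<tau>0 ^ k * weighted_part \<alpha> \<beta> (k + v) \<Omega> (h k) (X0, Y0))) F"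
    by (intro tendsto_sum tendsto_mult tendsto_power lim eval2_scaling_tendsto[OF h R \<alpha> \<beta> wt]) auto
  moreover have "\<forall>\<^sub>F z in F. \<bar>\<sigma> z ^ \<alpha> * X z\<bar> < R \<and> \<bar>\<sigma> z ^ \<beta> * Y z\<bar> < R"
    using order_tendstoD(2)[OF tendsto_rabs_zero[OF tendsto_scaled_point_zero[OF lim(1,3) \<alpha>]] R]
      order_tendstoD(2)[OF tendsto_rabs_zero[OF tendsto_scaled_point_zero[OF lim(1,4) \<beta>]] R]
    by eventually_elim auto
  then have "\<forall>\<^sub>F z in F. (\<Sum>k\<le>\<Omega>. \<tau> z ^ k * (\<sigma> z ^ (k + v) * eval2 (h k) (\<sigma> z ^ \<alpha> * X z, \<sigma> z ^ \<beta> * Y z) / \<sigma> z ^ \<Omega>))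
     = \<sigma> z ^ v * eval2 (family_ser \<Omega> h (\<tau> z * \<sigma> z)) (\<sigma> z ^ \<alpha> * X z, \<sigma> z ^ \<beta> * Y z) / \<sigma> z ^ \<Omega>"
    by eventually_elim
       (subst eval2_family[where R = R], auto simp: h sum_distrib_left sum_divide_distrib power_mult_distrib power_add mult_ac
         intro!: sum.cong)
  ultimately show ?thesis by (simp add: tendsto_cong)
qed

locale weighted_family =
  fixes \<alpha> \<beta> \<Omega> :: nat and g :: "nat \<Rightarrow> real ser2" and R :: real
  assumes \<alpha>: "\<alpha> \<ge> 1" and \<beta>: "\<beta> \<ge> 1" and R: "R > 0"
    and conv: "k \<le> \<Omega> \<Longrightarrow> conv_on (g k) R"
    and weight: "k \<le> \<Omega> \<Longrightarrow> g k r q \<noteq> 0 \<Longrightarrow> \<Omega> \<le> \<alpha> * r + \<beta> * q + k"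
begin

abbreviation "P s \<equiv> family_ser \<Omega> g s"
abbreviation "L \<tau> \<equiv> leading_ser \<alpha> \<beta> \<Omega> g \<tau>"

lemma conv_P: "conv_on (P s) R"
  by (rule conv_on_family[OF conv])

lemma conv_L: "conv_on (L \<tau>) \<rho>"
  by (rule conv_on_leading_ser[OF \<alpha> \<beta>])

lemma P_0: "P 0 = g 0"
  by (intro ext) (simp add: family_ser_def power_0_left if_distrib[of "\<lambda>x. x * _"] cong: if_cong)

context
  fixes \<sigma> X Y \<tau> :: "'z \<Rightarrow> real" and X0 Y0 \<tau>0 :: real and F :: "'z filter"
  assumes lim: "(\<sigma> \<longlongrightarrow> 0) F" "\<forall>\<^sub>F z in F. \<sigma> z > 0" "(X \<longlongrightarrow> X0) F" "(Y \<longlongrightarrow> Y0) F" "(\<tau> \<longlongrightarrow> \<tau>0) F"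
begin

lemma scaled_tendsto:
  "((\<lambda>z. eval2 (P (\<tau> z * \<sigma> z)) (\<sigma> z ^ \<alpha> * X z, \<sigma> z ^ \<beta> * Y z) / \<sigma> z ^ \<Omega>)
     \<longlongrightarrow> eval2 (L \<tau>0) (X0, Y0)) F"
  using family_scaling_tendsto_aux[OF conv R \<alpha> \<beta> _ lim, where v = 0] weight
  by (simp add: eval2_leading_ser[OF \<alpha> \<beta>])

lemma scaled_dx_tendsto:
  "((\<lambda>z. \<sigma> z ^ \<alpha> * eval2 (ser_dx (P (\<tau> z * \<sigma> z))) (\<sigma> z ^ \<alpha> * X z, \<sigma> z ^ \<beta> * Y z) / \<sigma> z ^ \<Omega>)
     \<longlongrightarrow> eval2 (ser_dx (L \<tau>0)) (X0, Y0)) F"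
  unfolding eval2_ser_dx_leading_ser[OF \<alpha> \<beta>] ser_dx_family
proof (rule family_scaling_tendsto_aux[OF conv_on_ser_dx[OF conv] R \<alpha> \<beta> _ lim])
  fix k r q assume k: "k \<le> \<Omega>" and "ser_dx (g k) r q \<noteq> 0"
  then have "g k (Suc r) q \<noteq> 0" by (auto simp: ser_dx_def)
  from weight[OF k this] show "\<Omega> \<le> \<alpha> * r + \<beta> * q + (k + \<alpha>)" by simp
qed

lemma scaled_dy_tendsto:
  "((\<lambda>z. \<sigma> z ^ \<beta> * eval2 (ser_dy (P (\<tau> z * \<sigma> z))) (\<sigma> z ^ \<alpha> * X z, \<sigma> z ^ \<beta> * Y z) / \<sigma> z ^ \<Omega>)
     \<longlongrightarrow> eval2 (ser_dy (L \<tau>0)) (X0, Y0)) F"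
  unfolding eval2_ser_dy_leading_ser[OF \<alpha> \<beta>] ser_dy_family
proof (rule family_scaling_tendsto_aux[OF conv_on_ser_dy[OF conv] R \<alpha> \<beta> _ lim])
  fix k r q assume k: "k \<le> \<Omega>" and "ser_dy (g k) r q \<noteq> 0"
  then have "g k r (Suc q) \<noteq> 0" by (auto simp: ser_dy_def)
  from weight[OF k this] show "\<Omega> \<le> \<alpha> * r + \<beta> * q + (k + \<beta>)" by simp
qed

end

end

section \<open>Extrema on components of real curves\<close>

lemma eval2_continuous_on:
  fixes a :: "'a::{real_normed_field,banach} ser2"
  assumes "conv_on a R" "\<And>p. p \<in> S \<Longrightarrow> norm (fst p) < R \<and> norm (snd p) < R"
  shows "continuous_on S (eval2 a)"
  by (intro continuous_at_imp_continuous_on ballI has_derivative_continuous[OF eval2_has_derivative[OF assms(1)]])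
     (use assms(2) in auto)

lemma eval2_lipschitz:
  fixes a :: "'a::{real_normed_field,banach,heine_borel} ser2"
  assumes a: "conv_on a R" and S: "compact S" "convex S" "\<And>p. p \<in> S \<Longrightarrow> norm (fst p) < R \<and> norm (snd p) < R"
  shows "\<exists>M>0. \<forall>p\<in>S. \<forall>q\<in>S. norm (eval2 a q - eval2 a p) \<le> M * norm (q - p)"
proof -
  have bd: "\<exists>M>0. \<forall>p\<in>S. norm (eval2 b p) \<le> M" if "conv_on b R" for b :: "'a ser2"
    using compact_imp_bounded[OF compact_continuous_image[OF eval2_continuous_on[OF that S(3)] S(1)]]
    unfolding bounded_pos by auto
  obtain M1 where M1: "M1 > 0" "\<And>p. p \<in> S \<Longrightarrow> norm (eval2 (ser_dx a) p) \<le> M1" using bd[OF conv_on_ser_dx[OF a]] by auto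
  obtain M2 where M2: "M2 > 0" "\<And>p. p \<in> S \<Longrightarrow> norm (eval2 (ser_dy a) p) \<le> M2" using bd[OF conv_on_ser_dy[OF a]] by auto
  have "norm (eval2 a q - eval2 a p) \<le> (M1 + M2) * norm (q - p)" if pq: "p \<in> S" "q \<in> S" for p q
  proof (rule differentiable_bound[OF S(2) _ _ pq(2,1)])
    fix r assume r: "r \<in> S"
    show "(eval2 a has_derivative (\<lambda>h. eval2 (ser_dx a) r * fst h + eval2 (ser_dy a) r * snd h)) (at r within S)"
      using S(3)[OF r] by (intro has_derivative_at_withinI[OF eval2_has_derivative[OF a]]) blast+
    show "onorm (\<lambda>h. eval2 (ser_dx a) r * fst h + eval2 (ser_dy a) r * snd h) \<le> M1 + M2"
    proof (rule onorm_bound)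
      fix h :: "'a \<times> 'a"
      have h: "norm (fst h) \<le> norm h" "norm (snd h) \<le> norm h"
        using norm_fst_le[of "fst h" "snd h"] norm_snd_le[of "snd h" "fst h"] by simp_all
      have "norm (eval2 (ser_dx a) r * fst h + eval2 (ser_dy a) r * snd h) \<le> M1 * norm h + M2 * norm h"
        using M1(2)[OF r] M2(2)[OF r] M1(1) M2(1) h
        by (intro order_trans[OF norm_triangle_ineq] add_mono; unfold norm_mult; intro mult_mono; simp)
      then show "norm (eval2 (ser_dx a) r * fst h + eval2 (ser_dy a) r * snd h) \<le> (M1 + M2) * norm h"
        by (simp add: distrib_right)
    qed (use M1 M2 in simp)
  qed
  then show ?thesis using M1(1) M2(1) by (intro exI[of _ "M1 + M2"]) auto
qed

text \<open>The gradient is Lipschitz on the convex compact set.\<close>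

lemma eval2_quadratic_remainder:
  fixes a :: "'a::{real_normed_field,banach,heine_borel} ser2"
  assumes a: "conv_on a R" and S: "compact S" "convex S" "\<And>p. p \<in> S \<Longrightarrow> norm (fst p) < R \<and> norm (snd p) < R"
  shows "\<exists>C>0. \<forall>p\<in>S. \<forall>q\<in>S.
    norm (eval2 a q - eval2 a p - (eval2 (ser_dx a) p * fst (q - p) + eval2 (ser_dy a) p * snd (q - p))) \<le> C * norm (q - p) ^ 2"
proof -
  obtain M1 where M1: "M1 > 0" "\<And>p q. p \<in> S \<Longrightarrow> q \<in> S \<Longrightarrow> norm (eval2 (ser_dx a) q - eval2 (ser_dx a) p) \<le> M1 * norm (q - p)"
    using eval2_lipschitz[OF conv_on_ser_dx[OF a] S] by auto
  obtain M2 where M2: "M2 > 0" "\<And>p q. p \<in> S \<Longrightarrow> q \<in> S \<Longrightarrow> norm (eval2 (ser_dy a) q - eval2 (ser_dy a) p) \<le> M2 * norm (q - p)"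
    using eval2_lipschitz[OF conv_on_ser_dy[OF a] S] by auto
  define f' where "f' = (\<lambda>p h. eval2 (ser_dx a) p * fst h + eval2 (ser_dy a) p * snd h)"
  have "norm (eval2 a q - eval2 a p - f' p (q - p)) \<le> norm (q - p) * ((M1 + M2) * norm (q - p))"
    if p: "p \<in> S" and q: "q \<in> S" for p q
  proof (rule differentiable_bound_linearization[where S = "(\<lambda>t. p + t *\<^sub>R (q - p)) ` {0..1}"])
    have seg: "p + t *\<^sub>R (q - p) \<in> S" if "t \<in> {0..1}" for t
      using mem_convex_alt[OF S(2) p q, of "1 - t" t] that
      by (simp add: algebra_simps scaleR_diff_left scaleR_diff_right)
    show "p + t *\<^sub>R (q - p) \<in> (\<lambda>t. p + t *\<^sub>R (q - p)) ` {0..1}" if "t \<in> {0..1}" for t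
      using that by blast
    show "(eval2 a has_derivative f' r) (at r within (\<lambda>t. p + t *\<^sub>R (q - p)) ` {0..1})"
      if "r \<in> (\<lambda>t. p + t *\<^sub>R (q - p)) ` {0..1}" for r
    proof -
      have "r \<in> S" using that seg by blast
      then show ?thesis
        unfolding f'_def using S(3) by (intro has_derivative_at_withinI[OF eval2_has_derivative[OF a]]) blast+
    qed
    show "p \<in> (\<lambda>t. p + t *\<^sub>R (q - p)) ` {0..1}" by (rule image_eqI[of _ _ 0]) auto
    show "onorm (f' r - f' p) \<le> (M1 + M2) * norm (q - p)" if rim: "r \<in> (\<lambda>t. p + t *\<^sub>R (q - p)) ` {0..1}" for r
    proof (rule onorm_bound)
      show "0 \<le> (M1 + M2) * norm (q - p)" using M1 M2 by simp
      fix h :: "'a \<times> 'a"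
      obtain t where t: "t \<in> {0..1}" "r = p + t *\<^sub>R (q - p)" using rim by blast
      have rS: "r \<in> S" using seg[OF t(1)] t(2) by simp
      have "norm (r - p) \<le> norm (q - p)" using t by (simp add: mult_left_le_one_le)
      then have "M1 * norm (r - p) \<le> M1 * norm (q - p)" "M2 * norm (r - p) \<le> M2 * norm (q - p)"
        using M1(1) M2(1) by simp_all
      then have r: "norm (eval2 (ser_dx a) r - eval2 (ser_dx a) p) \<le> M1 * norm (q - p)"
          "norm (eval2 (ser_dy a) r - eval2 (ser_dy a) p) \<le> M2 * norm (q - p)"
        using M1(2)[OF p rS] M2(2)[OF p rS] by linarith+
      have h: "norm (fst h) \<le> norm h" "norm (snd h) \<le> norm h"
        using norm_fst_le[of "fst h" "snd h"] norm_snd_le[of "snd h" "fst h"] by simp_all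
      have "norm ((f' r - f' p) h) = norm ((eval2 (ser_dx a) r - eval2 (ser_dx a) p) * fst h + (eval2 (ser_dy a) r - eval2 (ser_dy a) p) * snd h)"
        by (simp add: f'_def algebra_simps)
      also have "\<dots> \<le> (M1 * norm (q - p)) * norm h + (M2 * norm (q - p)) * norm h"
        using r h M1(1) M2(1)
        by (intro order_trans[OF norm_triangle_ineq] add_mono; unfold norm_mult; intro mult_mono; simp)
      finally show "norm ((f' r - f' p) h) \<le> (M1 + M2) * norm (q - p) * norm h" by (simp add: distrib_right)
    qed
  qed
  then show ?thesis
    using M1(1) M2(1) by (intro exI[of _ "M1 + M2"]) (auto simp: f'_def power2_eq_square mult_ac)
qed

lemma norm_cball_less:
  fixes p :: "'a::real_normed_vector \<times> 'a"
  assumes "norm p \<le> \<rho>" "\<rho> < R"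
  shows "norm (fst p) < R" "norm (snd p) < R"
  using norm_fst_le[of "fst p" "snd p"] norm_snd_le[of "snd p" "fst p"] assms by auto

text \<open>The Jacobian determinant of the map \<open>(a, b)\<close>; on the curve \<open>a = 0\<close> it vanishes at the critical points of \<open>b\<close>.\<close>

definition gradient_det :: "real ser2 \<Rightarrow> real ser2 \<Rightarrow> real \<times> real \<Rightarrow> real" where
  "gradient_det a b p = eval2 (ser_dx a) p * eval2 (ser_dy b) p - eval2 (ser_dy a) p * eval2 (ser_dx b) p"

text \<open>If the Jacobian did not vanish, \<open>(a, b)\<close> would be local coordinates at \<open>p\<close>, and the curve
  \<open>a = 0\<close> would contain an arc through \<open>p\<close> along which \<open>b\<close> increases.\<close>

lemma gradient_det_zero_at_component_max:
  fixes a b :: "real ser2"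
  assumes a: "conv_on a R" and b: "conv_on b R" and \<rho>: "\<rho> < R"
    and K: "K \<in> components (real_part a \<rho>)" and p: "p \<in> K" "norm p < \<rho>"
    and max: "\<And>q. q \<in> K \<Longrightarrow> eval2 b q \<le> eval2 b p"
  shows "gradient_det a b p = 0"
proof (rule ccontr)
  assume J: "gradient_det a b p \<noteq> 0"
  define ax ay bx "by" where "ax = eval2 (ser_dx a)" and "ay = eval2 (ser_dy a)"
    and "bx = eval2 (ser_dx b)" and "by = eval2 (ser_dy b)"
  define f where "f = (\<lambda>q. (eval2 a q, eval2 b q))"
  \<comment> \<open>the differential of \<open>(a, b)\<close> as a continuous function into the space of linear maps\<close>
  define B1 :: "(real \<times> real) \<Rightarrow>\<^sub>L (real \<times> real)" where "B1 = Blinfun (\<lambda>h. (fst h, 0))"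
  define B2 :: "(real \<times> real) \<Rightarrow>\<^sub>L (real \<times> real)" where "B2 = Blinfun (\<lambda>h. (snd h, 0))"
  define B3 :: "(real \<times> real) \<Rightarrow>\<^sub>L (real \<times> real)" where "B3 = Blinfun (\<lambda>h. (0, fst h))"
  define B4 :: "(real \<times> real) \<Rightarrow>\<^sub>L (real \<times> real)" where "B4 = Blinfun (\<lambda>h. (0, snd h))"
  have B: "blinfun_apply B1 h = (fst h, 0)" "blinfun_apply B2 h = (snd h, 0)"
      "blinfun_apply B3 h = (0, fst h)" "blinfun_apply B4 h = (0, snd h)" for h
    unfolding B1_def B2_def B3_def B4_def
    by (subst bounded_linear_Blinfun_apply; simp add: bounded_linear_Pair bounded_linear_fst bounded_linear_snd bounded_linear_zero)+
  define f' where "f' = (\<lambda>q. ax q *\<^sub>R B1 + ay q *\<^sub>R B2 + bx q *\<^sub>R B3 + by q *\<^sub>R B4)"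
  have f': "blinfun_apply (f' q) h = (ax q * fst h + ay q * snd h, bx q * fst h + by q * snd h)" for q h
    by (simp add: f'_def blinfun.add_left blinfun.scaleR_left B)
  define J where "J = ax p * by p - ay p * bx p"
  have J0: "J \<noteq> 0" using J by (simp add: J_def gradient_det_def ax_def ay_def bx_def by_def)
  define invf where "invf = (1 / J) *\<^sub>R (by p *\<^sub>R B1 - ay p *\<^sub>R B2 - bx p *\<^sub>R B3 + ax p *\<^sub>R B4)"
  have inv: "invf o\<^sub>L f' p = id_blinfun"
  proof (rule blinfun_eqI)
    fix h :: "real \<times> real"
    have "by p * (ax p * fst h + ay p * snd h) - ay p * (bx p * fst h + by p * snd h) = J * fst h"
      "ax p * (bx p * fst h + by p * snd h) - bx p * (ax p * fst h + ay p * snd h) = J * snd h"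
      by (simp_all add: J_def algebra_simps)
    then show "blinfun_apply (invf o\<^sub>L f' p) h = blinfun_apply id_blinfun h"
      using J0 by (simp add: invf_def f' blinfun.add_left blinfun.diff_left blinfun.scaleR_left B prod_eq_iff)
  qed
  let ?U = "ball (0 :: real \<times> real) \<rho>"
  have U: "norm (fst q) < R" "norm (snd q) < R" if "q \<in> ?U" for q
    using norm_cball_less[of q \<rho> R] that \<rho> by auto
  have der: "(f has_derivative blinfun_apply (f' q)) (at q)" if "q \<in> ?U" for q
  proof -
    have e: "blinfun_apply (f' q) = (\<lambda>h. (ax q * fst h + ay q * snd h, bx q * fst h + by q * snd h))"
      by (rule ext) (rule f')
    show "(f has_derivative blinfun_apply (f' q)) (at q)"
      unfolding e f_def ax_def ay_def bx_def by_def
      by (intro has_derivative_Pair eval2_has_derivative[OF a] eval2_has_derivative[OF b] U[OF that])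
  qed
  have contf': "continuous_on ?U f'"
    unfolding f'_def ax_def ay_def bx_def by_def
    by (intro continuous_intros eval2_continuous_on[where R = R] conv_on_ser_dx conv_on_ser_dy a b conjI U)
  have pU: "p \<in> ?U" using p by simp
  obtain U' V k where U': "open U'" "U' \<subseteq> ?U" "p \<in> U'" and V: "open V" "f p \<in> V"
    and hom: "homeomorphism U' V f k"
    using inverse_function_theorem[OF open_ball der contf' pU inv] by metis
  obtain e where e: "e > 0" "cball (f p) e \<subseteq> V" using V open_contains_cball by blast
  have ap: "eval2 a p = 0" using in_components_subset[OF K] p by (auto simp: real_part_def)
  \<comment> \<open>the arc, in the coordinates \<open>(a, b)\<close>\<close>
  define I where "I = Pair (0::real) ` {eval2 b p .. eval2 b p + e}"
  have IV: "I \<subseteq> V"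
  proof
    fix v assume "v \<in> I"
    then have "dist (f p) v \<le> e" by (auto simp: I_def f_def ap dist_Pair_Pair dist_real_def)
    then show "v \<in> V" using e by auto
  qed
  have conI: "connected (k ` I)"
  proof (rule connected_continuous_image)
    show "continuous_on I k" using hom IV by (meson continuous_on_subset homeomorphism_def)
    show "connected I" unfolding I_def by (intro connected_continuous_image continuous_intros) auto
  qed
  have fk: "f (k v) = v" "k v \<in> U'" if "v \<in> I" for v
    using that IV hom by (auto simp: homeomorphism_def)
  have sub: "k ` I \<subseteq> real_part a \<rho>"
  proof (rule image_subsetI)
    fix v assume v: "v \<in> I"
    have "eval2 a (k v) = fst (f (k v))" by (simp add: f_def)
    also have "\<dots> = 0" using fk(1)[OF v] v by (auto simp: I_def)
    finally show "k v \<in> real_part a \<rho>" using fk(2)[OF v] U'(2) by (force simp: real_part_def)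
  qed
  have "k (f p) = p" using hom U' by (auto simp: homeomorphism_def)
  moreover have "f p \<in> I" using e by (auto simp: I_def f_def ap)
  ultimately have "p \<in> k ` I" by force
  then have "k ` I \<subseteq> K" using components_maximal[OF K conI sub] p by auto
  moreover have vI: "(0, eval2 b p + e) \<in> I" using e by (auto simp: I_def)
  ultimately have "eval2 b (k (0, eval2 b p + e)) \<le> eval2 b p" using max by blast
  with fk(1)[OF vI] e show False by (simp add: f_def)
qed

text \<open>The product of \<open>x y\<close> and the determinant is \<open>(x a_x) (y b_y) - (y a_y) (x b_x)\<close>, whose two summands have the same
  sign.\<close>

lemma gradient_det_nonzero_if_opposite_signs:
  assumes "fst p * eval2 (ser_dx a) p * (snd p * eval2 (ser_dy a) p) < 0"
    and "fst p \<noteq> 0 \<Longrightarrow> fst p * eval2 (ser_dx b) p > 0" "snd p \<noteq> 0 \<Longrightarrow> snd p * eval2 (ser_dy b) p > 0"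
  shows "gradient_det a b p \<noteq> 0"
proof
  assume J: "gradient_det a b p = 0"
  define u w X Y where "u = fst p * eval2 (ser_dx a) p" and "w = snd p * eval2 (ser_dy a) p"
    and "X = fst p * eval2 (ser_dx b) p" and "Y = snd p * eval2 (ser_dy b) p"
  have uw: "u * w < 0" using assms(1) by (simp add: u_def w_def)
  then have "fst p \<noteq> 0" "snd p \<noteq> 0" by (auto simp: u_def w_def)
  then have "X > 0" "Y > 0" using assms by (auto simp: X_def Y_def)
  have "u * Y - w * X = fst p * snd p * gradient_det a b p"
    by (simp add: u_def w_def X_def Y_def gradient_det_def algebra_simps)
  then have "u * Y = w * X" using J by simp
  then have "(u * w) * Y = w\<^sup>2 * X" by (simp add: power2_eq_square mult_ac)
  moreover have "(u * w) * Y < 0" using uw \<open>Y > 0\<close> by (rule mult_neg_pos)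
  moreover have "0 \<le> w\<^sup>2 * X" using \<open>X > 0\<close> by simp
  ultimately show False by simp
qed

lemma compact_real_part:
  assumes "conv_on a R" "\<rho> < R"
  shows "compact (real_part a \<rho>)"
proof -
  have "real_part a \<rho> = cball 0 \<rho> \<inter> eval2 a -` {0}" by (auto simp: real_part_def)
  moreover have "continuous_on (cball 0 \<rho>) (eval2 a)"
    by (rule eval2_continuous_on[OF assms(1)], intro conjI norm_cball_less[OF _ assms(2)]) auto
  then have "closed (cball 0 \<rho> \<inter> eval2 a -` {0})"
    by (intro continuous_closed_preimage) auto
  ultimately show ?thesis
    by (metis bounded_Int bounded_cball compact_eq_bounded_closed)
qed

lemma component_attains_max:
  assumes "conv_on a R" "\<rho> < R" "conv_on b R" "K \<in> components (real_part a \<rho>)"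
  obtains p where "p \<in> K" "\<And>q. q \<in> K \<Longrightarrow> eval2 b q \<le> eval2 b p"
proof -
  have "compact K" using compact_components[OF compact_real_part[OF assms(1,2)] assms(4)] .
  moreover have "K \<noteq> {}" using in_components_nonempty[OF assms(4)] .
  moreover have "continuous_on K (eval2 b)"
    by (rule eval2_continuous_on[OF assms(3)], intro conjI norm_cball_less[OF _ assms(2)])
       (use in_components_subset[OF assms(4)] in \<open>auto simp: real_part_def\<close>)
  ultimately show ?thesis using continuous_attains_sup that by metis
qed

section \<open>Nondegenerate initial forms\<close>

text \<open>The form in which asymptotic statements about families are proved here: a sequence of counterexamples
  tending to \<open>0\<close> is refuted by compactness.\<close>

lemma eventually_at_right_0_by_sequences:
  fixes \<delta> :: real
  assumes "\<delta> > 0"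
    and "\<And>s. (\<And>n. 0 < s n) \<Longrightarrow> (\<And>n. s n < \<delta>) \<Longrightarrow> s \<longlonglongrightarrow> 0 \<Longrightarrow> (\<And>n::nat. \<not> Q (s n)) \<Longrightarrow> False"
  shows "eventually Q (at_right (0::real))"
proof (rule ccontr)
  assume not: "\<not> eventually Q (at_right 0)"
  have "\<exists>s. 0 < s \<and> s < min \<delta> (inverse (real (Suc n))) \<and> \<not> Q s" for n
    using not assms(1) unfolding eventually_at_right_field
    by (auto simp: not_le dest!: spec[of _ "min \<delta> (inverse (real (Suc n)))"])
  then obtain s where s: "\<And>n. 0 < s n" "\<And>n. s n < min \<delta> (inverse (real (Suc n)))" "\<And>n. \<not> Q (s n)"
    by metis
  have "s \<longlonglongrightarrow> 0"
  proof (rule Lim_null_comparison)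
    show "\<forall>\<^sub>F n in sequentially. norm (s n) \<le> inverse (real (Suc n))"
      using s(1,2) by (auto intro!: always_eventually simp: less_imp_le)
    show "(\<lambda>n. inverse (real (Suc n))) \<longlonglongrightarrow> 0" by (rule LIMSEQ_inverse_real_of_nat)
  qed
  with assms(2)[of s] s show False by auto
qed

lemma bounded_pair_convergent_subsequence:
  fixes p :: "nat \<Rightarrow> real \<times> real"
  assumes "\<And>n. norm (p n) \<le> B"
  obtains l r where "strict_mono (r :: nat \<Rightarrow> nat)" "(\<lambda>n. p (r n)) \<longlonglongrightarrow> l"
proof -
  have "bounded (range p)" using assms by (auto simp: bounded_iff)
  from bounded_imp_convergent_subsequence[OF this] show ?thesis using that by (auto simp: o_def)
qed

text \<open>The weighted analogue of the squared distance to the origin: with these exponents both terms are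
  multiplied by the same factor under \<open>(x, y) \<mapsto> (\<sigma>^\<alpha> x, \<sigma>^\<beta> y)\<close>.\<close>

definition weighted_square :: "nat \<Rightarrow> nat \<Rightarrow> real \<times> real \<Rightarrow> real" where
  "weighted_square \<alpha> \<beta> p = fst p ^ (2 * \<beta>) + snd p ^ (2 * \<alpha>)"

lemma weighted_square_scale:
  "weighted_square \<alpha> \<beta> (\<sigma> ^ \<alpha> * X, \<sigma> ^ \<beta> * Y) = \<sigma> ^ (2 * \<alpha> * \<beta>) * weighted_square \<alpha> \<beta> (X, Y)"
proof -
  have "(\<sigma> ^ \<alpha>) ^ (2 * \<beta>) = \<sigma> ^ (2 * \<alpha> * \<beta>)" "(\<sigma> ^ \<beta>) ^ (2 * \<alpha>) = \<sigma> ^ (2 * \<alpha> * \<beta>)"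
    by (simp_all flip: power_mult add: mult_ac)
  then show ?thesis by (simp add: weighted_square_def power_mult_distrib distrib_left)
qed

lemma weighted_square_pos:
  assumes "\<alpha> \<ge> 1" "\<beta> \<ge> 1" "p \<noteq> 0"
  shows "weighted_square \<alpha> \<beta> p > 0"
proof -
  have "fst p \<noteq> 0 \<or> snd p \<noteq> 0" using assms(3) by (auto simp: prod_eq_iff)
  then have "(fst p ^ 2) ^ \<beta> > 0 \<or> (snd p ^ 2) ^ \<alpha> > 0" by auto
  moreover have "(fst p ^ 2) ^ \<beta> \<ge> 0" "(snd p ^ 2) ^ \<alpha> \<ge> 0" by simp_all
  ultimately have "(fst p ^ 2) ^ \<beta> + (snd p ^ 2) ^ \<alpha> > 0" by linarith
  then show ?thesis by (simp add: weighted_square_def power_mult)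
qed

lemma abs_le_if_even_power_le:
  fixes x :: real
  assumes "x ^ (2 * k) \<le> C" "k \<ge> 1" "C \<ge> 0"
  shows "\<bar>x\<bar> \<le> C + 1"
proof (rule ccontr)
  assume "\<not> \<bar>x\<bar> \<le> C + 1"
  then have gt: "C + 1 < \<bar>x\<bar>" by simp
  have "\<bar>x\<bar> ^ 1 \<le> \<bar>x\<bar> ^ (2 * k)" using gt assms by (intro power_increasing) auto
  also have "\<dots> = x ^ (2 * k)" by (simp add: power_even_abs)
  finally show False using gt assms by simp
qed

text \<open>The scale \<open>\<sigma>\<close> is a power of the weighted distance, with exponent chosen by homogeneity.\<close>

lemma weighted_polar_coordinates:
  assumes "\<alpha> \<ge> 1" "\<beta> \<ge> 1" "p \<noteq> 0"
  obtains \<sigma> X Y where "\<sigma> > 0" "p = (\<sigma> ^ \<alpha> * X, \<sigma> ^ \<beta> * Y)" "weighted_square \<alpha> \<beta> (X, Y) = 1"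
    "\<sigma> ^ (2 * \<alpha> * \<beta>) = weighted_square \<alpha> \<beta> p"
proof -
  define \<sigma> where "\<sigma> = root (2 * \<alpha> * \<beta>) (weighted_square \<alpha> \<beta> p)"
  have pos: "2 * \<alpha> * \<beta> > 0" using assms by simp
  have w: "weighted_square \<alpha> \<beta> p > 0" by (rule weighted_square_pos[OF assms])
  have \<sigma>: "\<sigma> > 0" unfolding \<sigma>_def using pos w by (rule real_root_gt_zero)
  have \<sigma>w: "\<sigma> ^ (2 * \<alpha> * \<beta>) = weighted_square \<alpha> \<beta> p"
    unfolding \<sigma>_def by (rule real_root_pow_pos[OF pos w])
  define X Y where "X = fst p / \<sigma> ^ \<alpha>" and "Y = snd p / \<sigma> ^ \<beta>"
  have p: "p = (\<sigma> ^ \<alpha> * X, \<sigma> ^ \<beta> * Y)" using \<sigma> by (simp add: X_def Y_def)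
  have "weighted_square \<alpha> \<beta> (X, Y) = 1"
    using \<sigma>w \<sigma> unfolding p weighted_square_scale by simp
  then show ?thesis using that \<sigma> p \<sigma>w by blast
qed

lemma weighted_square_tendsto:
  assumes "(X \<longlongrightarrow> X0) F" "(Y \<longlongrightarrow> Y0) F"
  shows "((\<lambda>z. weighted_square \<alpha> \<beta> (X z, Y z)) \<longlongrightarrow> weighted_square \<alpha> \<beta> (X0, Y0)) F"
  unfolding weighted_square_def by (auto intro!: tendsto_intros assms)

lemma tendsto_0_if_power_tendsto_0:
  fixes f :: "'z \<Rightarrow> real"
  assumes "((\<lambda>z. f z ^ n) \<longlongrightarrow> 0) F" "n > 0"
  shows "(f \<longlongrightarrow> 0) F"
proof -
  have "((\<lambda>z. root n (\<bar>f z\<bar> ^ n)) \<longlongrightarrow> root n 0) F"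
    using tendsto_rabs_zero[OF assms(1)] by (intro tendsto_real_root) (simp add: power_abs)
  then have "((\<lambda>z. \<bar>f z\<bar>) \<longlongrightarrow> 0) F"
    using assms(2) by (simp add: real_root_power_cancel)
  then show ?thesis by (rule tendsto_rabs_zero_cancel)
qed

locale nondegenerate_family = weighted_family +
  assumes initial_axes: "eval2 (L 0) (X, Y) = 0 \<Longrightarrow> (X, Y) \<noteq> 0 \<Longrightarrow> X \<noteq> 0 \<and> Y \<noteq> 0"
    and initial_smooth: "eval2 (L 0) (X, Y) = 0 \<Longrightarrow> X \<noteq> 0 \<Longrightarrow> Y \<noteq> 0 \<Longrightarrow>
      eval2 (ser_dx (L 0)) (X, Y) \<noteq> 0 \<or> eval2 (ser_dy (L 0)) (X, Y) \<noteq> 0"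
begin

text \<open>By the Euler identity \<open>\<alpha> x \<partial>_x\<close> and \<open>\<beta> y \<partial>_y\<close> of the initial form add up to zero along its zero set,
  and by nondegeneracy they do not both vanish.\<close>

lemma initial_form_opposite_signs:
  assumes "eval2 (L 0) (X, Y) = 0" "(X, Y) \<noteq> 0"
  shows "X * eval2 (ser_dx (L 0)) (X, Y) * (Y * eval2 (ser_dy (L 0)) (X, Y)) < 0"
proof -
  have hom: "\<alpha> * r + \<beta> * q = \<Omega>" if "L 0 r q \<noteq> 0" for r q
    using that by (auto simp: leading_ser_def power_0_left split: if_splits)
  define u w where "u = X * eval2 (ser_dx (L 0)) (X, Y)" and "w = Y * eval2 (ser_dy (L 0)) (X, Y)"
  have "\<alpha> * X * eval2 (ser_dx (L 0)) (X, Y) + \<beta> * Y * eval2 (ser_dy (L 0)) (X, Y) = \<Omega> * eval2 (L 0) (X, Y)"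
    using euler_identity[where b = "L 0" and p = "(X, Y)" and \<alpha> = \<alpha> and \<beta> = \<beta> and W = \<Omega>, OF conv_L[of 0 "max \<bar>X\<bar> \<bar>Y\<bar> + 1"] _ _ hom]
    by auto
  then have "\<alpha> * u + \<beta> * w = 0" by (simp add: u_def w_def assms mult.assoc)
  then have "\<beta> * w = - (\<alpha> * u)" by linarith
  then have "- (\<alpha> / \<beta>) * u = \<beta> * w / \<beta>" by simp
  also have "\<dots> = w" using \<beta> by simp
  finally have eq: "w = - (\<alpha> / \<beta>) * u" by (rule sym)
  have XY: "X \<noteq> 0" "Y \<noteq> 0" using initial_axes[OF assms] by blast+
  then have "u \<noteq> 0 \<or> w \<noteq> 0" using initial_smooth[OF assms(1) XY] XY by (auto simp: u_def w_def)
  then have "u \<noteq> 0" using eq by auto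
  have "u * w = - (\<alpha> / \<beta>) * u\<^sup>2" by (simp add: eq power2_eq_square)
  also have "\<dots> < 0" using \<alpha> \<beta> \<open>u \<noteq> 0\<close> by (simp add: mult_neg_pos)
  finally show ?thesis by (simp add: u_def w_def)
qed

text \<open>At scales that are large compared with the parameter the deformation looks like its initial form:
  a sequence of counterexamples, rescaled to weighted norm one, would accumulate at a zero of the initial
  form contradicting the opposite signs there.\<close>

lemma opposite_signs_near_origin:
  "\<exists>\<epsilon>>0. \<forall>s p. 0 \<le> s \<longrightarrow> p \<noteq> 0 \<longrightarrow> norm p < \<epsilon> \<longrightarrow> s ^ (2 * \<alpha> * \<beta>) < \<epsilon> * weighted_square \<alpha> \<beta> p \<longrightarrow>
     eval2 (P s) p = 0 \<longrightarrow> fst p * eval2 (ser_dx (P s)) p * (snd p * eval2 (ser_dy (P s)) p) < 0"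
proof (rule ccontr)
  assume contra: "\<not> ?thesis"
  define \<epsilon> where "\<epsilon> = (\<lambda>n. inverse (real (Suc n)))"
  have \<epsilon>0: "\<epsilon> n > 0" for n by (simp add: \<epsilon>_def)
  have \<epsilon>lim: "\<epsilon> \<longlonglongrightarrow> 0" unfolding \<epsilon>_def by (rule LIMSEQ_inverse_real_of_nat)
  define bad where "bad = (\<lambda>n s p. 0 \<le> s \<and> p \<noteq> 0 \<and> norm p < \<epsilon> n \<and>
     s ^ (2 * \<alpha> * \<beta>) < \<epsilon> n * weighted_square \<alpha> \<beta> p \<and> eval2 (P s) p = 0 \<and>
     \<not> fst p * eval2 (ser_dx (P s)) p * (snd p * eval2 (ser_dy (P s)) p) < 0)"
  have "\<forall>n. \<exists>s p. bad n s p"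
    using contra \<epsilon>0 unfolding bad_def by blast
  then obtain s p where bad: "\<And>n. bad n (s n) (p n)" by metis
  have "\<exists>\<sigma> X Y. \<sigma> > 0 \<and> p n = (\<sigma> ^ \<alpha> * X, \<sigma> ^ \<beta> * Y) \<and> weighted_square \<alpha> \<beta> (X, Y) = 1
    \<and> \<sigma> ^ (2 * \<alpha> * \<beta>) = weighted_square \<alpha> \<beta> (p n)" for n
    using weighted_polar_coordinates[OF \<alpha> \<beta>, of "p n"] bad[of n] unfolding bad_def by metis
  then obtain \<sigma> X Y where \<sigma>: "\<And>n. \<sigma> n > 0" and p: "\<And>n. p n = (\<sigma> n ^ \<alpha> * X n, \<sigma> n ^ \<beta> * Y n)"
    and ws: "\<And>n. weighted_square \<alpha> \<beta> (X n, Y n) = 1" and \<sigma>w: "\<And>n. \<sigma> n ^ (2 * \<alpha> * \<beta>) = weighted_square \<alpha> \<beta> (p n)"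
    by metis
  \<comment> \<open>the parameter in units of the scale; the hypothesis on \<open>s\<close> makes it tend to \<open>0\<close>\<close>
  define \<tau> where "\<tau> = (\<lambda>n. s n / \<sigma> n)"
  have s: "s n = \<tau> n * \<sigma> n" for n using \<sigma>[of n] by (simp add: \<tau>_def)
  have N: "2 * \<alpha> * \<beta> > 0" using \<alpha> \<beta> by simp
  have "norm (\<tau> n ^ (2 * \<alpha> * \<beta>)) \<le> \<epsilon> n" for n
  proof -
    have "s n ^ (2 * \<alpha> * \<beta>) < \<epsilon> n * \<sigma> n ^ (2 * \<alpha> * \<beta>)" "0 \<le> s n" using bad[of n] \<sigma>w[of n] by (auto simp: bad_def)
    then show ?thesis using \<sigma>[of n] by (simp add: \<tau>_def power_divide divide_simps less_imp_le)
  qed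
  then have "(\<lambda>n. \<tau> n ^ (2 * \<alpha> * \<beta>)) \<longlonglongrightarrow> 0"
    by (intro Lim_null_comparison[OF _ \<epsilon>lim]) auto
  then have \<tau>lim: "\<tau> \<longlonglongrightarrow> 0" using N by (rule tendsto_0_if_power_tendsto_0)
  have plim: "p \<longlonglongrightarrow> (0, 0)"
    using Lim_null_comparison[OF _ \<epsilon>lim, of p] bad by (auto simp: bad_def less_imp_le zero_prod_def)
  have "(\<lambda>n. weighted_square \<alpha> \<beta> (fst (p n), snd (p n))) \<longlonglongrightarrow> weighted_square \<alpha> \<beta> (0, 0)"
    using tendsto_fst[OF plim] tendsto_snd[OF plim] by (intro weighted_square_tendsto) auto
  moreover have "weighted_square \<alpha> \<beta> (0, 0) = 0" using \<alpha> \<beta> by (simp add: weighted_square_def power_0_left)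
  ultimately have "(\<lambda>n. \<sigma> n ^ (2 * \<alpha> * \<beta>)) \<longlonglongrightarrow> 0" by (simp add: \<sigma>w)
  then have \<sigma>lim: "\<sigma> \<longlonglongrightarrow> 0" using N by (rule tendsto_0_if_power_tendsto_0)
  have XY1: "\<bar>X n\<bar> \<le> 2" "\<bar>Y n\<bar> \<le> 2" for n
  proof -
    have "0 \<le> X n ^ (2 * \<beta>)" "0 \<le> Y n ^ (2 * \<alpha>)" by (simp_all add: power_mult)
    moreover have "X n ^ (2 * \<beta>) + Y n ^ (2 * \<alpha>) = 1" using ws[of n] by (simp add: weighted_square_def)
    ultimately have "X n ^ (2 * \<beta>) \<le> 1" "Y n ^ (2 * \<alpha>) \<le> 1" by linarith+
    then show "\<bar>X n\<bar> \<le> 2" "\<bar>Y n\<bar> \<le> 2"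
      using abs_le_if_even_power_le[of "X n" \<beta> 1] abs_le_if_even_power_le[of "Y n" \<alpha> 1] \<alpha> \<beta> by auto
  qed
  have "norm (X n, Y n) \<le> 4" for n
    using norm_Pair_le[of "X n" "Y n"] XY1[of n] by simp
  then obtain l r where r: "strict_mono (r :: nat \<Rightarrow> nat)" and l: "(\<lambda>n. (X (r n), Y (r n))) \<longlonglongrightarrow> l"
    by (rule bounded_pair_convergent_subsequence[of "\<lambda>n. (X n, Y n)"]) auto
  obtain X0 Y0 where l': "l = (X0, Y0)" by force
  have lims: "(\<lambda>n. X (r n)) \<longlonglongrightarrow> X0" "(\<lambda>n. Y (r n)) \<longlonglongrightarrow> Y0"
    using tendsto_fst[OF l] tendsto_snd[OF l] by (simp_all add: l')
  note sub = LIMSEQ_subseq_LIMSEQ[OF \<sigma>lim r, unfolded o_def] LIMSEQ_subseq_LIMSEQ[OF \<tau>lim r, unfolded o_def]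
  have \<sigma>ev: "\<forall>\<^sub>F n in sequentially. \<sigma> (r n) > 0" using \<sigma> by simp
  note T = sub(1) \<sigma>ev lims sub(2)
  have "weighted_square \<alpha> \<beta> (X0, Y0) = 1"
    using LIMSEQ_unique[OF weighted_square_tendsto[OF lims, of \<alpha> \<beta>]] by (simp add: ws)
  then have ne: "(X0, Y0) \<noteq> 0" using \<alpha> \<beta> by (auto simp: weighted_square_def zero_prod_def power_0_left)
  have z: "eval2 (L 0) (X0, Y0) = 0"
  proof (rule LIMSEQ_unique[OF scaled_tendsto[OF T]])
    have "eval2 (P (\<tau> (r n) * \<sigma> (r n))) (\<sigma> (r n) ^ \<alpha> * X (r n), \<sigma> (r n) ^ \<beta> * Y (r n)) / \<sigma> (r n) ^ \<Omega> = 0" for n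
      using bad[of "r n"] by (simp add: bad_def s p)
    then show "(\<lambda>n. eval2 (P (\<tau> (r n) * \<sigma> (r n))) (\<sigma> (r n) ^ \<alpha> * X (r n), \<sigma> (r n) ^ \<beta> * Y (r n)) / \<sigma> (r n) ^ \<Omega>) \<longlonglongrightarrow> 0"
      by (simp only: tendsto_const)
  qed
  have "0 \<le> X0 * eval2 (ser_dx (L 0)) (X0, Y0) * (Y0 * eval2 (ser_dy (L 0)) (X0, Y0))"
  proof (rule LIMSEQ_le_const[OF tendsto_mult[OF tendsto_mult[OF lims(1) scaled_dx_tendsto[OF T]]
        tendsto_mult[OF lims(2) scaled_dy_tendsto[OF T]]]], intro exI allI impI)
    fix n
    let ?\<sigma> = "\<sigma> (r n)" and ?p = "p (r n)" and ?s = "s (r n)"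
    have "0 \<le> fst ?p * eval2 (ser_dx (P ?s)) ?p * (snd ?p * eval2 (ser_dy (P ?s)) ?p)"
      using bad[of "r n"] by (simp add: bad_def)
    also have "\<dots> = (?\<sigma> ^ \<alpha> * X (r n)) * eval2 (ser_dx (P ?s)) ?p * ((?\<sigma> ^ \<beta> * Y (r n)) * eval2 (ser_dy (P ?s)) ?p)"
      using p[of "r n"] by simp
    finally have "0 \<le> (?\<sigma> ^ \<alpha> * X (r n)) * eval2 (ser_dx (P ?s)) ?p * ((?\<sigma> ^ \<beta> * Y (r n)) * eval2 (ser_dy (P ?s)) ?p)
        / ?\<sigma> ^ \<Omega> / ?\<sigma> ^ \<Omega>"
      using \<sigma>[of "r n"] by simp
    then show "0 \<le> X (r n) * (?\<sigma> ^ \<alpha> * eval2 (ser_dx (P (\<tau> (r n) * ?\<sigma>))) (?\<sigma> ^ \<alpha> * X (r n), ?\<sigma> ^ \<beta> * Y (r n)) / ?\<sigma> ^ \<Omega>) *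
       (Y (r n) * (?\<sigma> ^ \<beta> * eval2 (ser_dy (P (\<tau> (r n) * ?\<sigma>))) (?\<sigma> ^ \<alpha> * X (r n), ?\<sigma> ^ \<beta> * Y (r n)) / ?\<sigma> ^ \<Omega>))"
      unfolding s p by (simp add: mult_ac)
  qed
  with initial_form_opposite_signs[OF z ne] show False by simp
qed


end

section \<open>Families of ovals\<close>

text \<open>The test functions \<open>x^m + y^n\<close>, among them the square of the distance to the origin and its weighted
  analogue.\<close>

definition power_sum_ser :: "nat \<Rightarrow> nat \<Rightarrow> real ser2" where
  "power_sum_ser m n = (\<lambda>r s. if (r, s) = (m, 0) \<or> (r, s) = (0, n) then 1 else 0)"

definition linear_ser :: "real \<Rightarrow> real \<Rightarrow> real ser2" where
  "linear_ser u v = (\<lambda>r s. if (r, s) = (1, 0) then u else if (r, s) = (0, 1) then v else 0)"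

lemma conv_on_power_sum_ser: "conv_on (power_sum_ser m n) R"
  by (rule conv_on_finite[of "{(m, 0), (0, n)}"]) (auto simp: power_sum_ser_def split: if_splits)

lemma conv_on_linear_ser: "conv_on (linear_ser u v) R"
  by (rule conv_on_finite[of "{(1, 0), (0, 1)}"]) (auto simp: linear_ser_def split: if_splits)

lemma eval2_power_sum_ser:
  assumes "m \<ge> 1"
  shows "eval2 (power_sum_ser m n) p = fst p ^ m + snd p ^ n"
  by (subst eval2_finite[of "{(m, 0), (0, n)}"]) (use assms in \<open>auto simp: power_sum_ser_def split: if_splits\<close>)

lemma eval2_ser_dx_power_sum_ser:
  assumes "m \<ge> 1" "n \<ge> 1"
  shows "eval2 (ser_dx (power_sum_ser m n)) p = of_nat m * fst p ^ (m - 1)"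
  by (subst eval2_finite[of "{(m - 1, 0)}"])
     (use assms in \<open>auto simp: power_sum_ser_def ser_dx_def split: if_splits\<close>)

lemma eval2_ser_dy_power_sum_ser:
  assumes "m \<ge> 1" "n \<ge> 1"
  shows "eval2 (ser_dy (power_sum_ser m n)) p = of_nat n * snd p ^ (n - 1)"
  by (subst eval2_finite[of "{(0, n - 1)}"])
     (use assms in \<open>auto simp: power_sum_ser_def ser_dy_def split: if_splits\<close>)

lemma eval2_linear_ser: "eval2 (linear_ser u v) p = u * fst p + v * snd p"
  by (subst eval2_finite[of "{(1, 0), (0, 1)}"]) (auto simp: linear_ser_def split: if_splits)

lemma eval2_ser_dx_linear_ser: "eval2 (ser_dx (linear_ser u v)) p = u"
  by (subst eval2_finite[of "{(0, 0)}"]) (auto simp: linear_ser_def ser_dx_def split: if_splits)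

lemma eval2_ser_dy_linear_ser: "eval2 (ser_dy (linear_ser u v)) p = v"
  by (subst eval2_finite[of "{(0, 0)}"]) (auto simp: linear_ser_def ser_dy_def split: if_splits)

lemma gradient_det_linear_ser: "gradient_det a (linear_ser u v) p = v * eval2 (ser_dx a) p - u * eval2 (ser_dy a) p"
  by (simp add: gradient_det_def eval2_ser_dx_linear_ser eval2_ser_dy_linear_ser mult.commute)

lemma power_sum_ser_radially_increasing:
  assumes "m \<ge> 1" "n \<ge> 1"
  shows "fst p \<noteq> 0 \<Longrightarrow> fst p * eval2 (ser_dx (power_sum_ser (2 * m) (2 * n))) p > 0"
    and "snd p \<noteq> 0 \<Longrightarrow> snd p * eval2 (ser_dy (power_sum_ser (2 * m) (2 * n))) p > 0"
proof -
  have *: "x * (of_nat (2 * k) * x ^ (2 * k - 1)) > 0" if "k \<ge> 1" "x \<noteq> 0" for x :: real and k :: nat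
  proof -
    have eq: "x * (of_nat (2 * k) * x ^ (2 * k - 1)) = of_nat (2 * k) * x ^ (2 * k)"
      using that(1) by (simp add: power_eq_if mult_ac)
    have "0 < of_nat (2 * k) * (x\<^sup>2) ^ k" using that by (intro mult_pos_pos) auto
    then show ?thesis by (simp only: eq power_mult)
  qed
  show "fst p \<noteq> 0 \<Longrightarrow> fst p * eval2 (ser_dx (power_sum_ser (2 * m) (2 * n))) p > 0"
    using assms *[of m "fst p"] by (subst eval2_ser_dx_power_sum_ser) auto
  show "snd p \<noteq> 0 \<Longrightarrow> snd p * eval2 (ser_dy (power_sum_ser (2 * m) (2 * n))) p > 0"
    using assms *[of n "snd p"] by (subst eval2_ser_dy_power_sum_ser) auto
qed

lemma norm_power2_eq_power_sum: "norm p ^ 2 = eval2 (power_sum_ser (2 * 1) (2 * 1)) p" for p :: "real \<times> real"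
  by (simp add: eval2_power_sum_ser norm_prod_def)

lemma family_tendsto:
  assumes "\<And>k. k \<le> \<Omega> \<Longrightarrow> conv_on (h k) R" "(s \<longlongrightarrow> 0) F" "(p \<longlongrightarrow> p0) F" "\<bar>fst p0\<bar> < R" "\<bar>snd p0\<bar> < R"
  shows "((\<lambda>z. eval2 (family_ser \<Omega> h (s z)) (p z)) \<longlongrightarrow> eval2 (h 0) p0) F"
proof -
  have "((\<lambda>z. \<Sum>k\<le>\<Omega>. s z ^ k * eval2 (h k) (p z)) \<longlongrightarrow> (\<Sum>k\<le>\<Omega>. 0 ^ k * eval2 (h k) p0)) F"
    by (intro tendsto_sum tendsto_mult tendsto_power assms(2) eval2_tendsto[OF assms(1)]) (use assms in auto)
  moreover have "(\<Sum>k\<le>\<Omega>. 0 ^ k * eval2 (h k) p0) = eval2 (h 0) p0"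
    by (simp add: power_0_left if_distrib[of "\<lambda>x. x * _"] cong: if_cong)
  moreover have "\<forall>\<^sub>F z in F. \<bar>fst (p z)\<bar> < R \<and> \<bar>snd (p z)\<bar> < R"
    using order_tendstoD(2)[OF tendsto_rabs[OF tendsto_fst[OF assms(3)]] assms(4)]
      order_tendstoD(2)[OF tendsto_rabs[OF tendsto_snd[OF assms(3)]] assms(5)]
    by eventually_elim auto
  then have "\<forall>\<^sub>F z in F. (\<Sum>k\<le>\<Omega>. s z ^ k * eval2 (h k) (p z)) = eval2 (family_ser \<Omega> h (s z)) (p z)"
    by eventually_elim (simp add: eval2_family[OF assms(1)])
  ultimately show ?thesis by (simp add: tendsto_cong)
qed

text \<open>Ovals of the deformation in a ball, for small positive values of the parameter. The
  hypothesis \<open>radial\<close> says that the special curve crosses the circles around the origin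
  transversally.\<close>

locale oval_family = nondegenerate_family +
  fixes \<rho> \<delta> :: real and K :: "real \<Rightarrow> (real \<times> real) set"
  assumes \<rho>: "0 < \<rho>" "\<rho> < R" and \<delta>: "0 < \<delta>"
    and radial: "p \<noteq> 0 \<Longrightarrow> norm p \<le> \<rho> \<Longrightarrow> eval2 (g 0) p = 0 \<Longrightarrow> gradient_det (g 0) (power_sum_ser (2 * 1) (2 * 1)) p \<noteq> 0"
    and K: "0 < s \<Longrightarrow> s < \<delta> \<Longrightarrow> K s \<in> components (real_part (P s) \<rho>)"
    and inner: "0 < s \<Longrightarrow> s < \<delta> \<Longrightarrow> K s \<subseteq> ball 0 \<rho>"
    and K_cont: "0 < s \<Longrightarrow> s < \<delta> \<Longrightarrow> \<epsilon> > 0 \<Longrightarrow> \<forall>\<^sub>F s' in at s. hausdorff_close \<epsilon> (K s') (K s)"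
begin

lemma less_\<delta>: "\<forall>\<^sub>F s in at_right 0. s < \<delta>"
  by (rule eventually_at_rightI[OF _ \<delta>]) auto

lemma K_zero: "0 < s \<Longrightarrow> s < \<delta> \<Longrightarrow> p \<in> K s \<Longrightarrow> eval2 (P s) p = 0"
  using in_components_subset[OF K] by (auto simp: real_part_def)

text \<open>The maximum is attained in the open ball, so the critical point condition applies.\<close>

lemma K_max:
  assumes "0 < s" "s < \<delta>" "conv_on b R"
  obtains p where "p \<in> K s" "\<And>q. q \<in> K s \<Longrightarrow> eval2 b q \<le> eval2 b p" "gradient_det (P s) b p = 0"
proof -
  obtain p where p: "p \<in> K s" "\<And>q. q \<in> K s \<Longrightarrow> eval2 b q \<le> eval2 b p"
    by (rule component_attains_max[OF conv_P \<rho>(2) assms(3) K[OF assms(1,2)]]) blast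
  moreover have "gradient_det (P s) b p = 0"
    by (rule gradient_det_zero_at_component_max[OF conv_P assms(3) \<rho>(2) K[OF assms(1,2)] p(1) _ p(2)])
       (use p inner[OF assms(1,2)] in auto)
  ultimately show ?thesis using that by blast
qed

text \<open>Limits of points of the ovals at maximal distance from the origin are critical points of
  this distance on the special curve, hence equal to the origin.\<close>

lemma K_shrinks:
  assumes "\<epsilon> > 0"
  shows "\<forall>\<^sub>F s in at_right 0. K s \<subseteq> ball 0 \<epsilon>"
proof (rule eventually_at_right_0_by_sequences[OF \<delta>])
  fix s :: "nat \<Rightarrow> real"
  assume s: "\<And>n. 0 < s n" "\<And>n. s n < \<delta>" "s \<longlonglongrightarrow> 0" and far: "\<And>n. \<not> K (s n) \<subseteq> ball 0 \<epsilon>"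
  let ?b = "power_sum_ser (2 * 1) (2 * 1)"
  have "\<exists>p. p \<in> K (s n) \<and> \<epsilon> \<le> norm p \<and> norm p \<le> \<rho> \<and> gradient_det (P (s n)) ?b p = 0" for n
  proof -
    obtain p where p: "p \<in> K (s n)" "\<And>q. q \<in> K (s n) \<Longrightarrow> eval2 ?b q \<le> eval2 ?b p" "gradient_det (P (s n)) ?b p = 0"
      by (rule K_max[OF s(1,2) conv_on_power_sum_ser]) blast
    obtain q where "q \<in> K (s n)" "q \<notin> ball 0 \<epsilon>" using far[of n] by blast
    then have q: "q \<in> K (s n)" "\<epsilon> \<le> norm q" by auto
    have "norm q ^ 2 \<le> norm p ^ 2" using p(2)[OF q(1)] by (simp only: norm_power2_eq_power_sum)
    then have "norm q \<le> norm p" by (rule power2_le_imp_le) simp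
    moreover have "norm p \<le> \<rho>" using inner[OF s(1,2)] p(1) by (meson less_imp_le mem_ball_0 subsetD)
    ultimately show ?thesis using p q by (meson order_trans)
  qed
  then obtain p where p: "\<And>n. p n \<in> K (s n)" "\<And>n. \<epsilon> \<le> norm (p n)" "\<And>n. norm (p n) \<le> \<rho>"
    and J: "\<And>n. gradient_det (P (s n)) ?b (p n) = 0" by metis
  obtain l r where r: "strict_mono (r :: nat \<Rightarrow> nat)" and l: "(\<lambda>n. p (r n)) \<longlonglongrightarrow> l"
    using bounded_pair_convergent_subsequence[of p] p(3) by blast
  have sr: "(\<lambda>n. s (r n)) \<longlonglongrightarrow> 0" using LIMSEQ_subseq_LIMSEQ[OF s(3) r] by (simp add: o_def)
  have nl: "\<epsilon> \<le> norm l" "norm l \<le> \<rho>"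
    using LIMSEQ_le_const[OF tendsto_norm[OF l], of \<epsilon>] LIMSEQ_le_const2[OF tendsto_norm[OF l], of \<rho>] p by auto
  have d: "\<bar>fst l\<bar> < R" "\<bar>snd l\<bar> < R" using norm_cball_less[OF nl(2) \<rho>(2)] by auto
  have "eval2 (g 0) l = 0"
  proof (rule LIMSEQ_unique)
    show "(\<lambda>n. eval2 (P (s (r n))) (p (r n))) \<longlonglongrightarrow> eval2 (g 0) l"
      by (rule family_tendsto[OF conv sr l d])
    show "(\<lambda>n. eval2 (P (s (r n))) (p (r n))) \<longlonglongrightarrow> 0"
      using K_zero[OF s(1,2) p(1)] by simp
  qed
  moreover have "(\<lambda>n. gradient_det (P (s (r n))) ?b (p (r n))) \<longlonglongrightarrow> gradient_det (g 0) ?b l"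
    unfolding gradient_det_def ser_dx_family ser_dy_family
    by (intro tendsto_diff tendsto_mult family_tendsto[where R = R] conv_on_ser_dx conv_on_ser_dy conv sr l d
        eval2_tendsto[where R = R] conv_on_power_sum_ser) (use d in auto)
  then have "gradient_det (g 0) ?b l = 0" by (simp only: J LIMSEQ_const_iff)
  moreover have "norm l \<noteq> 0" using nl(1) assms by linarith
  then have "l \<noteq> 0" by simp
  ultimately show False using radial[of l] nl(2) by blast
qed

text \<open>At a maximum of the weighted distance on the oval the gradient of the equation is proportional to
  that of the weighted distance. This contradicts the opposite signs of the Euler derivatives, unless the
  maximum is of the order of the parameter.\<close>

lemma K_weighted_bound:
  "\<exists>B>0. \<forall>\<^sub>F s in at_right 0. \<forall>p\<in>K s. \<bar>fst p\<bar> \<le> B * s ^ \<alpha> \<and> \<bar>snd p\<bar> \<le> B * s ^ \<beta>"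
proof -
  obtain \<epsilon> where \<epsilon>: "\<epsilon> > 0" and opp: "\<And>s p. 0 \<le> s \<Longrightarrow> p \<noteq> 0 \<Longrightarrow> norm p < \<epsilon> \<Longrightarrow>
     s ^ (2 * \<alpha> * \<beta>) < \<epsilon> * weighted_square \<alpha> \<beta> p \<Longrightarrow> eval2 (P s) p = 0 \<Longrightarrow>
     fst p * eval2 (ser_dx (P s)) p * (snd p * eval2 (ser_dy (P s)) p) < 0"
    using opposite_signs_near_origin by blast
  let ?b = "power_sum_ser (2 * \<beta>) (2 * \<alpha>)"
  have ws: "weighted_square \<alpha> \<beta> p = eval2 ?b p" for p
    using \<beta> by (simp add: weighted_square_def eval2_power_sum_ser)
  have ev: "\<forall>\<^sub>F s in at_right 0. \<forall>p\<in>K s. weighted_square \<alpha> \<beta> p \<le> s ^ (2 * \<alpha> * \<beta>) / \<epsilon>"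
    using K_shrinks[OF \<epsilon>] eventually_at_right_less[of 0] less_\<delta>
  proof eventually_elim
    case (elim s)
    then have s: "0 < s" "s < \<delta>" by auto
    obtain p where p: "p \<in> K s" "\<And>q. q \<in> K s \<Longrightarrow> eval2 ?b q \<le> eval2 ?b p" "gradient_det (P s) ?b p = 0"
      by (rule K_max[OF s conv_on_power_sum_ser]) blast
    have "weighted_square \<alpha> \<beta> p \<le> s ^ (2 * \<alpha> * \<beta>) / \<epsilon>"
    proof (rule ccontr)
      assume "\<not> ?thesis"
      then have lt: "s ^ (2 * \<alpha> * \<beta>) < \<epsilon> * weighted_square \<alpha> \<beta> p" using \<epsilon> by (simp add: field_simps)
      moreover have "0 < s ^ (2 * \<alpha> * \<beta>)" using s by simp
      ultimately have "p \<noteq> 0" using \<alpha> \<beta> by (auto simp: weighted_square_def power_0_left)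
      moreover have "norm p < \<epsilon>" using elim(1) p(1) by auto
      ultimately have "fst p * eval2 (ser_dx (P s)) p * (snd p * eval2 (ser_dy (P s)) p) < 0"
        using opp lt K_zero[OF s p(1)] s by auto
      from gradient_det_nonzero_if_opposite_signs[OF this power_sum_ser_radially_increasing[OF \<beta> \<alpha>]] p(3)
      show False by simp
    qed
    then show ?case using p(2) unfolding ws by (meson order_trans)
  qed
  have scale: "\<bar>fst p\<bar> \<le> (1 / \<epsilon> + 1) * s ^ \<alpha> \<and> \<bar>snd p\<bar> \<le> (1 / \<epsilon> + 1) * s ^ \<beta>"
    if s: "0 < s" and w: "weighted_square \<alpha> \<beta> p \<le> s ^ (2 * \<alpha> * \<beta>) / \<epsilon>" for s p
  proof -
    define X Y where "X = fst p / s ^ \<alpha>" and "Y = snd p / s ^ \<beta>"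
    have p: "p = (s ^ \<alpha> * X, s ^ \<beta> * Y)" using s by (simp add: X_def Y_def)
    have pos: "0 < s ^ (2 * \<alpha> * \<beta>)" using s by simp
    have "s ^ (2 * \<alpha> * \<beta>) * weighted_square \<alpha> \<beta> (X, Y) \<le> s ^ (2 * \<alpha> * \<beta>) * (1 / \<epsilon>)"
      using w unfolding p weighted_square_scale by simp
    then have "weighted_square \<alpha> \<beta> (X, Y) \<le> 1 / \<epsilon>" using pos by (simp only: mult_le_cancel_left_pos)
    then have "X ^ (2 * \<beta>) + Y ^ (2 * \<alpha>) \<le> 1 / \<epsilon>" by (simp add: weighted_square_def)
    moreover have "0 \<le> X ^ (2 * \<beta>)" "0 \<le> Y ^ (2 * \<alpha>)" by (simp_all add: power_mult)
    ultimately have "X ^ (2 * \<beta>) \<le> 1 / \<epsilon>" "Y ^ (2 * \<alpha>) \<le> 1 / \<epsilon>" by linarith+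
    then have "\<bar>X\<bar> \<le> 1 / \<epsilon> + 1" "\<bar>Y\<bar> \<le> 1 / \<epsilon> + 1"
      using abs_le_if_even_power_le[of X \<beta>] abs_le_if_even_power_le[of Y \<alpha>] \<alpha> \<beta> \<epsilon> by auto
    then have "\<bar>X\<bar> * s ^ \<alpha> \<le> (1 / \<epsilon> + 1) * s ^ \<alpha>" "\<bar>Y\<bar> * s ^ \<beta> \<le> (1 / \<epsilon> + 1) * s ^ \<beta>"
      using s by (auto intro!: mult_right_mono)
    then show ?thesis using s by (simp add: p abs_mult mult.commute)
  qed
  have "\<forall>\<^sub>F s in at_right 0. \<forall>p\<in>K s. \<bar>fst p\<bar> \<le> (1 / \<epsilon> + 1) * s ^ \<alpha> \<and> \<bar>snd p\<bar> \<le> (1 / \<epsilon> + 1) * s ^ \<beta>"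
    using ev eventually_at_right_less[of 0]
  proof eventually_elim
    case (elim s)
    then show ?case using scale[of s] by blast
  qed
  then show ?thesis using \<epsilon> by (intro exI[of _ "1 / \<epsilon> + 1"]) (auto simp: add_pos_pos)
qed

end

section \<open>Critical values on smooth curves\<close>

text \<open>Pigeonhole principle for intervals of length \<open>d\<close>.\<close>

lemma separated_points_bound:
  fixes w :: "nat \<Rightarrow> real"
  assumes d: "d > 0" and B: "\<And>i. i \<le> N \<Longrightarrow> \<bar>w i\<bar> \<le> B"
    and sep: "\<And>i k. i < k \<Longrightarrow> k \<le> N \<Longrightarrow> d \<le> \<bar>w k - w i\<bar>"
  shows "real N * d \<le> 2 * B"
proof -
  define f where "f = (\<lambda>i. \<lfloor>(w i + B) / d\<rfloor>)"
  have "inj_on f {..N}"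
  proof (rule linorder_inj_onI)
    fix i k assume ik: "i < k" "i \<in> {..N}" "k \<in> {..N}"
    show "f i \<noteq> f k"
    proof
      assume "f i = f k"
      then have "\<bar>(w k + B) / d - (w i + B) / d\<bar> < 1" unfolding f_def by linarith
      moreover have "(w k + B) / d - (w i + B) / d = (w k - w i) / d" by (simp add: diff_divide_distrib[symmetric])
      ultimately have "\<bar>w k - w i\<bar> < d" using d by (simp add: abs_divide)
      with sep[of i k] ik show False by simp
    qed
  qed auto
  moreover have "f ` {..N} \<subseteq> {0..\<lfloor>2 * B / d\<rfloor>}"
  proof (rule image_subsetI)
    fix i assume "i \<in> {..N}"
    then have "0 \<le> w i + B" "w i + B \<le> 2 * B" using B[of i] by auto
    then show "f i \<in> {0..\<lfloor>2 * B / d\<rfloor>}"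
      using d unfolding f_def by (auto intro!: floor_mono divide_right_mono)
  qed
  ultimately have "card {..N} \<le> card {0..\<lfloor>2 * B / d\<rfloor>}" by (metis card_inj_on_le finite_atLeastAtMost_int)
  then have "int N \<le> \<lfloor>2 * B / d\<rfloor>" by simp
  then have "real N \<le> 2 * B / d" by linarith
  then show ?thesis using d by (simp add: field_simps)
qed

text \<open>An elementary form of Sard's theorem. At critical points of a linear function \<open>\<phi>\<close> on the
  smooth curve \<open>Q = 0\<close> the differential of \<open>Q\<close> is a multiple of \<open>\<phi>\<close>, so by Taylor's formula the
  difference of two critical values is at most quadratic in the distance of the critical points,
  measured along the kernel of \<open>\<phi>\<close>. Many critical values in an interval would therefore require
  more room for the critical points than a bounded region offers.\<close>

lemma critical_values_contain_no_interval:
  fixes Q :: "real ser2"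
  assumes conv: "\<And>R. conv_on Q R"
    and smooth: "\<And>p. eval2 Q p = 0 \<Longrightarrow> eval2 (ser_dx Q) p \<noteq> 0 \<or> eval2 (ser_dy Q) p \<noteq> 0"
    and uv: "u\<^sup>2 + v\<^sup>2 = 1" and c: "c1 < c2" and B: "B > 0"
  shows "\<exists>c. c1 < c \<and> c < c2 \<and> \<not> (\<exists>p. \<bar>fst p\<bar> \<le> B \<and> \<bar>snd p\<bar> \<le> B \<and> eval2 Q p = 0 \<and>
     gradient_det Q (linear_ser u v) p = 0 \<and> u * fst p + v * snd p = c)"
proof (rule ccontr)
  assume "\<not> ?thesis"
  then have all: "\<exists>p. \<bar>fst p\<bar> \<le> B \<and> \<bar>snd p\<bar> \<le> B \<and> eval2 Q p = 0 \<and>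
     gradient_det Q (linear_ser u v) p = 0 \<and> u * fst p + v * snd p = c" if "c1 < c" "c < c2" for c
    using that by blast
  define S where "S = {-B..B} \<times> {-B..B}"
  have S: "compact S" "convex S" by (auto simp: S_def intro: compact_Times convex_Times)
  have SB: "norm (fst p) < B + 1 \<and> norm (snd p) < B + 1" if "p \<in> S" for p
    using that by (auto simp: S_def)
  define Z where "Z = {p \<in> S. eval2 Q p = 0 \<and> gradient_det Q (linear_ser u v) p = 0}"
  \<comment> \<open>on critical points the differential of \<open>Q\<close> is \<open>lam\<close> times the linear function \<open>\<phi>\<close>; \<open>w\<close> is the orthogonal coordinate\<close>
  define lam where "lam = (\<lambda>p. u * eval2 (ser_dx Q) p + v * eval2 (ser_dy Q) p)"
  define \<phi> where "\<phi> = (\<lambda>p::real\<times>real. u * fst p + v * snd p)"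
  define w where "w = (\<lambda>p::real\<times>real. u * snd p - v * fst p)"
  have contQ: "continuous_on S (eval2 Q)" "continuous_on S (eval2 (ser_dx Q))" "continuous_on S (eval2 (ser_dy Q))"
    by (rule eval2_continuous_on[OF _ SB]; simp add: conv conv_on_ser_dx conv_on_ser_dy)+
  have contJ: "continuous_on S (gradient_det Q (linear_ser u v))"
    unfolding gradient_det_linear_ser[abs_def] by (intro continuous_intros contQ)
  have "Z = (S \<inter> eval2 Q -` {0}) \<inter> (S \<inter> gradient_det Q (linear_ser u v) -` {0})"
    by (auto simp: Z_def)
  moreover have "closed (S \<inter> eval2 Q -` {0})" "closed (S \<inter> gradient_det Q (linear_ser u v) -` {0})"
    by (intro continuous_closed_preimage contQ contJ compact_imp_closed S; simp)+
  ultimately have "closed Z" by (simp only: closed_Int)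
  then have compZ: "compact Z"
    using compact_Int_closed[OF S(1) \<open>closed Z\<close>] by (metis (no_types, lifting) Int_absorb1 Z_def mem_Collect_eq subsetI)
  have kr: "v * eval2 (ser_dx Q) p = u * eval2 (ser_dy Q) p" if "p \<in> Z" for p
    using that by (simp add: Z_def gradient_det_linear_ser)
  have gx: "eval2 (ser_dx Q) p = u * lam p" and gy: "eval2 (ser_dy Q) p = v * lam p" if "p \<in> Z" for p
  proof -
    have "u * lam p = u\<^sup>2 * eval2 (ser_dx Q) p + v * (u * eval2 (ser_dy Q) p)"
      by (simp add: lam_def power2_eq_square algebra_simps)
    also have "\<dots> = (u\<^sup>2 + v\<^sup>2) * eval2 (ser_dx Q) p"
      unfolding kr[OF that, symmetric] by (simp add: power2_eq_square algebra_simps)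
    finally show "eval2 (ser_dx Q) p = u * lam p" by (simp add: uv)
    have "v * lam p = u * (v * eval2 (ser_dx Q) p) + v\<^sup>2 * eval2 (ser_dy Q) p"
      by (simp add: lam_def power2_eq_square algebra_simps)
    also have "\<dots> = (u\<^sup>2 + v\<^sup>2) * eval2 (ser_dy Q) p"
      unfolding kr[OF that] by (simp add: power2_eq_square algebra_simps)
    finally show "eval2 (ser_dy Q) p = v * lam p" by (simp add: uv)
  qed
  have lam0: "lam p \<noteq> 0" if "p \<in> Z" for p
    using smooth[of p] gx[OF that] gy[OF that] that by (auto simp: Z_def)
  have memZ: "p \<in> Z \<longleftrightarrow> \<bar>fst p\<bar> \<le> B \<and> \<bar>snd p\<bar> \<le> B \<and> eval2 Q p = 0 \<and>
     gradient_det Q (linear_ser u v) p = 0" for p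
    by (auto simp: Z_def S_def mem_Times_iff abs_le_iff)
  have onto: "\<exists>p. p \<in> Z \<and> \<phi> p = c" if "c1 < c" "c < c2" for c
    using all[OF that] unfolding memZ \<phi>_def by blast
  have "Z \<noteq> {}" using onto[of "(c1 + c2) / 2"] c by auto
  moreover have "continuous_on Z (\<lambda>p. \<bar>lam p\<bar>)"
    unfolding lam_def by (intro continuous_intros continuous_on_subset[OF contQ(2)] continuous_on_subset[OF contQ(3)]) (auto simp: Z_def)
  ultimately obtain p0 where p0: "p0 \<in> Z" "\<And>p. p \<in> Z \<Longrightarrow> \<bar>lam p0\<bar> \<le> \<bar>lam p\<bar>"
    using continuous_attains_inf[OF compZ] by metis
  define m where "m = \<bar>lam p0\<bar>"
  have m: "m > 0" "\<And>p. p \<in> Z \<Longrightarrow> m \<le> \<bar>lam p\<bar>" using p0 lam0 by (auto simp: m_def)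
  obtain C where C: "C > 0" "\<And>p q. p \<in> S \<Longrightarrow> q \<in> S \<Longrightarrow>
    norm (eval2 Q q - eval2 Q p - (eval2 (ser_dx Q) p * fst (q - p) + eval2 (ser_dy Q) p * snd (q - p))) \<le> C * norm (q - p) ^ 2"
    using eval2_quadratic_remainder[OF conv S SB] by blast
  have quad: "m * \<bar>\<phi> q - \<phi> p\<bar> \<le> C * ((\<phi> q - \<phi> p)\<^sup>2 + (w q - w p)\<^sup>2)" if pq: "p \<in> Z" "q \<in> Z" for p q
  proof -
    have inS: "p \<in> S" "q \<in> S" and z: "eval2 Q p = 0" "eval2 Q q = 0" using pq by (auto simp: Z_def)
    have "eval2 (ser_dx Q) p * fst (q - p) + eval2 (ser_dy Q) p * snd (q - p) = lam p * (\<phi> q - \<phi> p)"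
      by (simp add: gx[OF pq(1)] gy[OF pq(1)] \<phi>_def algebra_simps)
    with C(2)[OF inS] z have "\<bar>lam p * (\<phi> q - \<phi> p)\<bar> \<le> C * norm (q - p) ^ 2" by simp
    moreover have "norm (q - p) ^ 2 = (\<phi> q - \<phi> p)\<^sup>2 + (w q - w p)\<^sup>2"
    proof -
      have "(\<phi> q - \<phi> p)\<^sup>2 + (w q - w p)\<^sup>2 = (u\<^sup>2 + v\<^sup>2) * ((fst q - fst p)\<^sup>2 + (snd q - snd p)\<^sup>2)"
        by (simp add: \<phi>_def w_def power2_eq_square algebra_simps)
      then show ?thesis by (simp add: uv norm_prod_def)
    qed
    moreover have "m * \<bar>\<phi> q - \<phi> p\<bar> \<le> \<bar>lam p * (\<phi> q - \<phi> p)\<bar>"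
      unfolding abs_mult by (intro mult_right_mono m(2) pq) simp
    ultimately show ?thesis by simp
  qed
  \<comment> \<open>at differences of critical values up to \<open>len\<close>, half of the linear term dominates the square of the difference\<close>
  define len where "len = min ((c2 - c1) / 2) (m / (2 * C))"
  have len: "len > 0" "c1 + len < c2" "C * len \<le> m / 2"
  proof -
    have "m / (2 * C) > 0" using m C by simp
    then show "len > 0" using c by (simp add: len_def)
    have "len \<le> (c2 - c1) / 2" unfolding len_def by (rule min.cobounded1)
    then show "c1 + len < c2" using c by (simp add: field_simps)
    have "len \<le> m / (2 * C)" unfolding len_def by (rule min.cobounded2)
    then show "C * len \<le> m / 2" using C(1) by (simp add: field_simps)
  qed
  \<comment> \<open>\<open>N + 1\<close> critical values at mutual distance about \<open>len / N\<close> have critical points at mutual distance of order \<open>N^(-1/2)\<close> in direction \<open>w\<close>, too much for a region of width \<open>4 B\<close> if \<open>N\<close> is large\<close>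
  obtain N :: nat where N: "max 2 (64 * C * B\<^sup>2 / (m * len)) < real N"
    using reals_Archimedean2 by blast
  define \<eta> where "\<eta> = len / (real N + 2)"
  have \<eta>: "\<eta> > 0" using len by (simp add: \<eta>_def)
  define ci where "ci = (\<lambda>i::nat. c1 + \<eta> * (real i + 1))"
  have ci: "c1 < ci i" "ci i < c1 + len" if "i \<le> N" for i
  proof -
    show "c1 < ci i" using \<eta> by (simp add: ci_def)
    have "\<eta> * (real i + 1) < \<eta> * (real N + 2)" using \<eta> that by (intro mult_strict_left_mono) auto
    also have "\<dots> = len" by (simp add: \<eta>_def)
    finally show "ci i < c1 + len" by (simp add: ci_def)
  qed
  have "\<exists>p. p \<in> Z \<and> \<phi> p = ci i" if "i \<le> N" for i
    by (rule onto) (use ci[OF that] len in auto)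
  then obtain p where p: "\<And>i. i \<le> N \<Longrightarrow> p i \<in> Z" "\<And>i. i \<le> N \<Longrightarrow> \<phi> (p i) = ci i" by metis
  define d where "d = sqrt (m * \<eta> / (2 * C))"
  have d: "d > 0" using m C \<eta> by (simp add: d_def)
  have "real N * d \<le> 2 * (2 * B)"
  proof (rule separated_points_bound[OF d])
    fix i assume i: "i \<le> N"
    have "u\<^sup>2 \<le> 1" "v\<^sup>2 \<le> 1" using uv zero_le_power2[of u] zero_le_power2[of v] by linarith+
    then have uv1: "\<bar>u\<bar> \<le> 1" "\<bar>v\<bar> \<le> 1" by (simp_all add: abs_square_le_1)
    have "\<bar>fst (p i)\<bar> \<le> B" "\<bar>snd (p i)\<bar> \<le> B" using p(1)[OF i] by (auto simp: Z_def S_def)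
    then have "\<bar>u * snd (p i)\<bar> \<le> 1 * B" "\<bar>v * fst (p i)\<bar> \<le> 1 * B"
      unfolding abs_mult using uv1 by (intro mult_mono; simp)+
    then show "\<bar>w (p i)\<bar> \<le> 2 * B" unfolding w_def by linarith
  next
    fix i k assume ik: "i < k" "k \<le> N"
    have D: "\<phi> (p k) - \<phi> (p i) = \<eta> * (real k - real i)" using p(2) ik by (simp add: ci_def algebra_simps)
    have D1: "\<eta> \<le> \<phi> (p k) - \<phi> (p i)" unfolding D using \<eta> ik by simp
    have D2: "\<phi> (p k) - \<phi> (p i) \<le> len" using ci[of k] ci[of i] p(2) ik by simp
    let ?D = "\<phi> (p k) - \<phi> (p i)"
    have "C * ?D\<^sup>2 = C * ?D * ?D" by (simp add: power2_eq_square)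
    also have "\<dots> \<le> (C * len) * ?D" using D1 D2 \<eta> C(1) by (intro mult_right_mono mult_left_mono) auto
    also have "\<dots> \<le> (m / 2) * ?D" using D1 \<eta> by (intro mult_right_mono len) auto
    finally have "m * ?D \<le> (m / 2) * ?D + C * (w (p k) - w (p i))\<^sup>2"
      using quad[of "p i" "p k"] p(1) ik D1 \<eta> by (simp add: distrib_left)
    then have "(m / 2) * ?D \<le> C * (w (p k) - w (p i))\<^sup>2" by simp
    moreover have "(m / 2) * \<eta> \<le> (m / 2) * ?D" using D1 m by simp
    ultimately have "(m / 2) * \<eta> \<le> C * (w (p k) - w (p i))\<^sup>2" by linarith
    then have "m * \<eta> / (2 * C) \<le> (w (p k) - w (p i))\<^sup>2" using C(1) by (simp add: field_simps)
    then have "d \<le> sqrt ((w (p k) - w (p i))\<^sup>2)" unfolding d_def by (rule real_sqrt_le_mono)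
    then show "d \<le> \<bar>w (p k) - w (p i)\<bar>" by simp
  qed
  then have "(real N * d)\<^sup>2 \<le> (4 * B)\<^sup>2" using d by (intro power_mono) auto
  then have "(real N)\<^sup>2 * (m * \<eta> / (2 * C)) \<le> 16 * B\<^sup>2"
    using m C \<eta> by (simp add: power_mult_distrib d_def)
  moreover have "real N / 2 * (m * len / (2 * C)) \<le> (real N)\<^sup>2 * (m * \<eta> / (2 * C))"
  proof -
    have "real N * (real N + 2) \<le> 2 * (real N)\<^sup>2" using N by (simp add: power2_eq_square)
    then have "real N / 2 \<le> (real N)\<^sup>2 / (real N + 2)" by (simp add: field_simps)
    then have "real N / 2 * (m * len / (2 * C)) \<le> (real N)\<^sup>2 / (real N + 2) * (m * len / (2 * C))"
      using m len C by (intro mult_right_mono) auto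
    then show ?thesis by (simp add: \<eta>_def)
  qed
  ultimately have "real N * (m * len) \<le> 64 * C * B\<^sup>2"
    using C(1) by (simp add: field_simps)
  then have "real N \<le> 64 * C * B\<^sup>2 / (m * len)" using m len by (simp add: pos_le_divide_eq)
  with N show False by simp
qed

text \<open>A bounded function that is continuous on the right of \<open>0\<close> takes, arbitrarily near \<open>0\<close>, all
  values between two of its cluster values. So the cluster values form an interval, which can only
  be a point here.\<close>

lemma tendsto_at_right_if_cluster_values_contain_no_interval:
  fixes c :: "real \<Rightarrow> real"
  assumes \<delta>: "\<delta> > 0" and cont: "\<And>s. 0 < s \<Longrightarrow> s < \<delta> \<Longrightarrow> isCont c s"
    and bounded: "\<And>s. 0 < s \<Longrightarrow> s < \<delta> \<Longrightarrow> \<bar>c s\<bar> \<le> B"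
    and cluster: "\<And>s l. (\<And>n. 0 < s n) \<Longrightarrow> (\<And>n. s n < \<delta>) \<Longrightarrow> s \<longlonglongrightarrow> 0 \<Longrightarrow> (\<lambda>n. c (s n)) \<longlonglongrightarrow> l \<Longrightarrow> Z l"
    and thin: "\<And>x y. x < y \<Longrightarrow> \<exists>z. x < z \<and> z < y \<and> \<not> Z z"
  shows "\<exists>l. Z l \<and> (c \<longlongrightarrow> l) (at_right 0)"
proof -
  have one_side: "(\<forall>\<^sub>F s in at_right 0. c s \<le> z) \<or> (\<forall>\<^sub>F s in at_right 0. z \<le> c s)" if "\<not> Z z" for z
  proof (rule ccontr)
    assume "\<not> ?thesis"
    then have *: "\<not> (\<forall>\<^sub>F s in at_right 0. c s \<le> z)" "\<not> (\<forall>\<^sub>F s in at_right 0. z \<le> c s)" by auto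
    have "\<exists>s. 0 < s \<and> s < \<delta> \<and> s < inverse (real (Suc n)) \<and> c s = z" for n
    proof -
      let ?e = "min \<delta> (inverse (real (Suc n)))"
      have e: "?e > 0" using \<delta> by simp
      obtain a where a: "0 < a" "a < ?e" "z < c a"
        using *(1) e unfolding eventually_at_right_field by (meson not_le)
      obtain b where b: "0 < b" "b < ?e" "c b < z"
        using *(2) e unfolding eventually_at_right_field by (meson not_le)
      have ab: "0 < s \<and> s < ?e" if "s \<in> closed_segment a b" for s
        using that a b by (auto simp: closed_segment_eq_real_ivl split: if_splits)
      have "connected (c ` closed_segment a b)"
        by (intro connected_continuous_image continuous_at_imp_continuous_on ballI cont connected_segment) (use ab in auto)
      moreover have "c a \<in> c ` closed_segment a b" "c b \<in> c ` closed_segment a b" by auto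
      ultimately have "z \<in> c ` closed_segment a b"
        using a b by (meson connectedD_interval less_imp_le)
      then show ?thesis using ab by fastforce
    qed
    then obtain s where s: "\<And>n. 0 < s n" "\<And>n. s n < \<delta>" "\<And>n. s n < inverse (real (Suc n))" "\<And>n. c (s n) = z" by metis
    have "s \<longlonglongrightarrow> 0"
      by (rule Lim_null_comparison[OF _ LIMSEQ_inverse_real_of_nat]) (use s in \<open>auto intro!: always_eventually simp: less_imp_le\<close>)
    from cluster[OF s(1,2) this, of z] s(4) that show False by simp
  qed
  define s where "s = (\<lambda>n. \<delta> / real (Suc (Suc n)))"
  have s: "0 < s n" "s n < \<delta>" for n using \<delta> by (auto simp: s_def field_simps intro!: add_pos_nonneg)
  have s0: "s \<longlonglongrightarrow> 0" unfolding s_def by (intro filterlim_compose[OF lim_const_over_n[of \<delta>], of "\<lambda>n. Suc (Suc n)"] filterlim_Suc filterlim_compose[OF filterlim_Suc])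
  have "bounded (range (\<lambda>n. c (s n)))" using bounded s by (auto simp: bounded_iff)
  then obtain l r where r: "strict_mono (r :: nat \<Rightarrow> nat)" and l: "(\<lambda>n. c (s (r n))) \<longlonglongrightarrow> l"
    using bounded_imp_convergent_subsequence[unfolded o_def] by blast
  have sr: "(\<lambda>n. s (r n)) \<longlonglongrightarrow> 0" using LIMSEQ_subseq_LIMSEQ[OF s0 r] by (simp add: o_def)
  have Zl: "Z l" by (rule cluster[OF _ _ sr l]) (use s in auto)
  have fl: "filterlim (\<lambda>n. s (r n)) (at_right 0) sequentially"
    using sr s(1) by (auto simp: filterlim_at less_imp_neq[THEN not_sym])
  have "(c \<longlongrightarrow> l) (at_right 0)"
  proof (rule order_tendstoI)
    fix x assume "x < l"
    then obtain z where z: "x < z" "z < l" "\<not> Z z" using thin by blast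
    have "\<not> (\<forall>\<^sub>F s in at_right 0. c s \<le> z)"
    proof
      assume "\<forall>\<^sub>F s in at_right 0. c s \<le> z"
      then have "\<forall>\<^sub>F n in sequentially. c (s (r n)) \<le> z" using fl by (rule eventually_compose_filterlim)
      moreover have "\<forall>\<^sub>F n in sequentially. z < c (s (r n))" by (rule order_tendstoD(1)[OF l z(2)])
      ultimately have "\<forall>\<^sub>F n in sequentially. False" by eventually_elim simp
      then show False by simp
    qed
    with one_side[OF z(3)] have "\<forall>\<^sub>F s in at_right 0. z \<le> c s" by blast
    then show "\<forall>\<^sub>F s in at_right 0. x < c s" by (rule eventually_mono) (use z in simp)
  next
    fix x assume "l < x"
    then obtain z where z: "l < z" "z < x" "\<not> Z z" using thin by blast
    have "\<not> (\<forall>\<^sub>F s in at_right 0. z \<le> c s)"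
    proof
      assume "\<forall>\<^sub>F s in at_right 0. z \<le> c s"
      then have "\<forall>\<^sub>F n in sequentially. z \<le> c (s (r n))" using fl by (rule eventually_compose_filterlim)
      moreover have "\<forall>\<^sub>F n in sequentially. c (s (r n)) < z" by (rule order_tendstoD(2)[OF l z(1)])
      ultimately have "\<forall>\<^sub>F n in sequentially. False" by eventually_elim simp
      then show False by simp
    qed
    with one_side[OF z(3)] have "\<forall>\<^sub>F s in at_right 0. c s \<le> z" by blast
    then show "\<forall>\<^sub>F s in at_right 0. c s < x" by (rule eventually_mono) (use z in simp)
  qed
  with Zl show ?thesis by blast
qed

section \<open>Supporting lines of the rescaled ovals\<close>

definition support_value :: "real \<Rightarrow> real \<Rightarrow> (real \<times> real) set \<Rightarrow> real" where
  "support_value u v S = Sup ((\<lambda>p. u * fst p + v * snd p) ` S)"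

lemma linear_diff_le_dist:
  assumes "\<bar>u\<bar> \<le> 1" "\<bar>v\<bar> \<le> 1"
  shows "\<bar>(u * fst p + v * snd p) - (u * fst q + v * snd q)\<bar> \<le> 2 * dist p (q :: real \<times> real)"
proof -
  have d: "\<bar>fst p - fst q\<bar> \<le> dist p q" "\<bar>snd p - snd q\<bar> \<le> dist p q"
    using dist_fst_le[of p q] dist_snd_le[of p q] by (simp_all add: dist_real_def)
  have "\<bar>u * (fst p - fst q)\<bar> \<le> 1 * dist p q" "\<bar>v * (snd p - snd q)\<bar> \<le> 1 * dist p q"
    unfolding abs_mult using assms d by (intro mult_mono; simp)+
  moreover have "(u * fst p + v * snd p) - (u * fst q + v * snd q) = u * (fst p - fst q) + v * (snd p - snd q)"
    by (simp add: algebra_simps)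
  ultimately show ?thesis by linarith
qed

lemma support_value_eq_max:
  assumes "p \<in> S" "\<And>q. q \<in> S \<Longrightarrow> u * fst q + v * snd q \<le> u * fst p + v * snd p"
  shows "support_value u v S = u * fst p + v * snd p"
  unfolding support_value_def by (rule cSup_eq_maximum) (use assms in auto)

context oval_family
begin

lemma K_support:
  assumes "0 < s" "s < \<delta>"
  obtains p where "p \<in> K s" "support_value u v (K s) = u * fst p + v * snd p"
    "\<And>q. q \<in> K s \<Longrightarrow> u * fst q + v * snd q \<le> u * fst p + v * snd p"
    "gradient_det (P s) (linear_ser u v) p = 0"
proof -
  obtain p where p: "p \<in> K s" "\<And>q. q \<in> K s \<Longrightarrow> eval2 (linear_ser u v) q \<le> eval2 (linear_ser u v) p"
    "gradient_det (P s) (linear_ser u v) p = 0"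
    by (rule K_max[OF assms conv_on_linear_ser]) blast
  then show ?thesis using that support_value_eq_max[of p "K s" u v] by (simp add: eval2_linear_ser)
qed

text \<open>The support function is Lipschitz for the Hausdorff distance.\<close>

lemma isCont_support_value:
  assumes s: "0 < s" "s < \<delta>" and uv: "\<bar>u\<bar> \<le> 1" "\<bar>v\<bar> \<le> 1"
  shows "isCont (\<lambda>s. support_value u v (K s)) s"
  unfolding isCont_def
proof (rule tendstoI)
  fix \<epsilon> :: real assume \<epsilon>: "\<epsilon> > 0"
  have "\<forall>\<^sub>F s' in at s. s' \<in> {0<..<\<delta>}"
    using s by (intro eventually_at_in_open') auto
  moreover have "\<forall>\<^sub>F s' in at s. hausdorff_close (\<epsilon> / 4) (K s') (K s)"
    using K_cont[OF s, of "\<epsilon> / 4"] \<epsilon> by simp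
  ultimately show "\<forall>\<^sub>F s' in at s. dist (support_value u v (K s')) (support_value u v (K s)) < \<epsilon>"
  proof eventually_elim
    case (elim s')
    then have s': "0 < s'" "s' < \<delta>" and h: "hausdorff_close (\<epsilon> / 4) (K s') (K s)" by auto
    obtain p where p: "p \<in> K s" "support_value u v (K s) = u * fst p + v * snd p"
      "\<And>q. q \<in> K s \<Longrightarrow> u * fst q + v * snd q \<le> u * fst p + v * snd p"
      by (rule K_support[OF s, where u = u and v = v]) blast
    obtain p' where p': "p' \<in> K s'" "support_value u v (K s') = u * fst p' + v * snd p'"
      "\<And>q. q \<in> K s' \<Longrightarrow> u * fst q + v * snd q \<le> u * fst p' + v * snd p'"
      by (rule K_support[OF s', where u = u and v = v]) blast
    obtain q where q: "q \<in> K s" "dist p' q < \<epsilon> / 4" using h p'(1) by (auto simp: hausdorff_close_def)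
    obtain q' where q': "q' \<in> K s'" "dist q' p < \<epsilon> / 4" using h p(1) by (auto simp: hausdorff_close_def)
    have "\<bar>support_value u v (K s') - support_value u v (K s)\<bar> \<le> \<epsilon> / 2"
      unfolding p(2) p'(2)
      using linear_diff_le_dist[OF uv, of p' q] linear_diff_le_dist[OF uv, of q' p]
        p(3)[OF q(1)] p'(3)[OF q'(1)] q(2) q'(2) by linarith
    then show ?case using \<epsilon> by (simp add: dist_real_def)
  qed
qed

text \<open>The supporting lines of the rescaled ovals in a coordinate direction converge: their cluster
  values are critical values of the coordinate on the limiting curve.\<close>

lemma support_value_asymptotics:
  assumes smooth: "\<And>p. eval2 (L 1) p = 0 \<Longrightarrow> eval2 (ser_dx (L 1)) p \<noteq> 0 \<or> eval2 (ser_dy (L 1)) p \<noteq> 0"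
    and uv: "u\<^sup>2 + v\<^sup>2 = 1" "u = 0 \<or> v = 0"
    and hom: "\<And>s X Y. u * (s ^ \<alpha> * X) + v * (s ^ \<beta> * Y) = s ^ \<gamma> * (u * X + v * Y)"
  shows "\<exists>p. eval2 (L 1) p = 0 \<and> gradient_det (L 1) (linear_ser u v) p = 0 \<and>
    ((\<lambda>s. support_value u v (K s) / s ^ \<gamma>) \<longlongrightarrow> u * fst p + v * snd p) (at_right 0)"
proof -
  have "u\<^sup>2 \<le> 1" "v\<^sup>2 \<le> 1" using uv(1) zero_le_power2[of u] zero_le_power2[of v] by linarith+
  then have uv1: "\<bar>u\<bar> \<le> 1" "\<bar>v\<bar> \<le> 1" by (simp_all add: abs_square_le_1)
  obtain B where B: "B > 0" and "\<forall>\<^sub>F s in at_right 0. \<forall>p\<in>K s. \<bar>fst p\<bar> \<le> B * s ^ \<alpha> \<and> \<bar>snd p\<bar> \<le> B * s ^ \<beta>"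
    using K_weighted_bound by blast
  then obtain \<delta>1 where \<delta>1: "\<delta>1 > 0" "\<And>s p. 0 < s \<Longrightarrow> s < \<delta>1 \<Longrightarrow> p \<in> K s \<Longrightarrow> \<bar>fst p\<bar> \<le> B * s ^ \<alpha> \<and> \<bar>snd p\<bar> \<le> B * s ^ \<beta>"
    unfolding eventually_at_right_field by auto
  define \<delta>' where "\<delta>' = min \<delta> \<delta>1"
  have \<delta>': "\<delta>' > 0" using \<delta> \<delta>1 by (simp add: \<delta>'_def)
  have XY: "\<bar>fst p / s ^ \<alpha>\<bar> \<le> B \<and> \<bar>snd p / s ^ \<beta>\<bar> \<le> B" if "0 < s" "s < \<delta>'" "p \<in> K s" for s p
    using \<delta>1(2)[OF that(1) _ that(3)] that by (auto simp: \<delta>'_def abs_divide divide_simps)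
  have hom': "(u * fst p + v * snd p) / s ^ \<gamma> = u * (fst p / s ^ \<alpha>) + v * (snd p / s ^ \<beta>)" if "0 < s" for s p
    using hom[of s "fst p / s ^ \<alpha>" "snd p / s ^ \<beta>"] that by simp
  \<comment> \<open>the critical values in the region that contains the rescaled ovals\<close>
  define Zp where "Zp = (\<lambda>l. \<exists>p. \<bar>fst p\<bar> \<le> B \<and> \<bar>snd p\<bar> \<le> B \<and> eval2 (L 1) p = 0 \<and>
     gradient_det (L 1) (linear_ser u v) p = 0 \<and> u * fst p + v * snd p = l)"
  have "\<exists>l. Zp l \<and> ((\<lambda>s. support_value u v (K s) / s ^ \<gamma>) \<longlongrightarrow> l) (at_right 0)"
  proof (rule tendsto_at_right_if_cluster_values_contain_no_interval[OF \<delta>'])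
    show "isCont (\<lambda>s. support_value u v (K s) / s ^ \<gamma>) s" if "0 < s" "s < \<delta>'" for s
      by (intro continuous_intros isCont_support_value[OF _ _ uv1]) (use that in \<open>auto simp: \<delta>'_def\<close>)
    show "\<bar>support_value u v (K s) / s ^ \<gamma>\<bar> \<le> 2 * B" if s: "0 < s" "s < \<delta>'" for s
    proof -
      have s': "s < \<delta>" using s by (simp add: \<delta>'_def)
      obtain p where p: "p \<in> K s" "support_value u v (K s) = u * fst p + v * snd p"
        by (rule K_support[OF s(1) s', where u = u and v = v]) blast
      have le: "\<bar>u * (fst p / s ^ \<alpha>)\<bar> \<le> 1 * B" "\<bar>v * (snd p / s ^ \<beta>)\<bar> \<le> 1 * B"
        unfolding abs_mult using XY[OF s p(1)] uv1 B by (intro mult_mono; simp)+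
      show ?thesis unfolding p(2) hom'[OF s(1)]
        by (rule order_trans[OF abs_triangle_ineq order_trans[OF add_mono[OF le]]]) simp
    qed
    show "\<exists>z. x < z \<and> z < y \<and> \<not> Zp z" if "x < y" for x y
      unfolding Zp_def by (rule critical_values_contain_no_interval[OF conv_L smooth uv(1) that B])
    show "Zp l" if s: "\<And>n. 0 < s n" "\<And>n. s n < \<delta>'" "s \<longlonglongrightarrow> 0"
      and l: "(\<lambda>n. support_value u v (K (s n)) / s n ^ \<gamma>) \<longlonglongrightarrow> l" for s :: "nat \<Rightarrow> real" and l
    proof -
      have s\<delta>: "s n < \<delta>" for n using s(2)[of n] by (simp add: \<delta>'_def)
      have "\<exists>p. p \<in> K (s n) \<and> support_value u v (K (s n)) = u * fst p + v * snd p \<and>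
         gradient_det (P (s n)) (linear_ser u v) p = 0" for n
        by (rule K_support[OF s(1) s\<delta>, where u = u and v = v]) blast
      then obtain p where p: "\<And>n. p n \<in> K (s n)" "\<And>n. support_value u v (K (s n)) = u * fst (p n) + v * snd (p n)"
         "\<And>n. gradient_det (P (s n)) (linear_ser u v) (p n) = 0" by metis
      define X Y where "X = (\<lambda>n. fst (p n) / s n ^ \<alpha>)" and "Y = (\<lambda>n. snd (p n) / s n ^ \<beta>)"
      have pXY: "p n = (s n ^ \<alpha> * X n, s n ^ \<beta> * Y n)" for n
        using s(1)[of n] by (simp add: X_def Y_def)
      have bd: "\<bar>X n\<bar> \<le> B" "\<bar>Y n\<bar> \<le> B" for n using XY[OF s(1,2) p(1)] by (auto simp: X_def Y_def)
      have "norm (X n, Y n) \<le> 2 * B" for n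
        using norm_Pair_le[of "X n" "Y n"] bd[of n] by simp
      then obtain p0 r where r: "strict_mono (r :: nat \<Rightarrow> nat)" and p0: "(\<lambda>n. (X (r n), Y (r n))) \<longlonglongrightarrow> p0"
        by (rule bounded_pair_convergent_subsequence[of "\<lambda>n. (X n, Y n)"]) auto
      obtain X0 Y0 where p0': "p0 = (X0, Y0)" by force
      have lims: "(\<lambda>n. X (r n)) \<longlonglongrightarrow> X0" "(\<lambda>n. Y (r n)) \<longlonglongrightarrow> Y0"
        using tendsto_fst[OF p0] tendsto_snd[OF p0] by (simp_all add: p0')
      have sr: "(\<lambda>n. s (r n)) \<longlonglongrightarrow> 0" using LIMSEQ_subseq_LIMSEQ[OF s(3) r] by (simp add: o_def)
      have "\<forall>\<^sub>F n in sequentially. s (r n) > 0" using s(1) by simp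
      note T = sr this lims tendsto_const[of "1::real"]
      have "eval2 (L 1) (X0, Y0) = 0"
      proof (rule LIMSEQ_unique[OF scaled_tendsto[OF T]])
        have "eval2 (P (1 * s (r n))) (s (r n) ^ \<alpha> * X (r n), s (r n) ^ \<beta> * Y (r n)) / s (r n) ^ \<Omega> = 0" for n
          using K_zero[OF s(1) s\<delta> p(1), of "r n"] by (simp add: pXY)
        then show "(\<lambda>n. eval2 (P (1 * s (r n))) (s (r n) ^ \<alpha> * X (r n), s (r n) ^ \<beta> * Y (r n)) / s (r n) ^ \<Omega>) \<longlonglongrightarrow> 0"
          by (simp only: tendsto_const)
      qed
      moreover have "gradient_det (L 1) (linear_ser u v) (X0, Y0) = 0"
      proof (rule LIMSEQ_unique)
        show "(\<lambda>n. v * (s (r n) ^ \<alpha> * eval2 (ser_dx (P (1 * s (r n)))) (s (r n) ^ \<alpha> * X (r n), s (r n) ^ \<beta> * Y (r n)) / s (r n) ^ \<Omega>) -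
            u * (s (r n) ^ \<beta> * eval2 (ser_dy (P (1 * s (r n)))) (s (r n) ^ \<alpha> * X (r n), s (r n) ^ \<beta> * Y (r n)) / s (r n) ^ \<Omega>))
            \<longlonglongrightarrow> gradient_det (L 1) (linear_ser u v) (X0, Y0)"
          unfolding gradient_det_linear_ser
          by (intro tendsto_diff tendsto_mult tendsto_const scaled_dx_tendsto[OF T] scaled_dy_tendsto[OF T])
        have "v * (s (r n) ^ \<alpha> * eval2 (ser_dx (P (1 * s (r n)))) (s (r n) ^ \<alpha> * X (r n), s (r n) ^ \<beta> * Y (r n)) / s (r n) ^ \<Omega>) -
            u * (s (r n) ^ \<beta> * eval2 (ser_dy (P (1 * s (r n)))) (s (r n) ^ \<alpha> * X (r n), s (r n) ^ \<beta> * Y (r n)) / s (r n) ^ \<Omega>) = 0" for n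
          \<comment> \<open>the two derivatives are scaled by different factors, but only one of them occurs\<close>
          using p(3)[of "r n"] uv(2) by (auto simp: gradient_det_linear_ser pXY)
        then show "(\<lambda>n. v * (s (r n) ^ \<alpha> * eval2 (ser_dx (P (1 * s (r n)))) (s (r n) ^ \<alpha> * X (r n), s (r n) ^ \<beta> * Y (r n)) / s (r n) ^ \<Omega>) -
            u * (s (r n) ^ \<beta> * eval2 (ser_dy (P (1 * s (r n)))) (s (r n) ^ \<alpha> * X (r n), s (r n) ^ \<beta> * Y (r n)) / s (r n) ^ \<Omega>))
            \<longlonglongrightarrow> 0" by (simp only: tendsto_const)
      qed
      moreover have "u * X0 + v * Y0 = l"
      proof (rule LIMSEQ_unique)
        show "(\<lambda>n. u * X (r n) + v * Y (r n)) \<longlonglongrightarrow> u * X0 + v * Y0"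
          by (intro tendsto_intros lims)
        have "support_value u v (K (s n)) / s n ^ \<gamma> = u * X n + v * Y n" for n
          unfolding p(2) hom'[OF s(1)] X_def Y_def ..
        then show "(\<lambda>n. u * X (r n) + v * Y (r n)) \<longlonglongrightarrow> l"
          using LIMSEQ_subseq_LIMSEQ[OF l r] by (simp add: o_def)
      qed
      moreover have "\<bar>X0\<bar> \<le> B" "\<bar>Y0\<bar> \<le> B"
        using LIMSEQ_le_const2[OF tendsto_rabs[OF lims(1)], of B] LIMSEQ_le_const2[OF tendsto_rabs[OF lims(2)], of B] bd by auto
      ultimately show "Zp l" unfolding Zp_def by (intro exI[of _ "(X0, Y0)"]) auto
    qed
  qed
  then show ?thesis unfolding Zp_def by blast
qed

end

section \<open>Curves transversal to spheres\<close>

lemma complexify_ser_dx: "ser_dx (complexify a) = complexify (ser_dx a)"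
  by (intro ext) (simp add: ser_dx_def complexify_def)

lemma complexify_ser_dy: "ser_dy (complexify a) = complexify (ser_dy a)"
  by (intro ext) (simp add: ser_dy_def complexify_def)

lemma norm_components_le:
  fixes h :: "'a::real_normed_vector \<times> 'b::real_normed_vector"
  shows "norm (fst h) \<le> norm h" "norm (snd h) \<le> norm h"
  using norm_fst_le[of "fst h" "snd h"] norm_snd_le[of "snd h" "fst h"] by simp_all

lemma eval2_along_line:
  fixes a :: "'a::{real_normed_field,banach} ser2"
  assumes "conv_on a R" "norm (x + w * v1) < R" "norm (y + w * v2) < R"
  shows "((\<lambda>w. eval2 a (x + w * v1, y + w * v2)) has_field_derivative
    eval2 (ser_dx a) (x + w * v1, y + w * v2) * v1 + eval2 (ser_dy a) (x + w * v1, y + w * v2) * v2) (at w)"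
proof -
  have line: "((\<lambda>w. (x + w * v1, y + w * v2)) has_derivative (\<lambda>h. (h * v1, h * v2))) (at w)"
    by (auto intro!: derivative_eq_intros)
  have "((\<lambda>w. eval2 a (x + w * v1, y + w * v2)) has_derivative
    (\<lambda>h. eval2 (ser_dx a) (x + w * v1, y + w * v2) * fst (h * v1, h * v2) +
         eval2 (ser_dy a) (x + w * v1, y + w * v2) * snd (h * v1, h * v2))) (at w)"
    by (rule has_derivative_compose[OF line eval2_has_derivative[OF assms(1)]]) (use assms in auto)
  then show ?thesis
    unfolding has_field_derivative_def
    by (rule has_derivative_eq_rhs) (simp add: fun_eq_iff algebra_simps)
qed

text \<open>Strict differentiability: both points vary, so that the difference of two zeros can be estimated.\<close>

lemma eval2_strictly_differentiable_at_0:
  fixes a :: "'a::{real_normed_field,banach,heine_borel} ser2"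
  assumes a: "conv_on a R" and R: "R > 0" and \<epsilon>: "\<epsilon> > 0"
  shows "\<exists>r>0. \<forall>p q. norm p < r \<longrightarrow> norm q < r \<longrightarrow>
    norm (eval2 a q - eval2 a p - (a 1 0 * fst (q - p) + a 0 1 * snd (q - p))) \<le> \<epsilon> * norm (q - p)"
proof -
  define S where "S = cball (0 :: 'a \<times> 'a) (R / 2)"
  have S: "compact S" "convex S" by (simp_all add: S_def)
  have SR: "norm (fst p) < R \<and> norm (snd p) < R" if "p \<in> S" for p
    using norm_cball_less[of p "R / 2" R] that R by (simp add: S_def)
  obtain C where C: "C > 0" "\<And>p q. p \<in> S \<Longrightarrow> q \<in> S \<Longrightarrow>
    norm (eval2 a q - eval2 a p - (eval2 (ser_dx a) p * fst (q - p) + eval2 (ser_dy a) p * snd (q - p))) \<le> C * norm (q - p) ^ 2"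
    using eval2_quadratic_remainder[OF a S SR] by blast
  obtain M1 where M1: "M1 > 0" "\<And>p q. p \<in> S \<Longrightarrow> q \<in> S \<Longrightarrow> norm (eval2 (ser_dx a) q - eval2 (ser_dx a) p) \<le> M1 * norm (q - p)"
    using eval2_lipschitz[OF conv_on_ser_dx[OF a] S SR] by blast
  obtain M2 where M2: "M2 > 0" "\<And>p q. p \<in> S \<Longrightarrow> q \<in> S \<Longrightarrow> norm (eval2 (ser_dy a) q - eval2 (ser_dy a) p) \<le> M2 * norm (q - p)"
    using eval2_lipschitz[OF conv_on_ser_dy[OF a] S SR] by blast
  define r where "r = min (R / 2) (\<epsilon> / (2 * C + M1 + M2))"
  have den: "2 * C + M1 + M2 > 0" using C M1 M2 by simp
  have r: "r > 0" using R \<epsilon> den by (simp add: r_def)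
  have "r \<le> \<epsilon> / (2 * C + M1 + M2)" unfolding r_def by (rule min.cobounded2)
  then have r\<epsilon>: "(2 * C + M1 + M2) * r \<le> \<epsilon>" using den by (simp add: pos_le_divide_eq mult.commute)
  have rR: "r \<le> R / 2" unfolding r_def by (rule min.cobounded1)
  have "norm (eval2 a q - eval2 a p - (a 1 0 * fst (q - p) + a 0 1 * snd (q - p))) \<le> \<epsilon> * norm (q - p)"
    if p: "norm p < r" and q: "norm q < r" for p q
  proof -
    have S': "p \<in> S" "q \<in> S" "(0, 0) \<in> S" using p q rR R by (auto simp: S_def zero_prod_def[symmetric])
    have h: "norm (fst (q - p)) \<le> norm (q - p)" "norm (snd (q - p)) \<le> norm (q - p)"
      by (rule norm_components_le)+
    have pr: "norm (p - (0, 0)) < r" using p by (simp add: zero_prod_def[symmetric])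
    have d1: "norm (eval2 (ser_dx a) p - a 1 0) \<le> M1 * r"
      using M1(2)[OF S'(3,1)] pr M1(1) by (simp add: eval2_zero ser_dx_def) (meson mult_left_mono less_imp_le order_trans)
    have d2: "norm (eval2 (ser_dy a) p - a 0 1) \<le> M2 * r"
      using M2(2)[OF S'(3,1)] pr M2(1) by (simp add: eval2_zero ser_dy_def) (meson mult_left_mono less_imp_le order_trans)
    have qp: "norm (q - p) \<le> 2 * r" using norm_triangle_ineq4[of q p] p q by simp
    have "eval2 a q - eval2 a p - (a 1 0 * fst (q - p) + a 0 1 * snd (q - p)) =
      (eval2 a q - eval2 a p - (eval2 (ser_dx a) p * fst (q - p) + eval2 (ser_dy a) p * snd (q - p))) +
      ((eval2 (ser_dx a) p - a 1 0) * fst (q - p) + (eval2 (ser_dy a) p - a 0 1) * snd (q - p))"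
      by (simp add: algebra_simps)
    also have "norm \<dots> \<le> C * norm (q - p) ^ 2 + (M1 * r * norm (q - p) + M2 * r * norm (q - p))"
      using C(2)[OF S'(1,2)] d1 d2 h M1(1) M2(1) r
      by (intro order_trans[OF norm_triangle_ineq] add_mono; (unfold norm_mult)?; (intro mult_mono)?; simp)
    also have "C * norm (q - p) ^ 2 \<le> C * (2 * r) * norm (q - p)"
      using mult_left_mono[OF mult_right_mono[OF qp norm_ge_zero[of "q - p"]], of C] C(1)
      by (simp add: power2_eq_square mult_ac)
    also have "C * (2 * r) * norm (q - p) + (M1 * r * norm (q - p) + M2 * r * norm (q - p)) = (2 * C + M1 + M2) * r * norm (q - p)"
      by (simp add: algebra_simps)
    also have "\<dots> \<le> \<epsilon> * norm (q - p)" using r\<epsilon> by (intro mult_right_mono) auto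
    finally show ?thesis by simp
  qed
  then show ?thesis using r by blast
qed

text \<open>The maximum modulus principle for \<open>1/f\<close>.\<close>

lemma norm_ge_if_nonvanishing_on_cball:
  assumes f: "f holomorphic_on ball 0 r" and r': "0 < r'" "r' < r"
    and nz: "\<And>w. norm w \<le> r' \<Longrightarrow> f w \<noteq> 0" and \<kappa>: "\<kappa> > 0" "\<And>w. norm w = r' \<Longrightarrow> \<kappa> \<le> norm (f w)"
    and w: "norm w \<le> r'"
  shows "\<kappa> \<le> norm (f w)"
proof -
  have hol: "(\<lambda>w. inverse (f w)) holomorphic_on cball 0 r'"
    by (intro holomorphic_on_inverse holomorphic_on_subset[OF f]) (use r' nz in auto)
  have "norm (inverse (f w)) \<le> inverse \<kappa>"
  proof (rule maximum_modulus_frontier[of "\<lambda>w. inverse (f w)" "cball 0 r'"])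
    show "(\<lambda>w. inverse (f w)) holomorphic_on interior (cball 0 r')"
      by (rule holomorphic_on_subset[OF hol]) auto
    show "continuous_on (closure (cball 0 r')) (\<lambda>w. inverse (f w))"
      using holomorphic_on_imp_continuous_on[OF hol] by simp
    show "norm (inverse (f z)) \<le> inverse \<kappa>" if "z \<in> frontier (cball 0 r')" for z
      using \<kappa>(2)[of z] \<kappa>(1) that r' by (auto simp: norm_inverse intro!: le_imp_inverse_le)
  qed (use w in auto)
  then show ?thesis using nz[OF w] \<kappa>(1) by (simp add: norm_inverse)
qed

text \<open>Coordinates around a real point \<open>p\<close> of the complex plane: \<open>z\<close> moves in the direction of \<open>p\<close>, and
  \<open>w\<close> in the direction of \<open>p\<close> turned by a right angle, which is tangent to the sphere through \<open>p\<close>.\<close>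

definition complex_point :: "real \<times> real \<Rightarrow> complex \<Rightarrow> complex \<Rightarrow> complex \<times> complex" where
  "complex_point p z w = (of_real (fst p) + z * of_real (fst p) - w * of_real (snd p),
     of_real (snd p) + z * of_real (snd p) + w * of_real (fst p))"

definition real_point :: "real \<times> real \<Rightarrow> real \<Rightarrow> real \<Rightarrow> real \<times> real" where
  "real_point p z w = (fst p + z * fst p - w * snd p, snd p + z * snd p + w * fst p)"

lemma complex_point_of_real:
  "complex_point p (of_real z) (of_real w) = (of_real (fst (real_point p z w)), of_real (snd (real_point p z w)))"
  by (simp add: complex_point_def real_point_def)

lemma norm_complex_pair: "norm (of_real x :: complex, of_real y :: complex) = norm (x, y)"
  by (simp add: norm_prod_def)

lemma norm_real_point: "norm (real_point p z w) ^ 2 = ((1 + z)\<^sup>2 + w\<^sup>2) * norm p ^ 2"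
proof -
  have "norm q ^ 2 = (fst q)\<^sup>2 + (snd q)\<^sup>2" for q :: "real \<times> real" by (simp add: norm_prod_def)
  then show ?thesis by (simp add: real_point_def power2_eq_square algebra_simps)
qed

lemma norm_complex_point_diff:
  "norm (complex_point p z w - complex_point p z' w') \<le> (norm (z - z') + norm (w - w')) * norm p"
proof -
  have "complex_point p z w - complex_point p z' w' =
     ((z - z') * of_real (fst p), (z - z') * of_real (snd p)) + ((w - w') * of_real (- snd p), (w - w') * of_real (fst p))"
    by (simp add: complex_point_def algebra_simps)
  also have "norm \<dots> \<le> norm (z - z') * norm p + norm (w - w') * norm p"
  proof (rule order_trans[OF norm_triangle_ineq add_mono])
    have *: "norm (c * of_real x :: complex, c * of_real y) = norm c * norm (x, y)" for c x y
    proof -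
      have "norm (c * of_real x :: complex, c * of_real y) ^ 2 = (norm c * norm (x, y)) ^ 2"
        by (simp add: norm_prod_def norm_mult power_mult_distrib algebra_simps)
      then show ?thesis by (simp add: power2_eq_iff_nonneg)
    qed
    show "norm ((z - z') * of_real (fst p) :: complex, (z - z') * of_real (snd p)) \<le> norm (z - z') * norm p"
      by (subst *) simp
    have "norm (- snd p, fst p) = norm p" by (simp add: norm_prod_def add.commute)
    then show "norm ((w - w') * of_real (- snd p) :: complex, (w - w') * of_real (fst p)) \<le> norm (w - w') * norm p"
      by (subst *) simp
  qed
  finally show ?thesis by (simp add: distrib_right)
qed

text \<open>At a real point where the complex curve is transversal to the sphere, the derivative of its reduced
  equation in the angular direction does not vanish, since otherwise the tangent line of the curve would be
  orthogonal to the radial direction. So the curve is locally the graph of a Lipschitz function of the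
  radial coordinate. The statement only mentions the zero set, and hence applies to equations that are not reduced.\<close>

lemma zeros_lipschitz_in_radial_coordinate:
  assumes tr: "transversal_to_sphere_at S (of_real (fst p), of_real (snd p))"
    and pS: "(of_real (fst p), of_real (snd p)) \<in> S"
  obtains r C where "r > 0" "C > 0" "\<And>z w z' w'. norm z < r \<Longrightarrow> norm w < r \<Longrightarrow> norm z' < r \<Longrightarrow> norm w' < r \<Longrightarrow>
    complex_point p z w \<in> S \<Longrightarrow> complex_point p z' w' \<in> S \<Longrightarrow> norm (w - w') \<le> C * norm (z - z')"
proof -
  let ?P = "(of_real (fst p) :: complex, of_real (snd p) :: complex)"
  obtain a \<delta> v where \<delta>: "\<delta> > 0" and a: "conv_on a \<delta>"
    and S: "\<And>v. norm v < \<delta> \<Longrightarrow> (?P + v \<in> S \<longleftrightarrow> eval2 a v = 0)"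
    and a10: "a 1 0 \<noteq> 0 \<or> a 0 1 \<noteq> 0" and v: "a 1 0 * fst v + a 0 1 * snd v = 0" "?P \<bullet> v \<noteq> 0"
    using tr unfolding transversal_to_sphere_at_def by blast
  \<comment> \<open>the derivatives of the reduced equation in the angular and in the radial direction\<close>
  define l\<theta> where "l\<theta> = a 0 1 * of_real (fst p) - a 1 0 * of_real (snd p)"
  define lp where "lp = a 1 0 * of_real (fst p) + a 0 1 * of_real (snd p)"
  have l\<theta>: "l\<theta> \<noteq> 0"
  proof
    assume "l\<theta> = 0"
    then have eq: "a 0 1 * of_real (fst p) = a 1 0 * of_real (snd p)" by (simp add: l\<theta>_def)
    let ?e = "of_real (fst p) * fst v + of_real (snd p) * snd v"
    have "a 1 0 * ?e = of_real (fst p) * (a 1 0 * fst v) + (a 1 0 * of_real (snd p)) * snd v" by (simp add: algebra_simps)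
    also have "\<dots> = of_real (fst p) * (a 1 0 * fst v + a 0 1 * snd v)" unfolding eq[symmetric] by (simp add: algebra_simps)
    finally have 1: "a 1 0 * ?e = 0" unfolding v(1) by simp
    have "a 0 1 * ?e = (a 0 1 * of_real (fst p)) * fst v + of_real (snd p) * (a 0 1 * snd v)" by (simp add: algebra_simps)
    also have "\<dots> = of_real (snd p) * (a 1 0 * fst v + a 0 1 * snd v)" unfolding eq by (simp add: algebra_simps)
    finally have 2: "a 0 1 * ?e = 0" unfolding v(1) by simp
    from 1 2 a10 have "?e = 0" by auto
    then have "Re ?e = 0" by simp
    then show False using v(2) by (simp add: inner_prod_def inner_complex_def)
  qed
  have p0: "norm p > 0"
  proof (rule ccontr)
    assume "\<not> norm p > 0"
    then have "p = 0" by simp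
    then show False using l\<theta> by (simp add: l\<theta>_def)
  qed
  \<comment> \<open>the error of the linear approximation uses up half of the angular derivative\<close>
  define \<epsilon> where "\<epsilon> = norm l\<theta> / (2 * norm p)"
  have \<epsilon>: "\<epsilon> > 0" using l\<theta> p0 by (simp add: \<epsilon>_def)
  obtain r1 where r1: "r1 > 0" and diff: "\<And>p q. norm p < r1 \<Longrightarrow> norm q < r1 \<Longrightarrow>
    norm (eval2 a q - eval2 a p - (a 1 0 * fst (q - p) + a 0 1 * snd (q - p))) \<le> \<epsilon> * norm (q - p)"
    using eval2_strictly_differentiable_at_0[OF a \<delta> \<epsilon>] by blast
  define r where "r = min \<delta> r1 / (2 * norm p)"
  have r: "r > 0" using \<delta> r1 p0 by (simp add: r_def)
  have P0: "complex_point p 0 0 = ?P" by (simp add: complex_point_def)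
  have small: "norm (complex_point p z w - ?P) < min \<delta> r1" if "norm z < r" "norm w < r" for z w
  proof -
    have "norm (complex_point p z w - ?P) \<le> (norm z + norm w) * norm p"
      using norm_complex_point_diff[of p z w 0 0] by (simp add: P0)
    also have "\<dots> < (2 * r) * norm p" using that p0 by (intro mult_strict_right_mono) auto
    also have "\<dots> = min \<delta> r1" using p0 by (simp add: r_def)
    finally show ?thesis .
  qed
  define C where "C = 2 * (norm lp + \<epsilon> * norm p) / norm l\<theta>"
  have C: "C > 0" using l\<theta> \<epsilon> p0 by (simp add: C_def add_nonneg_pos)
  show ?thesis
  proof (rule that[OF r C])
    fix z w z' w' assume n: "norm z < r" "norm w < r" "norm z' < r" "norm w' < r"
      and zero: "complex_point p z w \<in> S" "complex_point p z' w' \<in> S"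
    let ?v = "complex_point p z w - ?P" and ?v' = "complex_point p z' w' - ?P"
    have vz: "eval2 a ?v = 0" "eval2 a ?v' = 0"
      using S[of ?v] S[of ?v'] small[OF n(1,2)] small[OF n(3,4)] zero by auto
    have "norm ?v' < r1" "norm ?v < r1" using small[OF n(1,2)] small[OF n(3,4)] by simp_all
    from diff[OF this] have "norm (a 1 0 * fst (?v - ?v') + a 0 1 * snd (?v - ?v')) \<le> \<epsilon> * norm (?v - ?v')"
      by (simp only: vz diff_self diff_0 norm_minus_cancel)
    moreover have "a 1 0 * fst (?v - ?v') + a 0 1 * snd (?v - ?v') = (z - z') * lp + (w - w') * l\<theta>"
      by (simp add: complex_point_def lp_def l\<theta>_def algebra_simps)
    ultimately have 1: "norm ((z - z') * lp + (w - w') * l\<theta>) \<le> \<epsilon> * norm (?v - ?v')" by simp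
    have "norm (?v - ?v') \<le> (norm (z - z') + norm (w - w')) * norm p"
      using norm_complex_point_diff[of p z w z' w'] by simp
    then have 2: "\<epsilon> * norm (?v - ?v') \<le> \<epsilon> * ((norm (z - z') + norm (w - w')) * norm p)"
      using \<epsilon> by (intro mult_left_mono) auto
    have 3: "norm ((w - w') * l\<theta>) - norm ((z - z') * lp) \<le> norm ((z - z') * lp + (w - w') * l\<theta>)"
      using norm_triangle_ineq2[of "(w - w') * l\<theta>" "- ((z - z') * lp)"] by (simp add: add.commute)
    have e: "\<epsilon> * ((norm (z - z') + norm (w - w')) * norm p) = norm (z - z') * (\<epsilon> * norm p) + norm (w - w') * (norm l\<theta> / 2)"
      using p0 by (simp add: \<epsilon>_def field_simps)
    have "norm (w - w') * (norm l\<theta> / 2) \<le> norm (z - z') * (norm lp + \<epsilon> * norm p)"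
      using order_trans[OF 3 order_trans[OF 1 2]] unfolding e norm_mult by (simp add: algebra_simps)
    then show "norm (w - w') \<le> C * norm (z - z')"
      using l\<theta> by (simp add: C_def field_simps)
  qed
qed

section \<open>Curves in a Milnor ball\<close>

text \<open>If the zeros of a differentiable function near one of them lie in a cone around the radial
  direction, then the derivative in the angular direction can vanish only together with the
  derivative in the radial direction: otherwise the intermediate value theorem produces zeros
  outside of the cone.\<close>

lemma radial_derivative_zero_if_zeros_in_cone:
  fixes H :: "real \<Rightarrow> real \<Rightarrow> real"
  assumes der: "((\<lambda>q. H (fst q) (snd q)) has_derivative (\<lambda>h. D * fst h)) (at (z0, w0))"
    and zero: "H z0 w0 = 0" and r: "r > 0" and C: "C > 0"
    and cont: "\<And>z w. \<bar>z - z0\<bar> < r \<Longrightarrow> \<bar>w - w0\<bar> < r \<Longrightarrow> isCont (\<lambda>z. H z w) z"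
    and cone: "\<And>z w. \<bar>z - z0\<bar> < r \<Longrightarrow> \<bar>w - w0\<bar> < r \<Longrightarrow> H z w = 0 \<Longrightarrow> \<bar>w - w0\<bar> \<le> C * \<bar>z - z0\<bar>"
  shows "D = 0"
proof (rule ccontr)
  assume D: "D \<noteq> 0"
  \<comment> \<open>slope such that the segment of half width \<open>\<eta> t\<close> at height \<open>t\<close> avoids the cone \<open>t \<le> C |x|\<close>\<close>
  define \<eta> where "\<eta> = 1 / (2 * (C + 1))"
  have \<eta>: "\<eta> > 0" "\<eta> < 1" "C * \<eta> < 1" using C by (auto simp: \<eta>_def field_simps)
  define \<epsilon> where "\<epsilon> = \<bar>D\<bar> * \<eta> / 4"
  have \<epsilon>: "\<epsilon> > 0" using D \<eta> by (simp add: \<epsilon>_def)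
  obtain d where d: "d > 0" and dd: "\<And>q. norm (q - (z0, w0)) < d \<Longrightarrow>
     norm (H (fst q) (snd q) - H z0 w0 - D * fst (q - (z0, w0))) \<le> \<epsilon> * norm (q - (z0, w0))"
    using der[unfolded has_derivative_at_alt] \<epsilon> by (auto simp: fst_conv snd_conv)
  define t where "t = min (r / 2) (d / 4)"
  have t: "t > 0" "t < r" "2 * t < d" using r d by (auto simp: t_def)
  define w where "w = w0 + t"
  have val: "\<bar>H (z0 + x) w - D * x\<bar> < \<bar>D\<bar> * \<eta> * t" if x: "\<bar>x\<bar> = \<eta> * t" for x
  proof -
    have "\<eta> * t \<le> 1 * t" using \<eta> t by (intro mult_right_mono) auto
    then have xt: "\<bar>x\<bar> \<le> t" using x by simp
    have n: "norm (x, t) \<le> 2 * t" using norm_Pair_le[of x t] xt t by simp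
    have "\<bar>H (z0 + x) w - D * x\<bar> \<le> \<epsilon> * norm (x, t)"
      using dd[of "(z0 + x, w)"] n t zero by (simp add: w_def)
    also have "\<dots> \<le> \<epsilon> * (2 * t)" using n \<epsilon> by (intro mult_left_mono) auto
    also have "\<dots> = (\<bar>D\<bar> * \<eta> * t) / 2" by (simp add: \<epsilon>_def)
    also have "\<dots> < \<bar>D\<bar> * \<eta> * t" using D \<eta> t by simp
    finally show ?thesis .
  qed
  have "\<eta> * t < 1 * t" by (rule mult_strict_right_mono) (use \<eta> t in auto)
  then have etr: "\<eta> * t < r" using t by linarith
  define f where "f = (\<lambda>x. H (z0 + x) w)"
  have wr: "\<bar>w - w0\<bar> < r" using t by (simp add: w_def)
  have cf: "continuous_on (closed_segment (- (\<eta> * t)) (\<eta> * t)) f"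
    unfolding f_def
  proof (intro continuous_at_imp_continuous_on ballI)
    fix x assume "x \<in> closed_segment (- (\<eta> * t)) (\<eta> * t)"
    then have "\<bar>x\<bar> < r" using etr \<eta> t by (auto simp: closed_segment_eq_real_ivl split: if_splits)
    then have "isCont (\<lambda>z. H z w) (z0 + x)" by (intro cont wr) simp
    then show "isCont (\<lambda>x. H (z0 + x) w) x"
      using isCont_o2[where f = "\<lambda>x. z0 + x" and a = x and g = "\<lambda>z. H z w"] by (simp add: continuous_intros)
  qed
  \<comment> \<open>opposite signs at the ends give a zero on the segment, which is not in the cone\<close>
  have ends: "f (\<eta> * t) * f (- (\<eta> * t)) < 0"
  proof -
    have pos: "\<eta> * t > 0" using \<eta> t by simp
    have "\<bar>f (\<eta> * t) - D * (\<eta> * t)\<bar> < \<bar>D\<bar> * \<eta> * t" "\<bar>f (- (\<eta> * t)) - D * (- (\<eta> * t))\<bar> < \<bar>D\<bar> * \<eta> * t"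
      unfolding f_def using val[of "\<eta> * t"] val[of "- (\<eta> * t)"] pos by auto
    moreover have "D * (\<eta> * t) = D * \<eta> * t" "D * (- (\<eta> * t)) = - (D * \<eta> * t)" by simp_all
    ultimately have "\<bar>f (\<eta> * t) - D * \<eta> * t\<bar> < \<bar>D\<bar> * \<eta> * t" "\<bar>f (- (\<eta> * t)) + D * \<eta> * t\<bar> < \<bar>D\<bar> * \<eta> * t"
      by simp_all
    then show ?thesis
    proof (cases "D > 0")
      case True
      then have "f (\<eta> * t) > 0" "f (- (\<eta> * t)) < 0"
        using \<open>\<bar>f (\<eta> * t) - D * \<eta> * t\<bar> < \<bar>D\<bar> * \<eta> * t\<close> \<open>\<bar>f (- (\<eta> * t)) + D * \<eta> * t\<bar> < \<bar>D\<bar> * \<eta> * t\<close> by auto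
      then show ?thesis by (rule mult_pos_neg)
    next
      case False
      then have "f (\<eta> * t) < 0" "f (- (\<eta> * t)) > 0"
        using \<open>\<bar>f (\<eta> * t) - D * \<eta> * t\<bar> < \<bar>D\<bar> * \<eta> * t\<close> \<open>\<bar>f (- (\<eta> * t)) + D * \<eta> * t\<bar> < \<bar>D\<bar> * \<eta> * t\<close> D by auto
      then show ?thesis by (rule mult_neg_pos)
    qed
  qed
  have con: "connected (f ` closed_segment (- (\<eta> * t)) (\<eta> * t))"
    by (rule connected_continuous_image[OF cf connected_segment])
  have mem: "f (\<eta> * t) \<in> f ` closed_segment (- (\<eta> * t)) (\<eta> * t)" "f (- (\<eta> * t)) \<in> f ` closed_segment (- (\<eta> * t)) (\<eta> * t)"
    by auto
  have "0 \<in> f ` closed_segment (- (\<eta> * t)) (\<eta> * t)"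
    using ends connectedD_interval[OF con mem] connectedD_interval[OF con mem(2,1)]
    by (meson less_imp_le mult_less_0_iff)
  then obtain x where x: "x \<in> closed_segment (- (\<eta> * t)) (\<eta> * t)" "H (z0 + x) w = 0"
    by (auto simp: f_def)
  have xa: "\<bar>x\<bar> \<le> \<eta> * t" using x(1) \<eta> t by (auto simp: closed_segment_eq_real_ivl split: if_splits)
  have "t \<le> C * \<bar>x\<bar>" using cone[of "z0 + x" w] xa etr wr x(2) t by (simp add: w_def)
  also have "\<dots> \<le> C * (\<eta> * t)" using xa C by (intro mult_left_mono) auto
  also have "\<dots> = (C * \<eta>) * t" by simp
  also have "\<dots> < 1 * t" using \<eta> t by (intro mult_strict_right_mono) auto
  finally show False by simp
qed

lemma gradient_det_radius:
  "gradient_det a (power_sum_ser (2 * 1) (2 * 1)) p = 2 * (snd p * eval2 (ser_dx a) p - fst p * eval2 (ser_dy a) p)"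
  unfolding gradient_det_def
  by (subst eval2_ser_dx_power_sum_ser; (subst eval2_ser_dy_power_sum_ser)?; simp)

text \<open>The equation \<open>a\<close> need not be reduced away from the origin, whereas the Milnor ball condition concerns
  only the zero set; \<open>near_origin\<close> provides reducedness of the real curve near the origin, from where it
  will be propagated.\<close>

locale milnor_curve =
  fixes a :: "real ser2" and R \<rho> :: real
  assumes conv: "conv_on a R" and \<rho>R: "\<rho> < R" and milnor: "milnor_ball a \<rho>"
    and near_origin: "\<exists>\<epsilon>>0. \<forall>p. p \<noteq> 0 \<longrightarrow> norm p < \<epsilon> \<longrightarrow> eval2 a p = 0 \<longrightarrow>
       eval2 (ser_dx a) p \<noteq> 0 \<or> eval2 (ser_dy a) p \<noteq> 0"
begin

abbreviation "F p z w \<equiv> eval2 (complexify a) (complex_point p z w)"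

lemma complex_point_bound:
  assumes p: "norm p \<le> \<rho>" and z: "norm z < (R - \<rho>) / (2 * (\<rho> + 1))" and w: "norm w < (R - \<rho>) / (2 * (\<rho> + 1))"
  shows "norm (complex_point p z w) < R"
proof -
  have \<rho>: "\<rho> > 0" using milnor by (simp add: milnor_ball_def)
  have "norm (complex_point p z w - complex_point p 0 0) \<le> (norm z + norm w) * norm p"
    using norm_complex_point_diff[of p z w 0 0] by simp
  also have "\<dots> \<le> (norm z + norm w) * \<rho>" using p by (intro mult_left_mono) auto
  also have "\<dots> \<le> (2 * ((R - \<rho>) / (2 * (\<rho> + 1)))) * \<rho>"
    using add_mono[OF less_imp_le[OF z] less_imp_le[OF w]] \<rho> by (intro mult_right_mono) (simp_all only: mult_2 less_imp_le)
  also have "\<dots> < R - \<rho>" using \<rho> \<rho>R by (simp add: field_simps)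
  finally have "norm (complex_point p z w - complex_point p 0 0) < R - \<rho>" .
  moreover have "norm (complex_point p 0 0) \<le> \<rho>" using p norm_complex_pair[of "fst p" "snd p"] by (simp add: complex_point_def)
  ultimately show ?thesis
    using norm_triangle_ineq[of "complex_point p z w - complex_point p 0 0" "complex_point p 0 0"] by simp
qed

lemma F_of_real:
  assumes "norm (real_point p z w) < R"
  shows "F p (of_real z) (of_real w) = of_real (eval2 a (real_point p z w))"
  unfolding complex_point_of_real
  by (rule eval2_complexify[OF conv]) (use norm_components_le[of "real_point p z w"] assms in auto)

text \<open>Near \<open>p\<close> the zeros, including those that are not real, form a Lipschitz graph over the radial
  coordinate.\<close>

definition graph_at :: "real \<times> real \<Rightarrow> real \<Rightarrow> real \<Rightarrow> bool" where
  "graph_at p r C \<longleftrightarrow> r > 0 \<and> C > 0 \<and>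
    (\<forall>z w. norm z < r \<longrightarrow> norm w < r \<longrightarrow> norm (complex_point p z w) < R) \<and>
    (\<forall>z w z' w'. norm z < r \<longrightarrow> norm w < r \<longrightarrow> norm z' < r \<longrightarrow> norm w' < r \<longrightarrow>
      F p z w = 0 \<longrightarrow> F p z' w' = 0 \<longrightarrow> norm (w - w') \<le> C * norm (z - z'))"

lemma graph_exists:
  assumes p: "p \<noteq> 0" "norm p \<le> \<rho>" "eval2 a p = 0"
  obtains r C where "graph_at p r C"
proof -
  let ?P = "(of_real (fst p) :: complex, of_real (snd p) :: complex)"
  have P: "F p 0 0 = 0"
    using F_of_real[of p 0 0] p \<rho>R by (simp add: real_point_def)
  then have PS: "?P \<in> complex_zeros a" by (simp add: complex_zeros_def complex_point_def)
  moreover have "?P \<noteq> 0" using p(1) by (simp add: zero_prod_def prod_eq_iff)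
  moreover have "?P \<in> cball 0 \<rho>" using p(2) norm_complex_pair[of "fst p" "snd p"] by simp
  ultimately have tr: "transversal_to_sphere_at (complex_zeros a) ?P"
    using milnor by (auto simp: milnor_ball_def)
  obtain r1 C where r1: "r1 > 0" and C: "C > 0" and lip: "\<And>z w z' w'. norm z < r1 \<Longrightarrow> norm w < r1 \<Longrightarrow> norm z' < r1 \<Longrightarrow> norm w' < r1 \<Longrightarrow>
    complex_point p z w \<in> complex_zeros a \<Longrightarrow> complex_point p z' w' \<in> complex_zeros a \<Longrightarrow> norm (w - w') \<le> C * norm (z - z')"
    using zeros_lipschitz_in_radial_coordinate[OF tr PS] by metis
  have \<rho>: "\<rho> > 0" using milnor by (simp add: milnor_ball_def)
  then have "(R - \<rho>) / (2 * (\<rho> + 1)) > 0" using \<rho>R by simp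
  then have "graph_at p (min r1 ((R - \<rho>) / (2 * (\<rho> + 1)))) C"
    unfolding graph_at_def using r1 C lip complex_point_bound[OF p(2)] by (auto simp: complex_zeros_def)
  then show ?thesis by (rule that)
qed

lemma graph_at_real_bound:
  assumes "graph_at p r C" "\<bar>z\<bar> < r" "\<bar>w\<bar> < r"
  shows "norm (real_point p z w) < R"
proof -
  have "norm (complex_point p (of_real z) (of_real w)) < R"
    using assms unfolding graph_at_def by (metis norm_of_real)
  then show ?thesis unfolding complex_point_of_real norm_complex_pair by simp
qed

lemma graph_at_real_zeros:
  assumes g: "graph_at p r C" and n: "\<bar>z\<bar> < r" "\<bar>w\<bar> < r" "\<bar>z'\<bar> < r" "\<bar>w'\<bar> < r"
    and "eval2 a (real_point p z w) = 0" "eval2 a (real_point p z' w') = 0"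
  shows "\<bar>w - w'\<bar> \<le> C * \<bar>z - z'\<bar>"
proof -
  have "F p (of_real z) (of_real w) = 0" "F p (of_real z') (of_real w') = 0"
    using F_of_real graph_at_real_bound[OF g] n assms by simp_all
  then have "norm (of_real w - of_real w' :: complex) \<le> C * norm (of_real z - of_real z' :: complex)"
    using g n unfolding graph_at_def by (metis norm_of_real)
  then show ?thesis by (simp flip: of_real_diff)
qed

text \<open>The zeros lie in a cone around the radial direction.\<close>

lemma gradient_zero_if_angular_derivative_zero:
  assumes g: "graph_at p r C" and zw: "\<bar>z\<bar> < r" "\<bar>w\<bar> < r" and p: "p \<noteq> 0"
    and zero: "eval2 a (real_point p z w) = 0"
    and ang: "fst p * eval2 (ser_dy a) (real_point p z w) - snd p * eval2 (ser_dx a) (real_point p z w) = 0"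
  shows "eval2 (ser_dx a) (real_point p z w) = 0 \<and> eval2 (ser_dy a) (real_point p z w) = 0"
proof -
  let ?q = "real_point p z w"
  let ?ax = "eval2 (ser_dx a) ?q" and ?ay = "eval2 (ser_dy a) ?q"
  define D where "D = fst p * ?ax + snd p * ?ay"
  define r' where "r' = min (r - \<bar>z\<bar>) (r - \<bar>w\<bar>)"
  have r': "r' > 0" using zw by (simp add: r'_def)
  have in_r: "\<bar>z'\<bar> < r \<and> \<bar>w'\<bar> < r" if "\<bar>z' - z\<bar> < r'" "\<bar>w' - w\<bar> < r'" for z' w'
    using that by (auto simp: r'_def)
  have der: "(eval2 a has_derivative (\<lambda>h. eval2 (ser_dx a) q * fst h + eval2 (ser_dy a) q * snd h)) (at q)" if "norm q < R" for q
    by (rule eval2_has_derivative[OF conv]) (use norm_components_le[of q] that in auto)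
  have "D = 0"
  proof (rule radial_derivative_zero_if_zeros_in_cone)
    have line: "((\<lambda>q. real_point p (fst q) (snd q)) has_derivative
       (\<lambda>h. (fst h * fst p - snd h * snd p, fst h * snd p + snd h * fst p))) (at (z, w))"
      unfolding real_point_def by (auto intro!: derivative_eq_intros)
    have "((\<lambda>q. eval2 a (real_point p (fst q) (snd q))) has_derivative
       (\<lambda>h. ?ax * fst (fst h * fst p - snd h * snd p, fst h * snd p + snd h * fst p)
          + ?ay * snd (fst h * fst p - snd h * snd p, fst h * snd p + snd h * fst p))) (at (z, w))"
    proof (rule has_derivative_compose[OF line])
      show "(eval2 a has_derivative (\<lambda>h. ?ax * fst h + ?ay * snd h)) (at (real_point p (fst (z, w)) (snd (z, w))))"
        using der[OF graph_at_real_bound[OF g zw]] by simp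
    qed
    moreover have "?ax * fst (fst h * fst p - snd h * snd p, fst h * snd p + snd h * fst p)
          + ?ay * snd (fst h * fst p - snd h * snd p, fst h * snd p + snd h * fst p) = D * fst h" for h :: "real \<times> real"
    proof -
      have "?ax * (fst h * fst p - snd h * snd p) + ?ay * (fst h * snd p + snd h * fst p)
        = D * fst h + snd h * (fst p * ?ay - snd p * ?ax)" by (simp add: D_def algebra_simps)
      then show ?thesis unfolding ang by simp
    qed
    ultimately show "((\<lambda>q. eval2 a (real_point p (fst q) (snd q))) has_derivative (\<lambda>h. D * fst h)) (at (z, w))"
      by (simp only:)
    show "eval2 a (real_point p z w) = 0" by fact
    show "r' > 0" by fact
    show "C > 0" using g by (simp add: graph_at_def)
    show "isCont (\<lambda>z. eval2 a (real_point p z w')) z'" if "\<bar>z' - z\<bar> < r'" "\<bar>w' - w\<bar> < r'" for z' w'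
    proof (rule isCont_o2[where f = "\<lambda>z. real_point p z w'" and g = "eval2 a"])
      show "isCont (\<lambda>z. real_point p z w') z'" unfolding real_point_def by (intro continuous_intros)
      show "isCont (eval2 a) (real_point p z' w')"
        by (rule has_derivative_continuous[OF der]) (rule graph_at_real_bound[OF g]; use in_r[OF that] in simp)
    qed
    show "\<bar>w' - w\<bar> \<le> C * \<bar>z' - z\<bar>" if "\<bar>z' - z\<bar> < r'" "\<bar>w' - w\<bar> < r'" "eval2 a (real_point p z' w') = 0" for z' w'
      by (rule graph_at_real_zeros[OF g _ _ zw that(3) zero]) (use in_r[OF that(1,2)] in auto)
  qed
  have n0: "(fst p)\<^sup>2 + (snd p)\<^sup>2 \<noteq> 0" using p by (simp add: prod_eq_iff sum_power2_eq_zero_iff)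
  have "((fst p)\<^sup>2 + (snd p)\<^sup>2) * ?ax = fst p * D - snd p * (fst p * ?ay - snd p * ?ax)"
    "((fst p)\<^sup>2 + (snd p)\<^sup>2) * ?ay = snd p * D + fst p * (fst p * ?ay - snd p * ?ax)"
    by (simp_all add: D_def power2_eq_square algebra_simps)
  then have "((fst p)\<^sup>2 + (snd p)\<^sup>2) * ?ax = 0" "((fst p)\<^sup>2 + (snd p)\<^sup>2) * ?ay = 0"
    unfolding ang \<open>D = 0\<close> by simp_all
  then show ?thesis using n0 unfolding mult_eq_0_iff by blast
qed

end

context milnor_curve
begin

lemma F_has_field_derivative:
  assumes "norm (complex_point p z w) < R"
  shows "((\<lambda>w. F p z w) has_field_derivative
    (eval2 (complexify (ser_dy a)) (complex_point p z w) * of_real (fst p) -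
     eval2 (complexify (ser_dx a)) (complex_point p z w) * of_real (snd p))) (at w)"
proof -
  let ?x = "of_real (fst p) + z * of_real (fst p)" and ?y = "of_real (snd p) + z * of_real (snd p)"
  have cp: "complex_point p z w = (?x + w * (- of_real (snd p)), ?y + w * of_real (fst p))" for w
    by (simp add: complex_point_def)
  have "((\<lambda>w. eval2 (complexify a) (?x + w * (- of_real (snd p)), ?y + w * of_real (fst p))) has_field_derivative
    eval2 (ser_dx (complexify a)) (?x + w * (- of_real (snd p)), ?y + w * of_real (fst p)) * (- of_real (snd p)) +
    eval2 (ser_dy (complexify a)) (?x + w * (- of_real (snd p)), ?y + w * of_real (fst p)) * of_real (fst p)) (at w)"
    by (rule eval2_along_line[OF conv_on_complexify[OF conv]])
       (use norm_components_le[of "complex_point p z w"] assms in \<open>auto simp: cp\<close>)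
  then show ?thesis unfolding cp[symmetric] complexify_ser_dx complexify_ser_dy by (simp add: algebra_simps)
qed

lemma F_cnj:
  assumes "norm (complex_point p (of_real z) w) < R"
  shows "F p (of_real z) (cnj w) = cnj (F p (of_real z) w)"
proof -
  have "complex_point p (of_real z) (cnj w) = (cnj (fst (complex_point p (of_real z) w)), cnj (snd (complex_point p (of_real z) w)))"
    by (simp add: complex_point_def)
  then show ?thesis
    using eval2_complexify_cnj[OF conv, of "complex_point p (of_real z) w"] norm_components_le[of "complex_point p (of_real z) w"] assms
    by simp
qed

text \<open>If the curve is tangent to a circle at \<open>p\<close>, then the gradient vanishes at \<open>p\<close>. To exclude this, take
  a point \<open>p1\<close> of the curve with vanishing gradient that is nearest to the origin. For small \<open>z < 0\<close>, the
  function \<open>F p1 z\<close> has a zero \<open>w\<close> near \<open>0\<close> by the minimum modulus principle; it is the only one by the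
  Lipschitz property and thus real by symmetry under conjugation. It belongs to a real point of the curve nearer
  to the origin, where the gradient does not vanish, so the zero is simple. Dividing \<open>F p1 z\<close> by its zero
  gives a function without zeros that is bounded below on a fixed circle, hence also at \<open>w\<close>: the angular
  derivatives at these points stay away from \<open>0\<close>. By continuity this contradicts the vanishing of the
  gradient at \<open>p1\<close>.\<close>

lemma radial_transversality:
  assumes p: "p \<noteq> 0" "norm p \<le> \<rho>" "eval2 a p = 0"
  shows "gradient_det a (power_sum_ser (2 * 1) (2 * 1)) p \<noteq> 0"
proof
  assume det: "gradient_det a (power_sum_ser (2 * 1) (2 * 1)) p = 0"
  obtain \<epsilon> where \<epsilon>: "\<epsilon> > 0" and near: "\<And>p. p \<noteq> 0 \<Longrightarrow> norm p < \<epsilon> \<Longrightarrow> eval2 a p = 0 \<Longrightarrow>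
       eval2 (ser_dx a) p \<noteq> 0 \<or> eval2 (ser_dy a) p \<noteq> 0"
    using near_origin by blast
  have inR: "norm (fst q) < R \<and> norm (snd q) < R" if "norm q \<le> \<rho>" for q :: "real \<times> real"
    using norm_cball_less[OF that \<rho>R] by simp
  define T where "T = {q. norm q \<le> \<rho> \<and> \<epsilon> \<le> norm q \<and> eval2 a q = 0 \<and> eval2 (ser_dx a) q = 0 \<and> eval2 (ser_dy a) q = 0}"
  have grad_p: "eval2 (ser_dx a) p = 0 \<and> eval2 (ser_dy a) p = 0"
  proof -
    obtain r C where g: "graph_at p r C" using graph_exists[OF p] .
    then have "r > 0" by (simp add: graph_at_def)
    have rp: "real_point p 0 0 = p" by (simp add: real_point_def)
    show ?thesis
      using gradient_zero_if_angular_derivative_zero[OF g, of 0 0] \<open>r > 0\<close> p det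
      unfolding rp gradient_det_radius by simp
  qed
  then have pT: "p \<in> T" using p near[of p] by (force simp: T_def)
  have compT: "compact T"
  proof -
    have cl: "closed (cball (0 :: real \<times> real) \<rho> \<inter> eval2 b -` {0})" if "conv_on b R" for b
      by (intro continuous_closed_preimage eval2_continuous_on[OF that]) (use inR in auto)
    have "T = (cball 0 \<rho> \<inter> eval2 a -` {0}) \<inter> (cball 0 \<rho> \<inter> eval2 (ser_dx a) -` {0}) \<inter>
        (cball 0 \<rho> \<inter> eval2 (ser_dy a) -` {0}) \<inter> (- ball 0 \<epsilon>)"
      by (auto simp: T_def)
    moreover have "closed \<dots>"
      by (intro closed_Int cl conv conv_on_ser_dx conv_on_ser_dy closed_Compl open_ball)
    moreover have "bounded T" by (rule bounded_subset[of "cball 0 \<rho>"]) (auto simp: T_def)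
    ultimately show ?thesis by (simp add: compact_eq_bounded_closed)
  qed
  have "continuous_on T norm" by (intro continuous_intros)
  then obtain p1 where p1T: "p1 \<in> T" and p1min: "\<And>q. q \<in> T \<Longrightarrow> norm p1 \<le> norm q"
    using continuous_attains_inf[OF compT, of norm] pT by blast
  have p1: "norm p1 \<le> \<rho>" "\<epsilon> \<le> norm p1" "eval2 a p1 = 0" "eval2 (ser_dx a) p1 = 0" "eval2 (ser_dy a) p1 = 0"
    using p1T by (auto simp: T_def)
  have p10: "p1 \<noteq> 0" using p1(2) \<epsilon> by auto
  have grad: "eval2 (ser_dx a) q \<noteq> 0 \<or> eval2 (ser_dy a) q \<noteq> 0"
    if "q \<noteq> 0" "norm q < norm p1" "eval2 a q = 0" for q
  proof (cases "norm q < \<epsilon>")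
    case True
    then show ?thesis using near that by blast
  next
    case False
    then show ?thesis using p1min[of q] that p1 by (auto simp: T_def)
  qed
  obtain r C where g: "graph_at p1 r C" using graph_exists[OF p10 p1(1,3)] .
  have r: "r > 0" and C: "C > 0" using g by (auto simp: graph_at_def)
  have dom: "norm (complex_point p1 z w) < R" if "norm z < r" "norm w < r" for z w
    using g that by (auto simp: graph_at_def)
  have lip: "norm (w - w') \<le> C * norm (z - z')"
    if "norm z < r" "norm w < r" "norm z' < r" "norm w' < r" "F p1 z w = 0" "F p1 z' w' = 0" for z w z' w'
    using g that by (auto simp: graph_at_def)
  define r' where "r' = r / 2"
  have r': "0 < r'" "r' < r" using r by (auto simp: r'_def)
  define ang where "ang = (\<lambda>q. fst p1 * eval2 (ser_dy a) q - snd p1 * eval2 (ser_dx a) q)"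
  have F00: "F p1 0 0 = 0"
    using F_of_real[of p1 0 0] graph_at_real_bound[OF g, of 0 0] p1(3) r by (simp add: real_point_def)
  have contF: "continuous_on (cball 0 r' \<times> cball 0 r') (\<lambda>x. F p1 (fst x) (snd x))"
  proof (rule continuous_on_compose2[of "{q. norm q < R}" "eval2 (complexify a)"])
    show "continuous_on {q :: complex \<times> complex. norm q < R} (eval2 (complexify a))"
    proof (rule eval2_continuous_on[OF conv_on_complexify[OF conv]])
      fix q :: "complex \<times> complex" assume "q \<in> {q. norm q < R}"
      then show "norm (fst q) < R \<and> norm (snd q) < R" using norm_components_le[of q] by simp
    qed
    show "continuous_on (cball 0 r' \<times> cball 0 r') (\<lambda>x. complex_point p1 (fst x) (snd x))"
      unfolding complex_point_def by (intro continuous_intros)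
    show "(\<lambda>x. complex_point p1 (fst x) (snd x)) ` (cball 0 r' \<times> cball 0 r') \<subseteq> {q. norm q < R}"
      using dom r' by auto
  qed
  have hol: "(\<lambda>w. F p1 z w) holomorphic_on ball 0 r" if "norm z < r" for z
    by (rule holomorphic_onI) (use F_has_field_derivative[OF dom[OF that]] in
      \<open>auto simp: field_differentiable_def intro: has_field_derivative_at_within\<close>)
  obtain \<kappa> where \<kappa>: "\<kappa> > 0" "\<And>w. norm w = r' \<Longrightarrow> \<kappa> \<le> norm (F p1 0 w)"
  proof -
    have "compact (sphere (0::complex) r')" "sphere (0::complex) r' \<noteq> {}" using r' by auto
    moreover have "continuous_on (sphere 0 r') (\<lambda>w. norm (F p1 0 w))"
      by (intro continuous_on_norm holomorphic_on_imp_continuous_on holomorphic_on_subset[OF hol]) (use r r' in auto)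
    ultimately obtain w0 where w0: "w0 \<in> sphere 0 r'" "\<And>w. w \<in> sphere 0 r' \<Longrightarrow> norm (F p1 0 w0) \<le> norm (F p1 0 w)"
      using continuous_attains_inf by metis
    have "F p1 0 w0 \<noteq> 0"
    proof
      assume "F p1 0 w0 = 0"
      then have "norm (w0 - 0) \<le> C * norm (0 - 0 :: complex)" using w0(1) r r' F00 by (intro lip) auto
      then show False using w0(1) r' by simp
    qed
    then show ?thesis using w0 by (intro that[of "norm (F p1 0 w0)"]) auto
  qed
  have "uniformly_continuous_on (cball 0 r' \<times> cball 0 r') (\<lambda>x. F p1 (fst x) (snd x))"
    by (rule compact_uniformly_continuous[OF contF]) (intro compact_Times compact_cball)
  then obtain d where d: "d > 0" and ud: "\<And>x x'. x \<in> cball 0 r' \<times> cball 0 r' \<Longrightarrow> x' \<in> cball 0 r' \<times> cball 0 r' \<Longrightarrow>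
      dist x' x < d \<Longrightarrow> dist (F p1 (fst x') (snd x')) (F p1 (fst x) (snd x)) < \<kappa> / 2"
    unfolding uniformly_continuous_on_def using \<kappa>(1) by (metis half_gt_zero)
  have close: "norm (F p1 z w - F p1 0 w) < \<kappa> / 2" if "norm z < d" "norm z \<le> r'" "norm w \<le> r'" for z w
    using ud[of "(0, w)" "(z, w)"] that r' by (auto simp: dist_norm norm_Pair)
  \<comment> \<open>small enough for points with \<open>-c < z < 0\<close> and \<open>|w| \<le> C |z|\<close> to be nearer to the origin than \<open>p1\<close>\<close>
  define c where "c = min d (min r' (1 / (1 + C\<^sup>2)))"
  have c: "c > 0" using d r' C by (auto simp: c_def add_pos_nonneg)
  have key: "\<exists>w::real. \<bar>w\<bar> \<le> C * \<bar>z\<bar> \<and> \<kappa> / (2 * r) \<le> \<bar>ang (real_point p1 z w)\<bar>" if z: "- c < z" "z < 0" for z :: real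
  proof -
    let ?z = "of_real z :: complex"
    have zc: "norm ?z < d" "norm ?z \<le> r'" "norm ?z < r" "(1 + C\<^sup>2) * (- z) < 1"
    proof -
      have "- z < c" using z by simp
      then have "- z < d" "- z < r'" "- z < 1 / (1 + C\<^sup>2)" by (auto simp: c_def)
      then show "norm ?z < d" "norm ?z \<le> r'" "norm ?z < r" "(1 + C\<^sup>2) * (- z) < 1"
        using z r' C by (auto simp: field_simps add_pos_nonneg)
    qed
    have circ: "\<kappa> / 2 \<le> norm (F p1 ?z w)" if "norm w = r'" for w
    proof -
      have "norm (F p1 0 w) - norm (F p1 ?z w) \<le> norm (F p1 ?z w - F p1 0 w)"
        by (metis norm_minus_commute norm_triangle_ineq2)
      then show ?thesis using \<kappa>(2)[OF that] close[OF zc(1,2), of w] that by simp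
    qed
    have "\<exists>w. norm w \<le> r' \<and> F p1 ?z w = 0"
    proof (rule ccontr)
      assume "\<not> ?thesis"
      then have nz: "F p1 ?z w \<noteq> 0" if "norm w \<le> r'" for w using that by blast
      have "\<kappa> / 2 \<le> norm (F p1 ?z 0)"
        by (rule norm_ge_if_nonvanishing_on_cball[OF hol[OF zc(3)] r' nz _ circ]) (use \<kappa> r' in auto)
      then show False using close[OF zc(1,2), of 0] F00 r' by simp
    qed
    then obtain w0 where w0: "norm w0 \<le> r'" "F p1 ?z w0 = 0" by blast
    have w0r: "norm w0 < r" using w0 r' by simp
    have "F p1 ?z (cnj w0) = 0" using F_cnj[OF dom[OF zc(3) w0r]] w0 by simp
    then have "norm (w0 - cnj w0) \<le> C * norm (?z - ?z)" using w0 w0r zc by (intro lip) auto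
    then have "w0 = cnj w0" by simp
    define w where "w = Re w0"
    have w0w: "w0 = of_real w" using \<open>w0 = cnj w0\<close> by (simp add: w_def complex_eq_iff)
    have "norm (w0 - 0) \<le> C * norm (?z - 0)" using w0 w0r zc r F00 by (intro lip) auto
    then have wC: "\<bar>w\<bar> \<le> C * \<bar>z\<bar>" by (simp add: w0w)
    have wr: "\<bar>w\<bar> < r" "\<bar>z\<bar> < r" using w0r zc(3) by (simp_all add: w0w)
    let ?q = "real_point p1 z w"
    have qR: "norm ?q < R" by (rule graph_at_real_bound[OF g wr(2,1)])
    have q0: "eval2 a ?q = 0" using F_of_real[OF qR] w0(2) by (simp add: w0w)
    have small: "norm ?q < norm p1"
    proof -
      have "w\<^sup>2 \<le> (C * \<bar>z\<bar>)\<^sup>2" using power_mono[OF wC, of 2] by simp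
      then have "(1 + z)\<^sup>2 + w\<^sup>2 \<le> (1 + z)\<^sup>2 + C\<^sup>2 * z\<^sup>2" by (simp add: power_mult_distrib)
      also have "\<dots> = 1 + z * (2 - (1 + C\<^sup>2) * (- z))" by (simp add: power2_eq_square algebra_simps)
      also have "\<dots> < 1" using z zc(4) by (simp add: mult_neg_pos)
      finally have "norm ?q ^ 2 < 1 * norm p1 ^ 2"
        unfolding norm_real_point using p10 by (intro mult_strict_right_mono) auto
      then show ?thesis by (simp add: power2_less_imp_less)
    qed
    have qn: "?q \<noteq> 0"
    proof -
      have "0 \<le> C\<^sup>2 * (- z)" using z by (intro mult_nonneg_nonneg) auto
      moreover have "(1 + C\<^sup>2) * (- z) = - z + C\<^sup>2 * (- z)" by (simp add: algebra_simps)
      ultimately have "- z < 1" using zc(4) by linarith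
      then have "(1 + z)\<^sup>2 > 0" by simp
      then have "(1 + z)\<^sup>2 + w\<^sup>2 > 0" by (simp add: add_pos_nonneg)
      then have "norm ?q ^ 2 > 0" unfolding norm_real_point using p10 by simp
      then show ?thesis by auto
    qed
    have ang0: "ang ?q \<noteq> 0"
      using gradient_zero_if_angular_derivative_zero[OF g wr(2,1) p10 q0] grad[OF qn small q0]
      by (auto simp: ang_def)
    have der: "deriv (\<lambda>w. F p1 ?z w) w0 = of_real (ang ?q)"
    proof -
      have qc: "\<bar>fst ?q\<bar> < R" "\<bar>snd ?q\<bar> < R" using norm_components_le[of ?q] qR by auto
      have "deriv (\<lambda>w. F p1 ?z w) w0 = eval2 (complexify (ser_dy a)) (complex_point p1 ?z w0) * of_real (fst p1) -
         eval2 (complexify (ser_dx a)) (complex_point p1 ?z w0) * of_real (snd p1)"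
        by (rule DERIV_imp_deriv[OF F_has_field_derivative[OF dom[OF zc(3) w0r]]])
      also have "\<dots> = of_real (ang ?q)"
        unfolding w0w complex_point_of_real
        by (simp add: eval2_complexify[OF conv_on_ser_dx[OF conv] qc] eval2_complexify[OF conv_on_ser_dy[OF conv] qc] ang_def)
      finally show ?thesis .
    qed
    \<comment> \<open>the quotient of \<open>F p1 z\<close> by its zero; its value at \<open>w0\<close> is the derivative\<close>
    define G where "G = (\<lambda>w. if w = w0 then deriv (\<lambda>w. F p1 ?z w) w0 else (F p1 ?z w - F p1 ?z w0) / (w - w0))"
    have "\<kappa> / (2 * r) \<le> norm (G w0)"
    proof (rule norm_ge_if_nonvanishing_on_cball[OF _ r' _ _ _ w0(1)])
      show "G holomorphic_on ball 0 r"
        unfolding G_def by (rule pole_lemma_open[OF hol[OF zc(3)]]) simp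
      show "G w \<noteq> 0" if "norm w \<le> r'" for w
      proof (cases "w = w0")
        case True
        then show ?thesis using der ang0 by (simp add: G_def)
      next
        case False
        have "F p1 ?z w \<noteq> 0"
        proof
          assume "F p1 ?z w = 0"
          then have "norm (w - w0) \<le> C * norm (?z - ?z)" using w0 w0r zc that r' by (intro lip) auto
          then show False using False by simp
        qed
        then show ?thesis using False w0 by (simp add: G_def)
      qed
      show "\<kappa> / (2 * r) > 0" using \<kappa> r by simp
      show "\<kappa> / (2 * r) \<le> norm (G w)" if w: "norm w = r'" for w
      proof -
        have ne: "w \<noteq> w0" using circ[OF w] w0(2) \<kappa>(1) by auto
        have "norm (w - w0) \<le> r" using norm_triangle_ineq4[of w w0] w w0(1) by (simp add: r'_def)
        then have "(\<kappa> / 2) / r \<le> norm (F p1 ?z w) / norm (w - w0)"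
          using circ[OF w] ne \<kappa>(1) by (intro frac_le) auto
        then show ?thesis using ne w0(2) by (simp add: G_def norm_divide)
      qed
    qed
    then show ?thesis using wC by (intro exI[of _ w]) (simp add: G_def der)
  qed
  define z where "z = (\<lambda>n. - (c / real (Suc (Suc n))))"
  have zb: "- c < z n" "z n < 0" for n using c by (auto simp: z_def field_simps add_pos_nonneg)
  have z0: "z \<longlonglongrightarrow> 0"
  proof -
    have "(\<lambda>n. c / real (Suc (Suc n))) \<longlonglongrightarrow> 0"
      by (intro filterlim_compose[OF lim_const_over_n[of c], of "\<lambda>n. Suc (Suc n)"] filterlim_Suc filterlim_compose[OF filterlim_Suc])
    from tendsto_minus[OF this] show ?thesis by (simp add: z_def)
  qed
  obtain w where w: "\<And>n. \<bar>w n\<bar> \<le> C * \<bar>z n\<bar>" "\<And>n. \<kappa> / (2 * r) \<le> \<bar>ang (real_point p1 (z n) (w n))\<bar>"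
    using key[OF zb] by metis
  have w0: "w \<longlonglongrightarrow> 0"
    by (rule Lim_null_comparison[of _ "\<lambda>n. C * \<bar>z n\<bar>"]) (use w tendsto_mult_right_zero[OF tendsto_rabs_zero[OF z0]] in auto)
  have "(\<lambda>n. real_point p1 (z n) (w n)) \<longlonglongrightarrow> (fst p1 + 0 * fst p1 - 0 * snd p1, snd p1 + 0 * snd p1 + 0 * fst p1)"
    unfolding real_point_def by (intro tendsto_intros z0 w0)
  then have q: "(\<lambda>n. real_point p1 (z n) (w n)) \<longlonglongrightarrow> p1" by simp
  have "(\<lambda>n. \<bar>ang (real_point p1 (z n) (w n))\<bar>) \<longlonglongrightarrow> \<bar>ang p1\<bar>"
    unfolding ang_def
    by (intro tendsto_intros eval2_tendsto[OF conv_on_ser_dx[OF conv]] eval2_tendsto[OF conv_on_ser_dy[OF conv]] q) (use inR[OF p1(1)] in auto)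
  then have "\<kappa> / (2 * r) \<le> \<bar>ang p1\<bar>" using w(2) by (intro LIMSEQ_le_const) auto
  then show False using p1 \<kappa>(1) r by (simp add: ang_def field_simps)
qed

end

section \<open>Functions on the levels of the resolution\<close>

lemma tendsto_nhds_iff_coordinates:
  "(f \<longlongrightarrow> (0 :: real \<times> real)) F \<longleftrightarrow> ((\<lambda>z. fst (f z)) \<longlongrightarrow> 0) F \<and> ((\<lambda>z. snd (f z)) \<longlongrightarrow> 0) F"
  using tendsto_Pair[of "\<lambda>z. fst (f z)" 0 F "\<lambda>z. snd (f z)" 0] tendsto_fst[of f 0 F] tendsto_snd[of f 0 F]
  by (auto simp: zero_prod_def)

lemma eventually_nhds_0_square:
  assumes "\<forall>\<^sub>F p in nhds (0 :: real \<times> real). Q p"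
  shows "\<exists>\<delta>>0. \<forall>x y. \<bar>x\<bar> < \<delta> \<longrightarrow> \<bar>y\<bar> < \<delta> \<longrightarrow> Q (x, y)"
proof -
  obtain d where d: "d > 0" "\<And>p. dist p 0 < d \<Longrightarrow> Q p" using assms unfolding eventually_nhds_metric by blast
  have "Q (x, y)" if "\<bar>x\<bar> < d / 2" "\<bar>y\<bar> < d / 2" for x y
    using d(2)[of "(x, y)"] norm_Pair_le[of x y] that by (simp add: dist_norm)
  then show ?thesis using d(1) by (intro exI[of _ "d / 2"]) auto
qed

lemma coordinates_tendsto_0:
  "((\<lambda>p::real\<times>real. fst p) \<longlongrightarrow> 0) (nhds 0)" "((\<lambda>p::real\<times>real. snd p) \<longlongrightarrow> 0) (nhds 0)"
  using tendsto_nhds_iff_coordinates[of "\<lambda>p. p" "nhds 0"] filterlim_ident[of "nhds (0::real\<times>real)"] by auto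

lemma eventually_in_coord_square:
  assumes "R > 0" shows "\<forall>\<^sub>F p in nhds 0. p \<in> coord_square R"
proof -
  have "((\<lambda>p::real\<times>real. \<bar>fst p\<bar>) \<longlongrightarrow> 0) (nhds 0)" "((\<lambda>p::real\<times>real. \<bar>snd p\<bar>) \<longlongrightarrow> 0) (nhds 0)"
    by (rule tendsto_rabs_zero[OF coordinates_tendsto_0(1)], rule tendsto_rabs_zero[OF coordinates_tendsto_0(2)])
  then have "\<forall>\<^sub>F p in nhds (0::real\<times>real). \<bar>fst p\<bar> < R" "\<forall>\<^sub>F p in nhds (0::real\<times>real). \<bar>snd p\<bar> < R"
    using assms by (auto intro: order_tendstoD)
  then show ?thesis by eventually_elim (simp add: coord_square_def)
qed

text \<open>Functions that are a power of the first coordinate up to a factor tending to \<open>1\<close>. Only the limit of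
  the factor at the origin enters the asymptotics of the extreme values.\<close>

definition asymp_power :: "(real \<times> real \<Rightarrow> real) \<Rightarrow> nat \<Rightarrow> bool" where
  "asymp_power f N \<longleftrightarrow> (\<exists>U. (U \<longlongrightarrow> 1) (nhds 0) \<and> (\<forall>\<^sub>F p in nhds 0. f p = U p * fst p ^ N))"

lemma asymp_power_mult:
  assumes "asymp_power f N" "asymp_power f' N'"
  shows "asymp_power (\<lambda>p. f p * f' p) (N + N')"
proof -
  obtain U U' where U: "(U \<longlongrightarrow> 1) (nhds 0)" "\<forall>\<^sub>F p in nhds 0. f p = U p * fst p ^ N"
    and U': "(U' \<longlongrightarrow> 1) (nhds 0)" "\<forall>\<^sub>F p in nhds 0. f' p = U' p * fst p ^ N'"
    using assms by (auto simp: asymp_power_def)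
  have "((\<lambda>p. U p * U' p) \<longlongrightarrow> 1) (nhds 0)" using tendsto_mult[OF U(1) U'(1)] by simp
  moreover have "\<forall>\<^sub>F p in nhds 0. f p * f' p = (U p * U' p) * fst p ^ (N + N')"
    using U(2) U'(2) by eventually_elim (simp add: power_add)
  ultimately show ?thesis unfolding asymp_power_def by blast
qed

lemma asymp_power_1: "asymp_power (\<lambda>_. 1) 0"
  unfolding asymp_power_def by (intro exI[of _ "\<lambda>_. 1"]) auto

lemma asymp_power_power: "asymp_power f N \<Longrightarrow> asymp_power (\<lambda>p. f p ^ k) (k * N)"
  by (induction k) (auto intro: asymp_power_1 asymp_power_mult)

lemma asymp_power_prod:
  assumes "finite I" "\<And>i. i \<in> I \<Longrightarrow> \<exists>N. asymp_power (f i) N"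
  shows "\<exists>N. asymp_power (\<lambda>p. \<Prod>i\<in>I. f i p) N"
  using assms
proof (induction I)
  case empty
  show ?case using asymp_power_1 by auto
next
  case (insert i I)
  obtain N where "asymp_power (f i) N" using insert.prems[of i] by auto
  moreover obtain N' where "asymp_power (\<lambda>p. \<Prod>i\<in>I. f i p) N'" using insert.IH insert.prems by auto
  ultimately have *: "asymp_power (f i) N" "asymp_power (\<lambda>p. \<Prod>i\<in>I. f i p) N'" .
  from asymp_power_mult[OF *] insert show ?case by auto
qed

lemma asymp_power_nonzero:
  assumes "asymp_power f N"
  shows "\<forall>\<^sub>F p in nhds 0. fst p \<noteq> 0 \<longrightarrow> f p \<noteq> 0"
proof -
  obtain U where U: "(U \<longlongrightarrow> 1) (nhds 0)" "\<forall>\<^sub>F p in nhds 0. f p = U p * fst p ^ N"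
    using assms by (auto simp: asymp_power_def)
  have "\<forall>\<^sub>F p in nhds 0. U p > 0" by (rule order_tendstoD(1)[OF U(1)]) simp
  with U(2) show ?thesis by eventually_elim auto
qed

locale resolved_branch =
  fixes D :: branch_resolution
  assumes toric: "toric_resolution D"
begin

lemma level_data:
  assumes "1 \<le> j" "j \<le> gg D"
  shows "nn D j \<ge> 1" "mm D j \<ge> 1" "ee D (j - 1) = ee D j * nn D j" "rad D j > 0"
    "conv_on (local_eq D j) (rad D j)" "has_initial_form (local_eq D j) (nn D j) (mm D j) (ee D j)"
    "ee D j \<ge> 1"
proof -
  show "nn D j \<ge> 1" "mm D j \<ge> 1" "ee D (j - 1) = ee D j * nn D j" "rad D j > 0"
    "conv_on (local_eq D j) (rad D j)" "has_initial_form (local_eq D j) (nn D j) (mm D j) (ee D j)"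
    using toric assms unfolding toric_resolution_def by auto
  show "ee D j \<ge> 1"
  proof (cases "j = gg D")
    case True
    then show ?thesis using toric by (simp add: toric_resolution_def)
  next
    case False
    then have "ee D j > 1" using toric assms by (simp add: toric_resolution_def)
    then show ?thesis by simp
  qed
qed

lemma step_data:
  assumes "1 \<le> j" "j < gg D"
  shows "resolution_cone (nn D j, mm D j) (cc D j, dd D j)" "local_coordinates D (Suc j)"
    "pi_map D j ` coord_square (rad D (Suc j)) \<subseteq> coord_square (rad D j)"
    "\<exists>v. conv_on v (rad D (Suc j)) \<and> v 0 0 \<noteq> 0 \<and>
           (\<forall>p\<in>coord_square (rad D (Suc j)).
              eval2 (local_eq D j) (pi_map D j p) =
              snd (pi_map D j p) ^ ee D (j - 1) * (eval2 v p * eval2 (local_eq D (Suc j)) p))"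
  using toric assms unfolding toric_resolution_def by auto

lemma uu_tendsto:
  assumes "1 \<le> j" "j < gg D"
  shows "(uu D (Suc j) \<longlongrightarrow> 1) (nhds 0)"
proof -
  have r: "rad D (Suc j) > 0" using level_data(4)[of "Suc j"] assms by simp
  obtain b where b: "conv_on b (rad D (Suc j))" "\<And>p. p \<in> coord_square (rad D (Suc j)) \<Longrightarrow> uu D (Suc j) p = eval2 b p"
    and u0: "uu D (Suc j) (0, 0) = 1"
    using step_data(2)[OF assms] unfolding local_coordinates_def by blast
  have "(eval2 b \<longlongrightarrow> eval2 b 0) (nhds 0)"
    by (rule eval2_tendsto[OF b(1)]) (use r in \<open>auto intro: filterlim_ident\<close>)
  moreover have "eval2 b 0 = 1" using b(2)[of "(0, 0)"] u0 r by (simp add: coord_square_def zero_prod_def)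
  moreover have "\<forall>\<^sub>F p in nhds 0. eval2 b p = uu D (Suc j) p"
    using eventually_in_coord_square[OF r] by eventually_elim (simp add: b(2))
  ultimately show ?thesis using tendsto_cong by fastforce
qed

lemma pi_map_tendsto:
  assumes "1 \<le> j" "j < gg D"
  shows "(pi_map D j \<longlongrightarrow> 0) (nhds 0)"
proof -
  have nm: "nn D j \<ge> 1" "mm D j \<ge> 1" using level_data[of j] assms by auto
  have "((\<lambda>p. uu D (Suc j) p ^ cc D j * fst p ^ nn D j) \<longlongrightarrow> 1 ^ cc D j * 0 ^ nn D j) (nhds 0)"
    "((\<lambda>p. uu D (Suc j) p ^ dd D j * fst p ^ mm D j) \<longlongrightarrow> 1 ^ dd D j * 0 ^ mm D j) (nhds 0)"
    by (intro tendsto_mult tendsto_power uu_tendsto[OF assms] coordinates_tendsto_0)+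
  then show ?thesis
    unfolding tendsto_nhds_iff_coordinates pi_map_def using nm by (simp add: power_0_left)
qed

text \<open>The function \<open>u\<close> tends to \<open>1\<close>, so the first component of \<open>\<pi>_j\<close> is asymptotically \<open>x^(n_j)\<close>.\<close>

lemma asymp_power_compose_pi_map:
  assumes "1 \<le> j" "j < gg D" "asymp_power f N"
  shows "asymp_power (\<lambda>p. f (pi_map D j p)) (nn D j * N)"
proof -
  obtain U where U: "(U \<longlongrightarrow> 1) (nhds 0)" "\<forall>\<^sub>F p in nhds 0. f p = U p * fst p ^ N"
    using assms by (auto simp: asymp_power_def)
  have "((\<lambda>p. U (pi_map D j p) * (uu D (Suc j) p ^ cc D j) ^ N) \<longlongrightarrow> 1 * (1 ^ cc D j) ^ N) (nhds 0)"
    by (intro tendsto_mult tendsto_power uu_tendsto[OF assms(1,2)] filterlim_compose[OF U(1) pi_map_tendsto[OF assms(1,2)]])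
  moreover have "\<forall>\<^sub>F p in nhds 0. f (pi_map D j p) = U (pi_map D j p) * (uu D (Suc j) p ^ cc D j) ^ N * fst p ^ (nn D j * N)"
    using eventually_compose_filterlim[OF U(2) pi_map_tendsto[OF assms(1,2)]]
    by eventually_elim (simp add: pi_map_def power_mult_distrib power_mult)
  ultimately show ?thesis unfolding asymp_power_def by auto
qed

lemma asymp_power_fst_down:
  assumes "1 \<le> i" "i + k \<le> gg D"
  shows "asymp_power (\<lambda>p. fst (down D i k p)) (\<Prod>l\<in>{i..<i + k}. nn D l)"
  using assms
proof (induction k)
  case 0
  show ?case unfolding asymp_power_def by (intro exI[of _ "\<lambda>_. 1"]) auto
next
  case (Suc k)
  then have "asymp_power (\<lambda>p. fst (down D i k (pi_map D (i + k) p))) (nn D (i + k) * (\<Prod>l\<in>{i..<i + k}. nn D l))"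
    by (intro asymp_power_compose_pi_map) auto
  then show ?case by (simp add: mult.commute)
qed

lemma asymp_power_snd_down:
  assumes "1 \<le> i" "i + Suc k \<le> gg D"
  shows "asymp_power (\<lambda>p. snd (down D i (Suc k) p)) (mm D i * (\<Prod>l\<in>{Suc i..<i + Suc k}. nn D l))"
  using assms
proof (induction k)
  case 0
  have "((\<lambda>p. uu D (Suc i) p ^ dd D i) \<longlongrightarrow> 1 ^ dd D i) (nhds 0)"
    using 0 by (intro tendsto_power uu_tendsto) auto
  then show ?case unfolding asymp_power_def
    by (intro exI[of _ "\<lambda>p. uu D (Suc i) p ^ dd D i"]) (auto simp: pi_map_def)
next
  case (Suc k)
  then have "asymp_power (\<lambda>p. snd (down D i (Suc k) (pi_map D (i + Suc k) p)))
     (nn D (i + Suc k) * (mm D i * (\<Prod>l\<in>{Suc i..<i + Suc k}. nn D l)))"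
    by (intro asymp_power_compose_pi_map) auto
  moreover have "(\<Prod>l\<in>{Suc i..<i + Suc (Suc k)}. nn D l) = (\<Prod>l\<in>{Suc i..<i + Suc k}. nn D l) * nn D (i + Suc k)"
    using prod.atLeastLessThan_Suc[of "Suc i" "i + Suc k" "nn D"] by simp
  ultimately show ?case
    unfolding down.simps(2)[of D i "Suc k"] by (simp only: mult_ac)
qed

lemma down_tendsto:
  assumes "1 \<le> i" "i + k \<le> gg D"
  shows "(down D i k \<longlongrightarrow> 0) (nhds 0)"
  using assms
proof (induction k)
  case 0
  then show ?case by (simp add: filterlim_ident)
next
  case (Suc k)
  then show ?case using filterlim_compose[OF _ pi_map_tendsto[of "i + k"], of "down D i k" "nhds 0"] by simp
qed

lemma asymp_power_exc:
  assumes "1 \<le> j" "j \<le> gg D"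
  shows "\<exists>N. asymp_power (exc D j) N"
  unfolding exc_def
proof (rule asymp_power_prod)
  fix i assume i: "i \<in> {1..<j}"
  then have "asymp_power (\<lambda>p. snd (down D i (Suc (j - i - 1)) p)) (mm D i * (\<Prod>l\<in>{Suc i..<i + Suc (j - i - 1)}. nn D l))"
    using assms by (intro asymp_power_snd_down) auto
  moreover have "Suc (j - i - 1) = j - i" using i by auto
  ultimately show "\<exists>N. asymp_power (\<lambda>p. snd (down D i (j - i) p) ^ ee D (i - 1)) N"
    using asymp_power_power by metis
qed simp

text \<open>The exceptional factor vanishes only on the exceptional divisor, near the centre of the chart.\<close>

lemma exc_nonzero:
  assumes "1 \<le> j" "j \<le> gg D"
  shows "\<forall>\<^sub>F p in nhds 0. fst p \<noteq> 0 \<longrightarrow> exc D j p \<noteq> 0"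
  using asymp_power_exc[OF assms] asymp_power_nonzero by blast

lemma uu_down_tendsto:
  assumes "2 \<le> i" "i \<le> j" "j \<le> gg D"
  shows "((\<lambda>p. uu D i (down D i (j - i) p)) \<longlongrightarrow> 1) (nhds 0)"
  using filterlim_compose[OF uu_tendsto[of "i - 1"] down_tendsto[of i "j - i"]] assms by simp

lemma to_plane_Suc: "1 \<le> j \<Longrightarrow> to_plane D (Suc j) p = to_plane D j (pi_map D j p)"
  by (cases j) (auto simp: to_plane_def)

lemma exc_Suc:
  assumes "1 \<le> j"
  shows "exc D (Suc j) p = exc D j (pi_map D j p) * snd (pi_map D j p) ^ ee D (j - 1)"
proof -
  have "{1..<Suc j} = insert j {1..<j}" using assms by auto
  then have "exc D (Suc j) p = snd (down D j (Suc j - j) p) ^ ee D (j - 1) * (\<Prod>i\<in>{1..<j}. snd (down D i (Suc j - i) p) ^ ee D (i - 1))"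
    unfolding exc_def by simp
  moreover have "down D j (Suc j - j) p = pi_map D j p" by (simp add: Suc_diff_le)
  moreover have "(\<Prod>i\<in>{1..<j}. snd (down D i (Suc j - i) p) ^ ee D (i - 1)) = exc D j (pi_map D j p)"
    unfolding exc_def by (intro prod.cong refl) (simp add: Suc_diff_le)
  ultimately show ?thesis by simp
qed

lemma exc_1: "exc D (Suc 0) p = 1"
  by (simp add: exc_def)

text \<open>Off the exceptional divisor one can divide by the exceptional factor.\<close>

lemma is_strict_transform_unique:
  assumes j: "1 \<le> j" "j \<le> gg D" and a: "is_strict_transform D j P a" and b: "is_strict_transform D j P b"
  shows "a = b"
proof -
  have r: "rad D j > 0" using level_data[OF j] by simp
  have "\<forall>\<^sub>F p in nhds 0. fst p \<noteq> 0 \<longrightarrow> eval2 a p = eval2 b p"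
    using exc_nonzero[OF j] eventually_in_coord_square[OF r]
  proof eventually_elim
    case (elim p)
    then have "exc D j p * eval2 a p = exc D j p * eval2 b p"
      using a b unfolding is_strict_transform_def by metis
    then show ?case using elim by auto
  qed
  then obtain \<delta> where \<delta>: "\<delta> > 0" "\<And>x y. \<bar>x\<bar> < \<delta> \<Longrightarrow> \<bar>y\<bar> < \<delta> \<Longrightarrow> x \<noteq> 0 \<Longrightarrow> eval2 a (x, y) = eval2 b (x, y)"
    using eventually_nhds_0_square[of "\<lambda>p. fst p \<noteq> 0 \<longrightarrow> eval2 a p = eval2 b p"] by auto
  show ?thesis
    by (rule eval2_eq_on_quadrant_imp_eq[OF _ _ r \<delta>(1)])
       (use a b \<delta>(2) in \<open>auto simp: is_strict_transform_def\<close>)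
qed

lemma strict_transform_eq:
  assumes "1 \<le> j" "j \<le> gg D" "is_strict_transform D j P a"
  shows "strict_transform D j P = a"
  unfolding strict_transform_def
  by (rule the_equality) (use assms is_strict_transform_unique in blast)+

lemma is_strict_transform_add:
  assumes "is_strict_transform D j P a" "is_strict_transform D j P' a'"
  shows "is_strict_transform D j (P + P') (\<lambda>r s. a r s + a' r s)"
proof -
  have "conv_on a (rad D j)" "conv_on a' (rad D j)" using assms by (auto simp: is_strict_transform_def)
  then have "eval2 (\<lambda>r s. a r s + a' r s) p = eval2 a p + eval2 a' p" if "p \<in> coord_square (rad D j)" for p
    using that by (intro eval2_add[where R = "rad D j"]) (auto simp: coord_square_def)
  then show ?thesis
    using assms conv_on_add[of a "rad D j" a'] by (auto simp: is_strict_transform_def poly2_add distrib_left)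
qed

lemma is_strict_transform_smult:
  assumes "is_strict_transform D j P a"
  shows "is_strict_transform D j (smult [:c:] P) (\<lambda>r s. c * a r s)"
  using assms conv_on_scale[of a "rad D j" c]
  unfolding is_strict_transform_def
  by (auto simp: poly2_smult coord_square_def eval2_scale)

end

section \<open>Weights of strict transforms\<close>

lemma finite_coeff2_support: "finite {(r, s). coeff2 P r s \<noteq> 0}"
proof (rule finite_subset)
  show "{(r, s). coeff2 P r s \<noteq> 0} \<subseteq> (\<Union>s\<in>{..degree P}. {..degree (coeff P s)} \<times> {s})"
  proof clarify
    fix r s assume "coeff2 P r s \<noteq> 0"
    then have "coeff P s \<noteq> 0" "r \<le> degree (coeff P s)" by (auto simp: coeff2_def le_degree)
    then show "(r, s) \<in> (\<Union>s\<in>{..degree P}. {..degree (coeff P s)} \<times> {s})" by (auto simp: le_degree)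
  qed
qed simp

lemma poly2_eq_sum_monomials:
  assumes "finite S" "\<And>r s. coeff2 P r s \<noteq> 0 \<Longrightarrow> (r, s) \<in> S"
  shows "P = (\<Sum>(r,s)\<in>S. monom2 (coeff2 P r s) r s)"
proof -
  let ?Q = "\<Sum>(r,s)\<in>S. monom2 (coeff2 P r s) r s"
  have "coeff2 P r s = coeff2 ?Q r s" for r s
  proof -
    have "coeff2 ?Q r s = (if (r, s) \<in> S then coeff2 P r s else 0)"
      by (rule coeff2_sum_monom2[OF assms(1)])
    then show ?thesis using assms(2)[of r s] by auto
  qed
  then have eq: "coeff (coeff P s) r = coeff (coeff ?Q s) r" for r s unfolding coeff2_def .
  show ?thesis
  proof (rule poly_eqI)
    fix s show "coeff P s = coeff ?Q s" by (rule poly_eqI) (rule eq)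
  qed
qed

lemma poly2_eq_eval2: "poly2 P p = eval2 (coeff2 P) p"
proof -
  have eq: "P = (\<Sum>(r,s)\<in>{(r, s). coeff2 P r s \<noteq> 0}. monom2 (coeff2 P r s) r s)"
    by (rule poly2_eq_sum_monomials[OF finite_coeff2_support]) auto
  have "poly2 P p = (\<Sum>(r,s)\<in>{(r, s). coeff2 P r s \<noteq> 0}. coeff2 P r s * fst p ^ r * snd p ^ s)"
    by (subst eq) (simp add: poly2_sum case_prod_unfold poly2_monom2)
  also have "\<dots> = eval2 (coeff2 P) p"
    by (rule eval2_finite[OF finite_coeff2_support, symmetric]) auto
  finally show ?thesis .
qed

lemma coeff2_pderiv_y: "coeff2 (pderiv P) = ser_dy (coeff2 P)"
proof (intro ext)
  fix r s
  have "coeff (of_nat n * q) r = of_nat n * coeff q r" for n and q :: "real poly"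
    by (simp add: of_nat_poly)
  then show "coeff2 (pderiv P) r s = ser_dy (coeff2 P) r s"
    unfolding coeff2_def ser_dy_def coeff_pderiv by blast
qed

lemma coeff2_pderiv_x: "coeff2 (map_poly pderiv P) = ser_dx (coeff2 P)"
  by (intro ext) (simp add: coeff2_def ser_dx_def coeff_map_poly coeff_pderiv)

lemma coeff2_truncation:
  "coeff2 (truncation P \<Lambda>) r s = (if (real r, real s) \<in> \<Lambda> then coeff2 P r s else 0)"
proof -
  have "finite {(r,s)\<in>lattice_points \<Lambda>. coeff2 P r s \<noteq> 0}"
    by (rule finite_subset[OF _ finite_coeff2_support[of P]]) auto
  then show ?thesis
    unfolding truncation_def by (subst coeff2_sum_monom2) (auto simp: lattice_points_def)
qed

lemma nonsingular_in_torusD: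
  assumes "nonsingular_in_torus P" "X \<noteq> 0" "Y \<noteq> 0" "eval2 (coeff2 P) (X, Y) = 0"
  shows "eval2 (ser_dx (coeff2 P)) (X, Y) \<noteq> 0 \<or> eval2 (ser_dy (coeff2 P)) (X, Y) \<noteq> 0"
  using assms unfolding nonsingular_in_torus_def poly2_eq_eval2 coeff2_pderiv_x coeff2_pderiv_y by fastforce

lemma smult_sum_right: "smult c (sum f A) = (\<Sum>i\<in>A. smult c (f i))"
  by (induction A rule: infinite_finite_induct) (auto simp: smult_add_right)

text \<open>The members of a family that is polynomial in a parameter lie in a linear subspace only if all
  its coefficients do: replacing the parameter by its double and subtracting removes the top
  coefficient.\<close>

lemma coefficients_in_subspace:
  fixes G :: "nat \<Rightarrow> real poly poly"
  assumes add: "\<And>P Q. V P \<Longrightarrow> V Q \<Longrightarrow> V (P + Q)" and scale: "\<And>c P. V P \<Longrightarrow> V (smult [:c:] P)"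
    and "\<And>s::real. V (\<Sum>k\<le>N. smult [:s ^ k:] (G k))" and "k \<le> N"
  shows "V (G k)"
  using assms(3,4)
proof (induction N arbitrary: G k)
  case 0
  then show ?case by (simp flip: one_pCons)
next
  case (Suc N)
  let ?f = "\<lambda>s. \<Sum>k\<le>Suc N. smult [:s ^ k:] (G k)"
  let ?c = "\<lambda>k. (2::real) ^ k - 2 ^ Suc N"
  have low: "V (G k)" if k: "k \<le> N" for k
  proof -
    have "V (smult [:?c k:] (G k))"
    proof (rule Suc.IH[OF _ k])
      fix s :: real
      have "V (?f (2 * s) + smult [:- (2 ^ Suc N):] (?f s))"
        by (intro add scale Suc.prems(1))
      also have "?f (2 * s) + smult [:- (2 ^ Suc N):] (?f s)
         = (\<Sum>k\<le>Suc N. smult [:(2 * s) ^ k:] (G k) + smult [:- (2 ^ Suc N):] (smult [:s ^ k:] (G k)))"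
        by (simp add: sum.distrib smult_sum_right del: sum.atMost_Suc)
      also have "\<dots> = (\<Sum>k\<le>Suc N. smult [:s ^ k:] (smult [:?c k:] (G k)))"
        by (intro sum.cong refl) (simp add: power_mult_distrib flip: smult_add_left, simp add: algebra_simps)
      also have "\<dots> = (\<Sum>k\<le>N. smult [:s ^ k:] (smult [:?c k:] (G k)))" by simp
      finally show "V (\<Sum>k\<le>N. smult [:s ^ k:] (smult [:?c k:] (G k)))" .
    qed
    then have "V (smult [:inverse (?c k):] (smult [:?c k:] (G k)))" by (rule scale)
    moreover have "(2::real) ^ k < 2 ^ Suc N" using k by (intro power_strict_increasing) auto
    then have "?c k \<noteq> 0" by simp
    ultimately show ?thesis by (simp flip: one_pCons)
  qed
  have lowsum: "V (smult [:-1:] (sum G A))" if "finite A" "A \<noteq> {}" "A \<subseteq> {..N}" for A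
    using that
  proof (induction A rule: finite_ne_induct)
    case (singleton x)
    then show ?case by (auto intro: scale low)
  next
    case (insert x F)
    then show ?case using add[OF scale[OF low[of x], of "-1"]] by (simp add: smult_add_right)
  qed
  have "V (G (Suc N))"
  proof -
    have "V (?f 1 + smult [:-1:] (sum G {..N}))"
      by (intro add Suc.prems(1) lowsum) auto
    moreover have "[:-1::real:] = - 1" by (simp add: one_pCons)
    then have "?f 1 + smult [:-1:] (sum G {..N}) = G (Suc N)"
      by (simp flip: one_pCons)
    ultimately show ?thesis by simp
  qed
  with low Suc.prems(2) show ?case by (metis le_Suc_eq)
qed

text \<open>Comparing both sides of the defining identity along the curves on which \<open>x\<close> and \<open>y\<close> are
  rescaled shows that there are no terms below the edge.\<close>

lemma has_initial_form_weight:
  assumes a: "has_initial_form a n m e" and n: "n \<ge> 1" and m: "m \<ge> 1" and nz: "a r s \<noteq> 0"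
  shows "e * n * m \<le> n * r + m * s"
proof (rule ccontr)
  assume less: "\<not> e * n * m \<le> n * r + m * s"
  define S where "S = {(r,s). r * n + s * m \<le> e * n * m}"
  have fin: "finite S"
    using finite_weight_le[OF n m, of 0 "e * n * m"] by (simp add: S_def mult.commute)
  define b where "b = (\<lambda>r s. if (r, s) \<in> S then a r s else 0)"
  have b: "conv_on b 1" by (rule conv_on_finite[OF fin]) (auto simp: b_def split: if_splits)
  have ev: "eval2 b (x, y) = (y ^ n - x ^ m) ^ e" for x y
  proof -
    have "eval2 b (x, y) = (\<Sum>(r,s)\<in>S. a r s * x ^ r * y ^ s)"
      by (subst eval2_finite[OF fin]) (auto simp: b_def split: if_splits intro!: sum.cong)
    then show ?thesis using a by (simp add: has_initial_form_def S_def)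
  qed
  have "e * n * m \<le> n * r + m * s + 0"
  proof (rule weight_ge_if_scaling_tendsto(1)[OF b _ n m])
    fix X Y :: real
    have "\<forall>\<^sub>F \<sigma> in at_right 0. \<sigma> ^ 0 * eval2 b (\<sigma> ^ n * X, \<sigma> ^ m * Y) / \<sigma> ^ (e * n * m) = (Y ^ n - X ^ m) ^ e"
      using eventually_at_right_less[of 0]
    proof eventually_elim
      case (elim \<sigma>)
      have "(\<sigma> ^ m * Y) ^ n - (\<sigma> ^ n * X) ^ m = \<sigma> ^ (n * m) * (Y ^ n - X ^ m)"
        by (simp add: power_mult_distrib right_diff_distrib mult.commute flip: power_mult)
      then have "eval2 b (\<sigma> ^ n * X, \<sigma> ^ m * Y) = \<sigma> ^ (e * n * m) * (Y ^ n - X ^ m) ^ e"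
        by (simp add: ev power_mult_distrib mult_ac flip: power_mult)
      then show ?case using elim by simp
    qed
    then show "((\<lambda>\<sigma>. \<sigma> ^ 0 * eval2 b (\<sigma> ^ n * X, \<sigma> ^ m * Y) / \<sigma> ^ (e * n * m)) \<longlongrightarrow> (Y ^ n - X ^ m) ^ e) (at_right 0)"
      by (rule tendsto_eventually)
    show "b r s \<noteq> 0" using less nz by (simp add: b_def S_def mult.commute)
  qed simp
  with less show False by simp
qed

lemma scaled_point_tendsto_0:
  assumes "\<alpha> \<ge> 1" "\<beta> \<ge> 1"
  shows "((\<lambda>\<sigma>. (\<sigma> ^ \<alpha> * X, \<sigma> ^ \<beta> * Y)) \<longlongrightarrow> (0 :: real \<times> real)) (at_right 0)"
  unfolding tendsto_nhds_iff_coordinates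
  using tendsto_scaled_point_zero[OF _ tendsto_const assms(1), of "\<lambda>\<sigma>. \<sigma>" "at_right 0" X]
    tendsto_scaled_point_zero[OF _ tendsto_const assms(2), of "\<lambda>\<sigma>. \<sigma>" "at_right 0" Y]
  by (simp add: tendsto_ident_at)

context resolved_branch
begin

text \<open>The units by which the local equations of consecutive levels differ accumulate in \<open>V\<close>. Only its limit
  at the centre of the chart will matter.\<close>

lemma curve_poly_to_plane:
  assumes "1 \<le> j" "j \<le> gg D"
  shows "\<exists>V v0. (V \<longlongrightarrow> v0) (nhds 0) \<and>
    (\<forall>\<^sub>F p in nhds 0. poly2 (curve_poly D) (to_plane D j p) = exc D j p * V p * eval2 (local_eq D j) p)"
  using assms
proof (induction j rule: nat_induct_at_least)
  case base
  have "local_eq D 1 = coeff2 (curve_poly D)" using toric by (simp add: toric_resolution_def)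
  then show ?case
    by (intro exI[of _ "\<lambda>_. 1"] exI[of _ 1]) (simp add: to_plane_def exc_1 poly2_eq_eval2)
next
  case (Suc j)
  then have j: "1 \<le> j" "j < gg D" by auto
  obtain V v0 where V: "(V \<longlongrightarrow> v0) (nhds 0)"
    "\<forall>\<^sub>F p in nhds 0. poly2 (curve_poly D) (to_plane D j p) = exc D j p * V p * eval2 (local_eq D j) p"
    using Suc by auto
  have r: "rad D (Suc j) > 0" using level_data[of "Suc j"] j by simp
  obtain v where v: "conv_on v (rad D (Suc j))" "\<And>p. p\<in>coord_square (rad D (Suc j)) \<Longrightarrow>
      eval2 (local_eq D j) (pi_map D j p) = snd (pi_map D j p) ^ ee D (j - 1) * (eval2 v p * eval2 (local_eq D (Suc j)) p)"
    using step_data(4)[OF j] by blast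
  have "(eval2 v \<longlongrightarrow> eval2 v 0) (nhds 0)"
    by (rule eval2_tendsto[OF v(1)]) (use r in \<open>auto intro: filterlim_ident\<close>)
  then have "((\<lambda>p. V (pi_map D j p) * eval2 v p) \<longlongrightarrow> v0 * eval2 v 0) (nhds 0)"
    by (intro tendsto_mult filterlim_compose[OF V(1) pi_map_tendsto[OF j]])
  moreover have "\<forall>\<^sub>F p in nhds 0. poly2 (curve_poly D) (to_plane D (Suc j) p) =
      exc D (Suc j) p * (V (pi_map D j p) * eval2 v p) * eval2 (local_eq D (Suc j)) p"
    using eventually_compose_filterlim[OF V(2) pi_map_tendsto[OF j]] eventually_in_coord_square[OF r]
    by eventually_elim (simp add: to_plane_Suc[OF j(1)] exc_Suc[OF j(1)] v(2) mult_ac)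
  ultimately show ?case by blast
qed

text \<open>At the last level the strict transform of the branch is given up to a unit by its local
  equation.\<close>

lemma strict_transform_weight_last_level:
  assumes j: "j = gg D" "1 \<le> j" and a: "is_strict_transform D j (curve_poly D) a" and nz: "a r s \<noteq> 0"
  shows "ee D j * nn D j * mm D j \<le> nn D j * r + mm D j * s"
proof -
  note L = level_data[of j]
  have nm: "nn D j \<ge> 1" "mm D j \<ge> 1" and R: "rad D j > 0" using L j by auto
  have ca: "conv_on a (rad D j)" using a by (simp add: is_strict_transform_def)
  let ?W = "ee D j * nn D j * mm D j"
  obtain V v0 where V: "(V \<longlongrightarrow> v0) (nhds 0)"
    "\<forall>\<^sub>F p in nhds 0. poly2 (curve_poly D) (to_plane D j p) = exc D j p * V p * eval2 (local_eq D j) p"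
    using curve_poly_to_plane[of j] j by auto
  have ev: "\<forall>\<^sub>F p in nhds 0. fst p \<noteq> 0 \<longrightarrow> eval2 a p = V p * eval2 (local_eq D j) p"
    using V(2) exc_nonzero[of j] eventually_in_coord_square[OF R]
  proof -
    have "\<forall>\<^sub>F p in nhds 0. fst p \<noteq> 0 \<longrightarrow> exc D j p \<noteq> 0" using exc_nonzero[of j] j by simp
    with V(2) eventually_in_coord_square[OF R] show ?thesis
    proof eventually_elim
      case (elim p)
      then have "exc D j p * eval2 a p = exc D j p * (V p * eval2 (local_eq D j) p)"
        using a unfolding is_strict_transform_def by (simp add: mult.assoc)
      then show ?case using elim by auto
    qed
  qed
  have "?W \<le> nn D j * r + mm D j * s + 0"
  proof (rule weight_ge_if_scaling_tendsto(1)[OF ca R nm])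
    fix X Y :: real assume XY: "X > 0" "Y > 0"
    let ?p = "\<lambda>\<sigma>. (\<sigma> ^ nn D j * X, \<sigma> ^ mm D j * Y)"
    have "((\<lambda>\<sigma>. V (?p \<sigma>) * (\<sigma> ^ 0 * eval2 (local_eq D j) (?p \<sigma>) / \<sigma> ^ ?W))
      \<longlongrightarrow> v0 * weighted_part (nn D j) (mm D j) 0 ?W (local_eq D j) (X, Y)) (at_right 0)"
      by (intro tendsto_mult filterlim_compose[OF V(1) scaled_point_tendsto_0[OF nm]]
            eval2_scaling_tendsto[OF L(5) R nm])
         (use j nm has_initial_form_weight[OF L(6)] in \<open>auto simp: eventually_at_right_less\<close>)
    moreover have "\<forall>\<^sub>F \<sigma> in at_right 0. V (?p \<sigma>) * (\<sigma> ^ 0 * eval2 (local_eq D j) (?p \<sigma>) / \<sigma> ^ ?W)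
       = \<sigma> ^ 0 * eval2 a (?p \<sigma>) / \<sigma> ^ ?W"
      using eventually_compose_filterlim[OF ev scaled_point_tendsto_0[OF nm, of X Y]] eventually_at_right_less[of 0]
      by eventually_elim (use XY in auto)
    ultimately show "((\<lambda>\<sigma>. \<sigma> ^ 0 * eval2 a (?p \<sigma>) / \<sigma> ^ ?W)
      \<longlongrightarrow> v0 * weighted_part (nn D j) (mm D j) 0 ?W (local_eq D j) (X, Y)) (at_right 0)"
      by (rule Lim_transform_eventually)
  qed (use nz in auto)
  then show ?thesis by simp
qed

lemma resolution_cone_det:
  assumes "resolution_cone (n, m) (c, d)"
  shows "int c * int m - int d * int n = 1"
proof -
  obtain vs i where "minimal_regular_subdivision (n, m) vs" "Suc i < length vs" "vs ! i = (c, d)" "vs ! Suc i = (n, m)"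
    using assms unfolding resolution_cone_def by blast
  then show ?thesis
    unfolding minimal_regular_subdivision_def regular_subdivision_def by fastforce
qed

text \<open>If \<open>P\<close> has strict transforms at both levels, then the pullback of its strict transform at level \<open>j\<close>
  vanishes along the exceptional divisor to the order of \<open>y_j^(e_(j-1))\<close>. On that divisor the part of
  lowest weight is a polynomial in \<open>u\<close> whose exponents are pairwise different, because the cone is
  regular; hence it cannot cancel.\<close>

lemma strict_transform_weight:
  assumes j: "1 \<le> j" "j < gg D" and a: "is_strict_transform D j P a" and a': "is_strict_transform D (Suc j) P a'"
    and nz: "a r s \<noteq> 0"
  shows "ee D j * nn D j * mm D j \<le> nn D j * r + mm D j * s"
proof (rule ccontr)
  assume less: "\<not> ?thesis"
  let ?n = "nn D j" and ?m = "mm D j" and ?c = "cc D j" and ?d = "dd D j" and ?E = "ee D (j - 1)"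
  let ?u = "uu D (Suc j)"
  have nm: "?n \<ge> 1" "?m \<ge> 1" and R: "rad D j > 0" and E: "?E = ee D j * ?n" using level_data[of j] j by auto
  have R': "rad D (Suc j) > 0" using level_data[of "Suc j"] j by auto
  have ca: "conv_on a (rad D j)" and ca': "conv_on a' (rad D (Suc j))"
    using a a' by (auto simp: is_strict_transform_def)
  \<comment> \<open>the lowest weight of the strict transform at level \<open>j\<close>\<close>
  define k where "k = (LEAST w. \<exists>r s. a r s \<noteq> 0 \<and> w = ?n * r + ?m * s)"
  have ex: "\<exists>w. \<exists>r s. a r s \<noteq> 0 \<and> w = ?n * r + ?m * s" using nz by auto
  obtain r' s' where rs': "a r' s' \<noteq> 0" "k = ?n * r' + ?m * s'"
    using LeastI_ex[OF ex] unfolding k_def by blast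
  have min: "k \<le> ?n * i + ?m * l" if "a i l \<noteq> 0" for i l
    unfolding k_def by (rule Least_le) (use that in blast)
  have kE: "k < ?m * ?E" using min[OF nz] less unfolding E by (simp add: mult_ac)
  have ev: "\<forall>\<^sub>F p in nhds 0. fst p \<noteq> 0 \<longrightarrow> eval2 a (pi_map D j p) = snd (pi_map D j p) ^ ?E * eval2 a' p"
  proof -
    have "\<forall>\<^sub>F p in nhds 0. fst p \<noteq> 0 \<longrightarrow> exc D (Suc j) p \<noteq> 0" using exc_nonzero[of "Suc j"] j by simp
    with eventually_in_coord_square[OF R'] show ?thesis
    proof eventually_elim
      case (elim p)
      have pj: "pi_map D j p \<in> coord_square (rad D j)" using step_data(3)[OF j] elim(1) by blast
      have "exc D j (pi_map D j p) * eval2 a (pi_map D j p) = poly2 P (to_plane D (Suc j) p)"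
        using a pj by (simp add: is_strict_transform_def to_plane_Suc[OF j(1)])
      also have "\<dots> = exc D j (pi_map D j p) * (snd (pi_map D j p) ^ ?E * eval2 a' p)"
        using a' elim(1) by (simp add: is_strict_transform_def exc_Suc[OF j(1)])
      finally show ?case using elim(2) by (auto simp: exc_Suc[OF j(1)])
    qed
  qed
  obtain \<delta> where \<delta>: "\<delta> > 0" and id: "\<And>x y. \<bar>x\<bar> < \<delta> \<Longrightarrow> \<bar>y\<bar> < \<delta> \<Longrightarrow> x \<noteq> 0 \<Longrightarrow>
      eval2 a (pi_map D j (x, y)) = snd (pi_map D j (x, y)) ^ ?E * eval2 a' (x, y)"
    using eventually_nhds_0_square[OF ev] by auto
  obtain b where b: "conv_on b (rad D (Suc j))" "\<And>p. p \<in> coord_square (rad D (Suc j)) \<Longrightarrow> ?u p = eval2 b p"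
    and xi: "xi D (Suc j) \<noteq> 0"
    and loc: "\<And>p. p\<in>coord_square (rad D (Suc j)) \<Longrightarrow>
        xi D (Suc j) * snd p = 1 - ?u p + fst p * poly2 (RR D (Suc j)) (fst p, ?u p)"
    using step_data(2)[OF j] unfolding local_coordinates_def by blast
  \<comment> \<open>compare the orders of vanishing in \<open>x\<close> along the exceptional divisor; the value of \<open>u\<close> at \<open>(0, y)\<close> is \<open>1 - \<xi> y\<close>\<close>
  have wp0: "weighted_part ?n ?m 0 k a ((1 - xi D (Suc j) * y) ^ ?c, (1 - xi D (Suc j) * y) ^ ?d) = 0"
    if y: "\<bar>y\<bar> < min \<delta> (rad D (Suc j))" for y
  proof -
    have yR: "\<bar>snd (0, y)\<bar> < rad D (Suc j)" "\<bar>fst (0::real, y)\<bar> < rad D (Suc j)" using y R' by auto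
    have pt: "((\<lambda>x::real. (x, y)) \<longlongrightarrow> (0, y)) (at_right 0)" by (intro tendsto_intros)
    have sm: "\<forall>\<^sub>F x in at_right 0. 0 < x \<and> x < min \<delta> (rad D (Suc j))"
      by (rule eventually_at_rightI[of 0 "min \<delta> (rad D (Suc j))"]) (use \<delta> R' in auto)
    have u0: "?u (0, y) = 1 - xi D (Suc j) * y"
      using loc[of "(0, y)"] y R' by (simp add: coord_square_def)
    have "((\<lambda>x. eval2 b (x, y)) \<longlongrightarrow> eval2 b (0, y)) (at_right 0)"
      by (rule eval2_tendsto[OF b(1) _ _ pt]) (use y R' in auto)
    moreover have "eval2 b (0, y) = ?u (0, y)" using b(2)[of "(0, y)"] y R' by (simp add: coord_square_def)
    moreover have "\<forall>\<^sub>F x in at_right 0. eval2 b (x, y) = ?u (x, y)"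
      using sm by eventually_elim (rule b(2)[symmetric], use y in \<open>simp add: coord_square_def\<close>)
    ultimately have ut: "((\<lambda>x. ?u (x, y)) \<longlongrightarrow> 1 - xi D (Suc j) * y) (at_right 0)"
      using u0 Lim_transform_eventually by fastforce
    have A: "((\<lambda>x. x ^ 0 * eval2 a (x ^ ?n * ?u (x, y) ^ ?c, x ^ ?m * ?u (x, y) ^ ?d) / x ^ k)
      \<longlongrightarrow> weighted_part ?n ?m 0 k a ((1 - xi D (Suc j) * y) ^ ?c, (1 - xi D (Suc j) * y) ^ ?d)) (at_right 0)"
      by (rule eval2_scaling_tendsto[OF ca R nm]) (use min in \<open>auto intro!: tendsto_power ut simp: eventually_at_right_less\<close>)
    have B: "((\<lambda>x. (?u (x, y) ^ ?d) ^ ?E * x ^ (?m * ?E - k) * eval2 a' (x, y)) \<longlongrightarrow>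
        ((1 - xi D (Suc j) * y) ^ ?d) ^ ?E * 0 ^ (?m * ?E - k) * eval2 a' (0, y)) (at_right 0)"
      by (intro tendsto_mult tendsto_power ut eval2_tendsto[OF ca' _ _ pt] tendsto_ident_at) (use y R' in auto)
    have C: "\<forall>\<^sub>F x in at_right 0. (?u (x, y) ^ ?d) ^ ?E * x ^ (?m * ?E - k) * eval2 a' (x, y)
        = x ^ 0 * eval2 a (x ^ ?n * ?u (x, y) ^ ?c, x ^ ?m * ?u (x, y) ^ ?d) / x ^ k"
      using sm
    proof eventually_elim
      case (elim x)
      have pm: "pi_map D j (x, y) = (x ^ ?n * ?u (x, y) ^ ?c, x ^ ?m * ?u (x, y) ^ ?d)"
        by (simp add: pi_map_def mult.commute)
      have "eval2 a (pi_map D j (x, y)) = (x ^ ?m * ?u (x, y) ^ ?d) ^ ?E * eval2 a' (x, y)"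
        using id[of x y] elim y by (simp add: pi_map_def mult.commute)
      moreover have "(x ^ ?m) ^ ?E = x ^ (?m * ?E - k) * x ^ k"
        using kE by (simp flip: power_mult power_add)
      ultimately show ?case unfolding pm using elim by (simp add: power_mult_distrib)
    qed
    have "0 ^ (?m * ?E - k) = (0::real)" using kE by (simp add: zero_power)
    moreover have "weighted_part ?n ?m 0 k a ((1 - xi D (Suc j) * y) ^ ?c, (1 - xi D (Suc j) * y) ^ ?d)
      = ((1 - xi D (Suc j) * y) ^ ?d) ^ ?E * 0 ^ (?m * ?E - k) * eval2 a' (0, y)"
      by (rule tendsto_unique[OF trivial_limit_at_right_real A Lim_transform_eventually[OF B C]])
    ultimately show ?thesis by simp
  qed
  define S where "S = {(r::nat, s::nat). ?n * r + ?m * s + 0 = k}"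
  have finS: "finite S" unfolding S_def by (rule finite_weight_eq[OF nm])
  \<comment> \<open>the lowest part as a polynomial in \<open>u\<close>\<close>
  define q where "q = (\<Sum>(r,s)\<in>S. monom (a r s) (?c * r + ?d * s))"
  have qv: "poly q u = weighted_part ?n ?m 0 k a (u ^ ?c, u ^ ?d)" for u
    unfolding q_def weighted_part_def S_def[symmetric] poly_sum
    by (intro sum.cong refl) (auto simp: poly_monom power_add power_mult mult.assoc)
  have "q = 0"
  proof (rule ccontr)
    assume "q \<noteq> 0"
    then have "finite {u. poly q u = 0}" by (rule poly_roots_finite)
    moreover have "(\<lambda>y. 1 - xi D (Suc j) * y) ` {0<..<min \<delta> (rad D (Suc j))} \<subseteq> {u. poly q u = 0}"
      using wp0 by (auto simp: qv)
    ultimately have "finite ((\<lambda>y. 1 - xi D (Suc j) * y) ` {0<..<min \<delta> (rad D (Suc j))})"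
      using finite_subset by blast
    then have "finite {0<..<min \<delta> (rad D (Suc j))}"
      by (rule finite_imageD) (use xi in \<open>auto simp: inj_on_def\<close>)
    then show False using infinite_Ioo[of 0 "min \<delta> (rad D (Suc j))"] \<delta> R' by simp
  qed
  have det: "int ?c * int ?m - int ?d * int ?n = 1" by (rule resolution_cone_det[OF step_data(1)[OF j]])
  \<comment> \<open>different monomials of the same weight give different powers of \<open>u\<close>\<close>
  have inj: "(r1, s1) = (r', s')" if "(r1, s1) \<in> S" "?c * r1 + ?d * s1 = ?c * r' + ?d * s'" for r1 s1
  proof -
    let ?x = "int r1 - int r'" and ?y = "int s1 - int s'"
    have "?n * r1 + ?m * s1 = ?n * r' + ?m * s'" using that(1) rs' by (simp add: S_def)
    from arg_cong[OF this, of int] have 1: "int ?n * ?x + int ?m * ?y = 0" by (simp add: algebra_simps)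
    from arg_cong[OF that(2), of int] have 2: "int ?c * ?x + int ?d * ?y = 0" by (simp add: algebra_simps)
    have "(int ?c * int ?m - int ?d * int ?n) * ?x = int ?m * (int ?c * ?x + int ?d * ?y) - int ?d * (int ?n * ?x + int ?m * ?y)"
      "(int ?c * int ?m - int ?d * int ?n) * ?y = int ?c * (int ?n * ?x + int ?m * ?y) - int ?n * (int ?c * ?x + int ?d * ?y)"
      by (simp_all add: algebra_simps)
    then have "?x = 0" "?y = 0" unfolding 1 2 det by simp_all
    then show ?thesis by simp
  qed
  have mem: "(r', s') \<in> S" using rs' by (simp add: S_def)
  have "coeff q (?c * r' + ?d * s') = (\<Sum>z\<in>S. if z = (r', s') then a r' s' else 0)"
    unfolding q_def coeff_sum
    by (intro sum.cong refl) (use inj in \<open>auto split: if_splits\<close>)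
  also have "\<dots> = a r' s'" using finS mem by simp
  finally show False using \<open>q = 0\<close> rs' by simp
qed

end

section \<open>The deformation at one level\<close>

lemma hull_right_triangle:
  fixes a b :: real
  assumes "a > 0" "b > 0"
  shows "convex hull {(0, 0), (a, 0), (0, b)} = {p. 0 \<le> fst p \<and> 0 \<le> snd p \<and> b * fst p + a * snd p \<le> a * b}"
proof (intro set_eqI iffI)
  fix p :: "real \<times> real" assume "p \<in> convex hull {(0, 0), (a, 0), (0, b)}"
  then obtain u v w where uvw: "0 \<le> u" "0 \<le> v" "0 \<le> w" "u + v + w = 1" "p = (v * a, w * b)"
    unfolding convex_hull_3 by auto
  have "b * (v * a) + a * (w * b) = (v + w) * (a * b)" by (simp add: algebra_simps)
  also have "\<dots> \<le> 1 * (a * b)" using uvw assms by (intro mult_right_mono) auto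
  finally show "p \<in> {p. 0 \<le> fst p \<and> 0 \<le> snd p \<and> b * fst p + a * snd p \<le> a * b}"
    using uvw assms by simp
next
  fix p :: "real \<times> real" assume p: "p \<in> {p. 0 \<le> fst p \<and> 0 \<le> snd p \<and> b * fst p + a * snd p \<le> a * b}"
  define v w where "v = fst p / a" and "w = snd p / b"
  have "v + w = (b * fst p + a * snd p) / (a * b)" using assms by (simp add: v_def w_def field_simps)
  then have "v + w \<le> 1" using p assms by (simp add: pos_divide_le_eq)
  moreover have "0 \<le> v" "0 \<le> w" using p assms by (auto simp: v_def w_def)
  moreover have "p = (1 - v - w) *\<^sub>R (0, 0) + v *\<^sub>R (a, 0) + w *\<^sub>R (0, b)"
    using assms by (simp add: v_def w_def prod_eq_iff)
  ultimately show "p \<in> convex hull {(0, 0), (a, 0), (0, b)}"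
    unfolding convex_hull_3 by (intro CollectI exI[of _ "1 - v - w"] exI[of _ v] exI[of _ w]) auto
qed

lemma hypotenuse_segment:
  fixes a b :: real
  assumes "a > 0" "b > 0"
  shows "closed_segment (a, 0) (0, b) = {p. 0 \<le> fst p \<and> 0 \<le> snd p \<and> b * fst p + a * snd p = a * b}"
proof (intro set_eqI iffI)
  fix p assume "p \<in> closed_segment (a, 0) (0, b)"
  then obtain u where "0 \<le> u" "u \<le> 1" "p = ((1 - u) * a, u * b)" unfolding closed_segment_def by auto
  then show "p \<in> {p. 0 \<le> fst p \<and> 0 \<le> snd p \<and> b * fst p + a * snd p = a * b}"
    using assms by (simp add: algebra_simps)
next
  fix p assume p: "p \<in> {p. 0 \<le> fst p \<and> 0 \<le> snd p \<and> b * fst p + a * snd p = a * b}"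
  have "0 \<le> b * fst p" "b * fst p + a * snd p = a * b" using p assms by auto
  then have "a * snd p \<le> a * b" by linarith
  then have "snd p \<le> b" using assms by simp
  moreover have "fst p = (1 - snd p / b) * a" using p assms by (simp add: field_simps)
  ultimately show "p \<in> closed_segment (a, 0) (0, b)"
    unfolding closed_segment_def using p assms
    by (intro CollectI exI[of _ "snd p / b"]) (auto simp: prod_eq_iff)
qed

lemma symmetrize_iff_abs:
  assumes S: "\<And>p. p \<in> S \<Longrightarrow> 0 \<le> fst p \<and> 0 \<le> snd p"
  shows "p \<in> symmetrize S \<longleftrightarrow> (\<bar>fst p\<bar>, \<bar>snd p\<bar>) \<in> S"
proof
  assume "p \<in> symmetrize S"
  then obtain a b q where q: "q \<in> S" "p = reflect a b q" by (auto simp: symmetrize_def)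
  then have "(\<bar>fst p\<bar>, \<bar>snd p\<bar>) = q" using S[of q] by (auto simp: reflect_def abs_mult power_abs prod_eq_iff)
  then show "(\<bar>fst p\<bar>, \<bar>snd p\<bar>) \<in> S" using q by simp
next
  assume p: "(\<bar>fst p\<bar>, \<bar>snd p\<bar>) \<in> S"
  have "p = reflect (if fst p < 0 then 1 else 0) (if snd p < 0 then 1 else 0) (\<bar>fst p\<bar>, \<bar>snd p\<bar>)"
    by (auto simp: reflect_def prod_eq_iff)
  then show "p \<in> symmetrize S" unfolding symmetrize_def using p by blast
qed

text \<open>By invariance of domain, points of the closed ball that correspond to points of the symmetrized
  triangle off its boundary are interior.\<close>

lemma homeomorphism_ball_triangle_interior:
  fixes h k :: "real \<times> real \<Rightarrow> real \<times> real"
  assumes hom: "homeomorphism (cball 0 \<rho>) (symmetrize (convex hull {(0, 0), (a, 0), (0, b)})) h k"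
    and ab: "a > 0" "b > 0" and p: "p \<in> cball 0 \<rho>" and hp: "h p \<notin> symmetrize (closed_segment (a, 0) (0, b))"
  shows "p \<in> ball 0 \<rho>"
proof -
  let ?T = "symmetrize (convex hull {(0, 0), (a, 0), (0, b)})"
  have T: "q \<in> ?T \<longleftrightarrow> b * \<bar>fst q\<bar> + a * \<bar>snd q\<bar> \<le> a * b" for q
    by (subst symmetrize_iff_abs) (auto simp: hull_right_triangle[OF ab])
  have G: "q \<in> symmetrize (closed_segment (a, 0) (0, b)) \<longleftrightarrow> b * \<bar>fst q\<bar> + a * \<bar>snd q\<bar> = a * b" for q
    by (subst symmetrize_iff_abs) (auto simp: hypotenuse_segment[OF ab])
  define U where "U = {q :: real \<times> real. b * \<bar>fst q\<bar> + a * \<bar>snd q\<bar> < a * b}"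
  have "open U" unfolding U_def by (intro open_Collect_less continuous_intros)
  have UT: "U \<subseteq> ?T" using T by (auto simp: U_def)
  have "h p \<in> ?T" using hom p by (auto simp: homeomorphism_def)
  then have "h p \<in> U" using T[of "h p"] G[of "h p"] hp by (auto simp: U_def)
  moreover have "k (h p) = p" using hom p by (auto simp: homeomorphism_def)
  ultimately have "p \<in> k ` U" by force
  moreover have "open (k ` U)"
  proof (rule invariance_of_domain[OF _ \<open>open U\<close>])
    show "continuous_on U k" using hom UT by (meson continuous_on_subset homeomorphism_def)
    show "inj_on k U" using hom UT by (intro inj_on_inverseI[of _ h]) (auto simp: homeomorphism_def)
  qed
  moreover have "k ` U \<subseteq> cball 0 \<rho>"
    using image_mono[OF UT, of k] unfolding homeomorphism_image2[OF hom] .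
  ultimately have "p \<in> interior (cball 0 \<rho>)" by (meson interiorI)
  then show ?thesis by (simp only: interior_cball)
qed

locale deformed_branch = resolved_branch +
  fixes M :: monomials and A :: coefficients and j :: nat and t :: "nat \<Rightarrow> real"
  assumes deformation: "msqh_deformation D M A" and j: "1 \<le> j" "j \<le> gg D"
    and nondegenerate: "real_nondegenerated (Q_poly D M A j t) (Delta D j)"
begin

text \<open>The weights of \<open>x_j\<close> and \<open>y_j\<close>, in units of the weight of \<open>t_j\<close>, and the weight of the equation. They are
  \<open>e\<close> times the coprime weights \<open>n, m\<close> because \<open>\<omega>_j\<close> has the factor \<open>e\<close>.\<close>

abbreviation "n \<equiv> nn D j"
abbreviation "m \<equiv> mm D j"
abbreviation "e \<equiv> ee D j"
abbreviation "\<alpha> \<equiv> e * n"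
abbreviation "\<beta> \<equiv> e * m"
abbreviation "\<Omega> \<equiv> e * (e * n * m)"

lemma nme: "n \<ge> 1" "m \<ge> 1" "e \<ge> 1" and R: "rad D j > 0"
  using level_data[OF j] by auto

lemma \<alpha>\<beta>: "\<alpha> \<ge> 1" "\<beta> \<ge> 1"
  using nme by auto

lemma Delta_pos: "real (m * e) > 0" "real (n * e) > 0"
  using nme by auto

lemma Delta_eq: "Delta D j = {p. 0 \<le> fst p \<and> 0 \<le> snd p \<and> real (n * e) * fst p + real (m * e) * snd p \<le> real (m * e) * real (n * e)}"
  unfolding Delta_def by (rule hull_right_triangle[OF Delta_pos])

lemma Gamma_eq: "Gamma D j = {p. 0 \<le> fst p \<and> 0 \<le> snd p \<and> real (n * e) * fst p + real (m * e) * snd p = real (m * e) * real (n * e)}"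
  unfolding Gamma_def by (rule hypotenuse_segment[OF Delta_pos])

lemma lattice_weight: "real (n * e) * real r + real (m * e) * real s \<le> real (m * e) * real (n * e) \<longleftrightarrow> n * r + m * s \<le> e * n * m"
    "real (n * e) * real r + real (m * e) * real s = real (m * e) * real (n * e) \<longleftrightarrow> n * r + m * s = e * n * m"
proof -
  have l: "real (n * e) * real r + real (m * e) * real s = real (e * (n * r + m * s))"
    "real (m * e) * real (n * e) = real (e * (e * n * m))"
    by (simp_all add: algebra_simps)
  show "real (n * e) * real r + real (m * e) * real s \<le> real (m * e) * real (n * e) \<longleftrightarrow> n * r + m * s \<le> e * n * m"
    "real (n * e) * real r + real (m * e) * real s = real (m * e) * real (n * e) \<longleftrightarrow> n * r + m * s = e * n * m"
    unfolding l of_nat_le_iff of_nat_eq_iff using nme by simp_all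
qed

lemma lattice_Gamma: "lattice_points (Gamma D j) = {(r, s). n * r + m * s = e * n * m}"
  unfolding lattice_points_def Gamma_eq using lattice_weight by simp

lemma lattice_Delta_minus: "lattice_points (Delta_minus D j) = {(r, s). n * r + m * s < e * n * m}"
proof -
  have "(real r, real s) \<in> Delta_minus D j \<longleftrightarrow> n * r + m * s < e * n * m" for r s
    unfolding Delta_minus_def Delta_eq Gamma_eq using lattice_weight[of r s] by auto
  then show ?thesis by (simp add: lattice_points_def)
qed

lemma finite_lattice: "finite {(r, s). n * r + m * s = e * n * m}" "finite {(r, s). n * r + m * s < e * n * m}"
proof -
  show "finite {(r, s). n * r + m * s = e * n * m}"
    using finite_weight_eq[of n m 0 "e * n * m"] nme by simp
  show "finite {(r, s). n * r + m * s < e * n * m}"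
    by (rule finite_subset[OF _ finite_weight_le[of n m 0 "e * n * m"]]) (use nme in auto)
qed

lemma omega_eq:
  assumes "n * r + m * s \<le> e * n * m"
  shows "\<alpha> * r + \<beta> * s + omega D j r s = \<Omega>"
proof -
  have "omega D j r s = e * (e * n * m - (n * r + m * s))"
    by (simp add: omega_def mult_ac)
  moreover have "\<alpha> * r + \<beta> * s = e * (n * r + m * s)" by (simp add: algebra_simps)
  ultimately show ?thesis using assms by (simp flip: distrib_left)
qed

lemma omega_pos:
  assumes "n * r + m * s < e * n * m"
  shows "omega D j r s \<ge> 1"
proof -
  have "omega D j r s = e * (e * n * m - (n * r + m * s))"
    by (simp add: omega_def mult_ac)
  then show ?thesis using assms nme by simp
qed

text \<open>The coefficient of \<open>t_j^k\<close> in the equation of the deformation. For \<open>k = 0\<close> no term of level \<open>j\<close> occurs,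
  because \<open>\<omega>_j\<close> is positive off the hypotenuse.\<close>

definition param_coeff :: "nat \<Rightarrow> real poly poly" where
  "param_coeff k = (if k = 0 then msqh_poly D M A (Suc j) t
     else \<Sum>(r,s)\<in>{(r,s). n * r + m * s < e * n * m \<and> omega D j r s = k}. smult [:A j r s:] (M j r s))"

lemma msqh_poly_eq_sum: "msqh_poly D M A j (t(j := x)) = (\<Sum>k\<le>\<Omega>. smult [:x ^ k:] (param_coeff k))"
proof -
  let ?S = "{(r, s). n * r + m * s < e * n * m}"
  let ?h = "\<lambda>(r, s). smult [:A j r s * x ^ omega D j r s:] (M j r s)"
  have lev: "{j..gg D} = insert j {Suc j..gg D}" using j by auto
  have rest: "(\<Sum>l\<in>{Suc j..gg D}. \<Sum>(r,s)\<in>lattice_points (Delta_minus D l).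
        smult [:A l r s * (t(j := x)) l ^ omega D l r s:] (M l r s)) =
      (\<Sum>l\<in>{Suc j..gg D}. \<Sum>(r,s)\<in>lattice_points (Delta_minus D l). smult [:A l r s * t l ^ omega D l r s:] (M l r s))"
    by (intro sum.cong refl) auto
  have "msqh_poly D M A j (t(j := x)) = curve_poly D + (sum ?h ?S + (\<Sum>l\<in>{Suc j..gg D}. \<Sum>(r,s)\<in>lattice_points (Delta_minus D l).
        smult [:A l r s * (t(j := x)) l ^ omega D l r s:] (M l r s)))"
    unfolding msqh_poly_def lev lattice_Delta_minus[symmetric] by (subst sum.insert) simp_all
  then have 1: "msqh_poly D M A j (t(j := x)) = param_coeff 0 + sum ?h ?S"
    unfolding rest by (simp add: param_coeff_def msqh_poly_def)
  have "sum ?h ?S = (\<Sum>k\<in>{1..\<Omega>}. sum ?h {z \<in> ?S. (\<lambda>(r,s). omega D j r s) z = k})"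
  proof (rule sum.group[symmetric])
    show "(\<lambda>(r, s). omega D j r s) ` ?S \<subseteq> {1..\<Omega>}"
    proof clarsimp
      fix r s assume "n * r + m * s < e * n * m"
      then show "Suc 0 \<le> omega D j r s \<and> omega D j r s \<le> \<Omega>"
        using omega_pos[of r s] omega_eq[of r s] by simp
    qed
  qed (use finite_lattice in auto)
  also have "\<dots> = (\<Sum>k\<in>{1..\<Omega>}. smult [:x ^ k:] (param_coeff k))"
  proof (intro sum.cong refl)
    fix k assume k: "k \<in> {1..\<Omega>}"
    have "{z \<in> ?S. (\<lambda>(r,s). omega D j r s) z = k} = {(r,s). n * r + m * s < e * n * m \<and> omega D j r s = k}" by auto
    then show "sum ?h {z \<in> ?S. (\<lambda>(r,s). omega D j r s) z = k} = smult [:x ^ k:] (param_coeff k)"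
      using k by (auto simp: param_coeff_def smult_sum_right mult.commute intro!: sum.cong)
  qed
  finally have 2: "sum ?h ?S = (\<Sum>k\<in>{1..\<Omega>}. smult [:x ^ k:] (param_coeff k))" .
  have "{..\<Omega>} = insert 0 {1..\<Omega>}" by auto
  then have "(\<Sum>k\<le>\<Omega>. smult [:x ^ k:] (param_coeff k)) = param_coeff 0 + (\<Sum>k\<in>{1..\<Omega>}. smult [:x ^ k:] (param_coeff k))"
    by (simp flip: one_pCons)
  then show ?thesis unfolding 1 2 by (rule sym)
qed

lemma is_strict_transform_sum:
  assumes "finite I" "\<And>k. k \<in> I \<Longrightarrow> is_strict_transform D j (H k) (h k)"
  shows "is_strict_transform D j (sum H I) (\<lambda>r s. \<Sum>k\<in>I. h k r s)"
  using assms
proof (induction I rule: finite_induct)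
  case empty
  have "eval2 (\<lambda>_ _. 0) p = (0::real)" for p by (subst eval2_finite[of "{}"]) auto
  moreover have "conv_on (\<lambda>_ _. 0 :: real) (rad D j)" by (rule conv_on_finite[of "{}"]) auto
  ultimately show ?case by (simp add: is_strict_transform_def)
next
  case (insert k I)
  then show ?case using is_strict_transform_add[of j "H k" "h k" "sum H I" "\<lambda>r s. \<Sum>k\<in>I. h k r s"] by simp
qed

definition gser :: "nat \<Rightarrow> real ser2" where
  "gser k = strict_transform D j (param_coeff k)"

text \<open>The members of the family have strict transforms by the definition of a deformation; hence so do
  its coefficients, which are linear combinations of members.\<close>

lemma gser:
  assumes "k \<le> \<Omega>"
  shows "is_strict_transform D j (param_coeff k) (gser k)"
proof -
  have "\<exists>a. is_strict_transform D j (param_coeff k) a"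
  proof (rule coefficients_in_subspace[where N = \<Omega>, OF _ _ _ assms])
    fix x
    have "j \<in> {j..Suc (gg D)}" "j \<in> {1..gg D}" using j by auto
    then show "\<exists>a. is_strict_transform D j (\<Sum>k\<le>\<Omega>. smult [:x ^ k:] (param_coeff k)) a"
      using deformation unfolding msqh_deformation_def msqh_poly_eq_sum[symmetric] by blast
  qed (blast intro: is_strict_transform_add is_strict_transform_smult)+
  then show ?thesis unfolding gser_def using strict_transform_eq[OF j] by metis
qed

lemma strict_transform_eq_family:
  "strict_transform D j (msqh_poly D M A j (t(j := x))) = family_ser \<Omega> gser x"
proof (rule strict_transform_eq[OF j])
  show "is_strict_transform D j (msqh_poly D M A j (t(j := x))) (family_ser \<Omega> gser x)"
    unfolding msqh_poly_eq_sum family_ser_def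
    by (intro is_strict_transform_sum is_strict_transform_smult gser) auto
qed

lemma gser_0: "gser 0 = strict_transform D j (msqh_poly D M A (Suc j) t)"
  by (simp add: gser_def param_coeff_def)

lemma conv_gser: "k \<le> \<Omega> \<Longrightarrow> conv_on (gser k) (rad D j)"
  using gser by (simp add: is_strict_transform_def)

lemma weight_gser_0:
  assumes "gser 0 r s \<noteq> 0"
  shows "\<Omega> \<le> \<alpha> * r + \<beta> * s"
proof -
  have st: "is_strict_transform D j (msqh_poly D M A (Suc j) t) (gser 0)"
    using gser[of 0] by (simp add: param_coeff_def)
  have "e * n * m \<le> n * r + m * s"
  proof (cases "j = gg D")
    case True
    then have "msqh_poly D M A (Suc j) t = curve_poly D" by (simp add: msqh_poly_def)
    with st show ?thesis
      by (intro strict_transform_weight_last_level[where a = "gser 0"] True j(1) assms) simp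
  next
    case False
    then have jg: "j < gg D" using j by simp
    then have "Suc j \<in> {1..gg D}" "Suc j \<in> {Suc j..Suc (gg D)}" by auto
    then obtain a' where "is_strict_transform D (Suc j) (msqh_poly D M A (Suc j) t) a'"
      using deformation unfolding msqh_deformation_def by blast
    then show ?thesis
      by (intro strict_transform_weight[where a = "gser 0", OF j(1) jg st _ assms])
  qed
  then have "e * (e * n * m) \<le> e * (n * r + m * s)" by (rule mult_le_mono2)
  then show ?thesis by (simp add: algebra_simps)
qed

text \<open>The functions \<open>u_i\<close> tend to \<open>1\<close>.\<close>

lemma adapted_monomial_local:
  assumes "n * r + m * s < e * n * m"
  shows "\<exists>U. (U \<longlongrightarrow> 1) (nhds 0) \<and>
    (\<forall>\<^sub>F p in nhds 0. poly2 (M j r s) (to_plane D j p) = exc D j p * U p * fst p ^ r * snd p ^ s)"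
proof (cases "j = 1")
  case True
  have "M 1 r s = monom2 1 r s" using deformation by (simp add: msqh_deformation_def adapted_monomials_def)
  then show ?thesis using True
    by (intro exI[of _ "\<lambda>_. 1"]) (simp add: to_plane_def exc_1 poly2_monom2)
next
  case False
  then have j2: "j \<in> {2..gg D}" using j by auto
  have "m * s \<le> n * r + m * s" by simp
  also have "\<dots> < e * n * m" by (rule assms)
  also have "\<dots> = m * (e * n)" by (simp only: mult_ac)
  finally have sE: "s < ee D (j - 1)" using level_data(3)[OF j] by simp
  have "\<forall>j\<in>{2..gg D}. \<forall>r. \<forall>s<ee D (j - 1). \<exists>k :: nat \<Rightarrow> nat. (\<forall>i\<in>{2..j}. k i > 0) \<and>
        (\<forall>p\<in>coord_square (rad D j). poly2 (M j r s) (to_plane D j p) =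
           exc D j p * (\<Prod>i\<in>{2..j}. uu D i (down D i (j - i) p) ^ k i) * fst p ^ r * snd p ^ s)"
    using deformation unfolding msqh_deformation_def adapted_monomials_def by (elim conjE) assumption
  from this[rule_format, OF j2 sE, of r]
  obtain k :: "nat \<Rightarrow> nat" where k: "\<And>p. p \<in> coord_square (rad D j) \<Longrightarrow> poly2 (M j r s) (to_plane D j p) =
           exc D j p * (\<Prod>i\<in>{2..j}. uu D i (down D i (j - i) p) ^ k i) * fst p ^ r * snd p ^ s"
    by blast
  have "((\<lambda>p. \<Prod>i\<in>{2..j}. uu D i (down D i (j - i) p) ^ k i) \<longlongrightarrow> (\<Prod>i\<in>{2..j}. 1 ^ k i)) (nhds 0)"
    by (intro tendsto_prod tendsto_power uu_down_tendsto) (use j in auto)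
  moreover have "\<forall>\<^sub>F p in nhds 0. poly2 (M j r s) (to_plane D j p) =
           exc D j p * (\<Prod>i\<in>{2..j}. uu D i (down D i (j - i) p) ^ k i) * fst p ^ r * snd p ^ s"
    using eventually_in_coord_square[OF R] by eventually_elim (rule k)
  ultimately show ?thesis by auto
qed

text \<open>The strict transform of \<open>M_j(r,s)\<close> is the monomial \<open>x^r y^s\<close> times a factor tending to \<open>1\<close>, and the
  monomials with \<open>\<omega>_j(r,s) = k\<close> have weight \<open>\<Omega> - k\<close>.\<close>

lemma gser_scaling:
  assumes k: "1 \<le> k" "k \<le> \<Omega>" and XY: "X > 0" "Y > 0"
  shows "((\<lambda>\<sigma>. \<sigma> ^ k * eval2 (gser k) (\<sigma> ^ \<alpha> * X, \<sigma> ^ \<beta> * Y) / \<sigma> ^ \<Omega>)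
    \<longlongrightarrow> (\<Sum>(r,s)\<in>{(r,s). \<alpha> * r + \<beta> * s + k = \<Omega>}. A j r s * X ^ r * Y ^ s)) (at_right 0)"
proof -
  let ?S = "{(r,s). n * r + m * s < e * n * m \<and> omega D j r s = k}"
  have S: "?S = {(r,s). \<alpha> * r + \<beta> * s + k = \<Omega>}"
  proof -
    have "n * r + m * s < e * n * m \<and> omega D j r s = k \<longleftrightarrow> \<alpha> * r + \<beta> * s + k = \<Omega>" for r s
    proof
      assume "n * r + m * s < e * n * m \<and> omega D j r s = k"
      then show "\<alpha> * r + \<beta> * s + k = \<Omega>" using omega_eq[of r s] by simp
    next
      assume eq: "\<alpha> * r + \<beta> * s + k = \<Omega>"
      then have "e * (n * r + m * s) < e * (e * n * m)" using k by (simp add: algebra_simps)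
      then have "n * r + m * s < e * n * m" by simp
      then show "n * r + m * s < e * n * m \<and> omega D j r s = k" using omega_eq[of r s] eq by simp
    qed
    then show ?thesis by simp
  qed
  have finS: "finite ?S" unfolding S by (rule finite_weight_eq[OF \<alpha>\<beta>])
  have "\<forall>z\<in>?S. \<exists>U. (U \<longlongrightarrow> 1) (nhds 0) \<and> (\<forall>\<^sub>F p in nhds 0. poly2 (M j (fst z) (snd z)) (to_plane D j p) = exc D j p * U p * fst p ^ fst z * snd p ^ snd z)"
    using adapted_monomial_local by auto
  from bchoice[OF this] obtain U where U': "\<forall>z\<in>?S. (U z \<longlongrightarrow> 1) (nhds 0) \<and>
    (\<forall>\<^sub>F p in nhds 0. poly2 (M j (fst z) (snd z)) (to_plane D j p) = exc D j p * U z p * fst p ^ fst z * snd p ^ snd z)" ..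
  have U: "(U z \<longlongrightarrow> 1) (nhds 0)"
    "\<forall>\<^sub>F p in nhds 0. poly2 (M j (fst z) (snd z)) (to_plane D j p) = exc D j p * U z p * fst p ^ fst z * snd p ^ snd z"
    if "z \<in> ?S" for z
    using bspec[OF U' that] by (rule conjunct1, rule conjunct2)
  have "\<forall>\<^sub>F p in nhds 0. \<forall>z\<in>?S. poly2 (M j (fst z) (snd z)) (to_plane D j p) = exc D j p * U z p * fst p ^ fst z * snd p ^ snd z"
    using finS U(2) by (intro eventually_ball_finite) auto
  then have loc: "\<forall>\<^sub>F p in nhds 0. fst p \<noteq> 0 \<longrightarrow> eval2 (gser k) p = (\<Sum>z\<in>?S. A j (fst z) (snd z) * U z p * fst p ^ fst z * snd p ^ snd z)"
    using exc_nonzero[OF j] eventually_in_coord_square[OF R]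
  proof eventually_elim
    case (elim p)
    have "exc D j p * eval2 (gser k) p = poly2 (param_coeff k) (to_plane D j p)"
      using gser[OF k(2)] elim(3) by (simp add: is_strict_transform_def)
    also have "\<dots> = (\<Sum>z\<in>?S. A j (fst z) (snd z) * poly2 (M j (fst z) (snd z)) (to_plane D j p))"
      using k(1) by (simp add: param_coeff_def poly2_sum case_prod_unfold poly2_smult)
    also have "\<dots> = exc D j p * (\<Sum>z\<in>?S. A j (fst z) (snd z) * U z p * fst p ^ fst z * snd p ^ snd z)"
      unfolding sum_distrib_left using elim(1) by (intro sum.cong refl) (auto simp: mult_ac)
    finally show ?case using elim(2) by auto
  qed
  let ?p = "\<lambda>\<sigma>. (\<sigma> ^ \<alpha> * X, \<sigma> ^ \<beta> * Y)"
  have "((\<lambda>\<sigma>. \<Sum>z\<in>?S. A j (fst z) (snd z) * U z (?p \<sigma>) * X ^ fst z * Y ^ snd z)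
     \<longlongrightarrow> (\<Sum>z\<in>?S. A j (fst z) (snd z) * 1 * X ^ fst z * Y ^ snd z)) (at_right 0)"
    by (intro tendsto_sum tendsto_mult tendsto_const filterlim_compose[OF U(1) scaled_point_tendsto_0[OF \<alpha>\<beta>]])
  moreover have "\<forall>\<^sub>F \<sigma> in at_right 0. (\<Sum>z\<in>?S. A j (fst z) (snd z) * U z (?p \<sigma>) * X ^ fst z * Y ^ snd z) =
     \<sigma> ^ k * eval2 (gser k) (?p \<sigma>) / \<sigma> ^ \<Omega>"
    using eventually_compose_filterlim[OF loc scaled_point_tendsto_0[OF \<alpha>\<beta>, of X Y]] eventually_at_right_less[of 0]
  proof eventually_elim
    case (elim \<sigma>)
    have "\<sigma> ^ k * eval2 (gser k) (?p \<sigma>) = (\<Sum>z\<in>?S. \<sigma> ^ k * (A j (fst z) (snd z) * U z (?p \<sigma>) * (\<sigma> ^ \<alpha> * X) ^ fst z * (\<sigma> ^ \<beta> * Y) ^ snd z))"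
      using elim XY by (simp add: sum_distrib_left)
    also have "\<dots> = (\<Sum>z\<in>?S. \<sigma> ^ \<Omega> * (A j (fst z) (snd z) * U z (?p \<sigma>) * X ^ fst z * Y ^ snd z))"
    proof (intro sum.cong refl)
      fix z assume "z \<in> ?S"
      then have "\<alpha> * fst z + \<beta> * snd z + k = \<Omega>" unfolding S by auto
      then have 1: "\<sigma> ^ \<Omega> = \<sigma> ^ (\<alpha> * fst z) * \<sigma> ^ (\<beta> * snd z) * \<sigma> ^ k"
        by (simp only: power_add flip: \<open>\<alpha> * fst z + \<beta> * snd z + k = \<Omega>\<close>)
      have 2: "(\<sigma> ^ \<alpha> * X) ^ fst z = \<sigma> ^ (\<alpha> * fst z) * X ^ fst z" "(\<sigma> ^ \<beta> * Y) ^ snd z = \<sigma> ^ (\<beta> * snd z) * Y ^ snd z"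
        unfolding power_mult_distrib power_mult[of \<sigma> \<alpha>] power_mult[of \<sigma> \<beta>] by (rule refl)+
      show "\<sigma> ^ k * (A j (fst z) (snd z) * U z (?p \<sigma>) * (\<sigma> ^ \<alpha> * X) ^ fst z * (\<sigma> ^ \<beta> * Y) ^ snd z)
        = \<sigma> ^ \<Omega> * (A j (fst z) (snd z) * U z (?p \<sigma>) * X ^ fst z * Y ^ snd z)"
        unfolding 1 2 by (simp only: mult_ac)
    qed
    also have "\<dots> = \<sigma> ^ \<Omega> * (\<Sum>z\<in>?S. A j (fst z) (snd z) * U z (?p \<sigma>) * X ^ fst z * Y ^ snd z)"
      by (simp only: sum_distrib_left)
    finally show ?case using elim by simp
  qed
  ultimately have "((\<lambda>\<sigma>. \<sigma> ^ k * eval2 (gser k) (?p \<sigma>) / \<sigma> ^ \<Omega>)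
     \<longlongrightarrow> (\<Sum>z\<in>?S. A j (fst z) (snd z) * 1 * X ^ fst z * Y ^ snd z)) (at_right 0)"
    by (rule Lim_transform_eventually)
  then show ?thesis unfolding S by (simp add: case_prod_unfold)
qed

lemma weight_gser:
  assumes k: "k \<le> \<Omega>" and nz: "gser k r s \<noteq> 0"
  shows "\<Omega> \<le> \<alpha> * r + \<beta> * s + k"
proof (cases "k = 0")
  case True
  then show ?thesis using weight_gser_0 nz by simp
next
  case False
  show ?thesis
    by (rule weight_ge_if_scaling_tendsto(1)[OF conv_gser[OF k] R \<alpha>\<beta> gser_scaling nz]) (use False k in auto)
qed

lemma gser_leading_coeff:
  assumes k: "1 \<le> k" "k \<le> \<Omega>" and eq: "\<alpha> * r + \<beta> * s + k = \<Omega>"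
  shows "gser k r s = A j r s"
proof -
  let ?S = "{(r,s). \<alpha> * r + \<beta> * s + k = \<Omega>}"
  have "(\<lambda>r s. gser k r s - A j r s) r s = 0"
  proof (rule sum_monomials_zero_imp_coeff_zero)
    show "finite ?S" by (rule finite_weight_eq[OF \<alpha>\<beta>])
    show "(r, s) \<in> ?S" using eq by simp
    fix X Y :: real assume XY: "X > 0" "Y > 0"
    have "weighted_part \<alpha> \<beta> k \<Omega> (gser k) (X, Y) = (\<Sum>(r,s)\<in>?S. A j r s * X ^ r * Y ^ s)"
      by (rule weight_ge_if_scaling_tendsto(2)[OF conv_gser[OF k(2)] R \<alpha>\<beta> gser_scaling XY]) (use k in auto)
    then show "(\<Sum>(r,s)\<in>?S. (gser k r s - A j r s) * X ^ r * Y ^ s) = 0"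
      by (simp add: weighted_part_def case_prod_unfold left_diff_distrib sum_subtractf)
  qed
  then show ?thesis by simp
qed

lemma weighted_family_gser: "weighted_family \<alpha> \<beta> \<Omega> gser (rad D j)"
  by unfold_locales (use \<alpha>\<beta> R conv_gser weight_gser in auto)

end

section \<open>The limiting curve\<close>

lemma coeff2_add: "coeff2 (P + Q) r s = coeff2 P r s + coeff2 Q r s"
  by (simp add: coeff2_def)

lemma eval2_restrict_x0:
  fixes a :: "real ser2"
  shows "eval2 (\<lambda>r s. if r = 0 then a r s else 0) (X, Y) = eval2 a (0, Y)"
  unfolding eval2_def by (intro infsum_cong) (auto simp: power_0_left)

lemma eval2_restrict_y0:
  fixes a :: "real ser2"
  shows "eval2 (\<lambda>r s. if s = 0 then a r s else 0) (X, Y) = eval2 a (X, 0)"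
  unfolding eval2_def by (intro infsum_cong) (auto simp: power_0_left)

lemma eval2_0: "eval2 (\<lambda>r s. 0) p = (0 :: real)"
  by (subst eval2_finite[of "{}"]) auto

context deformed_branch
begin

abbreviation "Q \<equiv> Q_poly D M A j t"

lemma coeff2_Q: "coeff2 Q r s = (if n * r + m * s < e * n * m then A j r s
    else if n * r + m * s = e * n * m then gser 0 r s else 0)"
  unfolding Q_poly_def lattice_Delta_minus lattice_Gamma gser_0[symmetric] coeff2_add
    coeff2_sum_monom2[OF finite_lattice(1)] coeff2_sum_monom2[OF finite_lattice(2)]
  by auto

lemma weight_le_iff: "\<alpha> * r + \<beta> * s \<le> \<Omega> \<longleftrightarrow> n * r + m * s \<le> e * n * m"
proof -
  have "\<alpha> * r + \<beta> * s = e * (n * r + m * s)" by (simp add: algebra_simps)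
  then show ?thesis using nme by simp
qed

lemma weight_eq_iff: "\<alpha> * r + \<beta> * s = \<Omega> \<longleftrightarrow> n * r + m * s = e * n * m"
proof -
  have "\<alpha> * r + \<beta> * s = e * (n * r + m * s)" by (simp add: algebra_simps)
  then show ?thesis using nme by simp
qed

text \<open>So \<open>Q_j = 0\<close> is the limit of the curves rescaled by the parameter.\<close>

lemma leading_ser_1: "leading_ser \<alpha> \<beta> \<Omega> gser 1 = coeff2 Q"
proof (intro ext)
  fix r s
  consider "n * r + m * s < e * n * m" | "n * r + m * s = e * n * m" | "\<not> n * r + m * s \<le> e * n * m" by linarith
  then show "leading_ser \<alpha> \<beta> \<Omega> gser 1 r s = coeff2 Q r s"
  proof cases
    case 1
    have eq: "\<alpha> * r + \<beta> * s + omega D j r s = \<Omega>" using 1 by (intro omega_eq) simp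
    then have "\<Omega> - (\<alpha> * r + \<beta> * s) = omega D j r s" by simp
    moreover have "gser (omega D j r s) r s = A j r s"
      by (rule gser_leading_coeff[OF omega_pos[OF 1] _ eq]) (use eq in simp)
    ultimately show ?thesis using 1 eq unfolding leading_ser_def coeff2_Q by simp
  next
    case 2
    then have "\<alpha> * r + \<beta> * s = \<Omega>" using weight_eq_iff by blast
    then show ?thesis using 2 unfolding leading_ser_def coeff2_Q by simp
  next
    case 3
    then have "\<not> \<alpha> * r + \<beta> * s \<le> \<Omega>" using weight_le_iff by blast
    then show ?thesis using 3 unfolding leading_ser_def coeff2_Q by simp
  qed
qed

lemma Gamma_iff: "(real r, real s) \<in> Gamma D j \<longleftrightarrow> n * r + m * s = e * n * m"
  using lattice_Gamma by (auto simp: lattice_points_def set_eq_iff)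

lemma leading_ser_0: "leading_ser \<alpha> \<beta> \<Omega> gser 0 = coeff2 (truncation Q (Gamma D j))"
proof (intro ext)
  fix r s
  show "leading_ser \<alpha> \<beta> \<Omega> gser 0 r s = coeff2 (truncation Q (Gamma D j)) r s"
  proof (cases "n * r + m * s = e * n * m")
    case True
    then have "\<alpha> * r + \<beta> * s = \<Omega>" using weight_eq_iff by blast
    then show ?thesis using True unfolding leading_ser_def coeff2_truncation coeff2_Q Gamma_iff by simp
  next
    case False
    then have "\<alpha> * r + \<beta> * s \<noteq> \<Omega>" using weight_eq_iff by blast
    then show ?thesis using False unfolding leading_ser_def coeff2_truncation coeff2_Q Gamma_iff by simp
  qed
qed

lemma convex_Delta: "convex (Delta D j)"
  unfolding Delta_def by (rule convex_convex_hull)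

lemma face_nonsingular:
  assumes "\<Lambda> face_of Delta D j" "\<Lambda> \<noteq> {}" "X \<noteq> 0" "Y \<noteq> 0" "eval2 (coeff2 (truncation Q \<Lambda>)) (X, Y) = 0"
  shows "eval2 (ser_dx (coeff2 (truncation Q \<Lambda>))) (X, Y) \<noteq> 0 \<or> eval2 (ser_dy (coeff2 (truncation Q \<Lambda>))) (X, Y) \<noteq> 0"
  by (rule nonsingular_in_torusD[OF _ assms(3-5)]) (use nondegenerate assms(1,2) in \<open>auto simp: real_nondegenerated_def\<close>)

lemma origin_in_Delta: "(0, 0) \<in> Delta D j"
  unfolding Delta_eq by simp

lemma Gamma_face: "Gamma D j face_of Delta D j"
proof -
  have "Delta D j \<inter> {p. (real (n * e), real (m * e)) \<bullet> p = real (m * e) * real (n * e)} face_of Delta D j"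
    by (rule face_of_Int_supporting_hyperplane_le[OF convex_Delta]) (auto simp: Delta_eq inner_prod_def)
  moreover have "Delta D j \<inter> {p. (real (n * e), real (m * e)) \<bullet> p = real (m * e) * real (n * e)} = Gamma D j"
    unfolding Delta_eq Gamma_eq by (auto simp: inner_prod_def)
  ultimately show ?thesis by simp
qed

lemma edge_faces: "Delta D j \<inter> {p. fst p = 0} face_of Delta D j" "Delta D j \<inter> {p. snd p = 0} face_of Delta D j"
proof -
  have "Delta D j \<inter> {p. (1, 0) \<bullet> p = 0} face_of Delta D j"
    by (rule face_of_Int_supporting_hyperplane_ge[OF convex_Delta]) (auto simp: Delta_eq inner_prod_def)
  then show "Delta D j \<inter> {p. fst p = 0} face_of Delta D j" by (simp add: inner_prod_def)
  have "Delta D j \<inter> {p. (0, 1) \<bullet> p = 0} face_of Delta D j"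
    by (rule face_of_Int_supporting_hyperplane_ge[OF convex_Delta]) (auto simp: Delta_eq inner_prod_def)
  then show "Delta D j \<inter> {p. snd p = 0} face_of Delta D j" by (simp add: inner_prod_def)
qed

lemma coeff2_Q_in_Delta: "coeff2 Q r s \<noteq> 0 \<Longrightarrow> (real r, real s) \<in> Delta D j"
  unfolding coeff2_Q Delta_eq using lattice_weight(1)[of r s] by (auto split: if_splits)

lemma coeff2_Q_origin: "coeff2 Q 0 0 \<noteq> 0"
proof -
  have "A j 0 0 \<noteq> 0" using deformation j by (simp add: msqh_deformation_def)
  then show ?thesis unfolding coeff2_Q using nme by simp
qed

text \<open>The truncation of \<open>Q_j\<close> to the leg \<open>r = 0\<close> depends on \<open>y\<close> only, so its nondegeneracy says that its
  nonzero roots are simple; \<open>0\<close> is not a root because of the constant term.\<close>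

lemma Q_crosses_y_axis:
  assumes "eval2 (coeff2 Q) (0, Y) = 0"
  shows "eval2 (ser_dy (coeff2 Q)) (0, Y) \<noteq> 0"
proof -
  let ?\<Lambda> = "Delta D j \<inter> {p. fst p = 0}"
  have T: "coeff2 (truncation Q ?\<Lambda>) = (\<lambda>r s. if r = 0 then coeff2 Q r s else 0)"
  proof (intro ext)
    show "coeff2 (truncation Q ?\<Lambda>) r s = (if r = 0 then coeff2 Q r s else 0)" for r s
      using coeff2_Q_in_Delta[of r s] by (cases "coeff2 Q r s = 0") (auto simp: coeff2_truncation)
  qed
  have "Y \<noteq> 0" using assms coeff2_Q_origin eval2_zero[of "coeff2 Q"] by auto
  then have "eval2 (ser_dx (coeff2 (truncation Q ?\<Lambda>))) (1, Y) \<noteq> 0 \<or> eval2 (ser_dy (coeff2 (truncation Q ?\<Lambda>))) (1, Y) \<noteq> 0"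
    by (intro face_nonsingular edge_faces) (use origin_in_Delta assms in \<open>auto simp: T eval2_restrict_x0\<close>)
  moreover have "ser_dx (coeff2 (truncation Q ?\<Lambda>)) = (\<lambda>r s. 0)"
    unfolding T by (intro ext) (simp add: ser_dx_def)
  moreover have "ser_dy (coeff2 (truncation Q ?\<Lambda>)) = (\<lambda>r s. if r = 0 then ser_dy (coeff2 Q) r s else 0)"
    unfolding T by (intro ext) (simp add: ser_dy_def)
  ultimately show ?thesis by (simp add: eval2_0 eval2_restrict_x0)
qed

lemma Q_crosses_x_axis:
  assumes "eval2 (coeff2 Q) (X, 0) = 0"
  shows "eval2 (ser_dx (coeff2 Q)) (X, 0) \<noteq> 0"
proof -
  let ?\<Lambda> = "Delta D j \<inter> {p. snd p = 0}"
  have T: "coeff2 (truncation Q ?\<Lambda>) = (\<lambda>r s. if s = 0 then coeff2 Q r s else 0)"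
  proof (intro ext)
    show "coeff2 (truncation Q ?\<Lambda>) r s = (if s = 0 then coeff2 Q r s else 0)" for r s
      using coeff2_Q_in_Delta[of r s] by (cases "coeff2 Q r s = 0") (auto simp: coeff2_truncation)
  qed
  have "X \<noteq> 0" using assms coeff2_Q_origin eval2_zero[of "coeff2 Q"] by auto
  then have "eval2 (ser_dx (coeff2 (truncation Q ?\<Lambda>))) (X, 1) \<noteq> 0 \<or> eval2 (ser_dy (coeff2 (truncation Q ?\<Lambda>))) (X, 1) \<noteq> 0"
    by (intro face_nonsingular edge_faces) (use origin_in_Delta assms in \<open>auto simp: T eval2_restrict_y0\<close>)
  moreover have "ser_dy (coeff2 (truncation Q ?\<Lambda>)) = (\<lambda>r s. 0)"
    unfolding T by (intro ext) (simp add: ser_dy_def)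
  moreover have "ser_dx (coeff2 (truncation Q ?\<Lambda>)) = (\<lambda>r s. if s = 0 then ser_dx (coeff2 Q) r s else 0)"
    unfolding T by (intro ext) (simp add: ser_dx_def)
  ultimately show ?thesis by (simp add: eval2_0 eval2_restrict_y0)
qed

lemma Q_smooth:
  assumes "eval2 (coeff2 Q) p = 0"
  shows "eval2 (ser_dx (coeff2 Q)) p \<noteq> 0 \<or> eval2 (ser_dy (coeff2 Q)) p \<noteq> 0"
proof -
  obtain X Y where p: "p = (X, Y)" by force
  have T: "coeff2 (truncation Q (Delta D j)) = coeff2 Q"
    using coeff2_Q_in_Delta by (intro ext) (auto simp: coeff2_truncation)
  consider "X = 0" | "Y = 0" | "X \<noteq> 0" "Y \<noteq> 0" by blast
  then show ?thesis
  proof cases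
    case 1
    then show ?thesis using Q_crosses_y_axis[of Y] assms p by simp
  next
    case 2
    then show ?thesis using Q_crosses_x_axis[of X] assms p by simp
  next
    case 3
    then show ?thesis
      using face_nonsingular[OF face_of_refl[OF convex_Delta], of X Y] origin_in_Delta assms p unfolding T by auto
  qed
qed

text \<open>The Newton polygon being the whole triangle, each vertex is the exponent of a monomial of \<open>Q_j\<close>.\<close>

lemma Q_vertices: "coeff2 Q 0 (n * e) \<noteq> 0" "coeff2 Q (m * e) 0 \<noteq> 0"
proof -
  let ?S = "{(real r, real s) |r s. coeff2 Q r s \<noteq> 0}"
  have hull: "convex hull ?S = Delta D j" using nondegenerate by (simp add: real_nondegenerated_def newton_polygon_def)
  have bd: "fst p \<le> real (m * e)" "snd p \<le> real (n * e)" if "p \<in> Delta D j" for p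
  proof -
    have p: "0 \<le> fst p" "0 \<le> snd p" "real (n * e) * fst p + real (m * e) * snd p \<le> real (m * e) * real (n * e)"
      using that unfolding Delta_eq by auto
    have "0 \<le> real (n * e) * fst p" "0 \<le> real (m * e) * snd p" using p by simp_all
    then have "real (n * e) * fst p \<le> real (n * e) * real (m * e)" "real (m * e) * snd p \<le> real (m * e) * real (n * e)"
      using p(3) mult.commute[of "real (m * e)" "real (n * e)"] by linarith+
    then show "fst p \<le> real (m * e)" "snd p \<le> real (n * e)"
      using Delta_pos by (simp_all only: mult_le_cancel_left_pos)
  qed
  have "Delta D j \<inter> {p. (0, 1) \<bullet> p = real (n * e)} face_of Delta D j"
    by (rule face_of_Int_supporting_hyperplane_le[OF convex_Delta]) (use bd in \<open>auto simp: inner_prod_def\<close>)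
  moreover have "Delta D j \<inter> {p. (0, 1) \<bullet> p = real (n * e)} = {(0, real (n * e))}"
  proof -
    have "fst p = 0" if "p \<in> Delta D j" "snd p = real (n * e)" for p
    proof -
      have "real (n * e) * fst p \<le> 0" "0 \<le> fst p" using that unfolding Delta_eq by auto
      then show ?thesis using nme by (auto simp: mult_le_0_iff)
    qed
    moreover have "(0, real (n * e)) \<in> Delta D j" unfolding Delta_eq by simp
    ultimately show ?thesis by (auto simp: inner_prod_def prod_eq_iff)
  qed
  ultimately have "(0, real (n * e)) extreme_point_of (convex hull ?S)" using face_of_singleton hull by metis
  then have "(0, real (n * e)) \<in> ?S" by (rule extreme_point_of_convex_hull)
  then obtain r s where "coeff2 Q r s \<noteq> 0" "real r = 0" "real s = real (n * e)" by auto
  then show "coeff2 Q 0 (n * e) \<noteq> 0" by (metis of_nat_eq_0_iff of_nat_eq_iff)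
  have "Delta D j \<inter> {p. (1, 0) \<bullet> p = real (m * e)} face_of Delta D j"
    by (rule face_of_Int_supporting_hyperplane_le[OF convex_Delta]) (use bd in \<open>auto simp: inner_prod_def\<close>)
  moreover have "Delta D j \<inter> {p. (1, 0) \<bullet> p = real (m * e)} = {(real (m * e), 0)}"
  proof -
    have "snd p = 0" if "p \<in> Delta D j" "fst p = real (m * e)" for p
    proof -
      have "real (m * e) * snd p \<le> 0" "0 \<le> snd p" using that unfolding Delta_eq by (auto simp: mult.commute)
      then show ?thesis using nme by (auto simp: mult_le_0_iff)
    qed
    moreover have "(real (m * e), 0) \<in> Delta D j" unfolding Delta_eq by simp
    ultimately show ?thesis by (auto simp: inner_prod_def prod_eq_iff)
  qed
  ultimately have "(real (m * e), 0) extreme_point_of (convex hull ?S)" using face_of_singleton hull by metis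
  then have "(real (m * e), 0) \<in> ?S" by (rule extreme_point_of_convex_hull)
  then obtain r s where "coeff2 Q r s \<noteq> 0" "real r = real (m * e)" "real s = 0" by auto
  then show "coeff2 Q (m * e) 0 \<noteq> 0" by (metis of_nat_eq_0_iff of_nat_eq_iff)
qed

text \<open>Nondegeneracy on the hypotenuse, together with the vertices for the points on the axes.\<close>

sublocale nondegenerate_family \<alpha> \<beta> \<Omega> gser "rad D j"
proof -
  interpret weighted_family \<alpha> \<beta> \<Omega> gser "rad D j" by (rule weighted_family_gser)
  have L: "L 0 r s = (if n * r + m * s = e * n * m then coeff2 Q r s else 0)" for r s
    unfolding leading_ser_0 coeff2_truncation Gamma_iff ..
  have x0: "Y = 0" if "eval2 (L 0) (0, Y) = 0" for Y
  proof (rule ccontr)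
    assume "Y \<noteq> 0"
    have "eval2 (L 0) (0, Y) = eval2 (\<lambda>r s. if r = 0 then L 0 r s else 0) (1, Y)" by (simp only: eval2_restrict_x0)
    also have "\<dots> = coeff2 Q 0 (n * e) * Y ^ (n * e)"
    proof (subst eval2_finite[of "{(0, n * e)}"])
      show "(r, s) \<in> {(0, n * e)}" if "(if r = 0 then L 0 r s else 0) \<noteq> 0" for r s
      proof -
        have r: "r = 0" and "n * r + m * s = e * n * m" using that unfolding L by (auto split: if_splits)
        then have "m * s = m * (n * e)" by (simp add: mult_ac)
        then show ?thesis using r nme by simp
      qed
      have "n * 0 + m * (n * e) = e * n * m" by (simp add: mult_ac)
      then show "(\<Sum>(r, s)\<in>{(0, n * e)}. (if r = 0 then L 0 r s else 0) * fst (1, Y) ^ r * snd (1, Y) ^ s) = coeff2 Q 0 (n * e) * Y ^ (n * e)"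
        using L[of 0 "n * e"] by simp
    qed simp
    finally show False using that Q_vertices(1) \<open>Y \<noteq> 0\<close> by simp
  qed
  have y0: "X = 0" if "eval2 (L 0) (X, 0) = 0" for X
  proof (rule ccontr)
    assume "X \<noteq> 0"
    have "eval2 (L 0) (X, 0) = eval2 (\<lambda>r s. if s = 0 then L 0 r s else 0) (X, 1)" by (simp only: eval2_restrict_y0)
    also have "\<dots> = coeff2 Q (m * e) 0 * X ^ (m * e)"
    proof (subst eval2_finite[of "{(m * e, 0)}"])
      show "(r, s) \<in> {(m * e, 0)}" if "(if s = 0 then L 0 r s else 0) \<noteq> 0" for r s
      proof -
        have s: "s = 0" and "n * r + m * s = e * n * m" using that unfolding L by (auto split: if_splits)
        then have "n * r = n * (m * e)" by (simp add: mult_ac)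
        then show ?thesis using s nme by simp
      qed
      have "n * (m * e) + m * 0 = e * n * m" by (simp add: mult_ac)
      then show "(\<Sum>(r, s)\<in>{(m * e, 0)}. (if s = 0 then L 0 r s else 0) * fst (X, 1) ^ r * snd (X, 1) ^ s) = coeff2 Q (m * e) 0 * X ^ (m * e)"
        using L[of "m * e" 0] by simp
    qed simp
    finally show False using that Q_vertices(2) \<open>X \<noteq> 0\<close> by simp
  qed
  show "nondegenerate_family \<alpha> \<beta> \<Omega> gser (rad D j)"
  proof unfold_locales
    fix X Y assume z: "eval2 (L 0) (X, Y) = 0"
    show "X \<noteq> 0 \<and> Y \<noteq> 0" if "(X, Y) \<noteq> 0"
      using z x0[of Y] y0[of X] that by (auto simp: zero_prod_def)
    show "eval2 (ser_dx (L 0)) (X, Y) \<noteq> 0 \<or> eval2 (ser_dy (L 0)) (X, Y) \<noteq> 0" if "X \<noteq> 0" "Y \<noteq> 0"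
      using face_nonsingular[OF Gamma_face _ that] z
      unfolding leading_ser_0 by (auto simp: Gamma_def)
  qed
qed

text \<open>The image of the oval in the chart does not meet the hypotenuses, which keeps the oval away from the
  boundary of the ball. Near the origin the gradient of the curve at \<open>t_j = 0\<close> does not vanish by
  nondegeneracy, so that the Milnor ball yields transversality to all circles.\<close>

lemma oval_family_if_depth_one:
  assumes "depth_one_oval D M A j t K"
  shows "\<exists>\<rho> \<delta>. oval_family \<alpha> \<beta> \<Omega> gser (rad D j) \<rho> \<delta> K"
proof -
  obtain \<rho> \<delta> K0 where \<rho>: "\<rho> < rad D j" and \<delta>: "\<delta> > 0"
    and mil: "milnor_ball (strict_transform D j (msqh_poly D M A (Suc j) t)) \<rho>"
    and K0: "K0 \<inter> symmetrize (Gamma D j) = {}"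
    and ov: "\<forall>s\<in>{0<..<\<delta>}. let C = real_part (strict_transform D j (msqh_poly D M A j (t(j := s)))) \<rho>
        in oval_of C (K s) \<and> (\<exists>h. patchworking_homeo (cball 0 \<rho>) C Q (Delta D j) h \<and> h ` K s = K0)"
    and cont: "\<forall>s\<in>{0<..<\<delta>}. \<forall>\<epsilon>>0. \<forall>\<^sub>F s' in at s. hausdorff_close \<epsilon> (K s') (K s)"
    using assms unfolding depth_one_oval_def by (elim exE conjE) (rule that)
  have milg: "milnor_ball (gser 0) \<rho>" using mil by (simp only: gser_0)
  then have \<rho>0: "\<rho> > 0" by (simp add: milnor_ball_def)
  obtain \<epsilon> where \<epsilon>: "\<epsilon> > 0" and opp: "\<And>s p. 0 \<le> s \<Longrightarrow> p \<noteq> 0 \<Longrightarrow> norm p < \<epsilon> \<Longrightarrow>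
     s ^ (2 * \<alpha> * \<beta>) < \<epsilon> * weighted_square \<alpha> \<beta> p \<Longrightarrow> eval2 (P s) p = 0 \<Longrightarrow>
     fst p * eval2 (ser_dx (P s)) p * (snd p * eval2 (ser_dy (P s)) p) < 0"
    using opposite_signs_near_origin by blast
  have "eval2 (ser_dx (gser 0)) p \<noteq> 0" if "p \<noteq> 0" "norm p < \<epsilon>" "eval2 (gser 0) p = 0" for p
  proof -
    have z: "(0::real) ^ (2 * \<alpha> * \<beta>) = 0" using nme by (simp add: power_0_left)
    have "0 < \<epsilon> * weighted_square \<alpha> \<beta> p" using \<epsilon> weighted_square_pos[OF \<alpha>\<beta> that(1)] by simp
    then have "(0::real) ^ (2 * \<alpha> * \<beta>) < \<epsilon> * weighted_square \<alpha> \<beta> p" unfolding z .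
    from opp[OF order_refl that(1,2) this] that(3) show ?thesis unfolding P_0 by auto
  qed
  then interpret milnor_curve "gser 0" "rad D j" \<rho>
    using \<epsilon> by unfold_locales (use conv_gser \<rho> milg in auto)
  have comp: "K s \<in> components (real_part (P s) \<rho>)" if "0 < s" "s < \<delta>" for s
    using bspec[OF ov, of s] that unfolding strict_transform_eq_family Let_def oval_of_def by simp
  have "oval_family \<alpha> \<beta> \<Omega> gser (rad D j) \<rho> \<delta> K"
  proof unfold_locales
    show "K s \<subseteq> ball 0 \<rho>" if s: "0 < s" "s < \<delta>" for s
    proof
      fix p assume p: "p \<in> K s"
      obtain h k where h: "homeomorphism (cball 0 \<rho>) (symmetrize (Delta D j)) h k" "h ` K s = K0"
        using bspec[OF ov, of s] s unfolding Let_def patchworking_homeo_def by auto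
      have "p \<in> cball 0 \<rho>" using in_components_subset[OF comp[OF s]] p by (auto simp: real_part_def)
      moreover have "h p \<notin> symmetrize (Gamma D j)" using h(2) K0 p by auto
      ultimately show "p \<in> ball 0 \<rho>"
        using homeomorphism_ball_triangle_interior[OF h(1)[unfolded Delta_def] Delta_pos] unfolding Gamma_def by blast
    qed
    show "K s \<in> components (real_part (P s) \<rho>)" if "0 < s" "s < \<delta>" for s by (rule comp[OF that])
    show "\<forall>\<^sub>F s' in at s. hausdorff_close \<epsilon> (K s') (K s)" if "0 < s" "s < \<delta>" "\<epsilon> > 0" for s \<epsilon>
      using cont that by simp
    show "gradient_det (gser 0) (power_sum_ser (2 * 1) (2 * 1)) p \<noteq> 0"
      if "p \<noteq> 0" "norm p \<le> \<rho>" "eval2 (gser 0) p = 0" for p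
      by (rule radial_transversality[OF that])
  qed (use \<rho>0 \<rho> \<delta> in auto)
  then show ?thesis by blast
qed

end

section \<open>Asymptotic extremal values and size\<close>

lemma very_small_mono:
  assumes "very_small i k \<Phi> t" "\<And>t'. (\<And>l. k < l \<Longrightarrow> t' l = t l) \<Longrightarrow> \<Phi> t' \<Longrightarrow> \<Psi> t'"
  shows "very_small i k \<Psi> t"
  using assms
proof (induction k arbitrary: t)
  case 0
  then show ?case by simp
next
  case (Suc k)
  show ?case
  proof (cases "Suc k < i")
    case True
    then show ?thesis using Suc.prems by simp
  next
    case False
    then have "\<forall>\<^sub>F s in at_right 0. very_small i k \<Phi> (t(Suc k := s))" using Suc.prems(1) by simp
    then have "\<forall>\<^sub>F s in at_right 0. very_small i k \<Psi> (t(Suc k := s))"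
    proof (rule eventually_mono)
      fix s assume vs: "very_small i k \<Phi> (t(Suc k := s))"
      show "very_small i k \<Psi> (t(Suc k := s))"
      proof (rule Suc.IH[OF vs])
        fix t' assume "\<And>l. k < l \<Longrightarrow> t' l = (t(Suc k := s)) l" "\<Phi> t'"
        then show "\<Psi> t'" by (intro Suc.prems(2)) auto
      qed
    qed
    then show ?thesis using False by simp
  qed
qed

lemma very_small_conj:
  assumes "very_small i k \<Phi> t" "very_small i k \<Psi> t"
  shows "very_small i k (\<lambda>t. \<Phi> t \<and> \<Psi> t) t"
  using assms
proof (induction k arbitrary: t)
  case 0
  then show ?case by simp
next
  case (Suc k)
  show ?case
  proof (cases "Suc k < i")
    case True
    then show ?thesis using Suc.prems by simp
  next
    case False
    then have "\<forall>\<^sub>F s in at_right 0. very_small i k \<Phi> (t(Suc k := s))" "\<forall>\<^sub>F s in at_right 0. very_small i k \<Psi> (t(Suc k := s))"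
      using Suc.prems by auto
    then have "\<forall>\<^sub>F s in at_right 0. very_small i k (\<lambda>t. \<Phi> t \<and> \<Psi> t) (t(Suc k := s))"
      by eventually_elim (rule Suc.IH)
    then show ?thesis using False by simp
  qed
qed

text \<open>Asymptotics \<open>l s^\<gamma>\<close> of the supremum of \<open>f\<close> over \<open>S s\<close>. Stated without the supremum it needs no
  compactness or boundedness and is visibly stable under perturbation.\<close>

definition max_asymp :: "(real \<times> real \<Rightarrow> real) \<Rightarrow> (real \<Rightarrow> (real \<times> real) set) \<Rightarrow> nat \<Rightarrow> real \<Rightarrow> bool" where
  "max_asymp f S \<gamma> l \<longleftrightarrow> (\<forall>\<epsilon>>0. \<forall>\<^sub>F s in at_right 0.
     (\<forall>p\<in>S s. f p \<le> (l + \<epsilon>) * s ^ \<gamma>) \<and> (\<exists>p\<in>S s. (l - \<epsilon>) * s ^ \<gamma> \<le> f p))"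

lemma max_asymp_perturb:
  assumes f: "max_asymp f S \<gamma> l"
    and close: "\<And>\<epsilon>. \<epsilon> > 0 \<Longrightarrow> \<forall>\<^sub>F s in at_right 0. \<forall>p\<in>S s. \<bar>f' p - f p\<bar> \<le> \<epsilon> * s ^ \<gamma>"
  shows "max_asymp f' S \<gamma> l"
  unfolding max_asymp_def
proof (intro allI impI)
  fix \<epsilon> :: real assume "\<epsilon> > 0"
  then have \<epsilon>: "\<epsilon> / 2 > 0" by simp
  have "\<forall>\<^sub>F s in at_right 0. (\<forall>p\<in>S s. f p \<le> (l + \<epsilon> / 2) * s ^ \<gamma>) \<and> (\<exists>p\<in>S s. (l - \<epsilon> / 2) * s ^ \<gamma> \<le> f p)"
    using f \<epsilon> unfolding max_asymp_def by blast
  then show "\<forall>\<^sub>F s in at_right 0. (\<forall>p\<in>S s. f' p \<le> (l + \<epsilon>) * s ^ \<gamma>) \<and> (\<exists>p\<in>S s. (l - \<epsilon>) * s ^ \<gamma> \<le> f' p)"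
    using close[OF \<epsilon>]
  proof eventually_elim
    case (elim s)
    have e: "(l + \<epsilon>) * s ^ \<gamma> = (l + \<epsilon> / 2) * s ^ \<gamma> + \<epsilon> / 2 * s ^ \<gamma>" "(l - \<epsilon>) * s ^ \<gamma> = (l - \<epsilon> / 2) * s ^ \<gamma> - \<epsilon> / 2 * s ^ \<gamma>"
      by (simp_all add: algebra_simps)
    obtain p0 where p0: "p0 \<in> S s" "(l - \<epsilon> / 2) * s ^ \<gamma> \<le> f p0" using elim(1) by blast
    have "(l - \<epsilon>) * s ^ \<gamma> \<le> f' p0" using bspec[OF elim(2) p0(1)] p0(2) unfolding e by linarith
    moreover have "f' p \<le> (l + \<epsilon>) * s ^ \<gamma>" if "p \<in> S s" for p
      using bspec[OF elim(2) that] bspec[OF conjunct1[OF elim(1)] that] unfolding e by linarith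
    ultimately show ?case using p0(1) by blast
  qed
qed

lemma max_asymp_image: "max_asymp f (\<lambda>s. h ` S s) \<gamma> l \<longleftrightarrow> max_asymp (\<lambda>p. f (h p)) S \<gamma> l"
  by (simp add: max_asymp_def)

lemma power_between_on_one_side_of_zero:
  fixes a b x :: real
  assumes "a \<le> x" "x \<le> b" "0 < a \<or> b < 0"
  shows "min (a ^ N) (b ^ N) \<le> x ^ N \<and> x ^ N \<le> max (a ^ N) (b ^ N)"
proof (cases "0 < a")
  case True
  then have "a ^ N \<le> x ^ N" "x ^ N \<le> b ^ N" using assms by (auto intro!: power_mono)
  then show ?thesis by auto
next
  case False
  then have "(- b) ^ N \<le> (- x) ^ N" "(- x) ^ N \<le> (- a) ^ N" using assms by (auto intro!: power_mono)
  then show ?thesis by (cases "even N") (auto simp: power_minus_odd)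
qed

text \<open>The tolerance is relative to \<open>s^\<gamma>\<close>, hence invisible in the leading term.\<close>

lemma sup_close_if_hausdorff_close:
  fixes f :: "real \<times> real \<Rightarrow> real"
  assumes lip: "\<And>p q. \<bar>f p - f q\<bar> \<le> dist p q" and O: "compact S" and s: "s > 0" and \<epsilon>: "\<epsilon> > 0"
    and close: "hausdorff_close (\<epsilon> / 4 * s ^ \<gamma>) S I"
    and max: "\<forall>p\<in>I. f p \<le> (l + \<epsilon> / 4) * s ^ \<gamma>" "\<exists>p\<in>I. (l - \<epsilon> / 4) * s ^ \<gamma> \<le> f p"
  shows "dist (Sup (f ` S) / s ^ \<gamma>) l < \<epsilon>"
proof -
  have pos: "s ^ \<gamma> > 0" using s by simp
  have e: "(l + \<epsilon> / 2) * s ^ \<gamma> = (l + \<epsilon> / 4) * s ^ \<gamma> + \<epsilon> / 4 * s ^ \<gamma>" "(l - \<epsilon> / 2) * s ^ \<gamma> = (l - \<epsilon> / 4) * s ^ \<gamma> - \<epsilon> / 4 * s ^ \<gamma>"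
    by (simp_all add: algebra_simps)
  have upper: "f p \<le> (l + \<epsilon> / 2) * s ^ \<gamma>" if pS: "p \<in> S" for p
  proof -
    obtain q where q: "q \<in> I" "dist p q < \<epsilon> / 4 * s ^ \<gamma>" using close pS unfolding hausdorff_close_def by blast
    then show ?thesis using lip[of p q] bspec[OF max(1) q(1)] unfolding e by linarith
  qed
  obtain q where q: "q \<in> I" "(l - \<epsilon> / 4) * s ^ \<gamma> \<le> f q" using max(2) by blast
  obtain p where p: "p \<in> S" "dist p q < \<epsilon> / 4 * s ^ \<gamma>" using close q(1) unfolding hausdorff_close_def by blast
  have lower: "(l - \<epsilon> / 2) * s ^ \<gamma> \<le> f p" using lip[of p q] p(2) q(2) unfolding e by linarith
  have bdd: "bdd_above (f ` S)" by (rule bdd_aboveI2) (rule upper)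
  have "f p \<le> Sup (f ` S)" using bdd p(1) by (intro cSup_upper) auto
  then have 1: "(l - \<epsilon> / 2) * s ^ \<gamma> \<le> Sup (f ` S)" using lower by linarith
  have 2: "Sup (f ` S) \<le> (l + \<epsilon> / 2) * s ^ \<gamma>" by (rule cSup_least) (use p(1) upper in auto)
  have "l - \<epsilon> / 2 \<le> Sup (f ` S) / s ^ \<gamma>" "Sup (f ` S) / s ^ \<gamma> \<le> l + \<epsilon> / 2"
    using 1 2 pos by (simp_all add: pos_le_divide_eq pos_divide_le_eq)
  then show ?thesis using \<epsilon> by (simp add: dist_real_def abs_if)
qed

text \<open>The lower corner is also written with suprema, so that all four sides are of the same kind.\<close>

lemma minimal_box_of_compact:
  fixes S :: "(real \<times> real) set"
  assumes S: "compact S" "S \<noteq> {}"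
  shows "minimal_box S (- Sup ((\<lambda>p. - fst p) ` S), - Sup ((\<lambda>p. - snd p) ` S)) (Sup (fst ` S), Sup (snd ` S))"
proof -
  have ex: "\<exists>p\<in>S. Sup (f ` S) = f p \<and> (\<forall>q\<in>S. f q \<le> f p)" if cf: "continuous_on S f" for f :: "real \<times> real \<Rightarrow> real"
  proof -
    obtain p where p: "p \<in> S" "\<forall>q\<in>S. f q \<le> f p" using continuous_attains_sup[OF S cf] by auto
    moreover have "Sup (f ` S) = f p" by (rule cSup_eq_maximum) (use p in auto)
    ultimately show ?thesis by blast
  qed
  obtain p1 where p1: "p1 \<in> S" "Sup (fst ` S) = fst p1" "\<And>q. q \<in> S \<Longrightarrow> fst q \<le> fst p1"
    using ex[OF continuous_on_fst[OF continuous_on_id]] by blast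
  obtain p2 where p2: "p2 \<in> S" "Sup (snd ` S) = snd p2" "\<And>q. q \<in> S \<Longrightarrow> snd q \<le> snd p2"
    using ex[OF continuous_on_snd[OF continuous_on_id]] by blast
  obtain p3 where p3: "p3 \<in> S" "Sup ((\<lambda>p. - fst p) ` S) = - fst p3" "\<And>q. q \<in> S \<Longrightarrow> - fst q \<le> - fst p3"
    using ex[OF continuous_on_minus[OF continuous_on_fst[OF continuous_on_id]]] by blast
  obtain p4 where p4: "p4 \<in> S" "Sup ((\<lambda>p. - snd p) ` S) = - snd p4" "\<And>q. q \<in> S \<Longrightarrow> - snd q \<le> - snd p4"
    using ex[OF continuous_on_minus[OF continuous_on_snd[OF continuous_on_id]]] by blast
  have cb: "cbox a b = {p. fst a \<le> fst p \<and> fst p \<le> fst b \<and> snd a \<le> snd p \<and> snd p \<le> snd b}" for a b :: "real \<times> real"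
    by (cases a; cases b) (auto simp: cbox_Pair_eq)
  show ?thesis
    unfolding minimal_box_def cb p1(2) p2(2) p3(2) p4(2) using p1 p2 p3 p4 by fastforce
qed

lemma oval_compact_nonempty:
  assumes "oval_of S K"
  shows "compact K \<and> K \<noteq> {}"
proof -
  have h: "K homeomorphic sphere (0 :: real \<times> real) 1" using assms by (simp add: oval_of_def)
  have "norm (1::real, 0::real) = 1" by (simp add: norm_Pair)
  then have "sphere (0 :: real \<times> real) 1 \<noteq> {}" by (metis dist_0_norm empty_iff mem_sphere)
  then show ?thesis using homeomorphic_compactness[OF h] homeomorphic_empty h by (metis compact_sphere)
qed

text \<open>The parameters \<open>t_1, \<dots>, t_(j-1)\<close> are chosen after \<open>t_j = s\<close>, so the tolerance in the Hausdorff distance may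
  be a small multiple of \<open>s^\<gamma>\<close>.\<close>

lemma sim_power_sup:
  assumes j: "1 \<le> j" and lip: "\<And>p q. \<bar>f p - f q\<bar> \<le> dist p q" and l: "l \<noteq> 0"
    and comp: "very_small 1 j (\<lambda>t'. compact (O' t')) t"
    and close: "\<forall>\<^sub>F s in at_right 0. \<forall>\<epsilon>>0. very_small 1 (j - 1) (\<lambda>t'. hausdorff_close \<epsilon> (O' t') (I s)) (t(j := s))"
    and max: "max_asymp f I \<gamma> l"
  shows "sim_power j t (\<lambda>t'. Sup (f ` O' t')) \<gamma>"
  unfolding sim_power_def
proof (intro exI[of _ l] conjI allI impI)
  fix \<epsilon> :: real assume \<epsilon>: "\<epsilon> > 0"
  obtain k where k: "j = Suc k" using j by (cases j) auto
  have "\<forall>\<^sub>F s in at_right 0. very_small 1 k (\<lambda>t'. compact (O' t')) (t(Suc k := s))"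
    using comp by (simp add: k)
  moreover have "\<forall>\<^sub>F s in at_right 0. (\<forall>p\<in>I s. f p \<le> (l + \<epsilon> / 4) * s ^ \<gamma>) \<and> (\<exists>p\<in>I s. (l - \<epsilon> / 4) * s ^ \<gamma> \<le> f p)"
    using max \<epsilon> unfolding max_asymp_def by (meson divide_pos_pos zero_less_numeral)
  ultimately have "\<forall>\<^sub>F s in at_right 0. very_small 1 k (\<lambda>t'. dist (Sup (f ` O' t') / t' j ^ \<gamma>) l < \<epsilon>) (t(Suc k := s))"
    using close eventually_at_right_less[of 0]
  proof eventually_elim
    case (elim s)
    have "\<epsilon> / 4 * s ^ \<gamma> > 0" using elim(4) \<epsilon> by simp
    then have "very_small 1 k (\<lambda>t'. hausdorff_close (\<epsilon> / 4 * s ^ \<gamma>) (O' t') (I s)) (t(Suc k := s))"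
      using elim(3) by (simp add: k)
    from very_small_conj[OF elim(1) this] show ?case
    proof (rule very_small_mono)
      fix t' assume t': "\<And>l. k < l \<Longrightarrow> t' l = (t(Suc k := s)) l" "compact (O' t') \<and> hausdorff_close (\<epsilon> / 4 * s ^ \<gamma>) (O' t') (I s)"
      have "t' j = s" using t'(1)[of j] by (simp add: k)
      moreover have "dist (Sup (f ` O' t') / s ^ \<gamma>) l < \<epsilon>"
        by (rule sup_close_if_hausdorff_close[OF lip _ elim(4) \<epsilon>]) (use t'(2) elim(2) in auto)
      ultimately show "dist (Sup (f ` O' t') / t' j ^ \<gamma>) l < \<epsilon>" by simp
    qed
  qed
  then show "very_small 1 j (\<lambda>t'. dist (Sup (f ` O' t') / t' j ^ \<gamma>) l < \<epsilon>) t" by (simp add: k)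
qed (rule l)

lemma sim_power_minus:
  assumes "sim_power j t f \<gamma>"
  shows "sim_power j t (\<lambda>t'. - f t') \<gamma>"
proof -
  obtain l where l: "l \<noteq> 0" "\<And>\<epsilon>. \<epsilon> > 0 \<Longrightarrow> very_small 1 j (\<lambda>t'. dist (f t' / t' j ^ \<gamma>) l < \<epsilon>) t"
    using assms unfolding sim_power_def by blast
  have "very_small 1 j (\<lambda>t'. dist (- f t' / t' j ^ \<gamma>) (- l) < \<epsilon>) t" if "\<epsilon> > 0" for \<epsilon>
    by (rule very_small_mono[OF l(2)[OF that]]) (simp add: dist_real_def abs_minus_commute)
  then show ?thesis unfolding sim_power_def using l(1) by (intro exI[of _ "- l"]) auto
qed

lemma has_size_if_max_asymp:
  assumes j: "1 \<le> j"
    and ov: "very_small 1 j (\<lambda>t'. oval_of (C t') (O' t')) t"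
    and close: "\<forall>\<^sub>F s in at_right 0. \<forall>\<epsilon>>0. very_small 1 (j - 1) (\<lambda>t'. hausdorff_close \<epsilon> (O' t') (I s)) (t(j := s))"
    and max: "\<exists>l. l \<noteq> 0 \<and> max_asymp fst I a l" "\<exists>l. l \<noteq> 0 \<and> max_asymp (\<lambda>p. - fst p) I a l"
      "\<exists>l. l \<noteq> 0 \<and> max_asymp snd I b l" "\<exists>l. l \<noteq> 0 \<and> max_asymp (\<lambda>p. - snd p) I b l"
  shows "has_size j t O' a b"
proof -
  have comp: "very_small 1 j (\<lambda>t'. compact (O' t')) t"
    by (rule very_small_mono[OF ov]) (use oval_compact_nonempty in blast)
  have lip: "\<bar>fst p - fst q\<bar> \<le> dist p q" "\<bar>snd p - snd q\<bar> \<le> dist p q"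
     "\<bar>- fst p - - fst q\<bar> \<le> dist p q" "\<bar>- snd p - - snd q\<bar> \<le> dist p q" for p q :: "real \<times> real"
    using dist_fst_le[of p q] dist_snd_le[of p q] by (auto simp: dist_real_def abs_minus_commute)
  have box: "very_small 1 j (\<lambda>t'. minimal_box (O' t')
      (- Sup ((\<lambda>p. - fst p) ` O' t'), - Sup ((\<lambda>p. - snd p) ` O' t')) (Sup (fst ` O' t'), Sup (snd ` O' t'))) t"
    by (rule very_small_mono[OF ov], rule minimal_box_of_compact) (use oval_compact_nonempty in blast)+
  obtain l0 where l0: "l0 \<noteq> 0" "max_asymp (fst) I a l0" using max(1) by blast
  have sp0: "sim_power j t (\<lambda>t'. Sup (fst ` O' t')) a"
    by (rule sim_power_sup[where f = "fst", OF j lip(1) l0(1) comp close l0(2)])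
  obtain l1 where l1: "l1 \<noteq> 0" "max_asymp (\<lambda>p. - fst p) I a l1" using max(2) by blast
  have sp1: "sim_power j t (\<lambda>t'. Sup ((\<lambda>p. - fst p) ` O' t')) a"
    by (rule sim_power_sup[where f = "\<lambda>p. - fst p", OF j lip(3) l1(1) comp close l1(2)])
  obtain l2 where l2: "l2 \<noteq> 0" "max_asymp (snd) I b l2" using max(3) by blast
  have sp2: "sim_power j t (\<lambda>t'. Sup (snd ` O' t')) b"
    by (rule sim_power_sup[where f = "snd", OF j lip(2) l2(1) comp close l2(2)])
  obtain l3 where l3: "l3 \<noteq> 0" "max_asymp (\<lambda>p. - snd p) I b l3" using max(4) by blast
  have sp3: "sim_power j t (\<lambda>t'. Sup ((\<lambda>p. - snd p) ` O' t')) b"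
    by (rule sim_power_sup[where f = "\<lambda>p. - snd p", OF j lip(4) l3(1) comp close l3(2)])
  show ?thesis unfolding has_size_def
    by (intro exI[of _ "\<lambda>t'. (- Sup ((\<lambda>p. - fst p) ` O' t'), - Sup ((\<lambda>p. - snd p) ` O' t'))"]
        exI[of _ "\<lambda>t'. (Sup (fst ` O' t'), Sup (snd ` O' t'))"], unfold fst_conv snd_conv)
       (intro conjI box sp0 sp2 sim_power_minus[OF sp1] sim_power_minus[OF sp3])
qed

lemma max_asymp_if_max_tendsto:
  assumes att: "\<forall>\<^sub>F s in at_right 0. (\<forall>p\<in>S s. f p \<le> m s) \<and> (\<exists>p\<in>S s. f p = m s)"
    and lim: "((\<lambda>s. m s / s ^ \<gamma>) \<longlongrightarrow> l) (at_right 0)"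
  shows "max_asymp f S \<gamma> l"
  unfolding max_asymp_def
proof (intro allI impI)
  fix \<epsilon> :: real assume \<epsilon>: "\<epsilon> > 0"
  have "\<forall>\<^sub>F s in at_right 0. dist (m s / s ^ \<gamma>) l < \<epsilon>"
    using lim \<epsilon> by (rule tendstoD)
  then show "\<forall>\<^sub>F s in at_right 0. (\<forall>p\<in>S s. f p \<le> (l + \<epsilon>) * s ^ \<gamma>) \<and> (\<exists>p\<in>S s. (l - \<epsilon>) * s ^ \<gamma> \<le> f p)"
    using eventually_at_right_less[of 0] att
  proof eventually_elim
    case (elim s)
    have "l - \<epsilon> \<le> m s / s ^ \<gamma>" "m s / s ^ \<gamma> \<le> l + \<epsilon>"
      using elim(1) by (auto simp: dist_real_def abs_if split: if_splits)
    then have "(l - \<epsilon>) * s ^ \<gamma> \<le> m s" "m s \<le> (l + \<epsilon>) * s ^ \<gamma>"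
      using elim(2) by (simp_all add: pos_le_divide_eq pos_divide_le_eq)
    then show ?case using elim(3) by (metis order_trans)
  qed
qed

lemma (in oval_family) max_asymp_if_support_tendsto:
  assumes "((\<lambda>s. support_value u v (K s) / s ^ \<gamma>) \<longlongrightarrow> l) (at_right 0)"
  shows "max_asymp (\<lambda>p. u * fst p + v * snd p) K \<gamma> l"
proof (rule max_asymp_if_max_tendsto[OF _ assms])
  show "\<forall>\<^sub>F s in at_right 0. (\<forall>p\<in>K s. u * fst p + v * snd p \<le> support_value u v (K s)) \<and>
      (\<exists>p\<in>K s. u * fst p + v * snd p = support_value u v (K s))"
    using eventually_at_right_less[of 0] less_\<delta>
  proof eventually_elim
    case (elim s)
    then show ?case by (metis K_support)
  qed
qed

section \<open>Ovals of depth j\<close>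

context oval_family
begin

text \<open>An oval that does not meet the second coordinate axis lies on one side of it, because it is connected.
  There \<open>x^N\<close> is monotonic, and its extreme values come from those of \<open>x\<close>.\<close>

lemma max_asymp_monomial:
  assumes off: "\<forall>\<^sub>F s in at_right 0. \<forall>p\<in>K s. fst p \<noteq> 0"
    and b: "((\<lambda>s. support_value 1 0 (K s) / s ^ \<alpha>) \<longlongrightarrow> b) (at_right 0)" "b \<noteq> 0"
    and a: "((\<lambda>s. support_value (-1) 0 (K s) / s ^ \<alpha>) \<longlongrightarrow> a) (at_right 0)" "a \<noteq> 0"
  shows "\<exists>l. l \<noteq> 0 \<and> max_asymp (\<lambda>p. fst p ^ N) K (\<alpha> * N) l"
    and "\<exists>l. l \<noteq> 0 \<and> max_asymp (\<lambda>p. - (fst p ^ N)) K (\<alpha> * N) l"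
proof -
  define hi lo where "hi = (\<lambda>s. support_value 1 0 (K s))" and "lo = (\<lambda>s. - support_value (-1) 0 (K s))"
  have bt: "\<forall>\<^sub>F s in at_right 0. (\<forall>p\<in>K s. min (lo s ^ N) (hi s ^ N) \<le> fst p ^ N \<and> fst p ^ N \<le> max (lo s ^ N) (hi s ^ N)) \<and>
     (\<exists>p\<in>K s. fst p = lo s) \<and> (\<exists>p\<in>K s. fst p = hi s)"
    using off eventually_at_right_less[of 0] less_\<delta>
  proof eventually_elim
    case (elim s)
    obtain p1 where p1: "p1 \<in> K s" "hi s = fst p1" "\<And>q. q \<in> K s \<Longrightarrow> fst q \<le> fst p1"
      by (rule K_support[OF elim(2,3), where u = 1 and v = 0]) (auto simp: hi_def)
    obtain p0 where p0: "p0 \<in> K s" "lo s = fst p0" "\<And>q. q \<in> K s \<Longrightarrow> fst p0 \<le> fst q"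
      by (rule K_support[OF elim(2,3), where u = "-1" and v = 0]) (auto simp: lo_def)
    have "connected (fst ` K s)"
      using in_components_connected[OF K[OF elim(2,3)]] by (intro connected_continuous_image continuous_intros)
    then have side: "0 < lo s \<or> hi s < 0"
      using connectedD_interval[of "fst ` K s" "lo s" "hi s" 0] p0(1,2) p1(1,2) elim(1)
      by (metis imageE image_eqI not_less order_le_less)
    have "min (lo s ^ N) (hi s ^ N) \<le> fst p ^ N \<and> fst p ^ N \<le> max (lo s ^ N) (hi s ^ N)" if "p \<in> K s" for p
      using p0(2,3) p1(2,3) that by (intro power_between_on_one_side_of_zero side) auto
    then show ?case using p0(1,2) p1(1,2) by metis
  qed
  have pw: "(x / s ^ \<alpha>) ^ N = x ^ N / s ^ (\<alpha> * N)" for x s :: real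
    by (simp add: power_divide power_mult)
  have lim: "((\<lambda>s. hi s ^ N / s ^ (\<alpha> * N)) \<longlongrightarrow> b ^ N) (at_right 0)" "((\<lambda>s. lo s ^ N / s ^ (\<alpha> * N)) \<longlongrightarrow> (- a) ^ N) (at_right 0)"
    unfolding pw[symmetric] using tendsto_power[OF b(1)] tendsto_power[OF tendsto_minus[OF a(1)]] by (simp_all add: hi_def lo_def)
  have mm: "max x y / c = max (x / c) (y / c)" "min x y / c = min (x / c) (y / c)" if "c > 0" for x y c :: real
    using that by (simp_all add: max_divide_distrib_right min_divide_distrib_right)
  have ev: "\<forall>\<^sub>F s in at_right 0. max (lo s ^ N / s ^ (\<alpha> * N)) (hi s ^ N / s ^ (\<alpha> * N)) = max (lo s ^ N) (hi s ^ N) / s ^ (\<alpha> * N)"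
    "\<forall>\<^sub>F s in at_right 0. - min (lo s ^ N / s ^ (\<alpha> * N)) (hi s ^ N / s ^ (\<alpha> * N)) = - min (lo s ^ N) (hi s ^ N) / s ^ (\<alpha> * N)"
    using eventually_at_right_less[of 0] by (eventually_elim, simp add: mm)+
  have "max_asymp (\<lambda>p. fst p ^ N) K (\<alpha> * N) (max ((- a) ^ N) (b ^ N))"
  proof (rule max_asymp_if_max_tendsto)
    show "\<forall>\<^sub>F s in at_right 0. (\<forall>p\<in>K s. fst p ^ N \<le> max (lo s ^ N) (hi s ^ N)) \<and> (\<exists>p\<in>K s. fst p ^ N = max (lo s ^ N) (hi s ^ N))"
      using bt by eventually_elim (metis max_def)
    show "((\<lambda>s. max (lo s ^ N) (hi s ^ N) / s ^ (\<alpha> * N)) \<longlongrightarrow> max ((- a) ^ N) (b ^ N)) (at_right 0)"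
      by (rule Lim_transform_eventually[OF tendsto_max[OF lim(2,1)] ev(1)])
  qed
  moreover have "max ((- a) ^ N) (b ^ N) \<noteq> 0" using a(2) b(2) by (simp add: max_def)
  ultimately show "\<exists>l. l \<noteq> 0 \<and> max_asymp (\<lambda>p. fst p ^ N) K (\<alpha> * N) l" by blast
  have "max_asymp (\<lambda>p. - (fst p ^ N)) K (\<alpha> * N) (- min ((- a) ^ N) (b ^ N))"
  proof (rule max_asymp_if_max_tendsto)
    show "\<forall>\<^sub>F s in at_right 0. (\<forall>p\<in>K s. - (fst p ^ N) \<le> - min (lo s ^ N) (hi s ^ N)) \<and> (\<exists>p\<in>K s. - (fst p ^ N) = - min (lo s ^ N) (hi s ^ N))"
      using bt by eventually_elim (metis min_def neg_le_iff_le)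
    show "((\<lambda>s. - min (lo s ^ N) (hi s ^ N) / s ^ (\<alpha> * N)) \<longlongrightarrow> - min ((- a) ^ N) (b ^ N)) (at_right 0)"
      by (rule Lim_transform_eventually[OF tendsto_minus[OF tendsto_min[OF lim(2,1)]] ev(2)])
  qed
  moreover have "- min ((- a) ^ N) (b ^ N) \<noteq> 0" using a(2) b(2) by (simp add: min_def)
  ultimately show "\<exists>l. l \<noteq> 0 \<and> max_asymp (\<lambda>p. - (fst p ^ N)) K (\<alpha> * N) l" by blast
qed

text \<open>The ovals shrink to the origin, where the factor is close to \<open>1\<close>, and \<open>x^N\<close> is at most of the order of
  \<open>s^(\<alpha> N)\<close> on them. The constant \<open>c\<close> will be \<open>1\<close> or \<open>-1\<close>.\<close>

lemma max_asymp_unit_multiple: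
  assumes f: "asymp_power f N" and c: "\<bar>c\<bar> \<le> 1" and mono: "max_asymp (\<lambda>p. c * fst p ^ N) K (\<alpha> * N) l"
  shows "max_asymp (\<lambda>p. c * f p) K (\<alpha> * N) l"
proof (rule max_asymp_perturb[OF mono])
  fix \<epsilon> :: real assume \<epsilon>: "\<epsilon> > 0"
  obtain U where U: "(U \<longlongrightarrow> 1) (nhds 0)" "\<forall>\<^sub>F p in nhds 0. f p = U p * fst p ^ N"
    using f by (auto simp: asymp_power_def)
  obtain B where B: "B > 0" "\<forall>\<^sub>F s in at_right 0. \<forall>p\<in>K s. \<bar>fst p\<bar> \<le> B * s ^ \<alpha> \<and> \<bar>snd p\<bar> \<le> B * s ^ \<beta>"
    using K_weighted_bound by blast
  have "\<epsilon> / B ^ N > 0" using \<epsilon> B by simp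
  from tendstoD[OF U(1) this] U(2) have "\<forall>\<^sub>F p in nhds 0. dist (U p) 1 < \<epsilon> / B ^ N \<and> f p = U p * fst p ^ N"
    by eventually_elim simp
  then obtain d where d: "d > 0" "\<And>p. dist p 0 < d \<Longrightarrow> dist (U p) 1 < \<epsilon> / B ^ N \<and> f p = U p * fst p ^ N"
    unfolding eventually_nhds_metric by blast
  show "\<forall>\<^sub>F s in at_right 0. \<forall>p\<in>K s. \<bar>c * f p - c * fst p ^ N\<bar> \<le> \<epsilon> * s ^ (\<alpha> * N)"
    using K_shrinks[OF d(1)] B(2) eventually_at_right_less[of 0]
  proof eventually_elim
    case (elim s)
    show ?case
    proof
      fix p assume p: "p \<in> K s"
      have pd: "dist p 0 < d" using elim(1) p by (auto simp: dist_commute)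
      have fp: "f p = U p * fst p ^ N" and Up: "\<bar>U p - 1\<bar> \<le> \<epsilon> / B ^ N"
        using d(2)[OF pd] by (auto simp: dist_real_def)
      have "\<bar>fst p\<bar> ^ N \<le> (B * s ^ \<alpha>) ^ N" using elim(2) p by (intro power_mono) auto
      then have X: "\<bar>fst p\<bar> ^ N \<le> B ^ N * s ^ (\<alpha> * N)" by (simp add: power_mult_distrib power_mult)
      have "c * f p - c * fst p ^ N = c * ((U p - 1) * fst p ^ N)" by (simp add: fp algebra_simps)
      then have "\<bar>c * f p - c * fst p ^ N\<bar> = \<bar>c\<bar> * (\<bar>U p - 1\<bar> * \<bar>fst p\<bar> ^ N)"
        by (simp only: abs_mult power_abs)
      also have "\<dots> \<le> 1 * (\<epsilon> / B ^ N * (B ^ N * s ^ (\<alpha> * N)))"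
        using c Up X \<epsilon> B by (intro mult_mono) auto
      also have "\<dots> = \<epsilon> * s ^ (\<alpha> * N)" using B by simp
      finally show "\<bar>c * f p - c * fst p ^ N\<bar> \<le> \<epsilon> * s ^ (\<alpha> * N)" .
    qed
  qed
qed

end

context resolved_branch
begin

text \<open>The multiplicities satisfy \<open>e_(l-1) = e_l n_l\<close>, and the product telescopes.\<close>

lemma multiplicity_product:
  assumes "2 \<le> j" "j \<le> gg D"
  shows "ee D 1 = ee D j * nn D j * (\<Prod>l\<in>{2..<j}. nn D l)"
  using assms
proof (induction j rule: nat_induct_at_least)
  case base
  then show ?case using level_data(3)[of 2] by simp
next
  case (Suc j)
  have "ee D j = ee D (Suc j) * nn D (Suc j)" using level_data(3)[of "Suc j"] Suc by simp
  moreover have "(\<Prod>l\<in>{2..<Suc j}. nn D l) = nn D j * (\<Prod>l\<in>{2..<j}. nn D l)"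
    using Suc(1) by (simp add: prod.atLeastLessThan_Suc mult.commute)
  ultimately show ?case using Suc by (simp add: mult_ac)
qed

end

context deformed_branch
begin

text \<open>In both coordinates of level \<open>j\<close> the extreme values on the ovals have the expected order, with limits that
  are nonzero critical values on \<open>Q_j = 0\<close>. The two coordinates in the plane depend asymptotically on
  \<open>x_j\<close> alone if \<open>j \<ge> 2\<close>, with exponents that turn \<open>e_j n_j\<close> into \<open>e_1 n_1\<close> and \<open>e_1 m_1\<close>.\<close>

lemma image_extremes_of_depth_one_oval:
  assumes "depth_one_oval D M A j t K" and off: "2 \<le> j \<Longrightarrow> \<forall>\<^sub>F s in at_right 0. \<forall>p\<in>K s. fst p \<noteq> 0"
  defines "I \<equiv> \<lambda>s. to_plane D j ` K s"
  shows "\<exists>l. l \<noteq> 0 \<and> max_asymp fst I (ee D 1 * nn D 1) l" "\<exists>l. l \<noteq> 0 \<and> max_asymp (\<lambda>p. - fst p) I (ee D 1 * nn D 1) l"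
    "\<exists>l. l \<noteq> 0 \<and> max_asymp snd I (ee D 1 * mm D 1) l" "\<exists>l. l \<noteq> 0 \<and> max_asymp (\<lambda>p. - snd p) I (ee D 1 * mm D 1) l"
proof -
  obtain \<rho> \<delta> where "oval_family \<alpha> \<beta> \<Omega> gser (rad D j) \<rho> \<delta> K"
    using oval_family_if_depth_one[OF assms(1)] by blast
  then interpret O: oval_family \<alpha> \<beta> \<Omega> gser "rad D j" \<rho> \<delta> K .
  have smooth: "eval2 (ser_dx (L 1)) p \<noteq> 0 \<or> eval2 (ser_dy (L 1)) p \<noteq> 0" if "eval2 (L 1) p = 0" for p
    using Q_smooth[of p] that unfolding leading_ser_1 by simp
  have xdir: "\<exists>l. l \<noteq> 0 \<and> ((\<lambda>s. support_value u 0 (K s) / s ^ \<alpha>) \<longlongrightarrow> l) (at_right 0)" if u: "u\<^sup>2 = 1" for u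
  proof -
    have "u * (s ^ \<alpha> * X) + 0 * (s ^ \<beta> * Y) = s ^ \<alpha> * (u * X + 0 * Y)" for s X Y by simp
    then obtain p where p: "eval2 (L 1) p = 0" "gradient_det (L 1) (linear_ser u 0) p = 0"
      "((\<lambda>s. support_value u 0 (K s) / s ^ \<alpha>) \<longlongrightarrow> u * fst p + 0 * snd p) (at_right 0)"
      using O.support_value_asymptotics[OF smooth, of u 0 \<alpha>] u by auto
    have "u \<noteq> 0" using u by auto
    have "fst p \<noteq> 0"
    proof
      assume "fst p = 0"
      then have "p = (0, snd p)" by (simp add: prod_eq_iff)
      then show False using Q_crosses_y_axis[of "snd p"] p(1,2) \<open>u \<noteq> 0\<close>
        unfolding leading_ser_1 by (simp add: gradient_det_linear_ser)
    qed
    then show ?thesis using p(3) \<open>u \<noteq> 0\<close> by (intro exI[of _ "u * fst p"]) simp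
  qed
  have ydir: "\<exists>l. l \<noteq> 0 \<and> ((\<lambda>s. support_value 0 v (K s) / s ^ \<beta>) \<longlongrightarrow> l) (at_right 0)" if v: "v\<^sup>2 = 1" for v
  proof -
    have "0 * (s ^ \<alpha> * X) + v * (s ^ \<beta> * Y) = s ^ \<beta> * (0 * X + v * Y)" for s X Y by simp
    then obtain p where p: "eval2 (L 1) p = 0" "gradient_det (L 1) (linear_ser 0 v) p = 0"
      "((\<lambda>s. support_value 0 v (K s) / s ^ \<beta>) \<longlongrightarrow> 0 * fst p + v * snd p) (at_right 0)"
      using O.support_value_asymptotics[OF smooth, of 0 v \<beta>] v by auto
    have "v \<noteq> 0" using v by auto
    have "snd p \<noteq> 0"
    proof
      assume "snd p = 0"
      then have "p = (fst p, 0)" by (simp add: prod_eq_iff)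
      then show False using Q_crosses_x_axis[of "fst p"] p(1,2) \<open>v \<noteq> 0\<close>
        unfolding leading_ser_1 by (simp add: gradient_det_linear_ser)
    qed
    then show ?thesis using p(3) \<open>v \<noteq> 0\<close> by (intro exI[of _ "v * snd p"]) simp
  qed
  have "(\<exists>l. l \<noteq> 0 \<and> max_asymp fst I (ee D 1 * nn D 1) l) \<and> (\<exists>l. l \<noteq> 0 \<and> max_asymp (\<lambda>p. - fst p) I (ee D 1 * nn D 1) l) \<and>
    (\<exists>l. l \<noteq> 0 \<and> max_asymp snd I (ee D 1 * mm D 1) l) \<and> (\<exists>l. l \<noteq> 0 \<and> max_asymp (\<lambda>p. - snd p) I (ee D 1 * mm D 1) l)"
  proof (cases "j = 1")
    case True
    have I: "I = K" by (intro ext) (auto simp: I_def True to_plane_def)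
    obtain l1 l2 l3 l4 where l: "l1 \<noteq> 0" "l2 \<noteq> 0" "l3 \<noteq> 0" "l4 \<noteq> 0"
      "((\<lambda>s. support_value 1 0 (K s) / s ^ \<alpha>) \<longlongrightarrow> l1) (at_right 0)"
      "((\<lambda>s. support_value (-1) 0 (K s) / s ^ \<alpha>) \<longlongrightarrow> l2) (at_right 0)"
      "((\<lambda>s. support_value 0 1 (K s) / s ^ \<beta>) \<longlongrightarrow> l3) (at_right 0)"
      "((\<lambda>s. support_value 0 (-1) (K s) / s ^ \<beta>) \<longlongrightarrow> l4) (at_right 0)"
      using xdir[of 1] xdir[of "-1"] ydir[of 1] ydir[of "-1"] by auto
    have "max_asymp fst K \<alpha> l1" "max_asymp (\<lambda>p. - fst p) K \<alpha> l2" "max_asymp snd K \<beta> l3" "max_asymp (\<lambda>p. - snd p) K \<beta> l4"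
      using O.max_asymp_if_support_tendsto[OF l(5)] O.max_asymp_if_support_tendsto[OF l(6)]
        O.max_asymp_if_support_tendsto[OF l(7)] O.max_asymp_if_support_tendsto[OF l(8)] by simp_all
    then show ?thesis using l(1-4) unfolding I True by blast
  next
    case False
    then have j2: "2 \<le> j" using j by simp
    obtain a b where ab: "((\<lambda>s. support_value 1 0 (K s) / s ^ \<alpha>) \<longlongrightarrow> b) (at_right 0)" "b \<noteq> 0"
      "((\<lambda>s. support_value (-1) 0 (K s) / s ^ \<alpha>) \<longlongrightarrow> a) (at_right 0)" "a \<noteq> 0"
      using xdir[of 1] xdir[of "-1"] by auto
    note mono = O.max_asymp_monomial[OF off[OF j2] ab]
    define N1 N2 where "N1 = (\<Prod>l\<in>{1..<j}. nn D l)" and "N2 = mm D 1 * (\<Prod>l\<in>{2..<j}. nn D l)"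
    have E1: "\<alpha> * N1 = ee D 1 * nn D 1"
    proof -
      have "{1..<j} = insert 1 {2..<j}" using j2 by auto
      then have "N1 = nn D 1 * (\<Prod>l\<in>{2..<j}. nn D l)" by (simp add: N1_def)
      then show ?thesis using multiplicity_product[OF j2 j(2)] by (simp add: mult_ac)
    qed
    have E2: "\<alpha> * N2 = ee D 1 * mm D 1"
      using multiplicity_product[OF j2 j(2)] by (simp add: N2_def mult_ac)
    have f1: "asymp_power (\<lambda>p. fst (to_plane D j p)) N1"
      using asymp_power_fst_down[of 1 "j - 1"] j by (simp add: to_plane_def N1_def)
    have "Suc (j - 2) = j - 1" "1 + Suc (j - 2) = j" "Suc 1 = 2" using j2 by auto
    then have f2: "asymp_power (\<lambda>p. snd (to_plane D j p)) N2"
      using asymp_power_snd_down[of 1 "j - 2"] j by (simp only: to_plane_def N2_def)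
    have tr: "\<exists>l. l \<noteq> 0 \<and> max_asymp (\<lambda>p. f (to_plane D j p)) K (\<alpha> * N) l" "\<exists>l. l \<noteq> 0 \<and> max_asymp (\<lambda>p. - f (to_plane D j p)) K (\<alpha> * N) l"
      if "asymp_power (\<lambda>p. f (to_plane D j p)) N" for f N
    proof -
      show "\<exists>l. l \<noteq> 0 \<and> max_asymp (\<lambda>p. f (to_plane D j p)) K (\<alpha> * N) l"
        using O.max_asymp_unit_multiple[OF that, of 1] mono(1)[of N] by auto
      show "\<exists>l. l \<noteq> 0 \<and> max_asymp (\<lambda>p. - f (to_plane D j p)) K (\<alpha> * N) l"
        using O.max_asymp_unit_multiple[OF that, of "-1"] mono(2)[of N] by auto
    qed
    show ?thesis
      unfolding I_def max_asymp_image using tr[OF f1] tr[OF f2] unfolding E1 E2 by blast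
  qed
  then show "\<exists>l. l \<noteq> 0 \<and> max_asymp fst I (ee D 1 * nn D 1) l" "\<exists>l. l \<noteq> 0 \<and> max_asymp (\<lambda>p. - fst p) I (ee D 1 * nn D 1) l"
    "\<exists>l. l \<noteq> 0 \<and> max_asymp snd I (ee D 1 * mm D 1) l" "\<exists>l. l \<noteq> 0 \<and> max_asymp (\<lambda>p. - snd p) I (ee D 1 * mm D 1) l"
    by auto
qed

lemma size_of_oval_of_depth:
  assumes "oval_of_depth D M A \<rho> j t O'"
  shows "has_size j t O' (ee D 1 * nn D 1) (ee D 1 * mm D 1)"
proof -
  obtain K where K: "depth_one_oval D M A j t K"
    and off: "j \<ge> 2 \<longrightarrow> (\<forall>\<^sub>F s in at_right 0. \<forall>p\<in>K s. fst p \<noteq> 0)"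
    and close: "\<forall>\<^sub>F s in at_right 0. \<forall>\<epsilon>>0.
           very_small 1 (j - 1) (\<lambda>t'. hausdorff_close \<epsilon> (O' t') (to_plane D j ` K s)) (t(j := s))"
    and ov: "very_small 1 j (\<lambda>t'. oval_of (real_part (coeff2 (msqh_poly D M A 1 t')) \<rho>) (O' t')) t"
    using assms unfolding oval_of_depth_def by blast
  show ?thesis
    by (rule has_size_if_max_asymp[OF j(1) ov close]; rule image_extremes_of_depth_one_oval[OF K]) (use off in auto)
qed

end

theorem proposition8p18:
  fixes D :: branch_resolution and M :: monomials and A :: coefficients
    and \<rho> :: real and j :: nat
  assumes "toric_resolution D"
    and "msqh_smoothing D M A \<rho>"
    and "real_nondegenerated_deformation D M A"
    and "1 \<le> j" and "j \<le> gg D"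
  shows "very_small (Suc j) (gg D)
    (\<lambda>t. \<forall>O'. oval_of_depth D M A \<rho> j t O' \<longrightarrow>
       has_size j t O' (ee D 1 * nn D 1) (ee D 1 * mm D 1)) (\<lambda>_. 0)"
proof (rule very_small_mono)
  show "very_small (Suc j) (gg D) (\<lambda>t. real_nondegenerated (Q_poly D M A j t) (Delta D j)) (\<lambda>_. 0)"
    using assms(3-5) by (simp add: real_nondegenerated_deformation_def)
  fix t assume "real_nondegenerated (Q_poly D M A j t) (Delta D j)"
  then interpret deformed_branch D M A j t
    using assms by unfold_locales (auto simp: msqh_smoothing_def)
  show "\<forall>O'. oval_of_depth D M A \<rho> j t O' \<longrightarrow> has_size j t O' (ee D 1 * nn D 1) (ee D 1 * mm D 1)"
    using size_of_oval_of_depth by blast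
qed

end
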